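(* Let $\lambda,\gamma,\rho>0$, let $l:H^1_0(0,1)\to\mathbb{R}^+$ be continuous, let $a\in C(\mathbb{R})$ with $a(\mathbb{R})\subset[m,M]\subset(0,\infty)$, and let $f:\mathbb{R}\to\mathbb{R}$ be continuous and such that for every $r>0$ there is a constant $\kappa=\kappa(r)>0$ for which $s\mapsto\kappa s+f(s)$ is increasing in $[-r,r]$. Assume the dissipativity condition: there exist $C_0,C_1\in\mathbb{R}$ such that, for both $\nu=\frac m\lambda$ and $\nu=\frac M\lambda$, $$uf(u)\leq-\nu C_0u^2+C_1|u|\quad\text{for all }u\in\mathbb{R},$$ and the first eigenvalue $\omega$ of $A+\nu C_0I$ is positive and satisfies $e^{-\omega\rho/m}+\frac{\gamma}{\omega m}<1$, where $A=-\frac{d^2}{dx^2}$ on $L^2(0,1)$ with domain $H^2(0,1)\cap H^1_0(0,1)$. Let $X=C([-\rho,0],H^1_0(0,1))$ and let $\mathcal{R}$ be the set of all solutions $\eta(\cdot,\phi):[0,\infty)\to X$, $\phi\in X$, of the retarded problem $$\frac{\partial w}{\partial\tau}-a(l(w))\frac{\partial^2w}{\partial x^2}=\lambda f(w)+\gamma w(\tau-\rho),\ \tau>0,\ x\in(0,1),$$ $$w(\tau,0)=w(\tau,1)=0,\qquad w(\tau)=\phi(\tau),\ \tau\in[-\rho,0].$$ Then $\mathcal{R}$ defines an upper semicontinuous strict multivalued semiflow in $X$; that is, the map $G(\tau,\phi)=\{\eta(\tau,\phi):\eta(\cdot,\phi)\in\mathcal{R}\text{ is a solution with initial function }\phi\}$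 is a strict multivalued semiflow on $X$ and $G(\tau,\cdot)$ is upper semicontinuous for each $\tau\geq0$.
   Context: Solutions. A function $w\in C([-\rho,\infty);H^1_0(0,1))$ with $w=\phi$ on $[-\rho,0]$ is a solution of the retarded problem if, with $\alpha^{-1}(\tau)=\int_0^\tau a(l(w(r)))^{-1}dr$ (an increasing bijection of $[0,\infty)$, with inverse $\alpha$), the function $u(t)=w(\alpha(t))$, $t\geq0$, satisfies $$u(t)=S(t)\phi(0)+\int_0^tS(t-s)\frac{\lambda f(u(s))+\gamma w(\alpha(s)-\rho)}{a(l(u(s)))}ds,\quad t\geq0,$$ where $S(t)$ is the analytic semigroup on $L^2(0,1)$ generated by $\frac{d^2}{dx^2}$ with domain $H^2(0,1)\cap H^1_0(0,1)$. Solutions need not be unique. For such $w$ and $\tau\geq0$ let $w^\tau(\theta)=w(\tau+\theta)$, $\theta\in[-\rho,0]$; the function $\eta(\cdot,\phi):[0,\infty)\to X$, $\eta(\tau,\phi)=w^\tau$, is called a solution of the retarded problem with initial function $\phi$. Multivalued semiflows. Let $P(X)$ be the collection of non-empty subsets of $X$. A map $G:\mathbb{R}^+\times X\to P(X)$ is a multivalued semiflow if $G(0,\cdot)$ is the identity and $G(t_1+t_2,x)\subset G(t_1,G(t_2,x))$ for all $t_1,t_2\in\mathbb{R}^+$, $x\in X$, where $G(t,B)=\bigcup_{x\in B}G(t,x)$ for $B\subset X$; it is strict if equality holds in the last inclusion. With $\operatorname{dist}_H(A,B)=\sup_{x\in A}\inf_{y\in B}\|x-y\|_X$, the map $G(t,\cdot)$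 is upper semicontinuous if for every sequence $x_n\to x$ in $X$ one has $\lim_{n\to\infty}\operatorname{dist}_H(G(t,x_n),G(t,x))=0$. *)

theory Defs
  imports "HOL-Analysis.Analysis"
begin

section \<open>The Hilbert space \<open>L\<^sup>2(0,1)\<close>\<close>

abbreviation unit_leb :: "real measure" where
  "unit_leb \<equiv> lebesgue_on {0<..<1}"

definition square_integrable :: "(real \<Rightarrow> real) \<Rightarrow> bool" where
  "square_integrable f \<longleftrightarrow>
     f \<in> borel_measurable unit_leb \<and> integrable unit_leb (\<lambda>x. (f x)\<^sup>2)"

lemma square_integrable_zero: "square_integrable (\<lambda>x. 0)"
  by (simp add: square_integrable_def)

lemma square_integrable_mult:
  assumes "square_integrable f" "square_integrable g"
  shows "integrable unit_leb (\<lambda>x. f x * g x)"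
proof (rule Bochner_Integration.integrable_bound)
  show "integrable unit_leb (\<lambda>x. (f x)\<^sup>2 + (g x)\<^sup>2)"
    using assms by (simp add: square_integrable_def)
  show "(\<lambda>x. f x * g x) \<in> borel_measurable unit_leb"
    using assms unfolding square_integrable_def by (intro borel_measurable_times) auto
  have "norm (f x * g x) \<le> norm ((f x)\<^sup>2 + (g x)\<^sup>2)" for x
  proof -
    have "0 \<le> (\<bar>f x\<bar> - \<bar>g x\<bar>)\<^sup>2" by simp
    then have "2 * (\<bar>f x\<bar> * \<bar>g x\<bar>) \<le> (f x)\<^sup>2 + (g x)\<^sup>2"
      by (simp add: power2_diff)
    moreover have "0 \<le> \<bar>f x\<bar> * \<bar>g x\<bar>" by simp
    ultimately have "\<bar>f x\<bar> * \<bar>g x\<bar> \<le> (f x)\<^sup>2 + (g x)\<^sup>2" by linarith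
    then show ?thesis by (simp add: abs_mult)
  qed
  then show "AE x in unit_leb. norm (f x * g x) \<le> norm ((f x)\<^sup>2 + (g x)\<^sup>2)" by simp
qed

lemma square_integrable_add:
  assumes "square_integrable f" "square_integrable g"
  shows "square_integrable (\<lambda>x. f x + g x)"
proof -
  have "integrable unit_leb (\<lambda>x. (f x)\<^sup>2 + (g x)\<^sup>2 + 2 * (f x * g x))"
    using square_integrable_mult[OF assms] assms by (simp add: square_integrable_def)
  then have "integrable unit_leb (\<lambda>x. (f x + g x)\<^sup>2)"
    by (simp add: power2_sum mult.assoc)
  moreover have "(\<lambda>x. f x + g x) \<in> borel_measurable unit_leb"
    using assms unfolding square_integrable_def by (intro borel_measurable_add) auto
  ultimately show ?thesis
    by (simp add: square_integrable_def)
qed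

lemma square_integrable_scale:
  "square_integrable f \<Longrightarrow> square_integrable (\<lambda>x. c * f x)"
  unfolding square_integrable_def
  by (auto simp: power_mult_distrib intro!: borel_measurable_times)

definition l2_rel :: "(real \<Rightarrow> real) \<Rightarrow> (real \<Rightarrow> real) \<Rightarrow> bool" where
  "l2_rel f g \<longleftrightarrow> square_integrable f \<and> square_integrable g \<and> (AE x in unit_leb. f x = g x)"

quotient_type l2 = "real \<Rightarrow> real" / partial: l2_rel
proof (rule part_equivpI)
  show "\<exists>f. l2_rel f f"
    using square_integrable_zero by (auto simp: l2_rel_def)
  show "symp l2_rel"
    by (rule sympI) (auto simp: l2_rel_def elim: AE_mp)
  show "transp l2_rel"
    by (rule transpI) (auto simp: l2_rel_def elim: AE_mp)
qed

instantiation l2 :: real_inner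
begin

lift_definition zero_l2 :: l2 is "\<lambda>x. 0"
  by (simp add: l2_rel_def square_integrable_zero)

lift_definition plus_l2 :: "l2 \<Rightarrow> l2 \<Rightarrow> l2" is "\<lambda>f g x. f x + g x"
  by (auto simp: l2_rel_def intro: square_integrable_add elim: AE_mp)

lift_definition scaleR_l2 :: "real \<Rightarrow> l2 \<Rightarrow> l2" is "\<lambda>c f x. c * f x"
  by (auto simp: l2_rel_def intro: square_integrable_scale)

definition uminus_l2 :: "l2 \<Rightarrow> l2" where "uminus_l2 u = (-1) *\<^sub>R u"

definition minus_l2 :: "l2 \<Rightarrow> l2 \<Rightarrow> l2" where "minus_l2 u v = u + (- v)"

lift_definition inner_l2 :: "l2 \<Rightarrow> l2 \<Rightarrow> real" is "\<lambda>f g. \<integral>x. f x * g x \<partial>unit_leb"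
  by (rule integral_cong_AE)
     (auto simp: l2_rel_def square_integrable_def elim: AE_mp)

definition norm_l2 :: "l2 \<Rightarrow> real" where "norm_l2 u = sqrt (inner u u)"

definition sgn_l2 :: "l2 \<Rightarrow> l2" where "sgn_l2 u = inverse (norm u) *\<^sub>R u"

definition dist_l2 :: "l2 \<Rightarrow> l2 \<Rightarrow> real" where "dist_l2 u v = norm (u - v)"

definition uniformity_l2 :: "(l2 \<times> l2) filter" where
  "uniformity_l2 = (INF e\<in>{0<..}. principal {(u, v). dist u v < e})"

definition open_l2 :: "l2 set \<Rightarrow> bool" where
  "open_l2 U \<longleftrightarrow> (\<forall>u\<in>U. eventually (\<lambda>(u', v). u' = u \<longrightarrow> v \<in> U) uniformity)"

instance
proof
  fix u v w :: l2 and a b :: real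
  show "u + v + w = u + (v + w)"
    by transfer (auto simp: l2_rel_def add.assoc intro!: square_integrable_add)
  show "u + v = v + u"
    by transfer (auto simp: l2_rel_def add.commute intro!: square_integrable_add)
  show zero: "0 + u = u"
    by transfer (auto simp: l2_rel_def)
  show "- u + u = 0"
    unfolding uminus_l2_def
    by transfer (auto simp: l2_rel_def square_integrable_zero)
  show "u - v = u + - v"
    by (simp add: minus_l2_def)
  show "a *\<^sub>R (u + v) = a *\<^sub>R u + a *\<^sub>R v"
    by transfer (auto simp: l2_rel_def distrib_left
        intro!: square_integrable_add square_integrable_scale)
  show "(a + b) *\<^sub>R u = a *\<^sub>R u + b *\<^sub>R u"
    by transfer (auto simp: l2_rel_def distrib_right
        intro!: square_integrable_add square_integrable_scale)
  show "a *\<^sub>R b *\<^sub>R u = (a * b) *\<^sub>R u"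
    by transfer (auto simp: l2_rel_def mult.assoc intro!: square_integrable_scale)
  show "1 *\<^sub>R u = u"
    by transfer (auto simp: l2_rel_def)
  show "sgn u = inverse (norm u) *\<^sub>R u"
    by (simp add: sgn_l2_def)
  show "dist u v = norm (u - v)"
    by (simp add: dist_l2_def)
  show "uniformity = (INF e\<in>{0<..}. principal {(u::l2, v). dist u v < e})"
    by (simp add: uniformity_l2_def)
  show "open U \<longleftrightarrow> (\<forall>u\<in>U. eventually (\<lambda>(u', v). u' = u \<longrightarrow> v \<in> U) uniformity)"
    for U :: "l2 set"
    by (simp add: open_l2_def)
  show "inner u v = inner v u"
    by transfer (simp add: mult.commute)
  show "inner (u + v) w = inner u w + inner v w"
    by transfer (auto simp: l2_rel_def distrib_right square_integrable_mult)
  show "inner (a *\<^sub>R u) v = a * inner u v"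
    by transfer (auto simp: l2_rel_def mult.assoc)
  show "0 \<le> inner u u"
    by transfer auto
  show "inner u u = 0 \<longleftrightarrow> u = 0"
  proof transfer
    fix f assume "l2_rel f f"
    then have f: "square_integrable f" by (simp add: l2_rel_def)
    have "(\<integral>x. f x * f x \<partial>unit_leb) = 0 \<longleftrightarrow> (AE x in unit_leb. f x * f x = 0)"
      using square_integrable_mult[OF f f] by (intro integral_nonneg_eq_0_iff_AE) auto
    then show "(\<integral>x. f x * f x \<partial>unit_leb) = 0 \<longleftrightarrow> l2_rel f (\<lambda>x. 0)"
      using f by (simp add: l2_rel_def square_integrable_zero)
  qed
  show "norm u = sqrt (inner u u)"
    by (simp add: norm_l2_def)
qed

end


section \<open>Sobolev spaces on \<open>(0,1)\<close>\<close>

text \<open>\<open>C\<^sub>c\<^sup>\<infinity>(0,1)\<close>, as functions on the whole line.\<close>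

definition test_functions :: "(real \<Rightarrow> real) set" where
  "test_functions = {\<phi>. (\<forall>k x. (deriv ^^ k) \<phi> field_differentiable at x) \<and>
     (\<exists>K. compact K \<and> K \<subseteq> {0<..<1} \<and> (\<forall>x. x \<notin> K \<longrightarrow> \<phi> x = 0))}"

definition weak_derivative :: "l2 \<Rightarrow> l2 \<Rightarrow> bool" where
  "weak_derivative u v \<longleftrightarrow>
     (\<forall>\<phi>\<in>test_functions. inner u (abs_l2 (deriv \<phi>)) = - inner v (abs_l2 \<phi>))"

text \<open>
  \<open>H\<^sup>1\<^sub>0(0,1)\<close> is the closure of \<open>C\<^sub>c\<^sup>\<infinity>(0,1)\<close> in the norm of \<open>H\<^sup>1(0,1)\<close>. A member is stored
  together with its weak derivative, as the pair \<open>(u, u')\<close>; the norm of the product space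
  \<open>L\<^sup>2 \<times> L\<^sup>2\<close> at \<open>(u, u')\<close> is precisely the \<open>H\<^sup>1\<close> norm of \<open>u\<close>.
\<close>

definition H10_graph :: "(l2 \<times> l2) set" where
  "H10_graph = closure ((\<lambda>\<phi>. (abs_l2 \<phi>, abs_l2 (deriv \<phi>))) ` test_functions)"

lemma test_function_support:
  assumes "\<phi> \<in> test_functions"
  shows "\<exists>K. compact K \<and> K \<subseteq> {0<..<1} \<and> (\<forall>x. x \<notin> K \<longrightarrow> \<phi> x = 0)"
  using assms by (simp add: test_functions_def)

lemma test_function_differentiable:
  "\<phi> \<in> test_functions \<Longrightarrow> (deriv ^^ k) \<phi> field_differentiable at x"
  by (simp add: test_functions_def)

lemma deriv_funpow_linear:
  assumes "\<phi> \<in> test_functions" "\<psi> \<in> test_functions"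
  shows "(deriv ^^ k) (\<lambda>x. a * \<phi> x + b * \<psi> x) = (\<lambda>x. a * (deriv ^^ k) \<phi> x + b * (deriv ^^ k) \<psi> x)"
proof (induction k)
  case (Suc k)
  have "deriv (\<lambda>x. a * (deriv ^^ k) \<phi> x + b * (deriv ^^ k) \<psi> x) x
      = a * deriv ((deriv ^^ k) \<phi>) x + b * deriv ((deriv ^^ k) \<psi>) x" for x
    using assms
    by (subst deriv_add)
       (auto simp: deriv_cmult test_function_differentiable intro!: field_differentiable_mult)
  then show ?case using Suc by auto
qed simp

lemma test_functions_linear:
  assumes "\<phi> \<in> test_functions" "\<psi> \<in> test_functions"
  shows "(\<lambda>x. a * \<phi> x + b * \<psi> x) \<in> test_functions"
proof -
  obtain K where K: "compact K" "K \<subseteq> {0<..<1}" "\<forall>x. x \<notin> K \<longrightarrow> \<phi> x = 0"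
    using test_function_support[OF assms(1)] by blast
  obtain L where L: "compact L" "L \<subseteq> {0<..<1}" "\<forall>x. x \<notin> L \<longrightarrow> \<psi> x = 0"
    using test_function_support[OF assms(2)] by blast
  have "\<exists>K. compact K \<and> K \<subseteq> {0<..<1} \<and> (\<forall>x. x \<notin> K \<longrightarrow> a * \<phi> x + b * \<psi> x = 0)"
    using K L by (intro exI[of _ "K \<union> L"]) (auto intro: compact_Un)
  moreover have "(deriv ^^ k) (\<lambda>x. a * \<phi> x + b * \<psi> x) field_differentiable at x" for k x
    unfolding deriv_funpow_linear[OF assms]
    using assms by (auto simp: test_function_differentiable
        intro!: field_differentiable_mult field_differentiable_add)
  ultimately show ?thesis by (auto simp: test_functions_def)
qed

lemma square_integrable_continuous:
  fixes f :: "real \<Rightarrow> real"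
  assumes "continuous_on UNIV f"
  shows "square_integrable f"
proof -
  have "f \<in> borel_measurable lebesgue"
    using assms by (simp add: borel_measurable_continuous_onI borel_measurable_if_I measurable_completion)
  then have meas: "f \<in> borel_measurable unit_leb"
    by (rule measurable_restrict_space1)
  have "compact (f ` {0..1})"
    by (rule compact_continuous_image) (auto intro: continuous_on_subset[OF assms])
  then obtain B where B: "\<And>x. x \<in> {0..1} \<Longrightarrow> \<bar>f x\<bar> \<le> B"
    using compact_imp_bounded bounded_iff by (metis imageI real_norm_def)
  have "integrable unit_leb (\<lambda>x. (f x)\<^sup>2)"
  proof (rule Bochner_Integration.integrable_bound)
    show "integrable unit_leb (\<lambda>x. B\<^sup>2)"
      by (simp add: integrable_iff_bounded emeasure_restrict_space nn_integral_const
          ennreal_mult_less_top)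
    have "(f x)\<^sup>2 \<le> B\<^sup>2" if "x \<in> {0<..<1}" for x
      using B[of x] that by (intro power2_le_iff_abs_le[THEN iffD2]) auto
    then show "AE x in unit_leb. norm ((f x)\<^sup>2) \<le> norm (B\<^sup>2)"
      by (intro AE_I2) auto
  qed (use meas in simp)
  with meas show ?thesis by (simp add: square_integrable_def)
qed

lemma continuous_deriv_funpow:
  "\<phi> \<in> test_functions \<Longrightarrow> continuous_on UNIV ((deriv ^^ k) \<phi>)"
  by (simp add: continuous_at_imp_continuous_on field_differentiable_imp_continuous_at
      test_function_differentiable)

lemma square_integrable_test_function:
  assumes "\<phi> \<in> test_functions"
  shows "square_integrable \<phi>" "square_integrable (deriv \<phi>)"
  using continuous_deriv_funpow[OF assms, of 0] continuous_deriv_funpow[OF assms, of 1]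
  by (simp_all add: square_integrable_continuous)

lemma abs_l2_linear:
  assumes "square_integrable f" "square_integrable g"
  shows "abs_l2 (\<lambda>x. a * f x + b * g x) = a *\<^sub>R abs_l2 f + b *\<^sub>R abs_l2 g"
  using assms
  by (simp add: scaleR_l2.abs_eq plus_l2.abs_eq l2_rel_def square_integrable_scale)

lemma subspace_H10_graph: "subspace H10_graph"
proof -
  let ?T = "(\<lambda>\<phi>. (abs_l2 \<phi>, abs_l2 (deriv \<phi>))) ` test_functions"
  have lin: "a *\<^sub>R p + b *\<^sub>R q \<in> ?T" if pq: "p \<in> ?T" "q \<in> ?T" for a b p q
  proof -
    obtain \<phi> \<psi> where T: "\<phi> \<in> test_functions" "\<psi> \<in> test_functions"
      and p: "p = (abs_l2 \<phi>, abs_l2 (deriv \<phi>))" and q: "q = (abs_l2 \<psi>, abs_l2 (deriv \<psi>))"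
      using pq by blast
    have "a *\<^sub>R p + b *\<^sub>R q = (abs_l2 (\<lambda>x. a * \<phi> x + b * \<psi> x), abs_l2 (deriv (\<lambda>x. a * \<phi> x + b * \<psi> x)))"
      using deriv_funpow_linear[OF T, where k=1 and a=a and b=b] T
      by (simp add: p q abs_l2_linear square_integrable_test_function)
    then show ?thesis using test_functions_linear[OF T] by blast
  qed
  have zero: "(\<lambda>x. 0) \<in> test_functions"
  proof -
    have "(deriv ^^ k) (\<lambda>x::real. 0::real) = (\<lambda>x. 0)" for k
      by (induction k) auto
    then show ?thesis by (auto simp: test_functions_def intro: exI[of _ "{}"])
  qed
  have closed_lin: "a *\<^sub>R p + b *\<^sub>R q \<in> H10_graph" if pq: "p \<in> H10_graph" "q \<in> H10_graph" for a b p q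
  proof -
    have "\<exists>P. (\<forall>n. P n \<in> ?T) \<and> P \<longlonglongrightarrow> p" "\<exists>Q. (\<forall>n. Q n \<in> ?T) \<and> Q \<longlonglongrightarrow> q"
      using pq by (simp_all only: H10_graph_def closure_sequential)
    then obtain P Q where P: "\<forall>n. P n \<in> ?T" "P \<longlonglongrightarrow> p" and Q: "\<forall>n. Q n \<in> ?T" "Q \<longlonglongrightarrow> q"
      by (elim exE conjE)
    have "(\<lambda>n. a *\<^sub>R P n + b *\<^sub>R Q n) \<longlonglongrightarrow> a *\<^sub>R p + b *\<^sub>R q"
      using P(2) Q(2) by (intro tendsto_intros)
    moreover have "\<forall>n. a *\<^sub>R P n + b *\<^sub>R Q n \<in> ?T"
      using P(1) Q(1) by (intro allI lin) simp_all
    ultimately show ?thesis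
      unfolding H10_graph_def closure_sequential
      by (intro exI[of _ "\<lambda>n. a *\<^sub>R P n + b *\<^sub>R Q n"] conjI)
  qed
  obtain p where p: "p \<in> H10_graph"
    using zero closure_subset unfolding H10_graph_def by blast
  show ?thesis
    unfolding subspace_def
  proof (intro conjI ballI allI)
    show "0 \<in> H10_graph" using closed_lin[OF p p, of 0 0] by simp
    show "x + y \<in> H10_graph" if "x \<in> H10_graph" "y \<in> H10_graph" for x y
      using closed_lin[OF that, of 1 1] by simp
    show "c *\<^sub>R x \<in> H10_graph" if "x \<in> H10_graph" for c x
      using closed_lin[OF that that, of c 0] by simp
  qed
qed

typedef h10 = H10_graph
  using subspace_0[OF subspace_H10_graph] by blast

setup_lifting type_definition_h10

instantiation h10 :: real_inner
begin

lift_definition zero_h10 :: h10 is 0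
  by (rule subspace_0[OF subspace_H10_graph])

lift_definition plus_h10 :: "h10 \<Rightarrow> h10 \<Rightarrow> h10" is "(+)"
  by (rule subspace_add[OF subspace_H10_graph])

lift_definition minus_h10 :: "h10 \<Rightarrow> h10 \<Rightarrow> h10" is "(-)"
  by (rule subspace_diff[OF subspace_H10_graph])

lift_definition uminus_h10 :: "h10 \<Rightarrow> h10" is uminus
  by (rule subspace_neg[OF subspace_H10_graph])

lift_definition scaleR_h10 :: "real \<Rightarrow> h10 \<Rightarrow> h10" is "(*\<^sub>R)"
  by (rule subspace_scale[OF subspace_H10_graph])

lift_definition inner_h10 :: "h10 \<Rightarrow> h10 \<Rightarrow> real" is inner .

lift_definition norm_h10 :: "h10 \<Rightarrow> real" is norm .

definition sgn_h10 :: "h10 \<Rightarrow> h10" where "sgn_h10 u = inverse (norm u) *\<^sub>R u"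

definition dist_h10 :: "h10 \<Rightarrow> h10 \<Rightarrow> real" where "dist_h10 u v = norm (u - v)"

definition uniformity_h10 :: "(h10 \<times> h10) filter" where
  "uniformity_h10 = (INF e\<in>{0<..}. principal {(u, v). dist u v < e})"

definition open_h10 :: "h10 set \<Rightarrow> bool" where
  "open_h10 U \<longleftrightarrow> (\<forall>u\<in>U. eventually (\<lambda>(u', v). u' = u \<longrightarrow> v \<in> U) uniformity)"

instance
proof
  fix u v w :: h10 and a b :: real
  show "u + v + w = u + (v + w)" by transfer (simp add: add.assoc)
  show "u + v = v + u" by transfer (simp add: add.commute)
  show "0 + u = u" by transfer simp
  show "- u + u = 0" by transfer simp
  show "u - v = u + - v" by transfer simp
  show "a *\<^sub>R (u + v) = a *\<^sub>R u + a *\<^sub>R v" by transfer (rule scaleR_add_right)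
  show "(a + b) *\<^sub>R u = a *\<^sub>R u + b *\<^sub>R u" by transfer (rule scaleR_add_left)
  show "a *\<^sub>R b *\<^sub>R u = (a * b) *\<^sub>R u" by transfer simp
  show "1 *\<^sub>R u = u" by transfer simp
  show "sgn u = inverse (norm u) *\<^sub>R u" by (simp add: sgn_h10_def)
  show "dist u v = norm (u - v)" by (simp add: dist_h10_def)
  show "uniformity = (INF e\<in>{0<..}. principal {(u::h10, v). dist u v < e})"
    by (simp add: uniformity_h10_def)
  show "open U \<longleftrightarrow> (\<forall>u\<in>U. eventually (\<lambda>(u', v). u' = u \<longrightarrow> v \<in> U) uniformity)"
    for U :: "h10 set"
    by (simp add: open_h10_def)
  show "inner u v = inner v u" by transfer (rule inner_commute)
  show "inner (u + v) w = inner u w + inner v w" by transfer (rule inner_add_left)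
  show "inner (a *\<^sub>R u) v = a * inner u v" by transfer (rule inner_scaleR_left)
  show "0 \<le> inner u u" by transfer (rule inner_ge_zero)
  show "inner u u = 0 \<longleftrightarrow> u = 0" by transfer (rule inner_eq_zero_iff)
  show "norm u = sqrt (inner u u)" by transfer (rule norm_eq_sqrt_inner)
qed

end

definition of_h10 :: "h10 \<Rightarrow> l2" where
  "of_h10 u = fst (Rep_h10 u)"


section \<open>The Dirichlet Laplacian and its semigroup\<close>

text \<open>Unbounded operators are represented by their graphs.\<close>

definition H2 :: "l2 set" where
  "H2 = {u. \<exists>v z. weak_derivative u v \<and> weak_derivative v z}"

definition dirichlet_laplacian :: "(l2 \<times> l2) set" where
  "dirichlet_laplacian = {(u, z). u \<in> H2 \<inter> range of_h10 \<and>
     (\<exists>v. weak_derivative u v \<and> weak_derivative v z)}"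

text \<open>The graph of \<open>A + c I\<close>, where \<open>A = - d\<^sup>2/dx\<^sup>2\<close>.\<close>

definition shifted_neg_laplacian :: "real \<Rightarrow> (l2 \<times> l2) set" where
  "shifted_neg_laplacian c = {(u, - z + c *\<^sub>R u) | u z. (u, z) \<in> dirichlet_laplacian}"

definition eigenvalue_of :: "('a::real_vector \<times> 'a) set \<Rightarrow> real \<Rightarrow> bool" where
  "eigenvalue_of T \<mu> \<longleftrightarrow> (\<exists>u. u \<noteq> 0 \<and> (u, \<mu> *\<^sub>R u) \<in> T)"

definition first_eigenvalue :: "('a::real_vector \<times> 'a) set \<Rightarrow> real \<Rightarrow> bool" where
  "first_eigenvalue T \<omega> \<longleftrightarrow> eigenvalue_of T \<omega> \<and> (\<forall>\<mu>. eigenvalue_of T \<mu> \<longrightarrow> \<omega> \<le> \<mu>)"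

definition C0_semigroup :: "(real \<Rightarrow> 'a::real_normed_vector \<Rightarrow> 'a) \<Rightarrow> bool" where
  "C0_semigroup S \<longleftrightarrow>
     (\<forall>t\<ge>0. bounded_linear (S t)) \<and> (\<forall>u. S 0 u = u) \<and>
     (\<forall>s\<ge>0. \<forall>t\<ge>0. \<forall>u. S (s + t) u = S s (S t u)) \<and>
     (\<forall>u. ((\<lambda>t. S t u) \<longlongrightarrow> u) (at_right 0))"

definition generator :: "(real \<Rightarrow> 'a::real_normed_vector \<Rightarrow> 'a) \<Rightarrow> ('a \<times> 'a) set" where
  "generator S = {(u, v). ((\<lambda>h. (S h u - u) /\<^sub>R h) \<longlongrightarrow> v) (at_right 0)}"

text \<open>
  A \<open>C\<^sub>0\<close>-semigroup is determined by its generator. The description below therefore fixes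
  \<open>S t\<close> for all \<open>t \<ge> 0\<close>, the only times that are used, and analyticity of the heat semigroup is
  a property of the object described, not part of its description.
\<close>

definition heat_semigroup :: "real \<Rightarrow> l2 \<Rightarrow> l2" where
  "heat_semigroup = (SOME S. C0_semigroup S \<and> generator S = dirichlet_laplacian)"


section \<open>The retarded problem\<close>

text \<open>
  \<open>H\<^sup>1\<^sub>0(0,1)\<close> consists of bounded functions, so the composition below is square integrable
  for continuous \<open>f\<close>; its class does not depend on the representative of \<open>u\<close>.
\<close>

definition superpose :: "(real \<Rightarrow> real) \<Rightarrow> h10 \<Rightarrow> l2" where
  "superpose f u = abs_l2 (\<lambda>x. f (rep_l2 (of_h10 u) x))"

text \<open>\<open>C([-\<rho>,0], H\<^sup>1\<^sub>0(0,1))\<close> with the supremum metric; elements are \<open>undefined\<close> off \<open>[-\<rho>,0]\<close>.\<close>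

definition history_space :: "real \<Rightarrow> (real \<Rightarrow> h10) metric" where
  "history_space \<rho> = cfunspace (top_of_set {-\<rho>..0}) euclidean_metric"

definition time_change :: "(real \<Rightarrow> real) \<Rightarrow> (h10 \<Rightarrow> real) \<Rightarrow> (real \<Rightarrow> h10) \<Rightarrow> real \<Rightarrow> real" where
  "time_change a l w \<tau> = integral {0..\<tau>} (\<lambda>r. inverse (a (l (w r))))"

definition retarded_solution ::
  "(real \<Rightarrow> real) \<Rightarrow> (h10 \<Rightarrow> real) \<Rightarrow> (real \<Rightarrow> real) \<Rightarrow> real \<Rightarrow> real \<Rightarrow> real \<Rightarrow>
   (real \<Rightarrow> h10) \<Rightarrow> (real \<Rightarrow> h10) \<Rightarrow> bool" where
  "retarded_solution a l f lam \<gamma> \<rho> \<phi> w \<longleftrightarrow>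
     continuous_on {-\<rho>..} w \<and> (\<forall>\<theta>\<in>{-\<rho>..0}. w \<theta> = \<phi> \<theta>) \<and>
     (let \<alpha> = inv_into {0..} (time_change a l w); u = (\<lambda>t. w (\<alpha> t))
      in \<forall>t\<ge>0. \<exists>I.
           ((\<lambda>s. heat_semigroup (t - s)
                   ((lam *\<^sub>R superpose f (u s) + \<gamma> *\<^sub>R of_h10 (w (\<alpha> s - \<rho>))) /\<^sub>R a (l (u s))))
              has_integral I) {0..t} \<and>
           of_h10 (u t) = heat_semigroup t (of_h10 (\<phi> 0)) + I)"

definition history :: "real \<Rightarrow> (real \<Rightarrow> 'a) \<Rightarrow> real \<Rightarrow> real \<Rightarrow> 'a" where
  "history \<rho> w \<tau> = restrict (\<lambda>\<theta>. w (\<tau> + \<theta>)) {-\<rho>..0}"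

text \<open>
  The history-valued solutions \<open>\<tau> \<mapsto> w\<^sup>\<tau>\<close> are restricted to \<open>[0,\<infinity>)\<close>, so that values of \<open>w\<close> off
  \<open>[-\<rho>,\<infinity>)\<close> play no role.
\<close>

definition solutions_from ::
  "(real \<Rightarrow> real) \<Rightarrow> (h10 \<Rightarrow> real) \<Rightarrow> (real \<Rightarrow> real) \<Rightarrow> real \<Rightarrow> real \<Rightarrow> real \<Rightarrow>
   (real \<Rightarrow> h10) \<Rightarrow> (real \<Rightarrow> real \<Rightarrow> h10) set" where
  "solutions_from a l f lam \<gamma> \<rho> \<phi> =
     {restrict (history \<rho> w) {0..} | w. retarded_solution a l f lam \<gamma> \<rho> \<phi> w}"

definition solution_map ::
  "(real \<Rightarrow> real) \<Rightarrow> (h10 \<Rightarrow> real) \<Rightarrow> (real \<Rightarrow> real) \<Rightarrow> real \<Rightarrow> real \<Rightarrow> real \<Rightarrow>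
   real \<Rightarrow> (real \<Rightarrow> h10) \<Rightarrow> (real \<Rightarrow> h10) set" where
  "solution_map a l f lam \<gamma> \<rho> \<tau> \<phi> = {\<eta> \<tau> | \<eta>. \<eta> \<in> solutions_from a l f lam \<gamma> \<rho> \<phi>}"


section \<open>Multivalued semiflows\<close>

definition multivalued_semiflow :: "'a set \<Rightarrow> (real \<Rightarrow> 'a \<Rightarrow> 'a set) \<Rightarrow> bool" where
  "multivalued_semiflow X G \<longleftrightarrow>
     (\<forall>t\<ge>0. \<forall>x\<in>X. G t x \<noteq> {} \<and> G t x \<subseteq> X) \<and>
     (\<forall>x\<in>X. G 0 x = {x}) \<and>
     (\<forall>t1\<ge>0. \<forall>t2\<ge>0. \<forall>x\<in>X. G (t1 + t2) x \<subseteq> \<Union> (G t1 ` G t2 x))"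

definition strict_multivalued_semiflow :: "'a set \<Rightarrow> (real \<Rightarrow> 'a \<Rightarrow> 'a set) \<Rightarrow> bool" where
  "strict_multivalued_semiflow X G \<longleftrightarrow>
     multivalued_semiflow X G \<and>
     (\<forall>t1\<ge>0. \<forall>t2\<ge>0. \<forall>x\<in>X. G (t1 + t2) x = \<Union> (G t1 ` G t2 x))"

text \<open>The Hausdorff semidistance takes values in \<open>[0,\<infinity>]\<close>, since the sets need not be bounded.\<close>

definition hausdorff_semidist :: "'a metric \<Rightarrow> 'a set \<Rightarrow> 'a set \<Rightarrow> ennreal" where
  "hausdorff_semidist X A B = (SUP x\<in>A. INF y\<in>B. ennreal (mdist X x y))"

definition upper_semicontinuous :: "'a metric \<Rightarrow> ('a \<Rightarrow> 'a set) \<Rightarrow> bool" where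
  "upper_semicontinuous X F \<longleftrightarrow>
     (\<forall>xs x. range xs \<subseteq> mspace X \<and> limitin (mtopology_of X) xs x sequentially \<longrightarrow>
        (\<lambda>n. hausdorff_semidist X (F (xs n)) (F x)) \<longlonglongrightarrow> 0)"

end

theory Submission
  imports Defs "HOL-Complex_Analysis.Great_Picard" "HOL-Library.Diagonal_Subsequence"
begin

text \<open>
  Everything is reduced to countably many scalar integral equations. The functions
  \<open>sqrt 2 sin (k \<pi> x)\<close>, \<open>k \<ge> 1\<close>, form a total orthonormal sequence of \<open>L\<^sup>2(0,1)\<close>, are orthogonal and
  total in \<open>H\<^sup>1\<^sub>0(0,1)\<close> as well, and diagonalise the Dirichlet Laplacian (\<open>dirichlet_laplacian_iff\<close>). The
  generator then determines the heat semigroup mode by mode (\<open>coef_heat_semigroup\<close>), and the mild equation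
  for \<open>u = w \<circ> \<alpha>\<close> becomes, in the original time and with \<open>p = 1 / (a \<circ> l)\<close>, \<open>q = p\<^sup>2\<close>, the system
  \<open>w\<^sub>k' = - \<mu>\<^sub>k p(w) w\<^sub>k + q(w) (\<lambda> f(w) + \<gamma> w(\<sqdot> - \<rho>))\<^sub>k\<close> for the Fourier coefficients, where \<open>\<mu>\<^sub>k\<close> is the
  \<open>k\<close>-th eigenvalue (\<open>retarded_solution_iff_global_solution\<close>). This system is autonomous, and integrated
  in time it allows solutions to be translated and to be concatenated along a common history; hence
  \<open>G(t\<^sub>1 + t\<^sub>2, \<phi>) = G(t\<^sub>1, G(t\<^sub>2, \<phi>))\<close>.

  There remain existence and upper semicontinuity, and both rest on one compactness statement
  (\<open>weak_solution_compactness\<close>): if the diffusion coefficients lie between positive bounds, the forcing terms are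
  bounded in \<open>L\<^sup>2\<close> and the initial values converge in \<open>H\<^sup>1\<^sub>0\<close>, then a subsequence of the solutions converges in \<open>H\<^sup>1\<^sub>0\<close>, uniformly in time up to time \<open>0\<close>. Each
  mode is equicontinuous, and an energy estimate makes the high modes small uniformly (\<open>energy_tail\<close>).

  The forcing terms are bounded in \<open>L\<^sup>2\<close> once the solutions are bounded in \<open>L\<^sup>\<infinity>\<close>. The dissipativity condition
  enters only through its consequence that \<open>f(u) \<le> K u + K\<close> for \<open>u \<ge> 0\<close> and \<open>f(u) \<ge> K u - K\<close> for \<open>u \<le> 0\<close>.
  On one delay interval the delayed term is given, and the maximum principle for the heat semigroup bounds
  solutions by an explicit exponential (\<open>upper_barrier\<close>). The nonlinearity is not monotone, but \<open>\<kappa> s + f(s)\<close>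
  is increasing on bounded sets, and the resulting bound depends neither on \<open>\<kappa>\<close> nor on the set.

  For existence, \<open>f\<close> is clamped outside a bounded interval and the clamped equation is solved by Tonelli's
  method: evaluating the nonlinearity at time \<open>s - \<delta>\<close> makes the equation explicit, and compactness yields a
  limit as \<open>\<delta> \<rightarrow> 0\<close>. The barrier is the same for all clamped nonlinearities, so a clamp at its height is never
  active. For upper semicontinuity, solutions on one delay interval whose initial histories converge have a
  uniformly convergent subsequence whose limit is again a solution; the semiflow property carries this over
  to arbitrary times.
\<close>

section \<open>Total orthonormal sequences\<close>

text \<open>The sines in \<open>L\<^sup>2\<close> and the rescaled sines in \<open>H\<^sup>1\<^sub>0\<close> are both instances.\<close>

locale total_orthonormal =
  fixes e :: "nat \<Rightarrow> 'a::{real_inner,banach}"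
  assumes ortho: "inner (e i) (e j) = (if i = j then 1 else 0)"
    and total: "(\<And>k. inner u (e k) = 0) \<Longrightarrow> u = 0"
begin

lemma inner_sum_basis:
  assumes "finite F"
  shows "inner (\<Sum>k\<in>F. c k *\<^sub>R e k) (e j) = (if j \<in> F then c j else 0)"
  using assms by (simp add: inner_sum_left ortho if_distrib cong: if_cong)

lemma norm_sum_basis:
  assumes "finite F"
  shows "(norm (\<Sum>k\<in>F. c k *\<^sub>R e k))\<^sup>2 = (\<Sum>k\<in>F. (c k)\<^sup>2)"
proof -
  have "(norm (\<Sum>k\<in>F. c k *\<^sub>R e k))\<^sup>2 = (\<Sum>j\<in>F. c j * inner (\<Sum>k\<in>F. c k *\<^sub>R e k) (e j))"
    by (simp add: power2_norm_eq_inner inner_sum_right)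
  also have "\<dots> = (\<Sum>k\<in>F. (c k)\<^sup>2)"
    using assms by (intro sum.cong) (auto simp: inner_sum_basis power2_eq_square)
  finally show ?thesis .
qed

lemma bessel:
  assumes "finite F"
  shows "(\<Sum>k\<in>F. (inner u (e k))\<^sup>2) \<le> (norm u)\<^sup>2"
proof -
  let ?s = "\<Sum>k\<in>F. inner u (e k) *\<^sub>R e k"
  have us: "inner u ?s = (\<Sum>k\<in>F. (inner u (e k))\<^sup>2)"
    by (simp add: inner_sum_right power2_eq_square)
  have ss: "inner ?s ?s = (\<Sum>k\<in>F. (inner u (e k))\<^sup>2)"
    using norm_sum_basis[OF assms, of "\<lambda>k. inner u (e k)"] by (simp add: power2_norm_eq_inner)
  have "0 \<le> inner (u - ?s) (u - ?s)" by simp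
  also have "\<dots> = inner u u - 2 * inner u ?s + inner ?s ?s"
    by (simp add: inner_diff_left inner_diff_right inner_commute)
  also have "\<dots> = inner u u - (\<Sum>k\<in>F. (inner u (e k))\<^sup>2)" using us ss by simp
  finally show ?thesis by (simp add: power2_norm_eq_inner)
qed

lemma summable_coefficients: "summable (\<lambda>k. (inner u (e k))\<^sup>2)"
  by (rule summableI_nonneg_bounded[where x = "(norm u)\<^sup>2"]) (auto intro: bessel)

lemma riesz_fischer:
  assumes "summable (\<lambda>k. (c k)\<^sup>2)"
  obtains u where "(\<lambda>k. c k *\<^sub>R e k) sums u" "\<And>k. inner u (e k) = c k"
proof -
  have "summable (\<lambda>k. c k *\<^sub>R e k)"
    unfolding summable_Cauchy
  proof (intro allI impI)
    fix \<epsilon> :: real assume \<epsilon>: "\<epsilon> > 0"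
    then obtain N where N: "\<And>m n. m \<ge> N \<Longrightarrow> norm (\<Sum>k=m..<n. (c k)\<^sup>2) < \<epsilon>\<^sup>2"
      using assms unfolding summable_Cauchy by (metis zero_less_power)
    have "norm (\<Sum>k=m..<n. c k *\<^sub>R e k) < \<epsilon>" if "m \<ge> N" for m n
    proof -
      have "(norm (\<Sum>k=m..<n. c k *\<^sub>R e k))\<^sup>2 < \<epsilon>\<^sup>2"
        using N[OF that, of n] by (simp add: norm_sum_basis)
      then show ?thesis using \<epsilon> by (meson less_imp_le power_less_imp_less_base)
    qed
    then show "\<exists>N. \<forall>m\<ge>N. \<forall>n. norm (\<Sum>k=m..<n. c k *\<^sub>R e k) < \<epsilon>" by blast
  qed
  then obtain u where u: "(\<lambda>k. c k *\<^sub>R e k) sums u" by (auto simp: summable_def)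
  have "inner u (e k) = c k" for k
  proof -
    have "(\<lambda>j. inner (c j *\<^sub>R e j) (e k)) sums inner u (e k)"
      by (rule bounded_linear.sums[OF bounded_linear_inner_left u])
    moreover have "(\<lambda>j. inner (c j *\<^sub>R e j) (e k)) sums c k"
      using sums_If_finite[of "\<lambda>j. j = k" "\<lambda>j. c j"] by (simp add: ortho if_distrib cong: if_cong)
    ultimately show ?thesis by (rule sums_unique2)
  qed
  with u that show ?thesis by blast
qed

lemma expansion: "(\<lambda>k. inner u (e k) *\<^sub>R e k) sums u"
proof -
  obtain v where v: "(\<lambda>k. inner u (e k) *\<^sub>R e k) sums v" "\<And>k. inner v (e k) = inner u (e k)"
    using riesz_fischer[OF summable_coefficients] by blast
  have "v - u = 0" by (rule total) (simp add: inner_diff_left v)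
  with v show ?thesis by simp
qed

lemma parseval_inner: "(\<lambda>k. inner u (e k) * inner v (e k)) sums inner u v"
  using bounded_linear.sums[OF bounded_linear_inner_right expansion[of v], of u]
  by (simp add: mult.commute)

lemma parseval: "(\<lambda>k. (inner u (e k))\<^sup>2) sums (norm u)\<^sup>2"
  using parseval_inner[of u u] by (simp add: power2_eq_square power2_norm_eq_inner[unfolded power2_eq_square])

lemma coefficients_eqI: "(\<And>k. inner u (e k) = inner v (e k)) \<Longrightarrow> u = v"
  using total[of "u - v"] by (simp add: inner_diff_left)

end

section \<open>Completeness of \<open>L\<^sup>2(0,1)\<close> and of \<open>H\<^sup>1\<^sub>0(0,1)\<close>\<close>

lemma l2_rel_refl: "square_integrable f \<Longrightarrow> l2_rel f f"
  by (simp add: l2_rel_def)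

lemma square_integrable_rep: "square_integrable (rep_l2 u)"
  using Quotient_rep_reflp[OF Quotient_l2] by (auto simp: l2_rel_def)

lemma abs_rep_l2: "abs_l2 (rep_l2 u) = u"
  by (rule Quotient_abs_rep[OF Quotient_l2])

lemma abs_l2_eqI:
  "\<lbrakk>square_integrable f; square_integrable g; AE x in unit_leb. f x = g x\<rbrakk> \<Longrightarrow> abs_l2 f = abs_l2 g"
  by (rule Quotient_rel_abs[OF Quotient_l2]) (simp add: l2_rel_def)

lemma abs_l2_eqD:
  assumes "square_integrable f" "square_integrable g" "abs_l2 f = abs_l2 g"
  shows "AE x in unit_leb. f x = g x"
proof -
  have "l2_rel f g" using Quotient_rel[OF Quotient_l2, of f g] assms by (simp add: l2_rel_refl)
  then show ?thesis by (simp add: l2_rel_def)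
qed

lemma rep_abs_l2: "square_integrable f \<Longrightarrow> AE x in unit_leb. rep_l2 (abs_l2 f) x = f x"
  by (rule abs_l2_eqD) (simp_all add: square_integrable_rep abs_rep_l2)

lemma inner_abs_l2:
  "\<lbrakk>square_integrable f; square_integrable g\<rbrakk> \<Longrightarrow> inner (abs_l2 f) (abs_l2 g) = (\<integral>x. f x * g x \<partial>unit_leb)"
  by (simp add: inner_l2.abs_eq l2_rel_refl)

lemma inner_rep_l2: "inner u v = (\<integral>x. rep_l2 u x * rep_l2 v x \<partial>unit_leb)"
  using inner_abs_l2[OF square_integrable_rep square_integrable_rep] by (simp add: abs_rep_l2)

lemma square_integrable_diff:
  "\<lbrakk>square_integrable f; square_integrable g\<rbrakk> \<Longrightarrow> square_integrable (\<lambda>x. f x - g x)"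
  using square_integrable_add[OF _ square_integrable_scale[of g "-1"]] by simp

lemma abs_l2_diff:
  "\<lbrakk>square_integrable f; square_integrable g\<rbrakk> \<Longrightarrow> abs_l2 (\<lambda>x. f x - g x) = abs_l2 f - abs_l2 g"
  using abs_l2_linear[of f g 1 "-1"] by simp

lemma norm_abs_l2: "square_integrable f \<Longrightarrow> (norm (abs_l2 f))\<^sup>2 = (\<integral>x. (f x)\<^sup>2 \<partial>unit_leb)"
  by (simp add: power2_norm_eq_inner inner_abs_l2) (simp add: power2_eq_square)

lemma nn_integral_square:
  "square_integrable f \<Longrightarrow> (\<integral>\<^sup>+x. ennreal ((f x)\<^sup>2) \<partial>unit_leb) = ennreal ((norm (abs_l2 f))\<^sup>2)"
  by (simp add: norm_abs_l2 square_integrable_def nn_integral_eq_integral)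

lemma square_integrable_const: "square_integrable (\<lambda>x. c)"
  by (rule square_integrable_continuous) simp

lemma square_integrable_integrable: "square_integrable f \<Longrightarrow> integrable unit_leb f"
  using square_integrable_mult[OF _ square_integrable_const[of 1]] by simp

lemma measure_unit_leb: "measure unit_leb (space unit_leb) = 1"
  by (simp add: measure_restrict_space)

lemma norm_one_l2: "norm (abs_l2 (\<lambda>x. 1)) = 1"
proof -
  have "(norm (abs_l2 (\<lambda>x. 1)))\<^sup>2 = 1"
    using measure_unit_leb by (simp add: norm_abs_l2 square_integrable_const)
  then show ?thesis by (intro power2_eq_imp_eq[of _ 1]) auto
qed

lemma square_integrable_abs: "square_integrable f \<Longrightarrow> square_integrable (\<lambda>x. \<bar>f x\<bar>)"
  unfolding square_integrable_def by (auto intro: borel_measurable_abs)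

lemma norm_abs_l2_abs: "square_integrable f \<Longrightarrow> norm (abs_l2 (\<lambda>x. \<bar>f x\<bar>)) = norm (abs_l2 f)"
  by (rule power2_eq_imp_eq) (simp_all add: norm_abs_l2 square_integrable_abs)

lemma nn_integral_abs_le_norm:
  assumes "square_integrable f"
  shows "(\<integral>\<^sup>+x. ennreal \<bar>f x\<bar> \<partial>unit_leb) \<le> ennreal (norm (abs_l2 f))"
proof -
  note f = assms square_integrable_abs[OF assms]
  have "(\<integral>x. \<bar>f x\<bar> \<partial>unit_leb) = inner (abs_l2 (\<lambda>x. \<bar>f x\<bar>)) (abs_l2 (\<lambda>x. 1))"
    using f by (simp add: inner_abs_l2 square_integrable_const)
  also have "\<dots> \<le> norm (abs_l2 f)"
    using norm_cauchy_schwarz[of "abs_l2 (\<lambda>x. \<bar>f x\<bar>)" "abs_l2 (\<lambda>x. 1)"] assms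
    by (simp add: norm_one_l2 norm_abs_l2_abs)
  finally show ?thesis
    using f by (simp add: nn_integral_eq_integral square_integrable_integrable ennreal_leI)
qed

text \<open>A subsequence with norm increments \<open>2\<^sup>-\<^sup>n\<close> has absolutely summable increments almost everywhere, because
  \<open>L\<^sup>1\<close> norms are dominated by \<open>L\<^sup>2\<close> norms on a probability space; Fatou's lemma shows that the pointwise
  limit is also the limit in norm.\<close>

lemma l2_complete: 
  fixes X :: "nat \<Rightarrow> l2"
  assumes "Cauchy X"
  shows "convergent X"
proof -
  have "\<exists>N. \<forall>m\<ge>N. \<forall>n\<ge>N. norm (X m - X n) < (1/2)^k" for k
    by (rule CauchyD[OF assms]) simp
  then obtain N where N: "\<And>k m n. m \<ge> N k \<Longrightarrow> n \<ge> N k \<Longrightarrow> norm (X m - X n) < (1/2)^k"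
    by metis
  define r where "r k = (\<Sum>j\<le>k. Suc (N j))" for k
  have r_mono: "strict_mono r" by (rule strict_monoI_Suc) (simp add: r_def)
  have rN: "r n \<ge> N k" if "n \<ge> k" for n k
  proof -
    have "N k \<le> Suc (N k)" by simp
    also have "\<dots> \<le> r n"
      unfolding r_def by (rule member_le_sum) (use that in auto)
    finally show ?thesis .
  qed
  define f where "f n = rep_l2 (X (r n))" for n
  have f: "square_integrable (f n)" for n by (simp add: f_def square_integrable_rep)
  have meas [measurable]: "f n \<in> borel_measurable unit_leb" for n
    using f[of n] by (simp add: square_integrable_def)
  have norm_f: "norm (abs_l2 (\<lambda>x. f m x - f n x)) < (1/2)^k" if "m \<ge> k" "n \<ge> k" for m n k
    using N[OF rN rN, OF that] by (simp add: abs_l2_diff f) (simp add: f_def abs_rep_l2)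
  have "(\<integral>\<^sup>+x. (\<Sum>n. ennreal \<bar>f (Suc n) x - f n x\<bar>) \<partial>unit_leb)
      = (\<Sum>n. \<integral>\<^sup>+x. ennreal \<bar>f (Suc n) x - f n x\<bar> \<partial>unit_leb)"
    by (rule nn_integral_suminf) simp
  also have "\<dots> \<le> (\<Sum>n. ennreal ((1/2)^n))"
  proof (intro suminf_le summableI)
    fix n
    have "(\<integral>\<^sup>+x. ennreal \<bar>f (Suc n) x - f n x\<bar> \<partial>unit_leb) \<le> ennreal (norm (abs_l2 (\<lambda>x. f (Suc n) x - f n x)))"
      by (intro nn_integral_abs_le_norm square_integrable_diff f)
    also have "\<dots> \<le> ennreal ((1/2)^n)" using norm_f[of n "Suc n" n] by (intro ennreal_leI) simp
    finally show "(\<integral>\<^sup>+x. ennreal \<bar>f (Suc n) x - f n x\<bar> \<partial>unit_leb) \<le> ennreal ((1/2)^n)" .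
  qed
  also have "\<dots> = ennreal 2"
  proof (rule suminf_ennreal_eq)
    show "(\<lambda>n. (1/2::real)^n) sums 2" using geometric_sums[of "1/2::real"] by simp
  qed simp
  finally have fin: "(\<integral>\<^sup>+x. (\<Sum>n. ennreal \<bar>f (Suc n) x - f n x\<bar>) \<partial>unit_leb) \<noteq> \<infinity>"
    by (metis ennreal_neq_top infinity_ennreal_def top_unique)
  have "AE x in unit_leb. (\<Sum>n. ennreal \<bar>f (Suc n) x - f n x\<bar>) \<noteq> \<infinity>"
    by (rule nn_integral_PInf_AE[OF _ fin]) simp
  then have conv: "AE x in unit_leb. (\<lambda>n. f n x) \<longlonglongrightarrow> lim (\<lambda>n. f n x)"
  proof eventually_elim
    case (elim x)
    have "summable (\<lambda>n. \<bar>f (Suc n) x - f n x\<bar>)"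
      using elim by (intro summable_suminf_not_top) simp_all
    then have "summable (\<lambda>n. f (Suc n) x - f n x)" by (rule summable_rabs_cancel)
    then have "convergent (\<lambda>n. \<Sum>i<n. f (Suc i) x - f i x)" by (simp add: summable_iff_convergent)
    then have "convergent (\<lambda>n. f n x - f 0 x)" by (simp only: sum_lessThan_telescope[of "\<lambda>i. f i x"])
    then have "convergent (\<lambda>n. f n x)" 
      using convergent_add[of "\<lambda>n. f n x - f 0 x" "\<lambda>n. f 0 x"] by (simp add: convergent_const)
    then show ?case by (simp add: convergent_LIMSEQ_iff)
  qed
  define g where "g x = lim (\<lambda>n. f n x)" for x
  have g_meas [measurable]: "g \<in> borel_measurable unit_leb" unfolding g_def by (rule borel_measurable_lim_metric) simp
  have gf: "(\<integral>\<^sup>+x. ennreal ((g x - f n x)\<^sup>2) \<partial>unit_leb) \<le> ennreal (((1/2)^n)\<^sup>2)" for n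
  proof -
    have "(\<integral>\<^sup>+x. ennreal ((g x - f n x)\<^sup>2) \<partial>unit_leb) = (\<integral>\<^sup>+x. liminf (\<lambda>m. ennreal ((f m x - f n x)\<^sup>2)) \<partial>unit_leb)"
    proof (rule nn_integral_cong_AE, use conv in eventually_elim)
      case (elim x)
      have "(\<lambda>m. ennreal ((f m x - f n x)\<^sup>2)) \<longlonglongrightarrow> ennreal ((g x - f n x)\<^sup>2)"
        using elim unfolding g_def by (intro tendsto_intros)
      then show ?case using lim_imp_Liminf[OF trivial_limit_sequentially] by metis
    qed
    also have "\<dots> \<le> liminf (\<lambda>m. \<integral>\<^sup>+x. ennreal ((f m x - f n x)\<^sup>2) \<partial>unit_leb)"
      by (rule nn_integral_liminf) simp
    also have "\<dots> \<le> ennreal (((1/2)^n)\<^sup>2)"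
    proof (rule Liminf_le)
      show "\<forall>\<^sub>F m in sequentially. (\<integral>\<^sup>+x. ennreal ((f m x - f n x)\<^sup>2) \<partial>unit_leb) \<le> ennreal (((1/2)^n)\<^sup>2)"
        using eventually_ge_at_top[of n]
      proof eventually_elim
        case (elim m)
        have "(norm (abs_l2 (\<lambda>x. f m x - f n x)))\<^sup>2 \<le> ((1/2)^n)\<^sup>2"
          using norm_f[OF elim, of n] by (intro power_mono) auto
        then show ?case
          by (simp only: nn_integral_square square_integrable_diff f ennreal_leI)
      qed
    qed simp
    finally show ?thesis .
  qed
  have gf_int: "square_integrable (\<lambda>x. g x - f n x)" for n
    unfolding square_integrable_def
  proof
    show "integrable unit_leb (\<lambda>x. (g x - f n x)\<^sup>2)"
      using le_less_trans[OF gf[of n] ennreal_less_top] by (intro integrableI_bounded) auto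
  qed measurable
  have g: "square_integrable g"
    using square_integrable_add[OF gf_int[of 0] f[of 0]] by simp
  have lim: "(\<lambda>n. X (r n)) \<longlonglongrightarrow> abs_l2 g"
  proof (rule LIMSEQ_I)
    fix \<epsilon> :: real assume "\<epsilon> > 0"
    then obtain K where K: "(1/2::real)^K < \<epsilon>" using real_arch_pow_inv[of \<epsilon> "1/2"] by auto
    have "norm (X (r n) - abs_l2 g) < \<epsilon>" if "n \<ge> K" for n
    proof -
      have "abs_l2 (\<lambda>x. g x - f n x) = abs_l2 g - X (r n)"
        by (simp add: abs_l2_diff f g) (simp add: f_def abs_rep_l2)
      moreover have "(norm (abs_l2 (\<lambda>x. g x - f n x)))\<^sup>2 \<le> ((1/2)^n)\<^sup>2"
        using gf[of n] by (simp add: nn_integral_square gf_int ennreal_le_iff)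
      ultimately have "norm (X (r n) - abs_l2 g) \<le> (1/2)^n"
        by (subst norm_minus_commute) (auto intro: power2_le_imp_le)
      also have "\<dots> \<le> (1/2)^K" using that by (simp add: power_decreasing)
      finally show ?thesis using K by simp
    qed
    then show "\<exists>no. \<forall>n\<ge>no. norm (X (r n) - abs_l2 g) < \<epsilon>" by blast
  qed
  have "X \<longlonglongrightarrow> abs_l2 g"
    by (rule Cauchy_converges_subseq[OF assms r_mono]) (use lim in \<open>simp add: o_def\<close>)
  then show ?thesis by (auto simp: convergent_def)
qed

instance l2 :: banach
  by standard (rule l2_complete)

instance h10 :: banach
proof
  fix X :: "nat \<Rightarrow> h10" assume X: "Cauchy X"
  have norm_diff: "norm (Rep_h10 u - Rep_h10 v) = norm (u - v)" for u v
    by (simp add: norm_h10.rep_eq minus_h10.rep_eq)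
  have "Cauchy (\<lambda>n. Rep_h10 (X n))"
    using X unfolding Cauchy_def dist_norm norm_diff .
  then obtain p where p: "(\<lambda>n. Rep_h10 (X n)) \<longlonglongrightarrow> p" by (auto simp: Cauchy_convergent_iff convergent_def)
  have "p \<in> H10_graph"
    by (rule closed_sequentially[OF _ _ p]) (auto simp: H10_graph_def Rep_h10[unfolded H10_graph_def])
  then have "(\<lambda>n. Rep_h10 (X n)) \<longlonglongrightarrow> Rep_h10 (Abs_h10 p)" using p by (simp add: Abs_h10_inverse)
  then have "X \<longlonglongrightarrow> Abs_h10 p" unfolding LIMSEQ_iff norm_diff .
  then show "convergent X" by (auto simp: convergent_def)
qed

section \<open>Smooth bump functions\<close>

text \<open>Differentiating from the inside, unlike iterating \<open>deriv\<close> from the outside, lets closure under sums,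
  products and affine substitutions be proved by induction on the order.\<close>

primrec times_differentiable :: "nat \<Rightarrow> (real \<Rightarrow> real) \<Rightarrow> bool" where
  "times_differentiable 0 f \<longleftrightarrow> True"
| "times_differentiable (Suc n) f \<longleftrightarrow> (\<forall>x. f field_differentiable at x) \<and> times_differentiable n (deriv f)"

lemma times_differentiable_funpow:
  "times_differentiable (Suc k) f \<Longrightarrow> (deriv ^^ k) f field_differentiable at x"
proof (induction k arbitrary: f)
  case (Suc k)
  then have "times_differentiable (Suc k) (deriv f)" by simp
  from Suc.IH[OF this] show ?case by (simp add: funpow_swap1)
qed simp

lemma times_differentiable_SucD: "times_differentiable (Suc n) f \<Longrightarrow> times_differentiable n f"
proof (induction n arbitrary: f)
  case (Suc n)
  then have "times_differentiable n (deriv f)" by (meson times_differentiable.simps(2))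
  with Suc.prems show ?case by simp
qed simp

lemma times_differentiable_lincomb:
  "times_differentiable n f \<Longrightarrow> times_differentiable n g \<Longrightarrow> times_differentiable n (\<lambda>x. a * f x + b * g x)"
proof (induction n arbitrary: f g)
  case (Suc n)
  have "deriv (\<lambda>x. a * f x + b * g x) = (\<lambda>x. a * deriv f x + b * deriv g x)"
    using Suc.prems by (auto simp: fun_eq_iff intro!: DERIV_imp_deriv derivative_eq_intros
        dest: DERIV_deriv_iff_field_differentiable[THEN iffD2, rule_format])
  moreover have "(\<lambda>x. a * f x + b * g x) field_differentiable at x" for x
    using Suc.prems by (auto intro!: field_differentiable_add field_differentiable_mult)
  ultimately show ?case using Suc by simp
qed simp

lemma times_differentiable_mult:
  "times_differentiable n f \<Longrightarrow> times_differentiable n g \<Longrightarrow> times_differentiable n (\<lambda>x. f x * g x)"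
proof (induction n arbitrary: f g)
  case (Suc n)
  have "deriv (\<lambda>x. f x * g x) = (\<lambda>x. 1 * (f x * deriv g x) + 1 * (deriv f x * g x))"
    using Suc.prems by (auto simp: fun_eq_iff deriv_mult)
  moreover have "(\<lambda>x. f x * g x) field_differentiable at x" for x
    using Suc.prems by (auto intro!: field_differentiable_mult)
  moreover have "times_differentiable n (\<lambda>x. 1 * (f x * deriv g x) + 1 * (deriv f x * g x))"
    using Suc.prems Suc.prems[THEN times_differentiable_SucD]
    by (intro times_differentiable_lincomb Suc.IH) simp_all
  ultimately show ?case by simp
qed simp

lemma DERIV_imp_times_differentiable_Suc:
  assumes "\<And>x. (f has_real_derivative f' x) (at x)" "times_differentiable n f'"
  shows "times_differentiable (Suc n) f"
proof -
  have "deriv f = f'" using assms(1) by (auto simp: fun_eq_iff intro: DERIV_imp_deriv)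
  moreover have "f field_differentiable at x" for x
    using assms(1) by (auto simp: field_differentiable_def)
  ultimately show ?thesis using assms(2) by simp
qed

lemma times_differentiable_affine:
  "times_differentiable n f \<Longrightarrow> times_differentiable n (\<lambda>x. f (a * x + b))"
proof (induction n arbitrary: f)
  case (Suc n)
  show ?case
  proof (rule DERIV_imp_times_differentiable_Suc)
    fix x
    have "(f has_real_derivative deriv f (a * x + b)) (at (a * x + b))"
      using Suc.prems by (simp add: DERIV_deriv_iff_field_differentiable)
    moreover have "((\<lambda>x. a * x + b) has_real_derivative a) (at x)"
      by (auto intro!: derivative_eq_intros)
    ultimately have "((\<lambda>x. f (a * x + b)) has_real_derivative deriv f (a * x + b) * a) (at x)"
      by (rule DERIV_chain2)
    then show "((\<lambda>x. f (a * x + b)) has_real_derivative a * deriv f (a * x + b) + 0 * deriv f (a * x + b)) (at x)"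
      by (simp add: mult.commute)
    show "times_differentiable n (\<lambda>x. a * deriv f (a * x + b) + 0 * deriv f (a * x + b))"
      using Suc by (intro times_differentiable_lincomb) auto
  qed
qed simp

lemma times_differentiable_sin_cos:
  "times_differentiable n (\<lambda>x. sin (c * x)) \<and> times_differentiable n (\<lambda>x. cos (c * x))"
proof (induction n)
  case (Suc n)
  have "times_differentiable (Suc n) (\<lambda>x. sin (c * x))"
  proof (rule DERIV_imp_times_differentiable_Suc)
    show "((\<lambda>x. sin (c * x)) has_real_derivative c * cos (c * x) + 0 * cos (c * x)) (at x)" for x
      by (auto intro!: derivative_eq_intros)
  qed (intro times_differentiable_lincomb, use Suc in auto)
  moreover have "times_differentiable (Suc n) (\<lambda>x. cos (c * x))"
  proof (rule DERIV_imp_times_differentiable_Suc)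
    show "((\<lambda>x. cos (c * x)) has_real_derivative (-c) * sin (c * x) + 0 * sin (c * x)) (at x)" for x
      by (auto intro!: derivative_eq_intros)
  qed (intro times_differentiable_lincomb, use Suc in auto)
  ultimately show ?case by simp
qed simp

text \<open>The functions \<open>x\<^sup>-\<^sup>j e\<^sup>-\<^sup>1\<^sup>/\<^sup>x\<close>, extended by \<open>0\<close>. The derivative of each is a combination of two others, so
  smoothness of all of them follows by induction on the order.\<close>

definition flat :: "nat \<Rightarrow> real \<Rightarrow> real" where
  "flat j x = (if x > 0 then (1/x)^j * exp (- (1/x)) else 0)"

lemma power_mult_exp_minus_le:
  fixes y :: real assumes "0 \<le> y"
  shows "y^j * exp (- y) \<le> fact j"
proof -
  have "(\<Sum>n\<in>{j}. inverse (fact n) *\<^sub>R y ^ n) \<le> exp y"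
    unfolding exp_def by (rule sum_le_suminf[OF summable_exp_generic]) (use assms in auto)
  then have "y^j \<le> fact j * exp y" by (simp add: field_simps)
  then show ?thesis by (simp add: exp_minus field_simps)
qed

lemma flat_nonneg: "0 \<le> flat j x" by (simp add: flat_def)

lemma flat_le: "flat j x \<le> fact j"
  using power_mult_exp_minus_le[of "1/x" j] by (simp add: flat_def)

lemma flat_le_1: "flat 0 x \<le> 1" using flat_le[of 0 x] by simp

lemma flat_Suc: "x * flat (Suc j) x = flat j x"
  by (simp add: flat_def)

lemma DERIV_flat: "(flat j has_real_derivative (1 * flat (j + 2) x + (- real j) * flat (j + 1) x)) (at x)"
proof -
  consider "x > 0" | "x < 0" | "x = 0" by linarith
  then show ?thesis
  proof cases
    case 1
    have "((\<lambda>x. (1/x)^j * exp (- (1/x))) has_real_derivative (1 * flat (j + 2) x + (- real j) * flat (j + 1) x)) (at x)"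
    proof -
      have inv: "((\<lambda>x. 1/x) has_real_derivative - ((1/x)\<^sup>2)) (at x)"
        using 1 by (auto intro!: derivative_eq_intros simp: power2_eq_square)
      have "((\<lambda>x. (1/x)^j) has_real_derivative - real j * (1/x)^(j + 1)) (at x)"
        by (rule DERIV_cong[OF DERIV_power[OF inv, of j]]) (use 1 in \<open>cases j; simp add: power2_eq_square field_simps\<close>)
      moreover have "((\<lambda>x. exp (- (1/x))) has_real_derivative exp (- (1/x)) * (1/x)\<^sup>2) (at x)"
        using DERIV_chain2[OF DERIV_exp DERIV_minus[OF inv]] by simp
      ultimately have "((\<lambda>x. (1/x)^j * exp (- (1/x))) has_real_derivative
          - real j * (1/x)^(j + 1) * exp (- (1/x)) + exp (- (1/x)) * (1/x)\<^sup>2 * (1/x)^j) (at x)"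
        by (rule DERIV_mult)
      then show ?thesis using 1 by (simp add: flat_def power2_eq_square algebra_simps)
    qed
    then show ?thesis
    proof (rule has_field_derivative_transform_within_open[where S = "{0<..}"])
    qed (use 1 in \<open>auto simp: flat_def\<close>)
  next
    case 2
    have "((\<lambda>x. 0) has_real_derivative (1 * flat (j + 2) x + (- real j) * flat (j + 1) x)) (at x)"
      using 2 by (simp add: flat_def)
    then show ?thesis
    proof (rule has_field_derivative_transform_within_open[where S = "{..<0}"])
    qed (use 2 in \<open>auto simp: flat_def\<close>)
  next
    case 3
    have quot: "norm (flat j h / h) \<le> fact (j + 2) * \<bar>h\<bar>" for h
    proof (cases "h > 0")
      case True
      have "flat j h / h = h * flat (j + 2) h"
        using True flat_Suc[of h j] flat_Suc[of h "j + 1"] by (simp add: field_simps)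
      then show ?thesis using True mult_right_mono[OF flat_le[of "j + 2" h], of h]
        by (simp add: abs_mult flat_nonneg mult.commute)
    next
      case False
      then have "flat j h / h = 0" by (simp add: flat_def)
      then show ?thesis by (simp only: norm_zero) (intro mult_nonneg_nonneg; simp)
    qed
    have "(\<lambda>h. flat j h / h) \<midarrow>0\<rightarrow> 0"
    proof (rule Lim_null_comparison)
      show "\<forall>\<^sub>F h in at 0. norm (flat j h / h) \<le> fact (j + 2) * \<bar>h\<bar>" using quot by simp
      have "((\<lambda>h::real. fact (j + 2) * \<bar>h\<bar>) \<longlongrightarrow> fact (j + 2) * \<bar>0\<bar>) (at 0)" by (intro tendsto_intros)
      then show "((\<lambda>h::real. fact (j + 2) * \<bar>h\<bar>) \<longlongrightarrow> 0) (at 0)" by simp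
    qed
    then show ?thesis using 3 by (simp add: DERIV_def) (simp add: flat_def)
  qed
qed

lemma times_differentiable_flat: "times_differentiable n (flat j)"
proof (induction n arbitrary: j)
  case (Suc n)
  show ?case
    by (rule DERIV_imp_times_differentiable_Suc[OF DERIV_flat]) (intro times_differentiable_lincomb Suc)
qed simp

lemma test_functionI:
  assumes "\<And>n. times_differentiable n f" "0 < p" "q < 1" "\<And>x. x \<notin> {p..q} \<Longrightarrow> f x = 0"
  shows "f \<in> test_functions"
proof -
  have "\<exists>K. compact K \<and> K \<subseteq> {0<..<1} \<and> (\<forall>x. x \<notin> K \<longrightarrow> f x = 0)"
    using assms(2-4) by (intro exI[of _ "{p..q}"]) auto
  then show ?thesis
    using times_differentiable_funpow[OF assms(1)] by (auto simp: test_functions_def)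
qed

text \<open>These test functions tend to the indicator function of \<open>(p,q)\<close> as \<open>n \<rightarrow> \<infinity>\<close>.\<close>

definition bump :: "real \<Rightarrow> real \<Rightarrow> real \<Rightarrow> real \<Rightarrow> real" where
  "bump n p q x = flat 0 (n * (x - p)) * flat 0 (n * (q - x))"

lemma times_differentiable_bump: "times_differentiable k (bump n p q)"
proof -
  have "bump n p q = (\<lambda>x. flat 0 (n * x + (- n * p)) * flat 0 ((- n) * x + n * q))"
    by (auto simp: bump_def fun_eq_iff algebra_simps)
  then show ?thesis
    by (simp only:) (intro times_differentiable_mult times_differentiable_affine times_differentiable_flat)
qed

lemma bump_nonneg: "0 \<le> bump n p q x" by (simp add: bump_def flat_nonneg)

lemma bump_le_1: "bump n p q x \<le> 1"
  unfolding bump_def by (intro mult_le_one flat_le_1 flat_nonneg)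

lemma bump_outside: "0 < n \<Longrightarrow> x \<notin> {p<..<q} \<Longrightarrow> bump n p q x = 0"
  by (auto simp: bump_def flat_def zero_less_mult_iff)

lemma bump_test_function: "\<lbrakk>0 < n; 0 < p; q < 1\<rbrakk> \<Longrightarrow> bump n p q \<in> test_functions"
  by (rule test_functionI[OF times_differentiable_bump, of p q]) (auto intro: bump_outside)

lemma flat_0_tendsto:
  assumes "filterlim Y at_top F"
  shows "((\<lambda>n. flat 0 (Y n)) \<longlongrightarrow> 1) F"
proof -
  have "((\<lambda>n. exp (- (1 / Y n))) \<longlongrightarrow> exp (- 0)) F"
    by (intro tendsto_intros real_tendsto_divide_at_top[OF tendsto_const assms])
  moreover have "\<forall>\<^sub>F n in F. exp (- (1 / Y n)) = flat 0 (Y n)"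
    using eventually_compose_filterlim[OF eventually_gt_at_top[of 0] assms]
    by eventually_elim (simp add: flat_def)
  ultimately show ?thesis by (simp add: tendsto_cong)
qed

lemma bump_tendsto:
  "(\<lambda>n. bump (real (Suc n)) p q x) \<longlonglongrightarrow> indicator {p<..<q} x"
proof (cases "x \<in> {p<..<q}")
  case True
  have lim: "filterlim (\<lambda>n. real (Suc n) * c) at_top sequentially" if "c > 0" for c
    using filterlim_tendsto_pos_mult_at_top[OF tendsto_const that
        filterlim_compose[OF filterlim_real_sequentially filterlim_Suc]]
    by (simp add: mult.commute)
  have "(\<lambda>n. bump (real (Suc n)) p q x) \<longlonglongrightarrow> 1 * 1"
    unfolding bump_def using True by (intro tendsto_mult flat_0_tendsto lim) auto
  then show ?thesis using True by simp
next
  case False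
  then show ?thesis by (subst bump_outside) auto
qed

lemma continuous_on_test_function: "\<phi> \<in> test_functions \<Longrightarrow> continuous_on S \<phi>"
  using continuous_deriv_funpow[of \<phi> 0] by (auto intro: continuous_on_subset)

lemma continuous_on_deriv_test_function: "\<phi> \<in> test_functions \<Longrightarrow> continuous_on S (deriv \<phi>)"
  using continuous_deriv_funpow[of \<phi> 1] by (auto intro: continuous_on_subset)

lemma DERIV_test_function: "\<phi> \<in> test_functions \<Longrightarrow> (\<phi> has_real_derivative deriv \<phi> x) (at x)"
  using test_function_differentiable[of \<phi> 0] by (simp add: DERIV_deriv_iff_field_differentiable)

lemma test_function_outside: "\<phi> \<in> test_functions \<Longrightarrow> x \<notin> {0<..<1} \<Longrightarrow> \<phi> x = 0"
  using test_function_support by blast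

section \<open>Order and totality tested against bump functions\<close>

lemma abs_l2_tendsto:
  assumes cont: "\<And>n. continuous_on UNIV (f n)" "continuous_on UNIV g"
    and lim: "\<And>x. 0 < x \<Longrightarrow> x < 1 \<Longrightarrow> (\<lambda>n. f n x) \<longlonglongrightarrow> g x"
    and bound: "\<And>n x. 0 < x \<Longrightarrow> x < 1 \<Longrightarrow> \<bar>f n x\<bar> \<le> B"
  shows "(\<lambda>n. abs_l2 (f n)) \<longlonglongrightarrow> abs_l2 g"
proof -
  have f: "square_integrable (f n)" for n by (intro square_integrable_continuous cont)
  have g: "square_integrable g" by (intro square_integrable_continuous cont)
  have gB: "\<bar>g x\<bar> \<le> B" if "0 < x" "x < 1" for x
    using lim[OF that] bound[OF that] by (intro LIMSEQ_le_const2[OF tendsto_rabs]) auto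
  have "(\<lambda>n. \<integral>x. (f n x - g x)\<^sup>2 \<partial>unit_leb) \<longlonglongrightarrow> (\<integral>x. 0 \<partial>unit_leb)"
  proof (rule integral_dominated_convergence[where w = "\<lambda>x. (2 * B)\<^sup>2"])
    show "(\<lambda>x. (f n x - g x)\<^sup>2) \<in> borel_measurable unit_leb" for n
      using square_integrable_diff[OF f[of n] g] unfolding square_integrable_def by auto
    show "integrable unit_leb (\<lambda>x. (2 * B)\<^sup>2)"
      using square_integrable_integrable[OF square_integrable_const] .
    show "AE x in unit_leb. (\<lambda>n. (f n x - g x)\<^sup>2) \<longlonglongrightarrow> 0"
    proof (rule AE_I2)
      fix x assume "x \<in> space unit_leb"
      then have "(\<lambda>n. (f n x - g x)\<^sup>2) \<longlonglongrightarrow> (g x - g x)\<^sup>2"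
        by (intro tendsto_intros lim) auto
      then show "(\<lambda>n. (f n x - g x)\<^sup>2) \<longlonglongrightarrow> 0" by simp
    qed
    show "AE x in unit_leb. norm ((f n x - g x)\<^sup>2) \<le> (2 * B)\<^sup>2" for n
    proof (rule AE_I2)
      fix x assume "x \<in> space unit_leb"
      then have "\<bar>f n x - g x\<bar> \<le> 2 * B" using bound[of x n] gB[of x] by auto
      then show "norm ((f n x - g x)\<^sup>2) \<le> (2 * B)\<^sup>2"
        using power_mono[OF _ abs_ge_zero, of "f n x - g x" "2 * B" 2] by simp
    qed
  qed simp
  then have "(\<lambda>n. (norm (abs_l2 (f n) - abs_l2 g))\<^sup>2) \<longlonglongrightarrow> 0"
    using f g by (simp add: norm_abs_l2 square_integrable_diff flip: abs_l2_diff)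
  then have "(\<lambda>n. norm (abs_l2 (f n) - abs_l2 g)) \<longlonglongrightarrow> 0"
    using tendsto_real_sqrt by fastforce
  then show ?thesis using LIM_zero_cancel tendsto_norm_zero_iff by blast
qed

text \<open>Bump functions approximating an indicator function show that \<open>u\<close> has nonnegative integral over every
  interval; almost every value of \<open>u\<close> is a limit of means over shrinking intervals.\<close>

lemma nonneg_l2I:
  assumes "\<And>\<phi>. \<phi> \<in> test_functions \<Longrightarrow> (\<And>x. 0 \<le> \<phi> x) \<Longrightarrow> 0 \<le> inner u (abs_l2 \<phi>)"
  shows "AE x in unit_leb. 0 \<le> rep_l2 u x"
proof -
  let ?g = "rep_l2 u"
  define h where "h x = (if x \<in> {0<..<1} then ?g x else 0)" for x
  have g: "integrable unit_leb ?g"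
    by (intro square_integrable_integrable square_integrable_rep)
  have gL: "set_integrable lebesgue {0<..<1} ?g"
    unfolding set_integrable_def using g by (simp add: integrable_restrict_space)
  have h: "h absolutely_integrable_on UNIV"
    using gL unfolding set_integrable_def h_def
    by (simp add: indicator_def if_distrib cong: if_cong) (erule Bochner_Integration.integrable_cong[THEN iffD1, rotated 2], auto)
  have hab: "h absolutely_integrable_on {p..q}" for p q
    by (rule set_integrable_subset[OF h]) auto
  have nonneg: "0 \<le> integral {p..q} h" if pq: "0 < p" "p < q" "q < 1" for p q
  proof -
    have sq: "square_integrable (bump (real (Suc n)) p q)" for n
      using bump_test_function[of "real (Suc n)" p q] pq by (intro square_integrable_test_function) auto
    have "(\<lambda>n. \<integral>x. ?g x * bump (real (Suc n)) p q x \<partial>unit_leb) \<longlonglongrightarrow> (\<integral>x. ?g x * indicator {p<..<q} x \<partial>unit_leb)"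
    proof (rule integral_dominated_convergence[where w = "\<lambda>x. \<bar>?g x\<bar>"])
      show "(\<lambda>x. ?g x * indicator {p<..<q} x) \<in> borel_measurable unit_leb"
        by (intro borel_measurable_times borel_measurable_integrable[OF g] borel_measurable_indicator)
          (use pq in \<open>auto simp: sets_restrict_space_iff\<close>)
      show "(\<lambda>x. ?g x * bump (real (Suc n)) p q x) \<in> borel_measurable unit_leb" for n
        using square_integrable_mult[OF square_integrable_rep sq] by auto
      show "AE x in unit_leb. norm (?g x * bump (real (Suc n)) p q x) \<le> \<bar>?g x\<bar>" for n
        using bump_nonneg bump_le_1 by (intro AE_I2) (auto simp: abs_mult mult_left_le)
    qed (use g in \<open>simp, intro AE_I2 tendsto_mult tendsto_const bump_tendsto\<close>)
    moreover have "0 \<le> (\<integral>x. ?g x * bump (real (Suc n)) p q x \<partial>unit_leb)" for n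
    proof -
      have "(\<integral>x. ?g x * bump (real (Suc n)) p q x \<partial>unit_leb) = inner (abs_l2 ?g) (abs_l2 (bump (real (Suc n)) p q))"
        by (rule inner_abs_l2[symmetric, OF square_integrable_rep sq])
      also have "\<dots> \<ge> 0"
        unfolding abs_rep_l2 using pq by (intro assms bump_test_function bump_nonneg) auto
      finally show ?thesis .
    qed
    ultimately have "0 \<le> (\<integral>x. ?g x * indicator {p<..<q} x \<partial>unit_leb)"
      by (intro LIMSEQ_le_const) auto
    also have "\<dots> = (\<integral>x. h x * indicator {p<..<q} x \<partial>lebesgue)"
      by (subst integral_restrict_space) (use pq in \<open>auto simp: h_def intro!: Bochner_Integration.integral_cong split: split_indicator\<close>)
    also have "\<dots> = set_lebesgue_integral lebesgue {p<..<q} h"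
      by (simp add: set_lebesgue_integral_def mult.commute)
    also have "\<dots> = integral {p<..<q} h"
      by (intro set_lebesgue_integral_eq_integral set_integrable_subset[OF h]) auto
    also have "\<dots> = integral {p..q} h" by (rule integral_open_interval_real[symmetric])
    finally show ?thesis .
  qed
  obtain N where N: "negligible N" 
    and N': "\<And>x e. \<lbrakk>x \<notin> N; 0 < e\<rbrakk> \<Longrightarrow> \<exists>d>0. \<forall>t. 0 < t \<and> t < d \<longrightarrow> norm (integral (cbox x (x + t *\<^sub>R One)) h /\<^sub>R t ^ DIM(real) - h x) < e"
    using integrable_ccontinuous_explicit[of h] hab
    by (metis box_real(2) set_lebesgue_integral_eq_integral(1))
  have pos: "0 \<le> ?g x" if x: "0 < x" "x < 1" "x \<notin> N" for x
  proof (rule ccontr)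
    assume neg: "\<not> 0 \<le> ?g x"
    then obtain d where d: "d > 0" "\<And>t. 0 < t \<Longrightarrow> t < d \<Longrightarrow> norm (integral {x..x+t} h / t - h x) < - ?g x"
      using N'[OF x(3), of "- ?g x"] by (auto simp: divide_inverse mult.commute)
    define t where "t = min (d/2) ((1-x)/2)"
    have t: "0 < t" "t < d" "x + t < 1" using d(1) x by (auto simp: t_def min_def field_simps)
    have "0 \<le> integral {x..x+t} h / t" using nonneg[of x "x+t"] x t by simp
    then have "- ?g x \<le> integral {x..x+t} h / t - h x" using x by (simp add: h_def)
    with d(2)[OF t(1,2)] show False by auto
  qed
  have "AE x in lebesgue. x \<notin> N" using N by (simp add: negligible_iff_null_sets AE_not_in)
  then have "AE x in lebesgue. x \<in> {0<..<1} \<longrightarrow> 0 \<le> ?g x" by eventually_elim (use pos in auto)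
  then show ?thesis by (simp add: AE_restrict_space_iff)
qed

lemma test_functions_total:
  assumes "\<And>\<phi>. \<phi> \<in> test_functions \<Longrightarrow> inner u (abs_l2 \<phi>) = 0"
  shows "u = 0"
proof -
  have "AE x in unit_leb. 0 \<le> rep_l2 u x" by (rule nonneg_l2I) (simp add: assms)
  moreover have "AE x in unit_leb. 0 \<le> rep_l2 (- u) x" by (rule nonneg_l2I) (simp add: assms)
  moreover have "AE x in unit_leb. rep_l2 (- u) x = - rep_l2 u x"
    using rep_abs_l2[OF square_integrable_scale[OF square_integrable_rep, of "-1" u]]
      abs_l2_linear[OF square_integrable_rep square_integrable_rep, of "-1" u 0 u]
    by (simp add: abs_rep_l2)
  ultimately have "AE x in unit_leb. rep_l2 u x = 0" by eventually_elim simp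
  then have "abs_l2 (rep_l2 u) = abs_l2 (\<lambda>x. 0)"
    by (intro abs_l2_eqI square_integrable_rep square_integrable_zero)
  then show ?thesis by (simp add: abs_rep_l2 zero_l2.abs_eq)
qed

lemma inner_nonneg_l2:
  assumes "AE x in unit_leb. 0 \<le> rep_l2 u x" "AE x in unit_leb. 0 \<le> rep_l2 v x"
  shows "0 \<le> inner u v"
  unfolding inner_rep_l2 by (rule integral_nonneg_AE) (use assms in eventually_elim, simp)

section \<open>The sine basis\<close>

definition sine :: "nat \<Rightarrow> real \<Rightarrow> real" where
  "sine k x = sqrt 2 * sin (real (Suc k) * pi * x)"

definition cosine :: "nat \<Rightarrow> real \<Rightarrow> real" where
  "cosine k x = sqrt 2 * (real (Suc k) * pi) * cos (real (Suc k) * pi * x)"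

definition ev :: "nat \<Rightarrow> real" where
  "ev k = (real (Suc k) * pi)\<^sup>2"

definition esine :: "nat \<Rightarrow> l2" where
  "esine k = abs_l2 (sine k)"

lemma ev_ge_1: "1 \<le> ev k"
proof -
  have "1 * 1 \<le> real (Suc k) * pi" using pi_ge_two by (intro mult_mono) auto
  then show ?thesis unfolding ev_def by (simp only: mult_1) (rule one_le_power)
qed

lemma ev_pos: "0 < ev k" using ev_ge_1[of k] by linarith

lemma ev_mono: "j \<le> k \<Longrightarrow> ev j \<le> ev k"
  unfolding ev_def by (intro power_mono mult_right_mono) auto

lemma ev_at_top: "filterlim ev at_top sequentially"
proof (rule filterlim_at_top_mono[OF filterlim_real_sequentially])
  have "real k \<le> ev k" for k
  proof -
    have "real k * 1 \<le> real (Suc k) * pi" using pi_ge_two by (intro mult_mono) auto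
    moreover have "real (Suc k) * pi \<le> (real (Suc k) * pi)\<^sup>2"
    proof (rule self_le_power)
      have "1 * 1 \<le> real (Suc k) * pi" using pi_ge_two by (intro mult_mono) auto
      then show "1 \<le> real (Suc k) * pi" by simp
    qed simp
    ultimately show ?thesis by (simp add: ev_def)
  qed
  then show "\<forall>\<^sub>F k in sequentially. real k \<le> ev k" by simp
qed

lemma DERIV_sine: "(sine k has_real_derivative cosine k x) (at x)"
  unfolding sine_def cosine_def by (auto intro!: derivative_eq_intros)

lemma DERIV_cosine: "(cosine k has_real_derivative - ev k * sine k x) (at x)"
  unfolding sine_def cosine_def ev_def
  by (auto intro!: derivative_eq_intros simp: power2_eq_square)

lemma continuous_on_sine: "continuous_on S (sine k)" "continuous_on S (cosine k)"
  unfolding sine_def cosine_def by (intro continuous_intros)+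

lemma square_integrable_sine: "square_integrable (sine k)" "square_integrable (cosine k)"
  by (intro square_integrable_continuous continuous_on_sine)+

lemma inner_abs_continuous:
  assumes "continuous_on UNIV f" "continuous_on UNIV g"
  shows "inner (abs_l2 f) (abs_l2 g) = integral {0..1} (\<lambda>x. f x * g x)"
proof -
  note sq = assms[THEN square_integrable_continuous]
  have "((\<lambda>x. f x * g x) has_integral (\<integral>x. f x * g x \<partial>unit_leb)) {0<..<1}"
    by (rule has_integral_integral_lebesgue_on[OF square_integrable_mult[OF sq]]) simp
  then show ?thesis
    by (simp add: inner_abs_l2 sq integral_unique integral_open_interval_real)
qed

lemma inner_abs_FTC:
  assumes "continuous_on UNIV f" "continuous_on UNIV g"
    and "\<And>x. (F has_real_derivative f x * g x) (at x)"
  shows "inner (abs_l2 f) (abs_l2 g) = F 1 - F 0"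
proof -
  have "((\<lambda>x. f x * g x) has_integral (F 1 - F 0)) {0..1}"
    using assms(3) by (intro fundamental_theorem_of_calculus)
      (auto simp: has_real_derivative_iff_has_vector_derivative[symmetric] intro: has_field_derivative_at_within)
  then show ?thesis using assms by (simp add: inner_abs_continuous integral_unique)
qed

lemma inner_deriv_test_function:
  assumes \<phi>: "\<phi> \<in> test_functions" and g: "\<And>x. (g has_real_derivative g' x) (at x)"
    and g': "continuous_on UNIV g'"
  shows "inner (abs_l2 (deriv \<phi>)) (abs_l2 g) = - inner (abs_l2 \<phi>) (abs_l2 g')"
proof -
  have cg: "continuous_on S g" for S
    using g DERIV_isCont continuous_at_imp_continuous_on by blast
  have cg': "continuous_on S g'" for S using g' continuous_on_subset by blast
  note c\<phi> = continuous_on_test_function[OF \<phi>] continuous_on_deriv_test_function[OF \<phi>]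
  have "((\<lambda>x. deriv \<phi> x * g x + \<phi> x * g' x) has_integral (\<phi> 1 * g 1 - \<phi> 0 * g 0)) {0..1}"
  proof (rule fundamental_theorem_of_calculus)
    fix x :: real
    have "((\<lambda>x. \<phi> x * g x) has_real_derivative deriv \<phi> x * g x + \<phi> x * g' x) (at x)"
      using DERIV_mult[OF DERIV_test_function[OF \<phi>] g] by (simp add: mult.commute)
    then show "((\<lambda>x. \<phi> x * g x) has_vector_derivative deriv \<phi> x * g x + \<phi> x * g' x) (at x within {0..1})"
      by (simp add: has_real_derivative_iff_has_vector_derivative[symmetric] has_field_derivative_at_within)
  qed simp
  moreover have "\<phi> 1 = 0" "\<phi> 0 = 0" using test_function_outside[OF \<phi>] by auto
  ultimately have "integral {0..1} (\<lambda>x. deriv \<phi> x * g x + \<phi> x * g' x) = 0"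
    by (simp add: integral_unique)
  moreover have "integral {0..1} (\<lambda>x. deriv \<phi> x * g x + \<phi> x * g' x)
      = integral {0..1} (\<lambda>x. deriv \<phi> x * g x) + integral {0..1} (\<lambda>x. \<phi> x * g' x)"
    by (intro integral_add integrable_continuous_interval continuous_intros c\<phi> cg cg')
  ultimately show ?thesis
    by (simp add: inner_abs_continuous c\<phi> cg g')
qed

lemma esine_orthonormal: "inner (esine j) (esine k) = (if j = k then 1 else 0)"
proof -
  define a where "a = real (Suc j) * pi"
  define b where "b = real (Suc k) * pi"
  have ab: "a > 0" "b > 0" by (simp_all add: a_def b_def)
  have s0: "sin a = 0" "sin b = 0" unfolding a_def b_def by (rule sin_npi)+
  show ?thesis
  proof (cases "j = k")
    case False
    then have d: "a - b \<noteq> 0" "a + b \<noteq> 0" using ab by (simp add: a_def b_def, linarith)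
    have "inner (abs_l2 (sine j)) (abs_l2 (sine k)) =
        (sin ((a - b) * 1) / (a - b) - sin ((a + b) * 1) / (a + b))
        - (sin ((a - b) * 0) / (a - b) - sin ((a + b) * 0) / (a + b))"
    proof (rule inner_abs_FTC[OF continuous_on_sine(1) continuous_on_sine(1)])
      fix x
      have D: "((\<lambda>x. sin (c * x) / c) has_real_derivative cos (c * x)) (at x)" if "c \<noteq> 0" for c
        using that by (auto intro!: derivative_eq_intros)
      have "((\<lambda>x. sin ((a - b) * x) / (a - b) - sin ((a + b) * x) / (a + b)) has_real_derivative
          cos ((a - b) * x) - cos ((a + b) * x)) (at x)"
        by (intro DERIV_diff D d)
      also have "cos ((a - b) * x) - cos ((a + b) * x) = cos (a * x - b * x) - cos (a * x + b * x)"
        by (simp add: algebra_simps)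
      also have "\<dots> = sine j x * sine k x"
        by (simp add: sine_def a_def b_def cos_diff cos_add)
      finally show "((\<lambda>x. sin ((a - b) * x) / (a - b) - sin ((a + b) * x) / (a + b)) has_real_derivative
          sine j x * sine k x) (at x)" .
    qed
    also have "\<dots> = 0" using s0 by (simp add: sin_diff sin_add)
    finally show ?thesis using False by (simp add: esine_def)
  next
    case True
    have "inner (abs_l2 (sine j)) (abs_l2 (sine k)) = (1 - sin (2 * a * 1) / (2 * a)) - (0 - sin (2 * a * 0) / (2 * a))"
    proof (rule inner_abs_FTC[OF continuous_on_sine(1) continuous_on_sine(1)])
      fix x
      have "((\<lambda>x. x - sin (2 * a * x) / (2 * a)) has_real_derivative 1 - cos (2 * (a * x))) (at x)"
        using ab by (auto intro!: derivative_eq_intros simp: field_simps)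
      also have "1 - cos (2 * (a * x)) = sine j x * sine k x"
      proof -
        have "sine j x * sine k x = (sqrt 2 * sqrt 2) * (sin (a * x))\<^sup>2"
          unfolding True sine_def a_def power2_eq_square by (simp only: mult_ac)
        then show ?thesis by (simp add: cos_double_sin)
      qed
      finally show "((\<lambda>x. x - sin (2 * a * x) / (2 * a)) has_real_derivative sine j x * sine k x) (at x)" .
    qed
    also have "\<dots> = 1" using s0 sin_double[of a] by simp
    finally show ?thesis using True by (simp add: esine_def)
  qed
qed

inductive_set sine_polynomials :: "(real \<Rightarrow> real) set" where
  zero: "(\<lambda>x. 0) \<in> sine_polynomials"
| step: "f \<in> sine_polynomials \<Longrightarrow> (\<lambda>x. f x + c * sine k x) \<in> sine_polynomials"

lemma sine_polynomials_add:
  assumes "g \<in> sine_polynomials" "f \<in> sine_polynomials"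
  shows "(\<lambda>x. f x + g x) \<in> sine_polynomials"
  using assms
proof induction
  case (step g c k)
  from sine_polynomials.step[OF step.IH[OF step.prems], of c k] show ?case by (simp add: add.assoc)
qed simp

lemma sine_polynomials_scale:
  "f \<in> sine_polynomials \<Longrightarrow> (\<lambda>x. c * f x) \<in> sine_polynomials"
proof (induction rule: sine_polynomials.induct)
  case (step f d k)
  from sine_polynomials.step[OF step.IH, of "c * d" k] show ?case by (simp add: algebra_simps)
qed (simp add: sine_polynomials.zero)

lemma sine_in_sine_polynomials: "(\<lambda>x. c * sine k x) \<in> sine_polynomials"
  using sine_polynomials.step[OF sine_polynomials.zero, of c k] by simp

lemma sine_mult_cos: "(\<lambda>x. sine k x * cos (pi * x)) \<in> sine_polynomials"
proof -
  have eq: "sine k x * cos (pi * x) = (1/2) * sine (Suc k) x + (if k = 0 then 0 else 1/2) * sine (k - 1) x" for x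
  proof (cases k)
    case 0
    then show ?thesis using sin_double[of "pi * x"] by (simp add: sine_def mult.assoc)
  next
    case (Suc i)
    have "sin (real (Suc k) * pi * x) * cos (pi * x) = (sin (real (Suc k) * pi * x + pi * x) + sin (real (Suc k) * pi * x - pi * x)) / 2"
      by (rule sin_times_cos)
    also have "real (Suc k) * pi * x + pi * x = real (Suc (Suc k)) * pi * x" by (simp add: algebra_simps)
    also have "real (Suc k) * pi * x - pi * x = real (Suc i) * pi * x" using Suc by (simp add: algebra_simps)
    finally show ?thesis using Suc by (simp add: sine_def algebra_simps add_divide_distrib)
  qed
  show ?thesis
    unfolding eq by (rule sine_polynomials_add[OF sine_in_sine_polynomials sine_in_sine_polynomials])
qed

lemma sine_polynomials_mult_cos:
  "f \<in> sine_polynomials \<Longrightarrow> (\<lambda>x. f x * cos (pi * x)) \<in> sine_polynomials"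
proof (induction rule: sine_polynomials.induct)
  case (step f c k)
  from sine_polynomials_add[OF sine_polynomials_scale[OF sine_mult_cos, of c k] step.IH] show ?case
    by (simp add: algebra_simps)
qed (simp add: sine_polynomials.zero)

lemma sin_mult_cos_power: "(\<lambda>x. sin (pi * x) * cos (pi * x)^i) \<in> sine_polynomials"
proof (induction i)
  case 0
  have "(\<lambda>x. (1 / sqrt 2) * sine 0 x) \<in> sine_polynomials" by (rule sine_in_sine_polynomials)
  then show ?case by (simp add: sine_def)
next
  case (Suc i)
  from sine_polynomials_mult_cos[OF Suc] show ?case by (simp add: mult_ac)
qed

lemma sin_mult_polynomial_cos: "(\<lambda>x. \<Sum>i\<le>n. a i * (sin (pi * x) * cos (pi * x)^i)) \<in> sine_polynomials"
proof (induction n)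
  case 0
  then show ?case using sine_polynomials_scale[OF sin_mult_cos_power[of 0]] by simp
next
  case (Suc n)
  then show ?case using sine_polynomials_add[OF sine_polynomials_scale[OF sin_mult_cos_power[of "Suc n"]] Suc] by simp
qed

text \<open>Since \<open>\<phi>\<close> vanishes near the boundary, \<open>\<phi>(x) / sin (\<pi> x)\<close> is a continuous function of \<open>cos (\<pi> x)\<close>. Weierstrass
  approximation of that function by a polynomial \<open>P\<close> yields \<open>sin (\<pi> x) P(cos (\<pi> x))\<close>, which is a combination
  of sines.\<close>

lemma sine_polynomial_approx:
  assumes \<phi>: "\<phi> \<in> test_functions" and \<epsilon>: "0 < \<epsilon>"
  obtains g where "g \<in> sine_polynomials" "\<And>x. 0 \<le> x \<Longrightarrow> x \<le> 1 \<Longrightarrow> \<bar>\<phi> x - g x\<bar> \<le> \<epsilon>"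
proof -
  obtain K where K: "compact K" "K \<subseteq> {0<..<1}" "\<And>x. x \<notin> K \<Longrightarrow> \<phi> x = 0"
    using test_function_support[OF \<phi>] by blast
  have "\<exists>\<delta>>0. \<forall>x\<in>K. \<delta> \<le> sin (pi * x)"
  proof (cases "K = {}")
    case False
    have "continuous_on K (\<lambda>x. sin (pi * x))" by (intro continuous_intros)
    then obtain x0 where "x0 \<in> K" "\<forall>x\<in>K. sin (pi * x0) \<le> sin (pi * x)"
      using continuous_attains_inf[OF K(1) False] by blast
    moreover have "0 < sin (pi * x0)" using K(2) \<open>x0 \<in> K\<close> by (intro sin_gt_zero) auto
    ultimately show ?thesis by blast
  qed (auto intro: exI[of _ 1])
  then obtain \<delta> where \<delta>: "\<delta> > 0" "\<And>x. x \<in> K \<Longrightarrow> \<delta> \<le> sin (pi * x)" by blast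
  \<comment> \<open>\<open>\<delta>\<close> keeps the denominator away from \<open>0\<close> where the numerator vanishes, and is inactive elsewhere\<close>
  define F where "F y = \<phi> (arccos y / pi) / max (sin (arccos y)) \<delta>" for y
  have "continuous_on {-1..1} F"
    unfolding F_def
  proof (intro continuous_intros continuous_on_compose2[OF continuous_on_test_function[OF \<phi>, of UNIV]])
    show "\<forall>x\<in>{-1..1}. max (sin (arccos x)) \<delta> \<noteq> 0" using \<delta>(1) by (auto simp: max_def)
  qed auto
  then obtain P where P: "real_polynomial_function P" "\<And>y. y \<in> {-1..1} \<Longrightarrow> \<bar>F y - P y\<bar> < \<epsilon>"
    using Stone_Weierstrass_real_polynomial_function[of "{-1..1::real}" F \<epsilon>] \<epsilon> by auto
  obtain a n where an: "P = (\<lambda>x. \<Sum>i\<le>n. a i * x^i)"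
    using P(1) real_polynomial_function_iff_sum by auto
  have "\<bar>\<phi> x - sin (pi * x) * P (cos (pi * x))\<bar> \<le> \<epsilon>" if x: "0 \<le> x" "x \<le> 1" for x
  proof -
    have ac: "arccos (cos (pi * x)) = pi * x" using x by (intro arccos_cos) auto
    have "\<phi> x = sin (pi * x) * F (cos (pi * x))"
      using \<delta> K(3) by (cases "x \<in> K") (force simp: F_def ac max_def)+
    then have "\<phi> x - sin (pi * x) * P (cos (pi * x)) = sin (pi * x) * (F (cos (pi * x)) - P (cos (pi * x)))"
      by (simp add: algebra_simps)
    then have "\<bar>\<phi> x - sin (pi * x) * P (cos (pi * x))\<bar> = \<bar>sin (pi * x)\<bar> * \<bar>F (cos (pi * x)) - P (cos (pi * x))\<bar>"
      by (simp add: abs_mult)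
    also have "\<dots> \<le> 1 * \<epsilon>"
      using P(2)[of "cos (pi * x)"] by (intro mult_mono) auto
    finally show ?thesis by simp
  qed
  moreover have "(\<lambda>x. sin (pi * x) * P (cos (pi * x))) \<in> sine_polynomials"
    using sin_mult_polynomial_cos[of a n] by (simp add: an sum_distrib_left mult_ac)
  ultimately show ?thesis using that by blast
qed

lemma continuous_on_sine_polynomial: "f \<in> sine_polynomials \<Longrightarrow> continuous_on S f"
  by (induction rule: sine_polynomials.induct) (auto intro!: continuous_intros continuous_on_sine)

lemma norm_le_AE:
  assumes "AE x in unit_leb. \<bar>rep_l2 u x\<bar> \<le> c" "0 \<le> c"
  shows "norm u \<le> c"
proof -
  have "(\<integral>x. (rep_l2 u x)\<^sup>2 \<partial>unit_leb) \<le> (\<integral>x. c\<^sup>2 \<partial>unit_leb)"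
  proof (rule integral_mono_AE)
    show "integrable unit_leb (\<lambda>x. (rep_l2 u x)\<^sup>2)" using square_integrable_rep by (simp add: square_integrable_def)
    show "integrable unit_leb (\<lambda>x. c\<^sup>2)" using square_integrable_integrable[OF square_integrable_const] .
    show "AE x in unit_leb. (rep_l2 u x)\<^sup>2 \<le> c\<^sup>2"
      using assms(1) by eventually_elim (use power_mono[OF _ abs_ge_zero, of _ _ 2] in fastforce)
  qed
  also have "\<dots> = c\<^sup>2" using measure_unit_leb by simp
  finally have "(norm u)\<^sup>2 \<le> c\<^sup>2"
    using norm_abs_l2[OF square_integrable_rep, of u] by (simp add: abs_rep_l2)
  then show ?thesis using assms(2) by (rule power2_le_imp_le)
qed

lemma norm_abs_l2_le:
  assumes f: "square_integrable f" and c: "\<And>x. 0 < x \<Longrightarrow> x < 1 \<Longrightarrow> \<bar>f x\<bar> \<le> c" "0 \<le> c"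
  shows "norm (abs_l2 f) \<le> c"
proof (rule norm_le_AE[OF _ c(2)])
  show "AE x in unit_leb. \<bar>rep_l2 (abs_l2 f) x\<bar> \<le> c"
    using rep_abs_l2[OF f] AE_space[of unit_leb] by eventually_elim (use c(1) in auto)
qed

lemma inner_sine_polynomial_eq_0:
  assumes "\<And>k. inner u (esine k) = 0" "f \<in> sine_polynomials"
  shows "inner u (abs_l2 f) = 0"
  using assms(2)
proof induction
  case zero
  then show ?case by (simp add: zero_l2.abs_eq[symmetric])
next
  case (step f c k)
  have "abs_l2 (\<lambda>x. f x + c * sine k x) = abs_l2 f + c *\<^sub>R esine k"
    using abs_l2_linear[OF square_integrable_continuous[OF continuous_on_sine_polynomial[OF step.hyps]] square_integrable_sine(1), of 1 c k]
    by (simp add: esine_def)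
  then show ?case using step assms(1) by (simp add: inner_add_right)
qed

lemma esine_total:
  assumes "\<And>k. inner u (esine k) = 0"
  shows "u = 0"
proof (rule test_functions_total)
  fix \<phi> assume \<phi>: "\<phi> \<in> test_functions"
  have "\<bar>inner u (abs_l2 \<phi>)\<bar> \<le> 0 + \<epsilon>" if "0 < \<epsilon>" for \<epsilon>
  proof -
    define d where "d = \<epsilon> / (norm u + 1)"
    have d: "d > 0" using that unfolding d_def by (intro divide_pos_pos add_nonneg_pos) auto
    obtain g where g: "g \<in> sine_polynomials" "\<And>x. 0 \<le> x \<Longrightarrow> x \<le> 1 \<Longrightarrow> \<bar>\<phi> x - g x\<bar> \<le> d"
      using sine_polynomial_approx[OF \<phi> d] by blast
    have sq: "square_integrable \<phi>" "square_integrable g"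
      using continuous_on_test_function[OF \<phi>] continuous_on_sine_polynomial[OF g(1)]
      by (auto intro: square_integrable_continuous)
    have "inner u (abs_l2 \<phi>) = inner u (abs_l2 (\<lambda>x. \<phi> x - g x))"
      using inner_sine_polynomial_eq_0[OF assms g(1)] sq by (simp add: abs_l2_diff inner_diff_right)
    also have "\<bar>\<dots>\<bar> \<le> norm u * d"
      using Cauchy_Schwarz_ineq2[of u "abs_l2 (\<lambda>x. \<phi> x - g x)"]
        mult_left_mono[OF norm_abs_l2_le[OF square_integrable_diff[OF sq], of d] norm_ge_zero[of u]] g(2) d
      by force
    also have "\<dots> \<le> (norm u + 1) * d" using d by (simp add: algebra_simps)
    also have "\<dots> = \<epsilon>" by (simp add: d_def add_nonneg_eq_0_iff)
    finally show ?thesis by simp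
  qed
  then have "\<bar>inner u (abs_l2 \<phi>)\<bar> \<le> 0" by (rule field_le_epsilon)
  then show "inner u (abs_l2 \<phi>) = 0" by simp
qed

interpretation esine: total_orthonormal esine
  by standard (auto simp: esine_orthonormal intro: esine_total)

section \<open>Fourier description of \<open>H\<^sup>1\<^sub>0(0,1)\<close> and of the Dirichlet Laplacian\<close>

lemma abs_sine_le:
  assumes "0 \<le> x" "x \<le> 1"
  shows "\<bar>sine k x\<bar> \<le> sqrt 2 * (real (Suc k) * pi) * x"
    and "\<bar>sine k x\<bar> \<le> sqrt 2 * (real (Suc k) * pi) * (1 - x)"
proof -
  define a where "a = real (Suc k) * pi"
  have a: "0 \<le> a" by (simp add: a_def)
  have sa: "sin a = 0" unfolding a_def by (rule sin_npi)
  have ca: "\<bar>cos a\<bar> = 1" using sin_cos_squared_add[of a] sa by (simp add: power2_eq_1_iff) auto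
  have 1: "\<bar>sin (a * x)\<bar> \<le> a * x" using abs_sin_x_le_abs_x[of "a * x"] assms a by simp
  have "\<bar>sin (a * x)\<bar> = \<bar>sin (a - a * x)\<bar>" by (simp add: sin_diff sa abs_mult ca)
  also have "\<dots> \<le> \<bar>a - a * x\<bar>" by (rule abs_sin_x_le_abs_x)
  also have "\<dots> = a * (1 - x)" using mult_left_mono[OF assms(2) a] by (simp add: algebra_simps)
  finally have 2: "\<bar>sin (a * x)\<bar> \<le> a * (1 - x)" .
  from 1 2 show "\<bar>sine k x\<bar> \<le> sqrt 2 * (real (Suc k) * pi) * x"
    and "\<bar>sine k x\<bar> \<le> sqrt 2 * (real (Suc k) * pi) * (1 - x)"
    unfolding a_def[symmetric] sine_def by (simp_all add: abs_mult)
qed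

text \<open>The derivative of the cutoff in \<open>sine_in_H10_graph\<close> is of order \<open>N\<close>, but it is concentrated at distance about
  \<open>1/N\<close> from the boundary point. Multiplied by a function \<open>s\<close> that vanishes linearly there, it stays bounded in \<open>N\<close>.\<close>

lemma scaled_flat_bound:
  assumes N: "1 \<le> N" and z: "0 \<le> z" and s: "\<bar>s\<bar> \<le> C * z" and C: "0 \<le> C"
  shows "\<bar>N * flat 2 (N * (z - 1/N\<^sup>2)) * s\<bar> \<le> 3 * C"
proof (cases "0 < N * (z - 1/N\<^sup>2)")
  case True
  define y where "y = N * (z - 1/N\<^sup>2)"
  have y: "y > 0" using True by (simp add: y_def)
  have Nz: "N * z = y + 1/N" using N by (simp add: y_def field_simps power2_eq_square)
  have "\<bar>N * flat 2 y * s\<bar> = N * flat 2 y * \<bar>s\<bar>" using N by (simp add: abs_mult flat_nonneg)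
  also have "\<dots> \<le> N * flat 2 y * (C * z)" using N by (intro mult_left_mono s) (simp add: flat_nonneg)
  also have "\<dots> = C * (flat 2 y * (N * z))" by (simp add: algebra_simps)
  also have "\<dots> = C * (flat 1 y + flat 2 y * (1/N))"
    using flat_Suc[of y 1] by (simp add: Nz algebra_simps numeral_2_eq_2)
  also have "\<dots> \<le> C * (1 + 2 * 1)"
    using N flat_le[of 1 y] flat_le[of 2 y] C
    by (intro mult_left_mono add_mono mult_mono) (auto simp: flat_nonneg fact_2)
  finally show ?thesis by (simp add: y_def)
qed (use C in \<open>simp add: flat_def\<close>)

lemma scaled_flat_tendsto:
  assumes "0 < z"
  shows "(\<lambda>n. real (n + 2) * flat 2 (real (n + 2) * (z - 1/(real (n + 2))\<^sup>2))) \<longlonglongrightarrow> 0"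
    and "(\<lambda>n. flat 0 (real (n + 2) * (z - 1/(real (n + 2))\<^sup>2))) \<longlonglongrightarrow> 1"
proof -
  define N where "N n = real (n + 2)" for n
  have N: "filterlim N at_top sequentially"
    unfolding N_def by (rule filterlim_compose[OF filterlim_real_sequentially filterlim_add_const_nat_at_top])
  have lim: "(\<lambda>n. z - 1/(N n)\<^sup>2) \<longlonglongrightarrow> z - 0"
    by (intro tendsto_intros real_tendsto_divide_at_top[OF tendsto_const] filterlim_pow_at_top N) simp
  then have y: "filterlim (\<lambda>n. N n * (z - 1/(N n)\<^sup>2)) at_top sequentially"
    using filterlim_tendsto_pos_mult_at_top[OF lim _ N] assms by (simp add: mult.commute)
  then show "(\<lambda>n. flat 0 (real (n + 2) * (z - 1/(real (n + 2))\<^sup>2))) \<longlonglongrightarrow> 1"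
    unfolding N_def by (rule flat_0_tendsto)
  have "(\<lambda>n. (1 / (z - 1/(N n)\<^sup>2)) * (1 / (N n * (z - 1/(N n)\<^sup>2))) * flat 0 (N n * (z - 1/(N n)\<^sup>2))) \<longlonglongrightarrow> (1 / z) * 0 * 1"
    using assms lim by (intro tendsto_intros flat_0_tendsto y real_tendsto_divide_at_top[OF tendsto_const y]) auto
  moreover have "\<forall>\<^sub>F n in sequentially. (1 / (z - 1/(N n)\<^sup>2)) * (1 / (N n * (z - 1/(N n)\<^sup>2))) * flat 0 (N n * (z - 1/(N n)\<^sup>2))
      = N n * flat 2 (N n * (z - 1/(N n)\<^sup>2))"
    using eventually_compose_filterlim[OF eventually_gt_at_top[of 0] y]
  proof eventually_elim
    case (elim n)
    have "N n > 0" by (simp add: N_def)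
    with elim have "z - 1/(N n)\<^sup>2 > 0" by (simp add: zero_less_mult_iff)
    define r where "r = z - 1/(N n)\<^sup>2"
    have "r > 0" "N n > 0" "N n * r > 0" using \<open>z - 1/(N n)\<^sup>2 > 0\<close> \<open>N n > 0\<close> by (auto simp: r_def)
    then show ?case unfolding r_def[symmetric] by (simp add: flat_def power2_eq_square)
  qed
  ultimately show "(\<lambda>n. real (n + 2) * flat 2 (real (n + 2) * (z - 1/(real (n + 2))\<^sup>2))) \<longlonglongrightarrow> 0"
    unfolding N_def by (simp add: tendsto_cong)
qed

text \<open>The sines are not compactly supported, so they are multiplied by bump functions that exhaust \<open>(0,1)\<close>.
  Dominated convergence applies to the derivatives because the sines vanish linearly at the boundary.\<close>

lemma sine_in_H10_graph: "(esine k, abs_l2 (cosine k)) \<in> H10_graph"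
proof -
  define C where "C = sqrt 2 * (real (Suc k) * pi)"
  have C: "0 \<le> C" by (simp add: C_def)
  define N where "N n = real (n + 2)" for n
  have N: "1 \<le> N n" for n by (simp add: N_def)
  define b where "b n x = bump (N n) (1/(N n)\<^sup>2) (1 - 1/(N n)\<^sup>2) x" for n x
  define b' where "b' n x = N n * flat 2 (N n * (x - 1/(N n)\<^sup>2)) * flat 0 (N n * ((1-x) - 1/(N n)\<^sup>2))
     - flat 0 (N n * (x - 1/(N n)\<^sup>2)) * (N n * flat 2 (N n * ((1-x) - 1/(N n)\<^sup>2)))" for n x
  define \<phi> where "\<phi> n x = b n x * sine k x" for n x
  define \<phi>' where "\<phi>' n x = b' n x * sine k x + b n x * cosine k x" for n x
  have b_alt: "b n = (\<lambda>x. flat 0 (N n * (x - 1/(N n)\<^sup>2)) * flat 0 (N n * ((1-x) - 1/(N n)\<^sup>2)))" for n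
    by (auto simp: b_def bump_def fun_eq_iff algebra_simps)
  have sm: "times_differentiable j (sine k)" for j
  proof -
    have "times_differentiable j (\<lambda>x. sqrt 2 * sin ((real (Suc k) * pi) * x) + 0 * sin ((real (Suc k) * pi) * x))"
      using times_differentiable_sin_cos by (intro times_differentiable_lincomb) auto
    then show ?thesis by (simp add: sine_def[abs_def])
  qed
  have test: "\<phi> n \<in> test_functions" for n
  proof (rule test_functionI)
    show "times_differentiable j (\<phi> n)" for j
      unfolding \<phi>_def b_def by (intro times_differentiable_mult times_differentiable_bump sm)
    have "0 < N n" using N[of n] by linarith
    then show "0 < 1/(N n)\<^sup>2" "1 - 1/(N n)\<^sup>2 < 1" by auto
    show "\<phi> n x = 0" if "x \<notin> {1/(N n)\<^sup>2..1 - 1/(N n)\<^sup>2}" for x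
      using bump_outside[OF \<open>0 < N n\<close>, of x "1/(N n)\<^sup>2" "1 - 1/(N n)\<^sup>2"] that by (auto simp: \<phi>_def b_def)
  qed
  have D_flat: "(flat 0 has_real_derivative flat 2 x) (at x)" for x
    using DERIV_flat[of 0 x] by (simp add: numeral_2_eq_2)
  have Db: "(b n has_real_derivative b' n x) (at x)" for n x
  proof -
    have "((\<lambda>x. flat 0 (N n * (x - 1/(N n)\<^sup>2))) has_real_derivative flat 2 (N n * (x - 1/(N n)\<^sup>2)) * N n) (at x)"
      by (rule DERIV_chain2[OF D_flat]) (auto intro!: derivative_eq_intros)
    moreover have "((\<lambda>x. flat 0 (N n * ((1-x) - 1/(N n)\<^sup>2))) has_real_derivative flat 2 (N n * ((1-x) - 1/(N n)\<^sup>2)) * (- N n)) (at x)"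
      by (rule DERIV_chain2[OF D_flat]) (auto intro!: derivative_eq_intros)
    ultimately show ?thesis
      unfolding b_alt by (rule DERIV_cong[OF DERIV_mult]) (simp add: b'_def algebra_simps)
  qed
  have D\<phi>: "(\<phi> n has_real_derivative \<phi>' n x) (at x)" for n x
    unfolding \<phi>_def \<phi>'_def by (rule DERIV_cong[OF DERIV_mult[OF Db DERIV_sine]]) (simp add: algebra_simps)
  then have deriv_\<phi>: "deriv (\<phi> n) = \<phi>' n" for n using DERIV_imp_deriv by blast
  have b_lim: "(\<lambda>n. b n x) \<longlonglongrightarrow> 1" and b'_lim: "(\<lambda>n. b' n x) \<longlonglongrightarrow> 0" if "0 < x" "x < 1" for x
  proof -
    have x: "0 < x" "0 < 1 - x" using that by auto
    note l = scaled_flat_tendsto[OF x(1), folded N_def] scaled_flat_tendsto[OF x(2), folded N_def]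
    show "(\<lambda>n. b n x) \<longlonglongrightarrow> 1" using tendsto_mult[OF l(2) l(4)] by (simp add: b_alt)
    show "(\<lambda>n. b' n x) \<longlonglongrightarrow> 0"
      unfolding b'_def using tendsto_diff[OF tendsto_mult[OF l(1) l(4)] tendsto_mult[OF l(2) l(3)]] by simp
  qed
  have b01: "0 \<le> b n x" "b n x \<le> 1" for n x by (simp_all add: b_def bump_nonneg bump_le_1)
  have "(\<lambda>n. abs_l2 (\<phi> n)) \<longlonglongrightarrow> abs_l2 (sine k)"
  proof (rule abs_l2_tendsto)
    show "continuous_on UNIV (\<phi> n)" for n by (rule continuous_on_test_function[OF test])
    fix x :: real assume x: "0 < x" "x < 1"
    show "(\<lambda>n. \<phi> n x) \<longlonglongrightarrow> sine k x"
      unfolding \<phi>_def using tendsto_mult[OF b_lim[OF x] tendsto_const, of "sine k x"] by simp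
    show "\<bar>\<phi> n x\<bar> \<le> sqrt 2" for n
    proof -
      have "\<bar>b n x\<bar> * (\<bar>sqrt 2\<bar> * \<bar>sin (real (Suc k) * pi * x)\<bar>) \<le> 1 * (sqrt 2 * 1)"
        using b01[of n x] by (intro mult_mono abs_sin_le_one) auto
      then show ?thesis by (simp add: \<phi>_def sine_def abs_mult)
    qed
  qed (rule continuous_on_sine)
  moreover have "(\<lambda>n. abs_l2 (deriv (\<phi> n))) \<longlonglongrightarrow> abs_l2 (cosine k)"
  proof (rule abs_l2_tendsto)
    show "continuous_on UNIV (deriv (\<phi> n))" for n by (rule continuous_on_deriv_test_function[OF test])
    fix x :: real assume x: "0 < x" "x < 1"
    show "(\<lambda>n. deriv (\<phi> n) x) \<longlonglongrightarrow> cosine k x"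
      unfolding deriv_\<phi> \<phi>'_def
      using tendsto_add[OF tendsto_mult[OF b'_lim[OF x] tendsto_const[of "sine k x"]] tendsto_mult[OF b_lim[OF x] tendsto_const[of "cosine k x"]]]
      by simp
    show "\<bar>deriv (\<phi> n) x\<bar> \<le> 7 * C" for n
    proof -
      define y1 where "y1 = N n * (x - 1/(N n)\<^sup>2)"
      define y2 where "y2 = N n * ((1-x) - 1/(N n)\<^sup>2)"
      have 1: "\<bar>N n * flat 2 y1 * sine k x\<bar> \<le> 3 * C" unfolding y1_def
        using x abs_sine_le(1)[of x k] by (intro scaled_flat_bound N C) (auto simp: C_def)
      have 2: "\<bar>N n * flat 2 y2 * sine k x\<bar> \<le> 3 * C" unfolding y2_def
        using x abs_sine_le(2)[of x k] by (intro scaled_flat_bound N C) (auto simp: C_def)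
      have 3: "\<bar>cosine k x\<bar> \<le> C"
        unfolding cosine_def abs_mult C_def using abs_cos_le_one by (simp add: mult_left_le)
      have "\<phi>' n x = (N n * flat 2 y1 * sine k x) * flat 0 y2 - (N n * flat 2 y2 * sine k x) * flat 0 y1 + cosine k x * b n x"
        unfolding \<phi>'_def b'_def y1_def[symmetric] y2_def[symmetric] by (simp add: algebra_simps)
      also have "\<bar>\<dots>\<bar> \<le> \<bar>N n * flat 2 y1 * sine k x\<bar> * flat 0 y2 + \<bar>N n * flat 2 y2 * sine k x\<bar> * flat 0 y1 + \<bar>cosine k x\<bar> * b n x"
      proof -
        have tri: "\<bar>A * p - B * q + D * r\<bar> \<le> \<bar>A\<bar> * p + \<bar>B\<bar> * q + \<bar>D\<bar> * r" if "0 \<le> p" "0 \<le> q" "0 \<le> r" for A B D p q r :: real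
        proof -
          have "\<bar>A * p - B * q + D * r\<bar> \<le> \<bar>A * p\<bar> + \<bar>B * q\<bar> + \<bar>D * r\<bar>" by linarith
          then show ?thesis using that by (simp add: abs_mult)
        qed
        show ?thesis by (intro tri flat_nonneg b01)
      qed
      also have "\<dots> \<le> 3 * C * 1 + 3 * C * 1 + C * 1"
        using C by (intro add_mono mult_mono 1 2 3 flat_le_1 b01 flat_nonneg) auto
      finally show ?thesis by (simp add: deriv_\<phi>)
    qed
  qed (rule continuous_on_sine)
  ultimately have "(\<lambda>n. (abs_l2 (\<phi> n), abs_l2 (deriv (\<phi> n)))) \<longlonglongrightarrow> (abs_l2 (sine k), abs_l2 (cosine k))"
    by (rule tendsto_Pair)
  then show ?thesis
    unfolding H10_graph_def closure_sequential esine_def using test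
    by (intro exI[of _ "\<lambda>n. (abs_l2 (\<phi> n), abs_l2 (deriv (\<phi> n)))"]) auto
qed

abbreviation coef :: "l2 \<Rightarrow> nat \<Rightarrow> real" where
  "coef u k \<equiv> inner u (esine k)"

lemma abs_l2_scale: "square_integrable f \<Longrightarrow> abs_l2 (\<lambda>x. c * f x) = c *\<^sub>R abs_l2 f"
  using abs_l2_linear[of f f c 0] by simp

lemma H10_graph_eqI:
  fixes F G :: "l2 \<times> l2 \<Rightarrow> real"
  assumes "p \<in> H10_graph" "continuous_on UNIV F" "continuous_on UNIV G"
    and "\<And>\<phi>. \<phi> \<in> test_functions \<Longrightarrow> F (abs_l2 \<phi>, abs_l2 (deriv \<phi>)) = G (abs_l2 \<phi>, abs_l2 (deriv \<phi>))"
  shows "F p = G p"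
proof -
  have "H10_graph \<subseteq> {p. F p = G p}"
    unfolding H10_graph_def
    by (rule closure_minimal) (use assms in \<open>auto intro!: closed_Collect_eq\<close>)
  with assms(1) show ?thesis by auto
qed

lemma H10_graph_weak_derivative: "p \<in> H10_graph \<Longrightarrow> weak_derivative (fst p) (snd p)"
  unfolding weak_derivative_def
proof
  fix \<phi> assume p: "p \<in> H10_graph" and \<phi>: "\<phi> \<in> test_functions"
  show "inner (fst p) (abs_l2 (deriv \<phi>)) = - inner (snd p) (abs_l2 \<phi>)"
  proof (rule H10_graph_eqI[OF p])
    fix \<psi> assume \<psi>: "\<psi> \<in> test_functions"
    show "inner (fst (abs_l2 \<psi>, abs_l2 (deriv \<psi>))) (abs_l2 (deriv \<phi>)) = - inner (snd (abs_l2 \<psi>, abs_l2 (deriv \<psi>))) (abs_l2 \<phi>)"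
      using inner_deriv_test_function[OF \<psi> DERIV_test_function[OF \<phi>] continuous_on_deriv_test_function[OF \<phi>]] by simp
  qed (intro continuous_intros)+
qed

lemma H10_graph_inner_cosine:
  "p \<in> H10_graph \<Longrightarrow> inner (snd p) (abs_l2 (cosine k)) = ev k * coef (fst p) k"
proof (rule H10_graph_eqI)
  fix \<phi> assume \<phi>: "\<phi> \<in> test_functions"
  have "inner (abs_l2 (deriv \<phi>)) (abs_l2 (cosine k)) = - inner (abs_l2 \<phi>) (abs_l2 (\<lambda>x. - ev k * sine k x))"
    by (rule inner_deriv_test_function[OF \<phi> DERIV_cosine]) (intro continuous_intros continuous_on_sine)
  also have "\<dots> = ev k * coef (abs_l2 \<phi>) k"
    using abs_l2_scale[OF square_integrable_sine(1), of "- ev k" k] by (simp add: esine_def)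
  finally show "inner (snd (abs_l2 \<phi>, abs_l2 (deriv \<phi>))) (abs_l2 (cosine k)) = ev k * coef (fst (abs_l2 \<phi>, abs_l2 (deriv \<phi>))) k"
    by simp
qed (assumption | intro continuous_intros)+

lemma of_h10_add: "of_h10 (u + v) = of_h10 u + of_h10 v"
  and of_h10_diff: "of_h10 (u - v) = of_h10 u - of_h10 v"
  and of_h10_scaleR: "of_h10 (c *\<^sub>R u) = c *\<^sub>R of_h10 u"
  and of_h10_minus: "of_h10 (- u) = - of_h10 u"
  by (simp_all add: of_h10_def plus_h10.rep_eq minus_h10.rep_eq scaleR_h10.rep_eq uminus_h10.rep_eq)

lemma norm_of_h10_le: "norm (of_h10 u) \<le> norm u"
  using norm_fst_le[of "fst (Rep_h10 u)" "snd (Rep_h10 u)"] by (simp add: of_h10_def norm_h10.rep_eq)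

lemma bounded_linear_of_h10: "bounded_linear of_h10"
  by (rule bounded_linear_intro[where K = 1]) (simp_all add: of_h10_add of_h10_scaleR norm_of_h10_le)

lemma of_h10_inj: "of_h10 u = of_h10 v \<Longrightarrow> u = v"
proof -
  assume eq: "of_h10 u = of_h10 v"
  define w where "w = u - v"
  have fst: "fst (Rep_h10 w) = 0" using eq by (simp add: w_def of_h10_def minus_h10.rep_eq)
  have "snd (Rep_h10 w) = 0"
  proof (rule test_functions_total)
    fix \<phi> assume "\<phi> \<in> test_functions"
    then show "inner (snd (Rep_h10 w)) (abs_l2 \<phi>) = 0"
      using H10_graph_weak_derivative[OF Rep_h10[of w]] by (simp add: weak_derivative_def fst)
  qed
  with fst have "Rep_h10 w = Rep_h10 0" by (simp add: zero_h10.rep_eq prod_eq_iff)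
  then show ?thesis by (simp add: Rep_h10_inject w_def)
qed

lemma h10_eqI: "(\<And>k. coef (of_h10 u) k = coef (of_h10 v) k) \<Longrightarrow> u = v"
  by (intro of_h10_inj esine.coefficients_eqI)

text \<open>The sines are orthogonal in \<open>H\<^sup>1\<^sub>0\<close> too, with squared norm \<open>1 + ev k\<close>.\<close>

definition hsine :: "nat \<Rightarrow> h10" where
  "hsine k = (1 / sqrt (1 + ev k)) *\<^sub>R Abs_h10 (esine k, abs_l2 (cosine k))"

lemma inner_hsine: "inner u (hsine k) = sqrt (1 + ev k) * coef (of_h10 u) k"
proof -
  have pos: "1 + ev k > 0" using ev_pos[of k] by simp
  have "inner u (Abs_h10 (esine k, abs_l2 (cosine k))) = (1 + ev k) * coef (of_h10 u) k"
    using H10_graph_inner_cosine[OF Rep_h10, of u k]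
    by (simp add: inner_h10.rep_eq Abs_h10_inverse sine_in_H10_graph inner_prod_def of_h10_def algebra_simps)
  also have "1 + ev k = sqrt (1 + ev k) * sqrt (1 + ev k)" using pos by simp
  finally show ?thesis using pos unfolding hsine_def inner_scaleR_right by (simp add: field_simps)
qed

lemma coef_hsine: "coef (of_h10 (hsine j)) k = (if j = k then 1 / sqrt (1 + ev j) else 0)"
  by (simp add: hsine_def of_h10_scaleR) (simp add: of_h10_def Abs_h10_inverse sine_in_H10_graph esine.ortho)

interpretation hsine: total_orthonormal hsine
proof
  show "inner (hsine i) (hsine j) = (if i = j then 1 else 0)" for i j
    using ev_pos[of j] by (simp add: inner_hsine coef_hsine)
  show "u = 0" if "\<And>k. inner u (hsine k) = 0" for u
  proof (rule h10_eqI)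
    fix k show "coef (of_h10 u) k = coef (of_h10 0) k"
      using that[of k] ev_pos[of k] by (simp add: inner_hsine) (simp add: of_h10_def zero_h10.rep_eq)
  qed
qed

lemma h10_inner_sums: "(\<lambda>k. (1 + ev k) * (coef (of_h10 u) k * coef (of_h10 v) k)) sums inner u v"
proof -
  have "inner u (hsine k) * inner v (hsine k) = (1 + ev k) * (coef (of_h10 u) k * coef (of_h10 v) k)" for k
  proof -
    have "sqrt (1 + ev k) * sqrt (1 + ev k) = 1 + ev k" using ev_pos[of k] by simp
    then show ?thesis by (simp add: inner_hsine)
  qed
  then show ?thesis using hsine.parseval_inner[of u v] by simp
qed

lemma h10_norm_sums: "(\<lambda>k. (1 + ev k) * (coef (of_h10 u) k)\<^sup>2) sums (norm u)\<^sup>2"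
  using h10_inner_sums[of u u] by (simp add: power2_norm_eq_inner power2_eq_square[of "inner _ _"])

lemma h10_with_coefs:
  assumes "summable (\<lambda>k. (1 + ev k) * (c k)\<^sup>2)"
  obtains u where "\<And>k. coef (of_h10 u) k = c k"
proof -
  have eq: "(1 + ev k) * (c k)\<^sup>2 = (sqrt (1 + ev k) * c k)\<^sup>2" for k
    using ev_pos[of k] by (simp add: power_mult_distrib)
  obtain u where u: "\<And>k. inner u (hsine k) = sqrt (1 + ev k) * c k"
    using hsine.riesz_fischer[of "\<lambda>k. sqrt (1 + ev k) * c k"] assms unfolding eq by blast
  have "coef (of_h10 u) k = c k" for k using u[of k] ev_pos[of k] by (simp add: inner_hsine)
  then show ?thesis using that by blast
qed

lemma l2_with_coefs:
  assumes "summable (\<lambda>k. (c k)\<^sup>2)"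
  obtains u where "\<And>k. coef u k = c k"
  using esine.riesz_fischer[OF assms] by blast

text \<open>Left to right, the boundary condition enters: the weak derivative of \<open>u\<close> is its \<open>H\<^sup>1\<^sub>0\<close> derivative, and the
  test-function identity for the second derivative extends to the closure \<open>H10_graph\<close>, which contains the
  sines. Right to left, square summability of \<open>ev k * coef u k\<close> places \<open>u\<close> in \<open>H\<^sup>1\<^sub>0\<close>, and Parseval's identity
  in both spaces exhibits \<open>z\<close> as the weak derivative of \<open>u'\<close>.\<close>

lemma dirichlet_laplacian_iff:
  "(u, z) \<in> dirichlet_laplacian \<longleftrightarrow> (\<forall>k. coef z k = - ev k * coef u k)"
proof
  assume "(u, z) \<in> dirichlet_laplacian"
  then obtain w v where u: "u = of_h10 w" and uv: "weak_derivative u v" and vz: "weak_derivative v z"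
    by (auto simp: dirichlet_laplacian_def)
  have v: "v = snd (Rep_h10 w)"
  proof -
    have "v - snd (Rep_h10 w) = 0"
    proof (rule test_functions_total)
      fix \<phi> assume "\<phi> \<in> test_functions"
      then have "- inner v (abs_l2 \<phi>) = - inner (snd (Rep_h10 w)) (abs_l2 \<phi>)"
        using uv H10_graph_weak_derivative[OF Rep_h10[of w]] unfolding weak_derivative_def u of_h10_def by metis
      then show "inner (v - snd (Rep_h10 w)) (abs_l2 \<phi>) = 0" by (simp add: inner_diff_left)
    qed
    then show ?thesis by simp
  qed
  show "\<forall>k. coef z k = - ev k * coef u k"
  proof
    fix k
    \<comment> \<open>the defining identity of the weak derivative extends from test functions to the closure\<close>
    have "inner z (fst (esine k, abs_l2 (cosine k))) = - inner v (snd (esine k, abs_l2 (cosine k)))"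
    proof (rule H10_graph_eqI[OF sine_in_H10_graph])
      fix \<phi> assume "\<phi> \<in> test_functions"
      then show "inner z (fst (abs_l2 \<phi>, abs_l2 (deriv \<phi>))) = - inner v (snd (abs_l2 \<phi>, abs_l2 (deriv \<phi>)))"
        using vz by (simp add: weak_derivative_def)
    qed (intro continuous_intros)+
    then show "coef z k = - ev k * coef u k"
      using H10_graph_inner_cosine[OF Rep_h10, of w k] by (simp add: v u of_h10_def)
  qed
next
  assume *: "\<forall>k. coef z k = - ev k * coef u k"
  have "summable (\<lambda>k. 2 * (coef z k)\<^sup>2)"
    by (intro summable_mult esine.summable_coefficients)
  then have "summable (\<lambda>k. (1 + ev k) * (coef u k)\<^sup>2)"
  proof (rule summable_comparison_test')
    fix k
    have "1 + ev k \<le> 2 * (ev k)\<^sup>2"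
      using ev_ge_1[of k] self_le_power[of "ev k" 2] by simp
    then have "(1 + ev k) * (coef u k)\<^sup>2 \<le> 2 * (ev k)\<^sup>2 * (coef u k)\<^sup>2"
      by (rule mult_right_mono) simp
    then show "norm ((1 + ev k) * (coef u k)\<^sup>2) \<le> 2 * (coef z k)\<^sup>2"
      using ev_pos[of k] by (simp add: * power_mult_distrib)
  qed
  then obtain w where "\<And>k. coef (of_h10 w) k = coef u k" using h10_with_coefs by metis
  then have u: "u = of_h10 w" by (intro esine.coefficients_eqI) simp
  define v where "v = snd (Rep_h10 w)"
  have uv: "weak_derivative u v"
    using H10_graph_weak_derivative[OF Rep_h10[of w]] by (simp add: u v_def of_h10_def)
  have vz: "weak_derivative v z"
    unfolding weak_derivative_def
  proof
    fix \<phi> assume \<phi>: "\<phi> \<in> test_functions"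
    have "(abs_l2 \<phi>, abs_l2 (deriv \<phi>)) \<in> H10_graph"
      unfolding H10_graph_def using \<phi> by (intro subsetD[OF closure_subset] image_eqI[of _ _ \<phi>] refl)
    then obtain p where p: "Rep_h10 p = (abs_l2 \<phi>, abs_l2 (deriv \<phi>))" by (metis Abs_h10_inverse)
    have "(\<lambda>k. coef u k * coef (abs_l2 \<phi>) k - coef z k * coef (abs_l2 \<phi>) k) sums (inner u (abs_l2 \<phi>) - inner z (abs_l2 \<phi>))"
      by (intro sums_diff esine.parseval_inner)
    moreover have "(\<lambda>k. coef u k * coef (abs_l2 \<phi>) k - coef z k * coef (abs_l2 \<phi>) k) sums (inner w p)"
      using h10_inner_sums[of w p] by (simp add: * u of_h10_def p algebra_simps)
    ultimately have "inner u (abs_l2 \<phi>) - inner z (abs_l2 \<phi>) = inner w p" by (rule sums_unique2)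
    also have "\<dots> = inner u (abs_l2 \<phi>) + inner v (abs_l2 (deriv \<phi>))"
      by (simp add: inner_h10.rep_eq inner_prod_def p u v_def of_h10_def)
    finally show "inner v (abs_l2 (deriv \<phi>)) = - inner z (abs_l2 \<phi>)" by simp
  qed
  from u uv vz show "(u, z) \<in> dirichlet_laplacian"
    by (auto simp: dirichlet_laplacian_def H2_def)
qed

section \<open>The heat semigroup\<close>

lemma norm_le_by_coefs:
  assumes "\<And>k. \<bar>coef u k\<bar> \<le> \<bar>coef v k\<bar>"
  shows "norm u \<le> norm v"
proof (rule power2_le_imp_le)
  show "(norm u)\<^sup>2 \<le> (norm v)\<^sup>2"
    by (rule sums_le[OF _ esine.parseval esine.parseval]) (use assms in \<open>simp add: abs_le_square_iff\<close>)
qed simp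

lemma abs_coef_le: "\<bar>coef u k\<bar> \<le> norm u"
  using Cauchy_Schwarz_ineq2[of u "esine k"] by (simp add: norm_eq_sqrt_inner[of "esine k"] esine.ortho)

lemma tendsto_0_by_coefs:
  assumes lim: "\<And>k. ((\<lambda>x. coef (f x) k) \<longlongrightarrow> 0) F"
    and bound: "\<forall>\<^sub>F x in F. \<forall>k. \<bar>coef (f x) k\<bar> \<le> \<bar>coef v k\<bar>"
  shows "(f \<longlongrightarrow> 0) F"
proof (cases "F = bot")
  case False
  have "((\<lambda>x. \<Sum>k. (coef (f x) k)\<^sup>2) \<longlongrightarrow> (\<Sum>k. 0)) F"
  proof (rule tannerys_theorem[THEN conjunct2, THEN conjunct2])
    show "((\<lambda>x. (coef (f x) k)\<^sup>2) \<longlongrightarrow> 0) F" for k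
      using tendsto_power[OF lim[of k], of 2] by simp
    show "\<forall>\<^sub>F (k, x) in at_top \<times>\<^sub>F F. norm ((coef (f x) k)\<^sup>2) \<le> (coef v k)\<^sup>2"
      using eventually_prodI[OF eventually_True bound]
      by (rule eventually_mono) (auto simp: abs_le_square_iff)
  qed (use False esine.summable_coefficients in auto)
  then have "((\<lambda>x. (norm (f x))\<^sup>2) \<longlongrightarrow> 0) F"
    using sums_unique[OF esine.parseval] by simp
  then have "((\<lambda>x. norm (f x)) \<longlongrightarrow> 0) F"
    using tendsto_real_sqrt by fastforce
  then show ?thesis by (rule tendsto_norm_zero_cancel)
qed simp

text \<open>Existence: all limits at \<open>t \<rightarrow> 0\<close> can be taken mode by mode, since each difference quotient is dominated
  by the coefficients of a fixed element of \<open>L\<^sup>2\<close>.\<close>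

lemma semigroup_with_coefs_C0:
  assumes S: "\<And>t u k. 0 \<le> t \<Longrightarrow> coef (S t u) k = exp (- (ev k * t)) * coef u k"
  shows "C0_semigroup S" and "generator S = dirichlet_laplacian"
proof -
  have norm_le: "norm (S t u) \<le> norm u" if "0 \<le> t" for t u
  proof (rule norm_le_by_coefs)
    show "\<bar>coef (S t u) k\<bar> \<le> \<bar>coef u k\<bar>" for k
      using that ev_pos[of k] by (simp add: S abs_mult mult_left_le_one_le)
  qed
  show "C0_semigroup S"
    unfolding C0_semigroup_def
  proof (intro conjI allI impI)
    fix t :: real assume t: "0 \<le> t"
    show "bounded_linear (S t)"
    proof (rule bounded_linear_intro[where K = 1])
      show "S t (u + v) = S t u + S t v" for u v
        by (rule esine.coefficients_eqI) (simp add: S[OF t] inner_add_left algebra_simps)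
      show "S t (c *\<^sub>R u) = c *\<^sub>R S t u" for c u
        by (rule esine.coefficients_eqI) (simp add: S[OF t])
    qed (simp add: norm_le[OF t])
  next
    show "S 0 u = u" for u by (rule esine.coefficients_eqI) (simp add: S)
  next
    fix s t :: real and u assume "0 \<le> s" "0 \<le> t"
    moreover have "exp (- (ev k * (s + t))) = exp (- (ev k * s)) * exp (- (ev k * t))" for k
      by (simp add: exp_add[symmetric] algebra_simps)
    ultimately show "S (s + t) u = S s (S t u)"
      by (intro esine.coefficients_eqI) (simp add: S)
  next
    fix u
    have "((\<lambda>t. S t u - u) \<longlongrightarrow> 0) (at_right 0)"
    proof (rule tendsto_0_by_coefs)
      fix k
      have "((\<lambda>t. exp (- (ev k * t)) * coef u k - coef u k) \<longlongrightarrow> exp (- (ev k * 0)) * coef u k - coef u k) (at_right 0)"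
        by (intro tendsto_intros)
      moreover have "\<forall>\<^sub>F t in at_right 0. exp (- (ev k * t)) * coef u k - coef u k = coef (S t u - u) k"
        using eventually_at_right_less[of "0::real"] by eventually_elim (simp add: S inner_diff_left)
      ultimately show "((\<lambda>t. coef (S t u - u) k) \<longlongrightarrow> 0) (at_right 0)" by (simp add: tendsto_cong)
    next
      show "\<forall>\<^sub>F t in at_right 0. \<forall>k. \<bar>coef (S t u - u) k\<bar> \<le> \<bar>coef u k\<bar>"
        using eventually_at_right_less[of "0::real"]
      proof eventually_elim
        case (elim t)
        show ?case
        proof
          fix k
          have "coef (S t u - u) k = (exp (- (ev k * t)) - 1) * coef u k"
            using elim by (simp add: S inner_diff_left algebra_simps)
          moreover have "\<bar>exp (- (ev k * t)) - 1\<bar> \<le> 1" using elim ev_pos[of k] by simp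
          ultimately show "\<bar>coef (S t u - u) k\<bar> \<le> \<bar>coef u k\<bar>"
            by (simp add: abs_mult mult_left_le_one_le)
        qed
      qed
    qed
    then show "((\<lambda>t. S t u) \<longlongrightarrow> u) (at_right 0)" by (rule LIM_zero_cancel)
  qed
  have quotient: "((\<lambda>h. (exp (- (ev k * h)) - 1) / h) \<longlongrightarrow> - ev k) (at_right 0)" for k
  proof -
    have "((\<lambda>h. exp (- (ev k * h))) has_real_derivative - ev k) (at 0)"
      by (auto intro!: derivative_eq_intros)
    then show ?thesis unfolding DERIV_def by (simp add: filterlim_at_split)
  qed
  show "generator S = dirichlet_laplacian"
  proof (intro set_eqI iffI; clarify)
    fix u v assume "(u, v) \<in> generator S"
    then have lim: "((\<lambda>h. (S h u - u) /\<^sub>R h) \<longlongrightarrow> v) (at_right 0)" by (simp add: generator_def)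
    have "coef v k = - ev k * coef u k" for k
    proof -
      have 1: "((\<lambda>h. coef ((S h u - u) /\<^sub>R h) k) \<longlongrightarrow> coef v k) (at_right 0)"
        by (intro tendsto_inner tendsto_const lim)
      have "((\<lambda>h. (exp (- (ev k * h)) - 1) / h * coef u k) \<longlongrightarrow> - ev k * coef u k) (at_right 0)"
        by (intro tendsto_intros quotient)
      moreover have "\<forall>\<^sub>F h in at_right 0. (exp (- (ev k * h)) - 1) / h * coef u k = coef ((S h u - u) /\<^sub>R h) k"
        using eventually_at_right_less[of "0::real"]
        by eventually_elim (simp add: S inner_diff_left divide_inverse algebra_simps)
      ultimately have "((\<lambda>h. coef ((S h u - u) /\<^sub>R h) k) \<longlongrightarrow> - ev k * coef u k) (at_right 0)"
        by (rule Lim_transform_eventually)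
      with 1 show ?thesis by (rule tendsto_unique[OF trivial_limit_at_right_real])
    qed
    then show "(u, v) \<in> dirichlet_laplacian" by (simp add: dirichlet_laplacian_iff)
  next
    fix u v assume "(u, v) \<in> dirichlet_laplacian"
    then have v: "coef v k = - ev k * coef u k" for k by (simp add: dirichlet_laplacian_iff)
    have c: "coef ((S h u - u) /\<^sub>R h - v) k = ((exp (- (ev k * h)) - 1) / h + ev k) * coef u k" if "0 < h" for h k
      using that by (simp add: S inner_diff_left v divide_inverse algebra_simps)
    have "((\<lambda>h. (S h u - u) /\<^sub>R h - v) \<longlongrightarrow> 0) (at_right 0)"
    proof (rule tendsto_0_by_coefs)
      fix k
      have "((\<lambda>h. ((exp (- (ev k * h)) - 1) / h + ev k) * coef u k) \<longlongrightarrow> (- ev k + ev k) * coef u k) (at_right 0)"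
        by (intro tendsto_intros quotient)
      moreover have "\<forall>\<^sub>F h in at_right 0. ((exp (- (ev k * h)) - 1) / h + ev k) * coef u k = coef ((S h u - u) /\<^sub>R h - v) k"
        using eventually_at_right_less[of "0::real"] by eventually_elim (simp only: c)
      ultimately show "((\<lambda>h. coef ((S h u - u) /\<^sub>R h - v) k) \<longlongrightarrow> 0) (at_right 0)" by (simp add: tendsto_cong)
    next
      show "\<forall>\<^sub>F h in at_right 0. \<forall>k. \<bar>coef ((S h u - u) /\<^sub>R h - v) k\<bar> \<le> \<bar>coef v k\<bar>"
        using eventually_at_right_less[of "0::real"]
      proof eventually_elim
        case (elim h)
        show ?case
        proof
          fix k
          have "1 + - (ev k * h) \<le> exp (- (ev k * h))" by (rule exp_ge_add_one_self)
          then have "- ev k \<le> (exp (- (ev k * h)) - 1) / h" using elim by (simp add: field_simps)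
          moreover have "(exp (- (ev k * h)) - 1) / h \<le> 0" using elim ev_pos[of k] by (simp add: divide_le_0_iff)
          ultimately have "\<bar>(exp (- (ev k * h)) - 1) / h + ev k\<bar> \<le> ev k" by linarith
          then show "\<bar>coef ((S h u - u) /\<^sub>R h - v) k\<bar> \<le> \<bar>coef v k\<bar>"
            unfolding c[OF elim] v abs_mult using ev_pos[of k] by (intro mult_right_mono) auto
        qed
      qed
    qed
    then show "(u, v) \<in> generator S" unfolding generator_def by (auto intro: LIM_zero_cancel)
  qed
qed

lemma abs_power_minus_1_le:
  fixes d :: real
  shows "\<bar>(1 + d)^n - 1\<bar> \<le> exp (real n * \<bar>d\<bar>) - 1"
proof -
  have "\<bar>(1 + d)^n - 1\<bar> \<le> (1 + \<bar>d\<bar>)^n - 1"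
  proof (induction n)
    case (Suc n)
    have "(1 + d)^Suc n - 1 = (1 + d) * ((1 + d)^n - 1) + d" by (simp add: algebra_simps)
    also have "\<bar>\<dots>\<bar> \<le> \<bar>1 + d\<bar> * \<bar>(1 + d)^n - 1\<bar> + \<bar>d\<bar>" by (metis abs_mult abs_triangle_ineq)
    also have "\<dots> \<le> (1 + \<bar>d\<bar>) * ((1 + \<bar>d\<bar>)^n - 1) + \<bar>d\<bar>"
      using Suc by (intro add_mono mult_mono) auto
    also have "\<dots> = (1 + \<bar>d\<bar>)^Suc n - 1" by (simp add: algebra_simps)
    finally show ?case .
  qed simp
  also have "(1 + \<bar>d\<bar>)^n \<le> (exp \<bar>d\<bar>)^n" by (intro power_mono) auto
  also have "(exp \<bar>d\<bar>)^n = exp (real n * \<bar>d\<bar>)" by (simp add: exp_of_nat_mult)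
  finally show ?thesis by simp
qed

text \<open>The quotient \<open>g\<close> of \<open>c\<close> by the exponential is multiplicative and has derivative \<open>0\<close> at \<open>0\<close>, so
  \<open>g t = g (t/n)\<^sup>n = (1 + o(1/n))\<^sup>n \<rightarrow> 1\<close>.\<close>

lemma multiplicative_eq_exp:
  fixes c :: "real \<Rightarrow> real"
  assumes mult: "\<And>s t. 0 \<le> s \<Longrightarrow> 0 \<le> t \<Longrightarrow> c (s + t) = c s * c t" and c0: "c 0 = 1"
    and lim: "((\<lambda>h. (c h - 1) / h) \<longlongrightarrow> - \<mu>) (at_right 0)" and t: "0 \<le> t"
  shows "c t = exp (- (\<mu> * t))"
proof (cases "t = 0")
  case False
  with t have t: "t > 0" by simp
  define g where "g h = c h * exp (\<mu> * h)" for h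
  have g_pow: "g (real n * h) = g h ^ n" if "0 \<le> h" for n h
  proof (induction n)
    case (Suc n)
    have "c (h + real n * h) = c h * c (real n * h)" using that by (intro mult) auto
    with Suc show ?case by (simp add: g_def algebra_simps exp_add)
  qed (simp add: g_def c0)
  have "((\<lambda>h. exp (\<mu> * h)) has_real_derivative \<mu>) (at 0)" by (auto intro!: derivative_eq_intros)
  then have e: "((\<lambda>h. (exp (\<mu> * h) - 1) / h) \<longlongrightarrow> \<mu>) (at_right 0)"
    unfolding DERIV_def by (simp add: filterlim_at_split)
  have "((\<lambda>h. (c h - 1) / h * exp (\<mu> * h) + (exp (\<mu> * h) - 1) / h) \<longlongrightarrow> - \<mu> * exp (\<mu> * 0) + \<mu>) (at_right 0)"
    by (intro tendsto_intros lim e)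
  moreover have "(c h - 1) / h * exp (\<mu> * h) + (exp (\<mu> * h) - 1) / h = (g h - 1) / h" for h
    by (cases "h = 0") (simp_all add: g_def field_simps)
  ultimately have g_lim: "((\<lambda>h. (g h - 1) / h) \<longlongrightarrow> 0) (at_right 0)" by simp
  have "filterlim (\<lambda>n. t / real (Suc n)) (at_right 0) sequentially"
  proof (rule tendsto_imp_filterlim_at_right)
    show "(\<lambda>n. t / real (Suc n)) \<longlonglongrightarrow> 0"
      by (intro real_tendsto_divide_at_top[OF tendsto_const] filterlim_compose[OF filterlim_real_sequentially filterlim_Suc])
  qed (use t in auto)
  then have "(\<lambda>n. (g (t / real (Suc n)) - 1) / (t / real (Suc n))) \<longlonglongrightarrow> 0"
    by (rule filterlim_compose[OF g_lim])
  then have "(\<lambda>n. exp (t * \<bar>(g (t / real (Suc n)) - 1) / (t / real (Suc n))\<bar>) - 1) \<longlonglongrightarrow> exp (t * \<bar>0\<bar>) - 1"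
    by (intro tendsto_intros)
  moreover have "\<bar>g t - 1\<bar> \<le> exp (t * \<bar>(g (t / real (Suc n)) - 1) / (t / real (Suc n))\<bar>) - 1" for n
  proof -
    define d where "d = g (t / real (Suc n)) - 1"
    have "g t = g (real (Suc n) * (t / real (Suc n)))" by simp
    also have "\<dots> = (1 + d)^Suc n" using t by (subst g_pow) (auto simp: d_def)
    finally have "\<bar>g t - 1\<bar> \<le> exp (real (Suc n) * \<bar>d\<bar>) - 1" by (metis abs_power_minus_1_le)
    also have "real (Suc n) * \<bar>d\<bar> = t * \<bar>d / (t / real (Suc n))\<bar>" using t by (simp add: abs_divide abs_mult del: of_nat_Suc)
    finally show ?thesis by (simp only: d_def)
  qed
  ultimately have "\<bar>g t - 1\<bar> \<le> exp (t * \<bar>0\<bar>) - 1" by (intro LIMSEQ_le_const) auto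
  then have "g t = 1" by simp
  then show ?thesis by (simp add: g_def exp_minus field_simps)
qed (simp add: c0)

text \<open>Uniqueness: each operator \<open>T t\<close> commutes with the generator and so maps an eigenvector to an eigenvector
  for the same eigenvalue. The eigenvalues are simple, hence the modes evolve by scalar multiplicative
  functions whose derivative at \<open>0\<close> is known.\<close>

lemma semigroup_coefs:
  assumes C0: "C0_semigroup T" and gen: "generator T = dirichlet_laplacian" and t: "0 \<le> t"
  shows "coef (T t u) k = exp (- (ev k * t)) * coef u k"
proof -
  have lin: "bounded_linear (T t)" if "0 \<le> t" for t using C0 that by (simp add: C0_semigroup_def)
  have sg: "T (s + t) u = T s (T t u)" if "0 \<le> s" "0 \<le> t" for s t u using C0 that by (simp add: C0_semigroup_def)
  have T0: "T 0 u = u" for u using C0 by (simp add: C0_semigroup_def)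
  define c where "c j t = coef (T t (esine j)) j" for j t
  have e_gen: "(esine j, - ev j *\<^sub>R esine j) \<in> generator T" for j
    unfolding gen dirichlet_laplacian_iff by (simp add: esine.ortho)
  have T_esine: "T t (esine j) = c j t *\<^sub>R esine j" if t: "0 \<le> t" for t j
  proof -
    have "((\<lambda>h. T t ((T h (esine j) - esine j) /\<^sub>R h)) \<longlongrightarrow> T t (- ev j *\<^sub>R esine j)) (at_right 0)"
      using e_gen[of j] by (intro bounded_linear.tendsto[OF lin[OF t]]) (simp add: generator_def)
    moreover have "\<forall>\<^sub>F h in at_right 0. T t ((T h (esine j) - esine j) /\<^sub>R h) = (T h (T t (esine j)) - T t (esine j)) /\<^sub>R h"
      using eventually_at_right_less[of "0::real"]
    proof eventually_elim
      case (elim h)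
      have "T h (T t (esine j)) = T t (T h (esine j))"
        using sg[of h t "esine j"] sg[of t h "esine j"] elim t by (simp add: add.commute)
      then show ?case
        using bounded_linear.linear[OF lin[OF t]] by (simp add: linear_scale linear_diff)
    qed
    ultimately have "(T t (esine j), T t (- ev j *\<^sub>R esine j)) \<in> generator T"
      by (simp add: generator_def tendsto_cong)
    then have *: "coef (T t (- ev j *\<^sub>R esine j)) i = - ev i * coef (T t (esine j)) i" for i
      unfolding gen dirichlet_laplacian_iff by blast
    show ?thesis
    proof (rule esine.coefficients_eqI)
      fix i
      have "- ev j * coef (T t (esine j)) i = - ev i * coef (T t (esine j)) i"
        using *[of i] bounded_linear.linear[OF lin[OF t]] by (simp add: linear_scale linear_neg)
      moreover have "ev j \<noteq> ev i" if "i \<noteq> j"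
        using that power2_eq_imp_eq[of "real (Suc j) * pi" "real (Suc i) * pi"] by (auto simp: ev_def)
      ultimately show "coef (T t (esine j)) i = coef (c j t *\<^sub>R esine j) i"
        by (cases "i = j") (auto simp: c_def esine.ortho)
    qed
  qed
  have c_exp: "c j t = exp (- (ev j * t))" if t: "0 \<le> t" for j t
  proof (rule multiplicative_eq_exp[OF _ _ _ t])
    fix s t :: real assume st: "0 \<le> s" "0 \<le> t"
    have "T (s + t) (esine j) = c j t *\<^sub>R T s (esine j)"
      using sg[OF st] T_esine[OF st(2)] bounded_linear.linear[OF lin[OF st(1)]] by (simp add: linear_scale)
    then show "c j (s + t) = c j s * c j t" by (simp add: c_def)
  next
    show "c j 0 = 1" by (simp add: c_def T0 esine.ortho)
    have "((\<lambda>h. coef ((T h (esine j) - esine j) /\<^sub>R h) j) \<longlongrightarrow> coef (- ev j *\<^sub>R esine j) j) (at_right 0)"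
      using e_gen[of j] by (intro tendsto_inner tendsto_const) (simp add: generator_def)
    then show "((\<lambda>h. (c j h - 1) / h) \<longlongrightarrow> - ev j) (at_right 0)"
      by (simp add: c_def inner_diff_left esine.ortho divide_inverse mult.commute)
  qed
  have "(\<lambda>j. coef (T t (coef u j *\<^sub>R esine j)) k) sums coef (T t u) k"
    by (intro bounded_linear.sums[OF bounded_linear_inner_left] bounded_linear.sums[OF lin[OF t]] esine.expansion)
  moreover have "coef (T t (coef u j *\<^sub>R esine j)) k = (if j = k then exp (- (ev k * t)) * coef u k else 0)" for j
    using bounded_linear.linear[OF lin[OF t]] t by (simp add: linear_scale T_esine c_exp esine.ortho)
  ultimately have "(\<lambda>j. if j = k then exp (- (ev k * t)) * coef u k else 0) sums coef (T t u) k" by simp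
  moreover have "(\<lambda>j. if j = k then exp (- (ev k * t)) * coef u k else 0) sums (exp (- (ev k * t)) * coef u k)"
    using sums_If_finite[of "\<lambda>j. j = k" "\<lambda>j. exp (- (ev k * t)) * coef u k"] by simp
  ultimately show ?thesis by (rule sums_unique2)
qed

lemma heat_semigroup_exists: "\<exists>S. C0_semigroup S \<and> generator S = dirichlet_laplacian"
proof -
  have "\<exists>v. \<forall>k. coef v k = exp (- (ev k * t)) * coef u k" if "0 \<le> t" for t u
  proof -
    have "summable (\<lambda>k. (exp (- (ev k * t)) * coef u k)\<^sup>2)"
    proof (rule summable_comparison_test'[OF esine.summable_coefficients[of u]])
      fix k
      have "\<bar>exp (- (ev k * t)) * coef u k\<bar> \<le> 1 * \<bar>coef u k\<bar>"
        unfolding abs_mult using that ev_pos[of k] by (intro mult_right_mono) auto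
      then show "norm ((exp (- (ev k * t)) * coef u k)\<^sup>2) \<le> (coef u k)\<^sup>2"
        by (simp add: abs_le_square_iff)
    qed
    then show ?thesis by (metis l2_with_coefs)
  qed
  then obtain S where "\<And>t u k. 0 \<le> t \<Longrightarrow> coef (S t u) k = exp (- (ev k * t)) * coef u k" by metis
  from semigroup_with_coefs_C0[OF this] show ?thesis by blast
qed

lemma coef_heat_semigroup:
  "0 \<le> t \<Longrightarrow> coef (heat_semigroup t u) k = exp (- (ev k * t)) * coef u k"
  using semigroup_coefs[of heat_semigroup] someI_ex[OF heat_semigroup_exists]
  unfolding heat_semigroup_def by blast

lemma heat_semigroup_bounded_linear: "0 \<le> t \<Longrightarrow> bounded_linear (heat_semigroup t)"
  using semigroup_with_coefs_C0(1)[of heat_semigroup] by (simp add: coef_heat_semigroup C0_semigroup_def)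

lemma norm_heat_semigroup_le:
  assumes "0 \<le> t" shows "norm (heat_semigroup t u) \<le> norm u"
proof (rule norm_le_by_coefs)
  show "\<bar>coef (heat_semigroup t u) k\<bar> \<le> \<bar>coef u k\<bar>" for k
    using assms ev_pos[of k] by (simp add: coef_heat_semigroup abs_mult mult_left_le_one_le)
qed

lemma inner_heat_semigroup:
  assumes "0 \<le> t"
  shows "inner (heat_semigroup t u) v = inner u (heat_semigroup t v)"
proof (rule sums_unique2)
  show "(\<lambda>k. coef (heat_semigroup t u) k * coef v k) sums inner (heat_semigroup t u) v"
    by (rule esine.parseval_inner)
  show "(\<lambda>k. coef (heat_semigroup t u) k * coef v k) sums inner u (heat_semigroup t v)"
    using esine.parseval_inner[of u "heat_semigroup t v"] assms
    by (simp add: coef_heat_semigroup mult.left_commute mult.commute)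
qed

lemma heat_semigroup_continuous_on: "continuous_on {0..} (\<lambda>t. heat_semigroup t u)"
  unfolding continuous_on_def
proof
  fix t0 :: real assume t0: "t0 \<in> {0..}"
  have nn: "\<forall>\<^sub>F t in at t0 within {0..}. 0 \<le> t" by (simp add: eventually_at_filter)
  have "((\<lambda>t. heat_semigroup t u - heat_semigroup t0 u) \<longlongrightarrow> 0) (at t0 within {0..})"
  proof (rule tendsto_0_by_coefs)
    fix k
    have "((\<lambda>t. exp (- (ev k * t)) * coef u k - exp (- (ev k * t0)) * coef u k)
        \<longlongrightarrow> exp (- (ev k * t0)) * coef u k - exp (- (ev k * t0)) * coef u k) (at t0 within {0..})"
      by (intro tendsto_intros)
    moreover have "\<forall>\<^sub>F t in at t0 within {0..}. exp (- (ev k * t)) * coef u k - exp (- (ev k * t0)) * coef u k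
        = coef (heat_semigroup t u - heat_semigroup t0 u) k"
      using nn by eventually_elim (use t0 in \<open>simp add: coef_heat_semigroup inner_diff_left\<close>)
    ultimately have "((\<lambda>t. coef (heat_semigroup t u - heat_semigroup t0 u) k)
        \<longlongrightarrow> exp (- (ev k * t0)) * coef u k - exp (- (ev k * t0)) * coef u k) (at t0 within {0..})"
      by (rule Lim_transform_eventually)
    then show "((\<lambda>t. coef (heat_semigroup t u - heat_semigroup t0 u) k) \<longlongrightarrow> 0) (at t0 within {0..})" by simp
  next
    show "\<forall>\<^sub>F t in at t0 within {0..}. \<forall>k. \<bar>coef (heat_semigroup t u - heat_semigroup t0 u) k\<bar> \<le> \<bar>coef u k\<bar>"
      using nn
    proof eventually_elim
      case (elim t)
      show ?case
      proof
        fix k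
        have "coef (heat_semigroup t u - heat_semigroup t0 u) k = (exp (- (ev k * t)) - exp (- (ev k * t0))) * coef u k"
          using elim t0 by (simp add: coef_heat_semigroup inner_diff_left algebra_simps)
        moreover have "\<bar>exp (- (ev k * t)) - exp (- (ev k * t0))\<bar> \<le> 1"
        proof -
          have b: "0 < exp (- (ev k * s))" "exp (- (ev k * s)) \<le> 1" if "0 \<le> s" for s
            using that ev_pos[of k] by simp_all
          have "0 \<le> t0" using t0 by simp
          then show ?thesis using b(1)[of t0] b(2)[of t0] b(1)[OF elim] b(2)[OF elim] by linarith
        qed
        ultimately show "\<bar>coef (heat_semigroup t u - heat_semigroup t0 u) k\<bar> \<le> \<bar>coef u k\<bar>"
          by (simp add: abs_mult mult_left_le_one_le)
      qed
    qed
  qed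
  then show "((\<lambda>t. heat_semigroup t u) \<longlongrightarrow> heat_semigroup t0 u) (at t0 within {0..})"
    by (rule LIM_zero_cancel)
qed

lemma continuous_on_heat_semigroup:
  fixes b :: "'a::topological_space \<Rightarrow> real" and g :: "'a \<Rightarrow> l2"
  assumes b: "continuous_on S b" "\<And>s. s \<in> S \<Longrightarrow> 0 \<le> b s" and g: "continuous_on S g"
  shows "continuous_on S (\<lambda>s. heat_semigroup (b s) (g s))"
  unfolding continuous_on_def
proof
  fix s0 assume s0: "s0 \<in> S"
  have ev_S: "\<forall>\<^sub>F s in at s0 within S. s \<in> S" by (simp add: eventually_at_filter)
  have "continuous_on S (\<lambda>s. heat_semigroup (b s) (g s0))"
    by (rule continuous_on_compose2[OF heat_semigroup_continuous_on b(1)]) (use b in auto)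
  then have 1: "((\<lambda>s. heat_semigroup (b s) (g s0)) \<longlongrightarrow> heat_semigroup (b s0) (g s0)) (at s0 within S)"
    using s0 by (auto simp: continuous_on_def)
  have "((\<lambda>s. g s - g s0) \<longlongrightarrow> 0) (at s0 within S)"
    using g s0 by (intro LIM_zero) (auto simp: continuous_on_def)
  then have "((\<lambda>s. heat_semigroup (b s) (g s) - heat_semigroup (b s) (g s0)) \<longlongrightarrow> 0) (at s0 within S)"
  proof (rule Lim_null_comparison[OF _ tendsto_norm_zero, rotated])
    show "\<forall>\<^sub>F s in at s0 within S. norm (heat_semigroup (b s) (g s) - heat_semigroup (b s) (g s0)) \<le> norm (g s - g s0)"
      using ev_S
    proof eventually_elim
      case (elim s)
      then show ?case
        using norm_heat_semigroup_le[of "b s" "g s - g s0"] b(2)[of s]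
          bounded_linear.linear[OF heat_semigroup_bounded_linear[of "b s"]]
        by (simp add: linear_diff)
    qed
  qed
  from tendsto_add[OF this 1]
  show "((\<lambda>s. heat_semigroup (b s) (g s)) \<longlongrightarrow> heat_semigroup (b s0) (g s0)) (at s0 within S)" by simp
qed

section \<open>The maximum principle\<close>

lemma sine_polynomial_sum:
  "f \<in> sine_polynomials \<Longrightarrow> \<exists>N c. f = (\<lambda>x. \<Sum>k<N. c k * sine k x)"
proof (induction rule: sine_polynomials.induct)
  case zero
  show ?case by (rule exI[of _ 0]) simp
next
  case (step f d j)
  then obtain N c where f: "f = (\<lambda>x. \<Sum>k<N. c k * sine k x)" by blast
  define N' where "N' = max N (Suc j)"
  define c' where "c' k = (if k < N then c k else 0) + (if k = j then d else 0)" for k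
  have "(\<Sum>k<N'. c' k * sine k x) = f x + d * sine j x" for x
  proof -
    have "(\<Sum>k<N'. c' k * sine k x) = (\<Sum>k<N'. if k < N then c k * sine k x else 0) + (\<Sum>k<N'. if k = j then d * sine k x else 0)"
      by (simp add: c'_def distrib_right sum.distrib if_distrib[of "\<lambda>z. z * _"] cong: if_cong)
    also have "(\<Sum>k<N'. if k < N then c k * sine k x else 0) = f x"
    proof -
      have "{..<N'} \<inter> {k. k < N} = {..<N}" by (auto simp: N'_def)
      then show ?thesis by (simp add: sum.If_cases f)
    qed
    also have "(\<Sum>k<N'. if k = j then d * sine k x else 0) = d * sine j x"
      by (simp add: N'_def)
    finally show ?thesis .
  qed
  then show ?case by (intro exI[of _ N'] exI[of _ c']) auto
qed

lemma abs_l2_sine_sum: "abs_l2 (\<lambda>x. \<Sum>k<N. c k * sine k x) = (\<Sum>k<N. c k *\<^sub>R esine k)"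
proof (induction N)
  case 0
  then show ?case by (simp add: zero_l2.abs_eq[symmetric])
next
  case (Suc N)
  have "square_integrable (\<lambda>x. \<Sum>k<N. c k * sine k x)"
    by (intro square_integrable_continuous continuous_intros continuous_on_sine)
  from abs_l2_linear[OF this square_integrable_sine(1), of 1 "c N" N] Suc
  show ?case by (simp add: esine_def)
qed

text \<open>If the solution \<open>v\<close> exceeded \<open>C\<close> somewhere, then \<open>v - \<epsilon> t\<close> would for small \<open>\<epsilon>\<close> have a maximum at a positive time
  and an interior point. There the time derivative of \<open>v\<close>, which is also \<open>v\<^sub>x\<^sub>x\<close>, is at least \<open>\<epsilon>\<close>, whereas
  \<open>v\<close> would have a maximum in \<open>x\<close>.\<close>

lemma sine_sum_maximum_principle:
  assumes init: "\<And>x. 0 \<le> x \<Longrightarrow> x \<le> 1 \<Longrightarrow> (\<Sum>k<N. c k * sine k x) \<le> C" and C: "0 \<le> C"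
    and t: "0 \<le> t" and x: "0 \<le> x" "x \<le> 1"
  shows "(\<Sum>k<N. c k * exp (- (ev k * t)) * sine k x) \<le> C"
proof (rule ccontr)
  define v where "v t x = (\<Sum>k<N. c k * exp (- (ev k * t)) * sine k x)" for t x
  define v1 where "v1 t x = (\<Sum>k<N. c k * exp (- (ev k * t)) * cosine k x)" for t x
  define v2 where "v2 t x = (\<Sum>k<N. c k * exp (- (ev k * t)) * (- ev k * sine k x))" for t x
  assume "\<not> (\<Sum>k<N. c k * exp (- (ev k * t)) * sine k x) \<le> C"
  then have big: "v t x > C" by (simp add: v_def)
  have v0: "v 0 y \<le> C" if "0 \<le> y" "y \<le> 1" for y using init[OF that] by (simp add: v_def)
  have "t \<noteq> 0" using big v0[OF x] by auto
  with t have t: "t > 0" by simp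
  have Dx: "(v s has_real_derivative v1 s y) (at y)" for s y
    unfolding v_def[abs_def] v1_def by (intro DERIV_sum DERIV_cmult DERIV_sine)
  have Dxx: "(v1 s has_real_derivative v2 s y) (at y)" for s y
    unfolding v1_def[abs_def] v2_def by (intro DERIV_sum DERIV_cmult DERIV_cosine)
  have Dt: "((\<lambda>s. v s y) has_real_derivative v2 s y) (at s)" for s y
  proof -
    have "((\<lambda>s. c k * exp (- (ev k * s)) * sine k y) has_real_derivative c k * exp (- (ev k * s)) * (- ev k * sine k y)) (at s)" for k
      by (auto intro!: derivative_eq_intros)
    then show ?thesis unfolding v_def v2_def by (intro DERIV_sum)
  qed
  define \<epsilon> where "\<epsilon> = (v t x - C) / (2 * t)"
  have \<epsilon>: "\<epsilon> > 0" using big t by (simp add: \<epsilon>_def)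
  let ?R = "{0..t} \<times> {0..1::real}"
  have "continuous_on ?R (\<lambda>p. v (fst p) (snd p) - \<epsilon> * fst p)"
    unfolding v_def by (intro continuous_intros continuous_on_compose2[OF continuous_on_sine(1)[of UNIV]]) auto
  moreover have "compact ?R" by (intro compact_Times compact_Icc)
  ultimately obtain p0 where p0: "p0 \<in> ?R" "\<And>p. p \<in> ?R \<Longrightarrow> v (fst p) (snd p) - \<epsilon> * fst p \<le> v (fst p0) (snd p0) - \<epsilon> * fst p0"
    using continuous_attains_sup[of ?R "\<lambda>p. v (fst p) (snd p) - \<epsilon> * fst p"] t by force
  define t0 where "t0 = fst p0"
  define x0 where "x0 = snd p0"
  have t0: "0 \<le> t0" "t0 \<le> t" and x0: "0 \<le> x0" "x0 \<le> 1" using p0(1) by (auto simp: t0_def x0_def)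
  have max: "v s y - \<epsilon> * s \<le> v t0 x0 - \<epsilon> * t0" if "0 \<le> s" "s \<le> t" "0 \<le> y" "y \<le> 1" for s y
    using p0(2)[of "(s, y)"] that by (simp add: t0_def x0_def)
  have "C < v t x - \<epsilon> * t" using big t by (simp add: \<epsilon>_def field_simps)
  then have M: "C < v t0 x0 - \<epsilon> * t0" using max[of t x] x t by linarith
  then have M': "C < v t0 x0" using mult_nonneg_nonneg[of \<epsilon> t0] \<epsilon> t0 by linarith
  have bd: "v t0 0 = 0" "v t0 1 = 0"
    using sin_npi[of "Suc _"] by (simp_all add: v_def sine_def del: of_nat_Suc)
  have x0': "0 < x0" "x0 < 1" using x0 bd M' C by (auto simp: order_less_le)
  have t0': "0 < t0" using t0 M v0[of x0] x0 by (cases "t0 = 0") auto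
  have vt: "v2 t0 x0 \<ge> \<epsilon>"
  proof (rule ccontr)
    assume "\<not> v2 t0 x0 \<ge> \<epsilon>"
    moreover have "((\<lambda>s. v s x0 - \<epsilon> * s) has_real_derivative (v2 t0 x0 - \<epsilon>)) (at t0)"
      using DERIV_diff[OF Dt DERIV_cmult[OF DERIV_ident, of \<epsilon>]] by simp
    ultimately obtain d where d: "d > 0" "\<And>h. 0 < h \<Longrightarrow> h < d \<Longrightarrow> v t0 x0 - \<epsilon> * t0 < v (t0 - h) x0 - \<epsilon> * (t0 - h)"
      using DERIV_neg_dec_left[of "\<lambda>s. v s x0 - \<epsilon> * s" "v2 t0 x0 - \<epsilon>" t0] by auto
    define h where "h = min (d / 2) t0"
    have h: "0 < h" "h < d" "h \<le> t0" using d(1) t0' by (auto simp: h_def)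
    from d(2)[OF h(1,2)] max[of "t0 - h" x0] h t0 x0 show False by auto
  qed
  have v1_0: "v1 t0 x0 = 0"
  proof (rule DERIV_local_max[OF Dx])
    show "0 < min x0 (1 - x0)" using x0' by simp
    show "\<forall>y. \<bar>x0 - y\<bar> < min x0 (1 - x0) \<longrightarrow> v t0 y \<le> v t0 x0"
      using max[of t0] t0 by (auto simp: abs_less_iff)
  qed
  obtain d where d: "d > 0" "\<And>h. 0 < h \<Longrightarrow> h < d \<Longrightarrow> 0 < v1 t0 (x0 + h)"
    using DERIV_pos_inc_right[OF Dxx, of t0 x0] vt \<epsilon> v1_0 by auto
  define h where "h = min (d / 2) (1 - x0)"
  have h: "0 < h" "h < d" "x0 + h \<le> 1" using d(1) x0' by (auto simp: h_def)
  obtain z where z: "x0 < z" "z < x0 + h" "v t0 (x0 + h) - v t0 x0 = (x0 + h - x0) * v1 t0 z"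
    using MVT2[of x0 "x0 + h" "v t0" "v1 t0"] Dx h(1) by auto
  have "0 < v1 t0 z" using d(2)[of "z - x0"] z h by auto
  then have "0 < v t0 (x0 + h) - v t0 x0" using z(3) h(1) by simp
  then show False using max[of t0 "x0 + h"] t0 x0 h by auto
qed

lemma coef_sine_sum: "coef (abs_l2 (\<lambda>x. \<Sum>k<N. c k * sine k x)) j = (if j < N then c j else 0)"
  unfolding abs_l2_sine_sum by (simp add: esine.inner_sum_basis)

lemma heat_semigroup_sine_sum:
  assumes "0 \<le> t"
  shows "heat_semigroup t (abs_l2 (\<lambda>x. \<Sum>k<N. c k * sine k x)) = abs_l2 (\<lambda>x. \<Sum>k<N. (c k * exp (- (ev k * t))) * sine k x)"
  by (rule esine.coefficients_eqI)
    (simp add: coef_heat_semigroup assms coef_sine_sum[of c N] coef_sine_sum[of "\<lambda>k. c k * exp (- (ev k * t))" N])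

definition one :: l2 where "one = abs_l2 (\<lambda>x. 1)"

text \<open>The order relation \<open>u \<le> c\<close> almost everywhere (\<open>le_const_AE\<close>), in dual form because this form passes to
  limits and to vector-valued integrals at once.\<close>

definition le_const :: "l2 \<Rightarrow> real \<Rightarrow> bool" where
  "le_const u c \<longleftrightarrow> (\<forall>\<psi>\<in>test_functions. (\<forall>x. 0 \<le> \<psi> x) \<longrightarrow> inner u (abs_l2 \<psi>) \<le> c * inner one (abs_l2 \<psi>))"

lemma AE_rep_lincomb: "AE x in unit_leb. rep_l2 (a *\<^sub>R u + b *\<^sub>R v) x = a * rep_l2 u x + b * rep_l2 v x"
proof -
  have "square_integrable (\<lambda>x. a * rep_l2 u x + b * rep_l2 v x)"
    by (intro square_integrable_add square_integrable_scale square_integrable_rep)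
  from rep_abs_l2[OF this] show ?thesis
    by (simp add: abs_l2_linear square_integrable_rep abs_rep_l2)
qed

lemma AE_rep_one: "AE x in unit_leb. rep_l2 one x = 1"
  unfolding one_def by (rule rep_abs_l2[OF square_integrable_const])

lemma AE_test_nonneg:
  assumes "\<psi> \<in> test_functions" "\<And>x. 0 \<le> \<psi> x"
  shows "AE x in unit_leb. 0 \<le> rep_l2 (abs_l2 \<psi>) x"
  using rep_abs_l2[OF square_integrable_test_function(1)[OF assms(1)]]
  by eventually_elim (use assms(2) in simp)

lemma le_const_AE: "le_const u c \<longleftrightarrow> (AE x in unit_leb. rep_l2 u x \<le> c)"
proof
  assume le: "le_const u c"
  have "AE x in unit_leb. 0 \<le> rep_l2 (c *\<^sub>R one + (-1) *\<^sub>R u) x"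
  proof (rule nonneg_l2I)
    fix \<phi> assume "\<phi> \<in> test_functions" "\<And>x. 0 \<le> \<phi> x"
    then show "0 \<le> inner (c *\<^sub>R one + (-1) *\<^sub>R u) (abs_l2 \<phi>)"
      using le by (simp add: le_const_def inner_diff_left)
  qed
  then show "AE x in unit_leb. rep_l2 u x \<le> c"
    using AE_rep_lincomb[of c one "-1" u] AE_rep_one by eventually_elim simp
next
  assume le: "AE x in unit_leb. rep_l2 u x \<le> c"
  have "AE x in unit_leb. 0 \<le> rep_l2 (c *\<^sub>R one + (-1) *\<^sub>R u) x"
    using AE_rep_lincomb[of c one "-1" u] AE_rep_one le by eventually_elim simp
  then have "0 \<le> inner (c *\<^sub>R one + (-1) *\<^sub>R u) (abs_l2 \<psi>)" if "\<psi> \<in> test_functions" "\<And>x. 0 \<le> \<psi> x" for \<psi>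
    using that by (intro inner_nonneg_l2 AE_test_nonneg)
  then show "le_const u c" by (auto simp: le_const_def inner_diff_left)
qed

lemma inner_one_test_nonneg: "\<psi> \<in> test_functions \<Longrightarrow> (\<And>x. 0 \<le> \<psi> x) \<Longrightarrow> 0 \<le> inner one (abs_l2 \<psi>)"
  using AE_rep_one by (intro inner_nonneg_l2 AE_test_nonneg) (auto elim: AE_mp)

lemma inner_test_le:
  assumes f: "continuous_on UNIV f" "\<And>x. 0 \<le> x \<Longrightarrow> x \<le> 1 \<Longrightarrow> f x \<le> c"
    and \<psi>: "\<psi> \<in> test_functions" "\<And>x. 0 \<le> \<psi> x"
  shows "inner (abs_l2 f) (abs_l2 \<psi>) \<le> c * inner one (abs_l2 \<psi>)"
proof -
  note sq = square_integrable_continuous[OF f(1)]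
  have "AE x in unit_leb. rep_l2 (abs_l2 f) x \<le> c"
    using rep_abs_l2[OF sq] AE_space[of unit_leb] by eventually_elim (use f(2) in auto)
  then show ?thesis using \<psi> unfolding le_const_AE[symmetric] le_const_def by blast
qed

text \<open>The maximum principle for sine sums carries over by uniform approximation.\<close>

lemma heat_semigroup_test_le:
  assumes t: "0 \<le> t" and \<phi>: "\<phi> \<in> test_functions" "\<And>x. 0 \<le> x \<Longrightarrow> x \<le> 1 \<Longrightarrow> \<phi> x \<le> C" and C: "0 \<le> C"
    and \<psi>: "\<psi> \<in> test_functions" "\<And>x. 0 \<le> \<psi> x"
  shows "inner (heat_semigroup t (abs_l2 \<phi>)) (abs_l2 \<psi>) \<le> C * inner one (abs_l2 \<psi>)"
proof (rule field_le_epsilon)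
  fix e :: real assume e: "0 < e"
  define K where "K = inner one (abs_l2 \<psi>) + norm (abs_l2 \<psi>) + 1"
  have K: "K > 0" unfolding K_def using inner_one_test_nonneg[OF \<psi>] by (intro add_nonneg_pos add_nonneg_nonneg) auto
  define \<epsilon> where "\<epsilon> = e / K"
  have \<epsilon>: "\<epsilon> > 0" using e K by (simp add: \<epsilon>_def)
  obtain g where g: "g \<in> sine_polynomials" "\<And>x. 0 \<le> x \<Longrightarrow> x \<le> 1 \<Longrightarrow> \<bar>\<phi> x - g x\<bar> \<le> \<epsilon>"
    using sine_polynomial_approx[OF \<phi>(1) \<epsilon>] by blast
  obtain N c where gs: "g = (\<lambda>x. \<Sum>k<N. c k * sine k x)" using sine_polynomial_sum[OF g(1)] by blast
  have sq: "square_integrable \<phi>" "square_integrable g"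
    using continuous_on_test_function[OF \<phi>(1)] continuous_on_sine_polynomial[OF g(1)]
    by (auto intro: square_integrable_continuous)
  have "g x \<le> C + \<epsilon>" if "0 \<le> x" "x \<le> 1" for x using g(2)[OF that] \<phi>(2)[OF that] by linarith
  then have "inner (heat_semigroup t (abs_l2 g)) (abs_l2 \<psi>) \<le> (C + \<epsilon>) * inner one (abs_l2 \<psi>)"
    unfolding gs heat_semigroup_sine_sum[OF t]
    using C \<epsilon> t by (intro inner_test_le \<psi> sine_sum_maximum_principle continuous_intros continuous_on_sine) auto
  moreover have "inner (heat_semigroup t (abs_l2 \<phi> - abs_l2 g)) (abs_l2 \<psi>) \<le> \<epsilon> * norm (abs_l2 \<psi>)"
  proof -
    have "inner (heat_semigroup t (abs_l2 \<phi> - abs_l2 g)) (abs_l2 \<psi>) \<le> norm (heat_semigroup t (abs_l2 \<phi> - abs_l2 g)) * norm (abs_l2 \<psi>)"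
      by (rule norm_cauchy_schwarz)
    also have "\<dots> \<le> norm (abs_l2 \<phi> - abs_l2 g) * norm (abs_l2 \<psi>)"
      by (intro mult_right_mono norm_heat_semigroup_le t) simp
    also have "\<dots> \<le> \<epsilon> * norm (abs_l2 \<psi>)"
      using norm_abs_l2_le[OF square_integrable_diff[OF sq], of \<epsilon>] g(2) \<epsilon>
      by (intro mult_right_mono) (auto simp: abs_l2_diff sq)
    finally show ?thesis .
  qed
  moreover have "heat_semigroup t (abs_l2 \<phi> - abs_l2 g) = heat_semigroup t (abs_l2 \<phi>) - heat_semigroup t (abs_l2 g)"
    using bounded_linear.linear[OF heat_semigroup_bounded_linear[OF t]] by (simp add: linear_diff)
  ultimately have "inner (heat_semigroup t (abs_l2 \<phi>)) (abs_l2 \<psi>) \<le> C * inner one (abs_l2 \<psi>) + \<epsilon> * (inner one (abs_l2 \<psi>) + norm (abs_l2 \<psi>))"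
    by (simp add: inner_diff_left algebra_simps)
  also have "\<epsilon> * (inner one (abs_l2 \<psi>) + norm (abs_l2 \<psi>)) \<le> \<epsilon> * K" using \<epsilon> by (simp add: K_def)
  also have "\<epsilon> * K = e" using K by (simp add: \<epsilon>_def)
  finally show "inner (heat_semigroup t (abs_l2 \<phi>)) (abs_l2 \<psi>) \<le> C * inner one (abs_l2 \<psi>) + e" by simp
qed

lemma heat_semigroup_test_nonneg:
  assumes t: "0 \<le> t" and \<phi>: "\<phi> \<in> test_functions" "\<And>x. 0 \<le> \<phi> x"
  shows "AE x in unit_leb. 0 \<le> rep_l2 (heat_semigroup t (abs_l2 \<phi>)) x"
proof (rule nonneg_l2I)
  fix \<psi> assume \<psi>: "\<psi> \<in> test_functions" "\<And>x. 0 \<le> \<psi> x"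
  have m\<phi>: "(\<lambda>x. (-1) * \<phi> x + 0 * \<phi> x) \<in> test_functions" by (rule test_functions_linear[OF \<phi>(1) \<phi>(1)])
  have "inner (heat_semigroup t (abs_l2 (\<lambda>x. (-1) * \<phi> x + 0 * \<phi> x))) (abs_l2 \<psi>) \<le> 0 * inner one (abs_l2 \<psi>)"
    by (rule heat_semigroup_test_le[OF t m\<phi> _ _ \<psi>]) (use \<phi> in auto)
  moreover have "abs_l2 (\<lambda>x. (-1) * \<phi> x + 0 * \<phi> x) = - abs_l2 \<phi>"
    using square_integrable_test_function[OF \<phi>(1)] by (subst abs_l2_linear) auto
  ultimately show "0 \<le> inner (heat_semigroup t (abs_l2 \<phi>)) (abs_l2 \<psi>)"
    using bounded_linear.linear[OF heat_semigroup_bounded_linear[OF t]] by (simp add: linear_neg)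
qed

lemma heat_semigroup_integral_test_le:
  assumes t: "0 \<le> t" and \<psi>: "\<psi> \<in> test_functions" "\<And>x. 0 \<le> \<psi> x"
  shows "inner one (heat_semigroup t (abs_l2 \<psi>)) \<le> inner one (abs_l2 \<psi>)"
proof -
  define N where "N n = real (n + 2)" for n
  define cutoff where "cutoff n = bump (N n) (1/(N n)\<^sup>2) (1 - 1/(N n)\<^sup>2)" for n
  have N: "N n > 0" for n by (simp add: N_def)
  have test: "cutoff n \<in> test_functions" for n
    unfolding cutoff_def using N[of n] by (intro bump_test_function) auto
  have "(\<lambda>n. abs_l2 (cutoff n)) \<longlonglongrightarrow> one"
    unfolding one_def
  proof (rule abs_l2_tendsto)
    fix x :: real assume x: "0 < x" "x < 1"
    have "(\<lambda>n. flat 0 (N n * (x - 1/(N n)\<^sup>2)) * flat 0 (N n * ((1-x) - 1/(N n)\<^sup>2))) \<longlonglongrightarrow> 1 * 1"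
      unfolding N_def using x by (intro tendsto_mult scaled_flat_tendsto) auto
    moreover have "cutoff n x = flat 0 (N n * (x - 1/(N n)\<^sup>2)) * flat 0 (N n * ((1-x) - 1/(N n)\<^sup>2))" for n
      by (simp add: cutoff_def bump_def algebra_simps)
    ultimately show "(\<lambda>n. cutoff n x) \<longlonglongrightarrow> 1" by simp
    show "\<bar>cutoff n x\<bar> \<le> 1" for n by (simp add: cutoff_def bump_nonneg bump_le_1)
  qed (auto intro: continuous_on_test_function test)
  then have "(\<lambda>n. inner (abs_l2 (cutoff n)) (heat_semigroup t (abs_l2 \<psi>))) \<longlonglongrightarrow> inner one (heat_semigroup t (abs_l2 \<psi>))"
    by (intro tendsto_inner tendsto_const)
  moreover have "inner (abs_l2 (cutoff n)) (heat_semigroup t (abs_l2 \<psi>)) \<le> inner one (abs_l2 \<psi>)" for n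
    using heat_semigroup_test_le[OF t test _ _ \<psi>, of n 1] t
    by (simp add: inner_heat_semigroup cutoff_def bump_le_1)
  ultimately show ?thesis by (intro LIMSEQ_le_const2) auto
qed

text \<open>By self-adjointness the semigroup can be moved to the test function, which it keeps nonnegative and
  whose integral it does not increase.\<close>

lemma heat_semigroup_le_const:
  assumes t: "0 \<le> t" and u: "le_const u c" and c: "0 \<le> c"
  shows "le_const (heat_semigroup t u) c"
  unfolding le_const_def
proof (intro ballI impI)
  fix \<psi> assume \<psi>: "\<psi> \<in> test_functions" "\<forall>x. 0 \<le> \<psi> x"
  have "AE x in unit_leb. 0 \<le> rep_l2 (c *\<^sub>R one + (-1) *\<^sub>R u) x"
    using AE_rep_lincomb[of c one "-1" u] AE_rep_one u[unfolded le_const_AE] by eventually_elim simp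
  then have "0 \<le> inner (c *\<^sub>R one + (-1) *\<^sub>R u) (heat_semigroup t (abs_l2 \<psi>))"
    using \<psi> by (intro inner_nonneg_l2 heat_semigroup_test_nonneg t) auto
  then have "inner u (heat_semigroup t (abs_l2 \<psi>)) \<le> c * inner one (heat_semigroup t (abs_l2 \<psi>))"
    by (simp add: inner_diff_left)
  also have "\<dots> \<le> c * inner one (abs_l2 \<psi>)"
    using \<psi> by (intro mult_left_mono heat_semigroup_integral_test_le t c) auto
  finally show "inner (heat_semigroup t u) (abs_l2 \<psi>) \<le> c * inner one (abs_l2 \<psi>)"
    by (simp add: inner_heat_semigroup t)
qed

section \<open>Sobolev embedding and superposition operators\<close>

text \<open>For a test function, \<open>\<phi>(x) \<le> \<integral>\<bar>\<phi>'\<bar> \<le> \<parallel>\<phi>'\<parallel>\<close>; the estimate passes to the closure.\<close>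

lemma H10_le_const: "le_const (of_h10 u) (norm u)"
  unfolding le_const_def
proof (intro ballI impI)
  fix \<psi> assume \<psi>: "\<psi> \<in> test_functions" "\<forall>x. 0 \<le> \<psi> x"
  have "H10_graph \<subseteq> {p. inner (fst p) (abs_l2 \<psi>) \<le> norm p * inner one (abs_l2 \<psi>)}"
    unfolding H10_graph_def
  proof (rule closure_minimal)
    show "closed {p. inner (fst p) (abs_l2 \<psi>) \<le> norm p * inner one (abs_l2 \<psi>)}"
      by (intro closed_Collect_le continuous_intros)
    show "(\<lambda>\<phi>. (abs_l2 \<phi>, abs_l2 (deriv \<phi>))) ` test_functions \<subseteq> {p. inner (fst p) (abs_l2 \<psi>) \<le> norm p * inner one (abs_l2 \<psi>)}"
    proof clarify
      fix \<phi> assume \<phi>: "\<phi> \<in> test_functions"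
      define D where "D x = \<bar>deriv \<phi> x\<bar>" for x
      have cD: "continuous_on S D" for S
        unfolding D_def by (intro continuous_intros continuous_on_deriv_test_function \<phi>)
      have "integral {0..1} D = inner (abs_l2 D) one"
        using inner_abs_continuous[OF cD continuous_on_const, of 1] by (simp add: one_def)
      also have "\<dots> \<le> norm (abs_l2 D) * norm one" by (rule norm_cauchy_schwarz)
      also have "\<dots> = norm (abs_l2 (deriv \<phi>))"
        unfolding one_def norm_one_l2 D_def using square_integrable_test_function(2)[OF \<phi>] by (simp add: norm_abs_l2_abs)
      also have "\<dots> \<le> norm (abs_l2 \<phi>, abs_l2 (deriv \<phi>))"
        using norm_snd_le[of "abs_l2 (deriv \<phi>)" "abs_l2 \<phi>"] by simp
      finally have I: "integral {0..1} D \<le> norm (abs_l2 \<phi>, abs_l2 (deriv \<phi>))" .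
      have "\<phi> x \<le> norm (abs_l2 \<phi>, abs_l2 (deriv \<phi>))" if x: "0 \<le> x" "x \<le> 1" for x
      proof -
        have "(deriv \<phi> has_integral (\<phi> x - \<phi> 0)) {0..x}"
          using x DERIV_test_function[OF \<phi>]
          by (intro fundamental_theorem_of_calculus)
            (auto simp: has_real_derivative_iff_has_vector_derivative[symmetric] intro: has_field_derivative_at_within)
        then have "\<phi> x = integral {0..x} (deriv \<phi>)"
          using test_function_outside[OF \<phi>, of 0] by (simp add: integral_unique)
        also have "\<dots> \<le> integral {0..x} D"
          by (intro integral_le integrable_continuous_interval continuous_on_deriv_test_function \<phi> cD) (simp add: D_def)
        also have "\<dots> \<le> integral {0..1} D"
          using x by (intro integral_subset_le integrable_continuous_interval cD) (auto simp: D_def)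
        finally show ?thesis using I by simp
      qed
      then show "inner (fst (abs_l2 \<phi>, abs_l2 (deriv \<phi>))) (abs_l2 \<psi>) \<le> norm (abs_l2 \<phi>, abs_l2 (deriv \<phi>)) * inner one (abs_l2 \<psi>)"
        using inner_test_le[OF continuous_on_test_function[OF \<phi>], of "norm (abs_l2 \<phi>, abs_l2 (deriv \<phi>))" \<psi>] \<psi> by simp
    qed
  qed
  then show "inner (of_h10 u) (abs_l2 \<psi>) \<le> norm u * inner one (abs_l2 \<psi>)"
    using Rep_h10[of u] by (auto simp: of_h10_def norm_h10.rep_eq)
qed

definition abs_le_const :: "l2 \<Rightarrow> real \<Rightarrow> bool" where
  "abs_le_const u c \<longleftrightarrow> (AE x in unit_leb. \<bar>rep_l2 u x\<bar> \<le> c)"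

lemma AE_rep_minus: "AE x in unit_leb. rep_l2 (- u) x = - rep_l2 u x"
  using AE_rep_lincomb[of "-1" u 0 u] by simp

lemma AE_rep_diff: "AE x in unit_leb. rep_l2 (u - v) x = rep_l2 u x - rep_l2 v x"
  using AE_rep_lincomb[of 1 u "-1" v] by simp

lemma abs_le_constI:
  assumes "le_const u c" "le_const (- u) c"
  shows "abs_le_const u c"
  unfolding abs_le_const_def
  using assms[unfolded le_const_AE] AE_rep_minus[of u] by eventually_elim auto

lemma abs_le_constD: "abs_le_const u c \<Longrightarrow> le_const u c" "abs_le_const u c \<Longrightarrow> le_const (- u) c"
  unfolding le_const_AE abs_le_const_def using AE_rep_minus[of u] by (auto elim: AE_mp)

lemma H10_abs_le_const: "abs_le_const (of_h10 u) (norm u)"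
  using H10_le_const[of u] H10_le_const[of "- u"] by (intro abs_le_constI) (auto simp: of_h10_minus)

lemma abs_le_const_mono: "abs_le_const u c \<Longrightarrow> c \<le> d \<Longrightarrow> abs_le_const u d"
  unfolding abs_le_const_def by (auto elim: AE_mp)

lemma square_integrable_AE_bounded:
  assumes "f \<in> borel_measurable unit_leb" "AE x in unit_leb. \<bar>f x\<bar> \<le> c"
  shows "square_integrable f"
  unfolding square_integrable_def
proof
  show "integrable unit_leb (\<lambda>x. (f x)\<^sup>2)"
  proof (rule Bochner_Integration.integrable_bound)
    show "integrable unit_leb (\<lambda>x. c\<^sup>2)" using square_integrable_integrable[OF square_integrable_const] .
    show "AE x in unit_leb. norm ((f x)\<^sup>2) \<le> norm (c\<^sup>2)"
      using assms(2) by eventually_elim (use power_mono[OF _ abs_ge_zero, of _ _ 2] in fastforce)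
  qed (use assms in simp)
qed (rule assms)

lemma continuous_bounded_on_interval:
  fixes f :: "real \<Rightarrow> real"
  assumes "continuous_on UNIV f"
  obtains B where "0 \<le> B" "\<And>s. \<bar>s\<bar> \<le> R \<Longrightarrow> \<bar>f s\<bar> \<le> B"
proof -
  have "compact (f ` {-R..R})"
    by (intro compact_continuous_image continuous_on_subset[OF assms]) auto
  then obtain B where "\<And>y. y \<in> f ` {-R..R} \<Longrightarrow> \<bar>y\<bar> \<le> B"
    using compact_imp_bounded bounded_iff by (metis real_norm_def)
  moreover have "f s \<in> f ` {-R..R}" if "\<bar>s\<bar> \<le> R" for s using that by (intro imageI) auto
  ultimately have "\<bar>f s\<bar> \<le> max B 0" if "\<bar>s\<bar> \<le> R" for s using that by (meson max.coboundedI1)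
  then show ?thesis using that[of "max B 0"] by simp
qed

lemma AE_rep_superpose:
  assumes f: "continuous_on UNIV f"
  shows "AE x in unit_leb. rep_l2 (superpose f u) x = f (rep_l2 (of_h10 u) x)"
  unfolding superpose_def
proof (rule rep_abs_l2)
  obtain B where B: "0 \<le> B" "\<And>s. \<bar>s\<bar> \<le> norm u \<Longrightarrow> \<bar>f s\<bar> \<le> B"
    using continuous_bounded_on_interval[OF f] by blast
  show "square_integrable (\<lambda>x. f (rep_l2 (of_h10 u) x))"
  proof (rule square_integrable_AE_bounded[where c = B])
    have "rep_l2 (of_h10 u) \<in> borel_measurable unit_leb"
      using square_integrable_rep by (auto simp: square_integrable_def)
    then show "(\<lambda>x. f (rep_l2 (of_h10 u) x)) \<in> borel_measurable unit_leb"
      by (rule measurable_compose[OF _ borel_measurable_continuous_onI[OF f]])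
    show "AE x in unit_leb. \<bar>f (rep_l2 (of_h10 u) x)\<bar> \<le> B"
      using H10_abs_le_const[of u, unfolded abs_le_const_def] by eventually_elim (rule B)
  qed
qed

lemma norm_superpose_le:
  assumes f: "continuous_on UNIV f" and u: "abs_le_const (of_h10 u) R"
    and B: "0 \<le> B" "\<And>s. \<bar>s\<bar> \<le> R \<Longrightarrow> \<bar>f s\<bar> \<le> B"
  shows "norm (superpose f u) \<le> B"
proof (rule norm_le_AE[OF _ B(1)])
  show "AE x in unit_leb. \<bar>rep_l2 (superpose f u) x\<bar> \<le> B"
    using AE_rep_superpose[OF f, of u] u[unfolded abs_le_const_def] by eventually_elim (simp add: B)
qed

lemma continuous_on_superpose:
  assumes f: "continuous_on UNIV f"
  shows "continuous_on UNIV (superpose f)"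
  unfolding continuous_on_iff
proof (intro ballI allI impI)
  fix u :: h10 and e :: real assume e: "0 < e"
  define R where "R = norm u + 1"
  have "uniformly_continuous_on {-R..R} f"
    by (intro compact_uniformly_continuous continuous_on_subset[OF f]) auto
  then obtain d where d: "d > 0" "\<And>s t. \<bar>s\<bar> \<le> R \<Longrightarrow> \<bar>t\<bar> \<le> R \<Longrightarrow> \<bar>s - t\<bar> < d \<Longrightarrow> \<bar>f s - f t\<bar> < e / 2"
    unfolding uniformly_continuous_on_def dist_real_def using e
    by (metis half_gt_zero abs_le_iff atLeastAtMost_iff minus_le_iff)
  show "\<exists>d>0. \<forall>v\<in>UNIV. dist v u < d \<longrightarrow> dist (superpose f v) (superpose f u) < e"
  proof (intro exI[of _ "min d 1"] conjI ballI impI)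
    fix v assume v: "dist v u < min d 1"
    have nv: "norm v \<le> R" using norm_triangle_ineq2[of v u] v by (simp add: R_def dist_norm)
    have "norm (superpose f v - superpose f u) \<le> e / 2"
    proof (rule norm_le_AE)
      show "AE x in unit_leb. \<bar>rep_l2 (superpose f v - superpose f u) x\<bar> \<le> e / 2"
        using AE_rep_diff[of "superpose f v" "superpose f u"] AE_rep_superpose[OF f, of u] AE_rep_superpose[OF f, of v]
          H10_abs_le_const[of u, unfolded abs_le_const_def] H10_abs_le_const[of v, unfolded abs_le_const_def]
          H10_abs_le_const[of "v - u", unfolded abs_le_const_def of_h10_diff] AE_rep_diff[of "of_h10 v" "of_h10 u"]
      proof eventually_elim
        case (elim x)
        have "\<bar>f (rep_l2 (of_h10 v) x) - f (rep_l2 (of_h10 u) x)\<bar> < e / 2"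
        proof (rule d(2))
          show "\<bar>rep_l2 (of_h10 v) x\<bar> \<le> R" using elim(5) nv by linarith
          show "\<bar>rep_l2 (of_h10 u) x\<bar> \<le> R" using elim(4) by (simp add: R_def)
          show "\<bar>rep_l2 (of_h10 v) x - rep_l2 (of_h10 u) x\<bar> < d" using elim(6,7) v by (simp add: dist_norm)
        qed
        then show ?case using elim by simp
      qed
    qed (use e in simp)
    then show "dist (superpose f v) (superpose f u) < e" using e by (simp add: dist_norm)
  qed (use d in simp)
qed

section \<open>Diagonal linear evolution equations\<close>

text \<open>Multiplying the \<open>k\<close>-th equation by \<open>ev k * y k\<close> and integrating: the forcing enters the
  energy of the modes \<open>k \<ge> N\<close> only through \<open>G\<^sup>2 / ev N\<close>. This uniform smallness of the high
  modes replaces all compact embeddings.\<close>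

lemma energy_tail:
  fixes y h :: "nat \<Rightarrow> real \<Rightarrow> real"
  assumes F: "finite F" "\<And>k. k \<in> F \<Longrightarrow> N \<le> k" and p0: "0 < p0"
    and cont: "\<And>k. k \<in> F \<Longrightarrow> continuous_on {0..T} (y k)"
    and der: "\<And>k s. k \<in> F \<Longrightarrow> 0 < s \<Longrightarrow> s < T \<Longrightarrow> (y k has_real_derivative - ev k * P s * y k s + h k s) (at s)"
    and P: "\<And>s. 0 < s \<Longrightarrow> s < T \<Longrightarrow> p0 \<le> P s"
    and h: "\<And>s. 0 < s \<Longrightarrow> s < T \<Longrightarrow> (\<Sum>k\<in>F. (h k s)\<^sup>2) \<le> G\<^sup>2"
    and \<tau>: "0 \<le> \<tau>" "\<tau> \<le> T"
  shows "(\<Sum>k\<in>F. ev k * (y k \<tau>)\<^sup>2) \<le> (\<Sum>k\<in>F. ev k * (y k 0)\<^sup>2) + G\<^sup>2 / (p0\<^sup>2 * ev N)"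
proof -
  define L where "L = ev N * p0"
  have L: "L > 0" using p0 ev_pos by (simp add: L_def)
  \<comment> \<open>the equilibrium of the inequality \<open>E' \<le> - L E + G\<^sup>2 / p0\<close> satisfied by the energy \<open>E\<close> of the modes in \<open>F\<close>\<close>
  define C where "C = G\<^sup>2 / (p0\<^sup>2 * ev N)"
  have C: "0 \<le> C" using p0 ev_pos[of N] by (simp add: C_def)
  have CL: "C * L = G\<^sup>2 / p0" using p0 ev_pos[of N] by (simp add: C_def L_def field_simps power2_eq_square)
  define Z where "Z s = exp (L * s) * ((\<Sum>k\<in>F. ev k * (y k s)\<^sup>2) - C)" for s
  have "Z \<tau> \<le> Z 0"
  proof (rule DERIV_nonpos_imp_decreasing_open[OF \<tau>(1)])
    show "continuous_on {0..\<tau>} Z"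
      unfolding Z_def using \<tau> by (intro continuous_intros continuous_on_subset[OF cont]) auto
    fix s assume "0 < s" "s < \<tau>"
    then have s: "0 < s" "s < T" using \<tau> by auto
    define R where "R = (\<Sum>k\<in>F. ev k * (2 * y k s * (- ev k * P s * y k s + h k s)))"
    have "((\<lambda>s. \<Sum>k\<in>F. ev k * (y k s)\<^sup>2) has_real_derivative R) (at s)"
      unfolding R_def
    proof (intro DERIV_sum DERIV_cmult)
      fix k assume "k \<in> F"
      from DERIV_power[OF der[OF this s], of 2]
      show "((\<lambda>s. (y k s)\<^sup>2) has_real_derivative 2 * y k s * (- ev k * P s * y k s + h k s)) (at s)"
        by (simp add: mult_ac)
    qed
    moreover have "((\<lambda>s. exp (L * s)) has_real_derivative exp (L * s) * L) (at s)"
      by (auto intro!: derivative_eq_intros)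
    ultimately have D: "(Z has_real_derivative exp (L * s) * L * ((\<Sum>k\<in>F. ev k * (y k s)\<^sup>2) - C) + R * exp (L * s)) (at s)"
      unfolding Z_def using DERIV_mult DERIV_diff[OF _ DERIV_const] by fastforce
    have "L * (\<Sum>k\<in>F. ev k * (y k s)\<^sup>2) + R = (\<Sum>k\<in>F. L * (ev k * (y k s)\<^sup>2) + ev k * (2 * y k s * (- ev k * P s * y k s + h k s)))"
      by (simp add: R_def sum_distrib_left sum.distrib)
    also have "\<dots> \<le> (\<Sum>k\<in>F. (h k s)\<^sup>2 / p0)"
    proof (rule sum_mono)
      fix k assume k: "k \<in> F"
      define z where "z = ev k * y k s"
      have z: "ev k * (y k s)\<^sup>2 * ev k = z\<^sup>2" by (simp add: z_def power2_eq_square)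
      have "L * (ev k * (y k s)\<^sup>2) \<le> p0 * z\<^sup>2"
      proof -
        have "ev N * (p0 * (ev k * (y k s)\<^sup>2)) \<le> ev k * (p0 * (ev k * (y k s)\<^sup>2))"
          using ev_mono[OF F(2)[OF k]] p0 ev_pos[of k] by (intro mult_right_mono) auto
        then show ?thesis by (simp add: L_def mult_ac z[symmetric])
      qed
      moreover have "p0 * z\<^sup>2 \<le> P s * z\<^sup>2" using P[OF s] by (intro mult_right_mono) auto
      moreover have "ev k * (2 * y k s * (- ev k * P s * y k s + h k s)) = - 2 * (P s * z\<^sup>2) + 2 * z * h k s"
        by (simp add: z_def power2_eq_square algebra_simps)
      moreover have "2 * z * h k s \<le> p0 * z\<^sup>2 + (h k s)\<^sup>2 / p0"
      proof -
        have "0 \<le> (p0 * z - h k s)\<^sup>2 / p0" using p0 by simp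
        also have "\<dots> = p0 * z\<^sup>2 + (h k s)\<^sup>2 / p0 - 2 * z * h k s"
          using p0 by (simp add: power2_eq_square field_simps)
        finally show ?thesis by simp
      qed
      ultimately show "L * (ev k * (y k s)\<^sup>2) + ev k * (2 * y k s * (- ev k * P s * y k s + h k s)) \<le> (h k s)\<^sup>2 / p0"
        by linarith
    qed
    also have "\<dots> \<le> G\<^sup>2 / p0"
      using h[OF s] p0 by (simp add: sum_divide_distrib[symmetric] divide_right_mono)
    finally have "L * ((\<Sum>k\<in>F. ev k * (y k s)\<^sup>2) - C) + R \<le> 0" using CL by (simp add: algebra_simps)
    then have "exp (L * s) * (L * ((\<Sum>k\<in>F. ev k * (y k s)\<^sup>2) - C) + R) \<le> 0"
      by (simp add: mult_le_0_iff)
    then have "exp (L * s) * L * ((\<Sum>k\<in>F. ev k * (y k s)\<^sup>2) - C) + R * exp (L * s) \<le> 0"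
      by (simp add: algebra_simps)
    with D show "\<exists>d. (Z has_real_derivative d) (at s) \<and> d \<le> 0" by blast
  qed
  then have "exp (L * \<tau>) * ((\<Sum>k\<in>F. ev k * (y k \<tau>)\<^sup>2) - C) \<le> (\<Sum>k\<in>F. ev k * (y k 0)\<^sup>2) - C" by (simp add: Z_def)
  then have "(\<Sum>k\<in>F. ev k * (y k \<tau>)\<^sup>2) - C \<le> exp (- (L * \<tau>)) * ((\<Sum>k\<in>F. ev k * (y k 0)\<^sup>2) - C)"
    by (simp add: exp_minus field_simps)
  also have "\<dots> \<le> exp (- (L * \<tau>)) * (\<Sum>k\<in>F. ev k * (y k 0)\<^sup>2)"
    using C by (intro mult_left_mono) auto
  also have "\<dots> \<le> 1 * (\<Sum>k\<in>F. ev k * (y k 0)\<^sup>2)"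
    using L \<tau> ev_pos by (intro mult_right_mono sum_nonneg) (auto simp: less_imp_le)
  finally show ?thesis by (simp add: C_def)
qed

text \<open>Ranging over finite index sets, the bound on the tail carries its own summability.\<close>

definition tail_le :: "nat \<Rightarrow> (nat \<Rightarrow> real) \<Rightarrow> real \<Rightarrow> bool" where
  "tail_le N c \<epsilon> \<longleftrightarrow> (\<forall>F. finite F \<longrightarrow> F \<subseteq> {N..} \<longrightarrow> (\<Sum>k\<in>F. (1 + ev k) * (c k)\<^sup>2) \<le> \<epsilon>)"

lemma tail_leD: "tail_le N c \<epsilon> \<Longrightarrow> finite F \<Longrightarrow> F \<subseteq> {N..} \<Longrightarrow> (\<Sum>k\<in>F. (1 + ev k) * (c k)\<^sup>2) \<le> \<epsilon>"
  by (simp add: tail_le_def)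

lemma tail_leI:
  "(\<And>F. finite F \<Longrightarrow> F \<subseteq> {N..} \<Longrightarrow> (\<Sum>k\<in>F. (1 + ev k) * (c k)\<^sup>2) \<le> \<epsilon>) \<Longrightarrow> tail_le N c \<epsilon>"
  by (simp add: tail_le_def)

lemma h10_norm_split:
  assumes "tail_le N (coef (of_h10 u)) \<epsilon>"
  shows "(norm u)\<^sup>2 \<le> (\<Sum>k<N. (1 + ev k) * (coef (of_h10 u) k)\<^sup>2) + \<epsilon>"
proof (rule LIMSEQ_le_const2)
  show "(\<lambda>n. \<Sum>k<n. (1 + ev k) * (coef (of_h10 u) k)\<^sup>2) \<longlonglongrightarrow> (norm u)\<^sup>2"
    using h10_norm_sums by (simp add: sums_def)
  have "(\<Sum>k<n. (1 + ev k) * (coef (of_h10 u) k)\<^sup>2) \<le> (\<Sum>k<N. (1 + ev k) * (coef (of_h10 u) k)\<^sup>2) + \<epsilon>" if "N \<le> n" for n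
  proof -
    have eq: "{..<N} \<union> {N..<n} = {..<n}" using that by auto
    have "(\<Sum>k\<in>{..<N} \<union> {N..<n}. (1 + ev k) * (coef (of_h10 u) k)\<^sup>2)
        = (\<Sum>k<N. (1 + ev k) * (coef (of_h10 u) k)\<^sup>2) + (\<Sum>k=N..<n. (1 + ev k) * (coef (of_h10 u) k)\<^sup>2)"
      by (rule sum.union_disjoint) auto
    moreover have "(\<Sum>k=N..<n. (1 + ev k) * (coef (of_h10 u) k)\<^sup>2) \<le> \<epsilon>"
      by (rule tail_leD[OF assms]) auto
    ultimately show ?thesis unfolding eq by linarith
  qed
  then show "\<exists>M. \<forall>n\<ge>M. (\<Sum>k<n. (1 + ev k) * (coef (of_h10 u) k)\<^sup>2) \<le> (\<Sum>k<N. (1 + ev k) * (coef (of_h10 u) k)\<^sup>2) + \<epsilon>" by blast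
qed

text \<open>Low modes converge by assumption and high modes are uniformly small, so the sequence is Cauchy.\<close>

lemma uniform_limit_by_coefs:
  fixes w :: "nat \<Rightarrow> 'a \<Rightarrow> h10"
  assumes tail: "\<And>\<epsilon>. 0 < \<epsilon> \<Longrightarrow> \<exists>N M. \<forall>n\<ge>M. \<forall>s\<in>S. tail_le N (coef (of_h10 (w n s))) \<epsilon>"
    and lim: "\<And>k. \<exists>g. uniform_limit S (\<lambda>n s. coef (of_h10 (w n s)) k) g sequentially"
  shows "\<exists>v. uniform_limit S w v sequentially"
proof -
  have "uniformly_Cauchy_on S w"
    unfolding uniformly_Cauchy_on_def
  proof (intro allI impI)
    fix e :: real assume e: "e > 0"
    define \<epsilon> where "\<epsilon> = e\<^sup>2 / 8"
    have \<epsilon>: "\<epsilon> > 0" using e by (simp add: \<epsilon>_def)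
    obtain N M where NM: "\<And>n s. n \<ge> M \<Longrightarrow> s \<in> S \<Longrightarrow> tail_le N (coef (of_h10 (w n s))) \<epsilon>"
      using tail[OF \<epsilon>] by blast
    have "\<exists>g. \<forall>k. uniform_limit S (\<lambda>n s. coef (of_h10 (w n s)) k) (g k) sequentially"
      by (rule choice) (use lim in blast)
    then obtain g where g: "\<And>k. uniform_limit S (\<lambda>n s. coef (of_h10 (w n s)) k) (g k) sequentially"
      by blast
    define W where "W = (\<Sum>k<N. 1 + ev k) + 1"
    have W: "W > 0" unfolding W_def by (intro add_nonneg_pos sum_nonneg) (auto intro!: add_nonneg_nonneg less_imp_le[OF ev_pos])
    define d where "d = min 1 (\<epsilon> / W)"
    have d: "0 < d" "d \<le> 1" "d * W \<le> \<epsilon>" using \<epsilon> W by (auto simp: d_def min_def field_simps)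
    have "\<forall>\<^sub>F n in sequentially. \<forall>k\<in>{..<N}. \<forall>s\<in>S. dist (coef (of_h10 (w n s)) k) (g k s) < d / 2"
      using d(1) uniform_limitD[OF g, of "d / 2"] by (intro eventually_ball_finite) auto
    then obtain M' where M': "\<And>n k s. n \<ge> M' \<Longrightarrow> k < N \<Longrightarrow> s \<in> S \<Longrightarrow> dist (coef (of_h10 (w n s)) k) (g k s) < d / 2"
      unfolding eventually_sequentially by blast
    have "dist (w m s) (w n s) < e" if mn: "m \<ge> max M M'" "n \<ge> max M M'" and s: "s \<in> S" for m n s
    proof -
      let ?a = "\<lambda>k. coef (of_h10 (w m s)) k" and ?b = "\<lambda>k. coef (of_h10 (w n s)) k"
      have "(norm (w m s - w n s))\<^sup>2 \<le> (\<Sum>k<N. (1 + ev k) * (coef (of_h10 (w m s - w n s)) k)\<^sup>2) + 4 * \<epsilon>"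
      proof (intro h10_norm_split tail_leI)
        fix F :: "nat set" assume F: "finite F" "F \<subseteq> {N..}"
        have "(\<Sum>k\<in>F. (1 + ev k) * (coef (of_h10 (w m s - w n s)) k)\<^sup>2) \<le> (\<Sum>k\<in>F. 2 * ((1 + ev k) * (?a k)\<^sup>2) + 2 * ((1 + ev k) * (?b k)\<^sup>2))"
        proof (rule sum_mono)
          fix k
          have "(?a k - ?b k)\<^sup>2 \<le> 2 * (?a k)\<^sup>2 + 2 * (?b k)\<^sup>2"
            using zero_le_power2[of "?a k + ?b k"] by (simp add: power2_sum power2_diff)
          then have "(1 + ev k) * (?a k - ?b k)\<^sup>2 \<le> (1 + ev k) * (2 * (?a k)\<^sup>2 + 2 * (?b k)\<^sup>2)"
            using ev_pos[of k] by (intro mult_left_mono) auto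
          then show "(1 + ev k) * (coef (of_h10 (w m s - w n s)) k)\<^sup>2 \<le> 2 * ((1 + ev k) * (?a k)\<^sup>2) + 2 * ((1 + ev k) * (?b k)\<^sup>2)"
            by (simp add: of_h10_diff inner_diff_left algebra_simps)
        qed
        also have "\<dots> \<le> 2 * \<epsilon> + 2 * \<epsilon>"
          using tail_leD[OF NM[OF _ s] F, of m] tail_leD[OF NM[OF _ s] F, of n] mn
          by (simp add: sum.distrib sum_distrib_left[symmetric])
        finally show "(\<Sum>k\<in>F. (1 + ev k) * (coef (of_h10 (w m s - w n s)) k)\<^sup>2) \<le> 4 * \<epsilon>" by simp
      qed
      also have "(\<Sum>k<N. (1 + ev k) * (coef (of_h10 (w m s - w n s)) k)\<^sup>2) \<le> (\<Sum>k<N. (1 + ev k) * d)"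
      proof (intro sum_mono mult_left_mono)
        fix k assume "k \<in> {..<N}"
        then have "\<bar>?a k - g k s\<bar> < d / 2" "\<bar>?b k - g k s\<bar> < d / 2"
          using M'[of m k s] M'[of n k s] mn s by (simp_all add: dist_real_def)
        then have "\<bar>?a k - ?b k\<bar> \<le> d" by linarith
        then have "(?a k - ?b k)\<^sup>2 \<le> d\<^sup>2" using power_mono[OF _ abs_ge_zero, of "?a k - ?b k" d 2] by simp
        also have "d\<^sup>2 \<le> d" using d by (simp add: power2_eq_square mult_left_le)
        finally show "(coef (of_h10 (w m s - w n s)) k)\<^sup>2 \<le> d" by (simp add: of_h10_diff inner_diff_left)
        show "0 \<le> 1 + ev k" using ev_pos[of k] by simp
      qed
      also have "\<dots> = d * (\<Sum>k<N. 1 + ev k)" by (simp add: sum_distrib_left mult.commute)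
      also have "\<dots> \<le> d * W" using d by (intro mult_left_mono) (auto simp: W_def)
      also have "\<dots> \<le> \<epsilon>" by (rule d)
      finally have "(norm (w m s - w n s))\<^sup>2 \<le> 5 * \<epsilon>" by simp
      also have "\<dots> < e\<^sup>2" using e by (simp add: \<epsilon>_def)
      finally show ?thesis using e by (simp add: dist_norm power_less_imp_less_base)
    qed
    then show "\<exists>M. \<forall>x\<in>S. \<forall>m\<ge>M. \<forall>n\<ge>M. dist (w m x) (w n x) < e" by blast
  qed
  then show ?thesis using Cauchy_uniformly_convergent uniformly_convergent_on_def by blast
qed

lemma h10_curve_with_coefs:
  fixes c :: "nat \<Rightarrow> 'a::topological_space \<Rightarrow> real"
  assumes cont: "\<And>k. continuous_on S (c k)"
    and tail: "\<And>\<epsilon>. 0 < \<epsilon> \<Longrightarrow> \<exists>N. \<forall>s\<in>S. tail_le N (\<lambda>k. c k s) \<epsilon>"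
  obtains v where "continuous_on S v" "\<And>s k. s \<in> S \<Longrightarrow> coef (of_h10 (v s)) k = c k s"
proof -
  define w where "w n s = (\<Sum>j<n. (c j s * sqrt (1 + ev j)) *\<^sub>R hsine j)" for n s
  have coef_w: "coef (of_h10 (w n s)) k = (if k < n then c k s else 0)" for n s k
  proof -
    have "inner (w n s) (hsine k) = (if k < n then c k s * sqrt (1 + ev k) else 0)"
      unfolding w_def by (simp add: hsine.inner_sum_basis)
    then show ?thesis using ev_pos[of k] by (auto simp: inner_hsine split: if_splits)
  qed
  have "\<exists>v. uniform_limit S w v sequentially"
  proof (rule uniform_limit_by_coefs)
    fix \<epsilon> :: real assume "0 < \<epsilon>"
    then obtain N where N: "\<And>s. s \<in> S \<Longrightarrow> tail_le N (\<lambda>k. c k s) \<epsilon>"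
      using tail by blast
    have "tail_le N (coef (of_h10 (w n s))) \<epsilon>" if "s \<in> S" for n s
    proof (rule tail_leI)
      fix F :: "nat set" assume F: "finite F" "F \<subseteq> {N..}"
      have "(\<Sum>k\<in>F. (1 + ev k) * (coef (of_h10 (w n s)) k)\<^sup>2) \<le> (\<Sum>k\<in>F. (1 + ev k) * (c k s)\<^sup>2)"
        using ev_pos by (intro sum_mono mult_left_mono) (auto simp: coef_w less_imp_le add_pos_pos)
      with tail_leD[OF N[OF that] F] show "(\<Sum>k\<in>F. (1 + ev k) * (coef (of_h10 (w n s)) k)\<^sup>2) \<le> \<epsilon>" by linarith
    qed
    then show "\<exists>N M. \<forall>n\<ge>M. \<forall>s\<in>S. tail_le N (coef (of_h10 (w n s))) \<epsilon>"
      by blast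
  next
    fix k
    have "uniform_limit S (\<lambda>n s. coef (of_h10 (w n s)) k) (c k) sequentially"
    proof (rule uniform_limitI)
      fix e :: real assume e: "e > 0"
      show "\<forall>\<^sub>F n in sequentially. \<forall>s\<in>S. dist (coef (of_h10 (w n s)) k) (c k s) < e"
        using eventually_gt_at_top[of k] by eventually_elim (simp add: coef_w e)
    qed
    then show "\<exists>g. uniform_limit S (\<lambda>n s. coef (of_h10 (w n s)) k) g sequentially" by blast
  qed
  then obtain v where v: "uniform_limit S w v sequentially" by blast
  have "continuous_on S (w n)" for n
    unfolding w_def by (intro continuous_intros cont)
  then have "continuous_on S v"
    by (intro uniform_limit_theorem[OF _ v]) auto
  moreover have "coef (of_h10 (v s)) k = c k s" if "s \<in> S" for s k
  proof -
    have "(\<lambda>n. coef (of_h10 (w n s)) k) \<longlonglongrightarrow> coef (of_h10 (v s)) k"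
      by (intro tendsto_inner tendsto_const bounded_linear.tendsto[OF bounded_linear_of_h10] tendsto_uniform_limitI[OF v that])
    moreover have "(\<lambda>n. coef (of_h10 (w n s)) k) \<longlonglongrightarrow> c k s"
      by (rule tendsto_eventually) (use eventually_gt_at_top[of k] in eventually_elim, simp add: coef_w)
    ultimately show ?thesis by (rule LIMSEQ_unique)
  qed
  ultimately show ?thesis using that by blast
qed

text \<open>The system \<open>w' = P w\<^sub>x\<^sub>x + h\<close> on \<open>[0,T]\<close>, tested against the eigenfunctions and integrated in
  time. In this form solutions can be translated, concatenated and passed to the limit freely.\<close>

definition weak_solution :: "real \<Rightarrow> (real \<Rightarrow> real) \<Rightarrow> (real \<Rightarrow> l2) \<Rightarrow> (real \<Rightarrow> h10) \<Rightarrow> bool" where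
  "weak_solution T P h w \<longleftrightarrow> continuous_on {0..T} w \<and>
     (\<forall>\<tau>\<in>{0..T}. \<forall>k. coef (of_h10 (w \<tau>)) k - coef (of_h10 (w 0)) k =
        integral {0..\<tau>} (\<lambda>r. - ev k * P r * coef (of_h10 (w r)) k + coef (h r) k))"

lemma continuous_on_coef_h10: "continuous_on S w \<Longrightarrow> continuous_on S (\<lambda>s. coef (of_h10 (w s)) k)"
  by (intro continuous_on_inner continuous_on_const bounded_linear.continuous_on[OF bounded_linear_of_h10])

lemma weak_solution_DERIV:
  assumes w: "weak_solution T P h w" and P: "continuous_on {0..T} P" and h: "continuous_on {0..T} h"
    and s: "s \<in> {0..T}"
  shows "((\<lambda>s. coef (of_h10 (w s)) k) has_real_derivative - ev k * P s * coef (of_h10 (w s)) k + coef (h s) k) (at s within {0..T})"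
proof -
  let ?f = "\<lambda>r. - ev k * P r * coef (of_h10 (w r)) k + coef (h r) k"
  have cw: "continuous_on {0..T} w" using w by (simp add: weak_solution_def)
  have "continuous_on {0..T} ?f"
    by (intro continuous_intros P h continuous_on_coef_h10 cw)
  then have "((\<lambda>s. integral {0..s} ?f) has_real_derivative ?f s) (at s within {0..T})"
    using s by (rule integral_has_real_derivative)
  then have "((\<lambda>s. coef (of_h10 (w 0)) k + integral {0..s} ?f) has_real_derivative ?f s) (at s within {0..T})"
    using DERIV_add[OF DERIV_const] by fastforce
  then show ?thesis
  proof (rule has_field_derivative_transform_within[OF _ zero_less_one s])
    fix x assume "x \<in> {0..T}"
    then have "coef (of_h10 (w x)) k - coef (of_h10 (w 0)) k = integral {0..x} ?f"
      using w unfolding weak_solution_def by blast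
    then show "coef (of_h10 (w 0)) k + integral {0..x} ?f = coef (of_h10 (w x)) k" by linarith
  qed
qed

lemma weak_solution_DERIV_interior:
  assumes w: "weak_solution T P h w" and P: "continuous_on {0..T} P" and h: "continuous_on {0..T} h"
    and s: "0 < s" "s < T"
  shows "((\<lambda>s. coef (of_h10 (w s)) k) has_real_derivative - ev k * P s * coef (of_h10 (w s)) k + coef (h s) k) (at s)"
  using weak_solution_DERIV[OF w P h, of s k] s by (simp add: at_within_Icc_at)

lemma one_plus_ev_le: "1 + ev k \<le> 2 * ev k" using ev_ge_1[of k] by simp

lemma weak_solution_tail:
  assumes w: "weak_solution T P h w" and P: "continuous_on {0..T} P" "\<And>s. 0 \<le> s \<Longrightarrow> s \<le> T \<Longrightarrow> p0 \<le> P s" "0 < p0"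
    and h: "continuous_on {0..T} h" "\<And>s. 0 \<le> s \<Longrightarrow> s \<le> T \<Longrightarrow> norm (h s) \<le> G"
    and F: "finite F" "F \<subseteq> {N..}" and \<tau>: "0 \<le> \<tau>" "\<tau> \<le> T"
  shows "(\<Sum>k\<in>F. ev k * (coef (of_h10 (w \<tau>)) k)\<^sup>2) \<le> (\<Sum>k\<in>F. ev k * (coef (of_h10 (w 0)) k)\<^sup>2) + G\<^sup>2 / (p0\<^sup>2 * ev N)"
proof (rule energy_tail[where P = P and T = T and h = "\<lambda>k s. coef (h s) k", OF F(1) _ P(3)])
  show "(\<Sum>k\<in>F. (coef (h s) k)\<^sup>2) \<le> G\<^sup>2" if "0 < s" "s < T" for s
  proof -
    have "(norm (h s))\<^sup>2 \<le> G\<^sup>2" using h(2)[of s] that by (intro power_mono) auto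
    with esine.bessel[OF F(1), of "h s"] show ?thesis by linarith
  qed
  show "continuous_on {0..T} (\<lambda>s. coef (of_h10 (w s)) k)" for k
    using w by (intro continuous_on_coef_h10) (simp add: weak_solution_def)
  show "((\<lambda>s. coef (of_h10 (w s)) k) has_real_derivative - ev k * P s * coef (of_h10 (w s)) k + coef (h s) k) (at s)" 
    if "0 < s" "s < T" for k s
    using weak_solution_DERIV_interior[OF w P(1) h(1) that] .
qed (use F P \<tau> in auto)

lemma h10_bessel:
  assumes "finite F"
  shows "(\<Sum>k\<in>F. (1 + ev k) * (coef (of_h10 u) k)\<^sup>2) \<le> (norm u)\<^sup>2"
proof -
  have "(\<Sum>k\<in>F. (1 + ev k) * (coef (of_h10 u) k)\<^sup>2) = (\<Sum>k\<in>F. (inner u (hsine k))\<^sup>2)"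
  proof (rule sum.cong[OF refl])
    fix k
    have "0 \<le> 1 + ev k" using ev_pos[of k] by simp
    then show "(1 + ev k) * (coef (of_h10 u) k)\<^sup>2 = (inner u (hsine k))\<^sup>2"
      by (simp add: inner_hsine power_mult_distrib)
  qed
  with hsine.bessel[OF assms, of u] show ?thesis by simp
qed

lemma tail_le_mono: "tail_le N c \<epsilon> \<Longrightarrow> N \<le> N' \<Longrightarrow> tail_le N' c \<epsilon>"
  unfolding tail_le_def by (meson atLeast_iff order_trans subset_iff)

lemma h10_tail:
  assumes \<epsilon>: "0 < \<epsilon>"
  obtains N where "tail_le N (coef (of_h10 x)) \<epsilon>"
proof -
  have "summable (\<lambda>k. (1 + ev k) * (coef (of_h10 x) k)\<^sup>2)" using h10_norm_sums sums_summable by blast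
  then obtain N where N: "\<And>m n. m \<ge> N \<Longrightarrow> norm (\<Sum>k=m..<n. (1 + ev k) * (coef (of_h10 x) k)\<^sup>2) < \<epsilon>"
    using \<epsilon> unfolding summable_Cauchy by blast
  have pos: "0 \<le> (1 + ev k) * (coef (of_h10 x) k)\<^sup>2" for k using ev_pos[of k] by simp
  have "tail_le N (coef (of_h10 x)) \<epsilon>"
  proof (rule tail_leI)
    fix F :: "nat set" assume F: "finite F" "F \<subseteq> {N..}"
    have "F \<subseteq> {N..<Suc (Max F)}" using F by (auto simp: less_Suc_eq_le)
    then have "(\<Sum>k\<in>F. (1 + ev k) * (coef (of_h10 x) k)\<^sup>2) \<le> (\<Sum>k=N..<Suc (Max F). (1 + ev k) * (coef (of_h10 x) k)\<^sup>2)"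
      by (intro sum_mono2 pos) auto
    also have "\<dots> \<le> \<epsilon>" using N[OF order_refl, of "Suc (Max F)"] unfolding real_norm_def by linarith
    finally show "(\<Sum>k\<in>F. (1 + ev k) * (coef (of_h10 x) k)\<^sup>2) \<le> \<epsilon>" .
  qed
  with that show ?thesis by blast
qed

lemma forcing_tail_small:
  assumes \<epsilon>: "0 < \<epsilon>"
  obtains N where "\<And>N'. N \<le> N' \<Longrightarrow> G\<^sup>2 / (p0\<^sup>2 * ev N') \<le> \<epsilon>"
proof -
  obtain N where N: "(G\<^sup>2 / p0\<^sup>2) / \<epsilon> \<le> ev N"
    using ev_at_top unfolding filterlim_at_top eventually_sequentially by blast
  have "G\<^sup>2 / (p0\<^sup>2 * ev N') \<le> \<epsilon>" if "N \<le> N'" for N'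
  proof -
    define a where "a = G\<^sup>2 / p0\<^sup>2"
    have "a / \<epsilon> \<le> ev N'" using N ev_mono[OF that] unfolding a_def by linarith
    then have "a \<le> \<epsilon> * ev N'" using \<epsilon> by (simp add: pos_divide_le_eq mult.commute)
    then have "a / ev N' \<le> \<epsilon>" using ev_pos[of N'] by (simp add: pos_divide_le_eq)
    then show ?thesis by (simp add: a_def)
  qed
  with that show ?thesis by blast
qed

text \<open>Equicontinuity of each Fourier mode is immediate from its differential equation; together with the
  uniform smallness of the high modes it yields uniform convergence in \<open>H\<^sup>1\<^sub>0\<close> along a diagonal subsequence.\<close>

lemma weak_solution_compactness:
  fixes w :: "nat \<Rightarrow> real \<Rightarrow> h10"
  assumes ws: "\<And>n. weak_solution T (P n) (h n) (w n)"
    and P: "\<And>n. continuous_on {0..T} (P n)" "\<And>n s. 0 \<le> s \<Longrightarrow> s \<le> T \<Longrightarrow> p0 \<le> P n s" "\<And>n s. 0 \<le> s \<Longrightarrow> s \<le> T \<Longrightarrow> P n s \<le> p1" "0 < p0"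
    and h: "\<And>n. continuous_on {0..T} (h n)" "\<And>n s. 0 \<le> s \<Longrightarrow> s \<le> T \<Longrightarrow> norm (h n s) \<le> G"
    and x: "(\<lambda>n. w n 0) \<longlonglongrightarrow> x" and T: "0 \<le> T"
  obtains r v where "strict_mono (r :: nat \<Rightarrow> nat)" "uniform_limit {0..T} (\<lambda>n. w (r n)) v sequentially"
proof -
  have G: "0 \<le> G" using h(2)[of 0 0] T by (meson norm_ge_zero order_trans order_refl)
  have p1: "0 \<le> p1" using P(2,3)[of 0 0] P(4) T by linarith
  obtain C where C: "0 < C" "\<And>n. norm (w n 0) \<le> C"
    using convergent_imp_Bseq[of "\<lambda>n. w n 0"] x unfolding Bseq_def convergent_def by blast
  define Y where "Y = C + G / p0"
  have Y: "0 \<le> Y" unfolding Y_def using C G P(4) by simp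
  have cY: "\<bar>coef (of_h10 (w n s)) k\<bar> \<le> Y" if s: "0 \<le> s" "s \<le> T" for n s k
  proof -
    let ?c = "coef (of_h10 (w n s)) k" and ?d = "coef (of_h10 (w n 0)) k"
    have "ev k * ?c\<^sup>2 \<le> ev k * ?d\<^sup>2 + G\<^sup>2 / (p0\<^sup>2 * ev k)"
      using weak_solution_tail[OF ws[of n] P(1)[of n] P(2)[of _ n] P(4) h(1)[of n] h(2)[of _ n], of "{k}" k s] s by simp
    also have "\<dots> \<le> ev k * C\<^sup>2 + ev k * (G\<^sup>2 / p0\<^sup>2)"
    proof (rule add_mono)
      have "\<bar>?d\<bar> \<le> C" using abs_coef_le[of "of_h10 (w n 0)" k] norm_of_h10_le[of "w n 0"] C(2)[of n] by linarith
      then have "?d\<^sup>2 \<le> C\<^sup>2" using power_mono[OF _ abs_ge_zero, of ?d C 2] by simp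
      then show "ev k * ?d\<^sup>2 \<le> ev k * C\<^sup>2" using ev_pos[of k] by (intro mult_left_mono) auto
      have "G\<^sup>2 / (p0\<^sup>2 * ev k) = (G\<^sup>2 / p0\<^sup>2) / ev k" by simp
      also have "\<dots> \<le> (G\<^sup>2 / p0\<^sup>2) / 1" using ev_ge_1[of k] by (intro divide_left_mono) auto
      also have "\<dots> \<le> ev k * (G\<^sup>2 / p0\<^sup>2)" using ev_ge_1[of k] mult_right_mono[of 1 "ev k" "G\<^sup>2 / p0\<^sup>2"] by simp
      finally show "G\<^sup>2 / (p0\<^sup>2 * ev k) \<le> ev k * (G\<^sup>2 / p0\<^sup>2)" .
    qed
    also have "\<dots> = ev k * (C\<^sup>2 + (G / p0)\<^sup>2)" by (simp add: algebra_simps power_divide)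
    finally have "?c\<^sup>2 \<le> C\<^sup>2 + (G / p0)\<^sup>2" using ev_pos[of k] by simp
    also have "\<dots> \<le> Y\<^sup>2" unfolding Y_def power2_sum using C G P(4) by simp
    finally show ?thesis using Y by (simp add: abs_le_square_iff[symmetric])
  qed
  have lip: "norm (coef (of_h10 (w n s)) k - coef (of_h10 (w n t)) k) \<le> (ev k * p1 * Y + G) * norm (s - t)"
    if "s \<in> {0..T}" "t \<in> {0..T}" for n s t k
  proof (rule field_differentiable_bound[of "{0..T}" "\<lambda>s. coef (of_h10 (w n s)) k"])
    fix z assume z: "z \<in> {0..T}"
    show "((\<lambda>s. coef (of_h10 (w n s)) k) has_field_derivative (- ev k * P n z * coef (of_h10 (w n z)) k + coef (h n z) k)) (at z within {0..T})"
      by (rule weak_solution_DERIV[OF ws P(1) h(1) z])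
    have 1: "\<bar>coef (h n z) k\<bar> \<le> G" using abs_coef_le[of "h n z" k] h(2)[of z n] z by simp
    have "\<bar>ev k * P n z * coef (of_h10 (w n z)) k\<bar> = ev k * P n z * \<bar>coef (of_h10 (w n z)) k\<bar>"
      using ev_pos[of k] P(2)[of z n] P(4) z by (simp add: abs_mult)
    also have "\<dots> \<le> ev k * p1 * Y"
      using ev_pos[of k] P(2)[of z n] P(3)[of z n] P(4) p1 z cY[of z n k] by (intro mult_mono) auto
    finally show "norm (- ev k * P n z * coef (of_h10 (w n z)) k + coef (h n z) k) \<le> ev k * p1 * Y + G"
      using 1 unfolding real_norm_def by linarith
  qed (use that in auto)
  \<comment> \<open>Arzela-Ascoli for one mode after the other; the diagonal subsequence serves all modes\<close>
  define Q where "Q k s \<longleftrightarrow> (\<exists>g. uniform_limit {0..T} (\<lambda>n t. coef (of_h10 (w (s n) t)) k) g sequentially)" for k and s :: "nat \<Rightarrow> nat"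
  interpret subseqs Q
  proof
    fix k and s :: "nat \<Rightarrow> nat" assume "strict_mono s"
    define K where "K = ev k * p1 * Y + G + 1"
    have K: "K > 0" unfolding K_def using ev_pos[of k] p1 Y G by (intro add_nonneg_pos add_nonneg_nonneg mult_nonneg_nonneg) auto
    obtain g r where r: "strict_mono (r :: nat \<Rightarrow> nat)"
      and lim: "\<And>e. 0 < e \<Longrightarrow> \<exists>N. \<forall>n x. n \<ge> N \<and> x \<in> {0..T} \<longrightarrow> norm (coef (of_h10 (w (s (r n)) x)) k - g x) < e"
    proof (rule Arzela_Ascoli[of "{0..T}" "\<lambda>n t. coef (of_h10 (w (s n) t)) k" Y])
      fix t e :: real assume t: "t \<in> {0..T}" and e: "0 < e"
      show "\<exists>d>0. \<forall>n y. y \<in> {0..T} \<and> norm (t - y) < d \<longrightarrow> norm (coef (of_h10 (w (s n) t)) k - coef (of_h10 (w (s n) y)) k) < e"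
      proof (intro exI[of _ "e / K"] conjI allI impI)
        fix n y assume y: "y \<in> {0..T} \<and> norm (t - y) < e / K"
        have "norm (coef (of_h10 (w (s n) t)) k - coef (of_h10 (w (s n) y)) k) \<le> (ev k * p1 * Y + G) * norm (t - y)"
          using y by (intro lip t) auto
        also have "\<dots> \<le> K * norm (t - y)" by (intro mult_right_mono) (auto simp: K_def)
        also have "\<dots> < e" using y K by (simp add: field_simps)
        finally show "norm (coef (of_h10 (w (s n) t)) k - coef (of_h10 (w (s n) y)) k) < e" .
      qed (use e K in simp)
    qed (use cY in auto)
    have "uniform_limit {0..T} (\<lambda>n t. coef (of_h10 (w ((s \<circ> r) n) t)) k) g sequentially"
    proof (rule uniform_limitI)
      fix e :: real assume "0 < e"
      from lim[OF this] obtain N where N: "\<forall>n x. n \<ge> N \<and> x \<in> {0..T} \<longrightarrow> norm (coef (of_h10 (w (s (r n)) x)) k - g x) < e" ..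
      show "\<forall>\<^sub>F n in sequentially. \<forall>t\<in>{0..T}. dist (coef (of_h10 (w ((s \<circ> r) n) t)) k) (g t) < e"
        by (rule eventually_sequentiallyI[of N]) (use N in \<open>simp add: dist_real_def\<close>)
    qed
    with r show "\<exists>r'. strict_mono r' \<and> Q k (s \<circ> r')" unfolding Q_def by blast
  qed
  have Q: "\<exists>g. uniform_limit {0..T} (\<lambda>n t. coef (of_h10 (w (diagseq n) t)) k) g sequentially" for k
  proof -
    have "Q k (diagseq \<circ> ((+) (Suc k)))"
    proof (rule diagseq_holds)
      fix r s :: "nat \<Rightarrow> nat" and n assume r: "strict_mono r" and "Q n s"
      then obtain g where "uniform_limit {0..T} (\<lambda>i t. coef (of_h10 (w (s i) t)) n) g sequentially" unfolding Q_def by blast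
      from filterlim_compose[OF this filterlim_subseq[OF r]] show "Q n (s \<circ> r)"
        unfolding Q_def by (auto simp: o_def)
    qed
    then obtain g where g: "uniform_limit {0..T} (\<lambda>n t. coef (of_h10 (w (diagseq (Suc k + n)) t)) k) g sequentially"
      unfolding Q_def by auto
    have "uniform_limit {0..T} (\<lambda>n t. coef (of_h10 (w (diagseq n) t)) k) g sequentially"
    proof (rule uniform_limitI)
      fix e :: real assume "0 < e"
      from uniform_limitD[OF g this] obtain N
        where N: "\<And>n t. n \<ge> N \<Longrightarrow> t \<in> {0..T} \<Longrightarrow> dist (coef (of_h10 (w (diagseq (Suc k + n)) t)) k) (g t) < e"
        unfolding eventually_sequentially by blast
      have "dist (coef (of_h10 (w (diagseq n) t)) k) (g t) < e" if "n \<ge> N + Suc k" "t \<in> {0..T}" for n t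
        using N[of "n - Suc k" t] that by simp
      then show "\<forall>\<^sub>F n in sequentially. \<forall>t\<in>{0..T}. dist (coef (of_h10 (w (diagseq n) t)) k) (g t) < e"
        unfolding eventually_sequentially by blast
    qed
    then show ?thesis by blast
  qed
  have "\<exists>v. uniform_limit {0..T} (\<lambda>n. w (diagseq n)) v sequentially"
  proof (rule uniform_limit_by_coefs[OF _ Q])
    fix \<epsilon> :: real assume \<epsilon>: "0 < \<epsilon>"
    then obtain N1 where N1: "tail_le N1 (coef (of_h10 x)) (\<epsilon> / 16)" using h10_tail[of "\<epsilon> / 16" x] by auto
    obtain N2 where N2: "\<And>N'. N2 \<le> N' \<Longrightarrow> G\<^sup>2 / (p0\<^sup>2 * ev N') \<le> \<epsilon> / 8"
      using forcing_tail_small[of "\<epsilon> / 8" G p0] \<epsilon> by auto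
    define N where "N = max N1 N2"
    have GN: "G\<^sup>2 / (p0\<^sup>2 * ev N) \<le> \<epsilon> / 8" by (rule N2) (simp add: N_def)
    have tx: "tail_le N (coef (of_h10 x)) (\<epsilon> / 16)" by (rule tail_le_mono[OF N1]) (simp add: N_def)
    have "(\<lambda>n. w (diagseq n) 0) \<longlonglongrightarrow> x"
      using LIMSEQ_subseq_LIMSEQ[OF x subseq_diagseq] by (simp add: o_def)
    then have "(\<lambda>n. (norm (w (diagseq n) 0 - x))\<^sup>2) \<longlonglongrightarrow> (norm (x - x))\<^sup>2" by (intro tendsto_intros)
    then have "\<forall>\<^sub>F n in sequentially. (norm (w (diagseq n) 0 - x))\<^sup>2 < \<epsilon> / 16"
      by (rule order_tendstoD) (use \<epsilon> in simp)
    then obtain M where M: "\<And>n. n \<ge> M \<Longrightarrow> (norm (w (diagseq n) 0 - x))\<^sup>2 < \<epsilon> / 16"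
      unfolding eventually_sequentially by blast
    have "tail_le N (coef (of_h10 (w (diagseq n) s))) \<epsilon>" if n: "n \<ge> M" and s: "s \<in> {0..T}" for n s
    proof (rule tail_leI)
      fix F :: "nat set" assume F: "finite F" "F \<subseteq> {N..}"
      let ?u = "w (diagseq n) s" and ?z = "w (diagseq n) 0"
      have "(\<Sum>k\<in>F. (1 + ev k) * (coef (of_h10 ?u) k)\<^sup>2) \<le> (\<Sum>k\<in>F. 2 * (ev k * (coef (of_h10 ?u) k)\<^sup>2))"
      proof (rule sum_mono)
        fix k show "(1 + ev k) * (coef (of_h10 ?u) k)\<^sup>2 \<le> 2 * (ev k * (coef (of_h10 ?u) k)\<^sup>2)"
          using mult_right_mono[OF one_plus_ev_le[of k], of "(coef (of_h10 ?u) k)\<^sup>2"] by (simp add: mult.assoc)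
      qed
      also have "\<dots> = 2 * (\<Sum>k\<in>F. ev k * (coef (of_h10 ?u) k)\<^sup>2)" by (simp add: sum_distrib_left)
      also have "\<dots> \<le> 2 * ((\<Sum>k\<in>F. ev k * (coef (of_h10 ?z) k)\<^sup>2) + G\<^sup>2 / (p0\<^sup>2 * ev N))"
        using weak_solution_tail[OF ws[of "diagseq n"] P(1)[of "diagseq n"] P(2)[of _ "diagseq n"] P(4)
          h(1)[of "diagseq n"] h(2)[of _ "diagseq n"] F, of s] s by (intro mult_left_mono) auto
      finally have 1: "(\<Sum>k\<in>F. (1 + ev k) * (coef (of_h10 ?u) k)\<^sup>2) \<le> 2 * ((\<Sum>k\<in>F. ev k * (coef (of_h10 ?z) k)\<^sup>2) + G\<^sup>2 / (p0\<^sup>2 * ev N))" .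
      have "(\<Sum>k\<in>F. ev k * (coef (of_h10 ?z) k)\<^sup>2) \<le> (\<Sum>k\<in>F. 2 * ((1 + ev k) * (coef (of_h10 x) k)\<^sup>2) + 2 * ((1 + ev k) * (coef (of_h10 (?z - x)) k)\<^sup>2))"
      proof (rule sum_mono)
        fix k
        let ?a = "coef (of_h10 ?z) k" and ?b = "coef (of_h10 x) k"
        have "?a\<^sup>2 \<le> 2 * ?b\<^sup>2 + 2 * (?a - ?b)\<^sup>2"
          using zero_le_power2[of "?a - 2 * ?b"] by (simp add: power2_diff power_mult_distrib)
        then have "(1 + ev k) * ?a\<^sup>2 \<le> (1 + ev k) * (2 * ?b\<^sup>2 + 2 * (?a - ?b)\<^sup>2)"
          using ev_pos[of k] by (intro mult_left_mono) auto
        moreover have "ev k * ?a\<^sup>2 \<le> (1 + ev k) * ?a\<^sup>2" by (intro mult_right_mono) auto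
        moreover have "(1 + ev k) * (2 * ?b\<^sup>2 + 2 * (?a - ?b)\<^sup>2) = 2 * ((1 + ev k) * ?b\<^sup>2) + 2 * ((1 + ev k) * (?a - ?b)\<^sup>2)"
          by (simp add: algebra_simps)
        moreover have "coef (of_h10 (?z - x)) k = ?a - ?b" by (simp add: of_h10_diff inner_diff_left)
        ultimately show "ev k * ?a\<^sup>2 \<le> 2 * ((1 + ev k) * ?b\<^sup>2) + 2 * ((1 + ev k) * (coef (of_h10 (?z - x)) k)\<^sup>2)"
          by (simp only:)
      qed
      also have "\<dots> = 2 * (\<Sum>k\<in>F. (1 + ev k) * (coef (of_h10 x) k)\<^sup>2) + 2 * (\<Sum>k\<in>F. (1 + ev k) * (coef (of_h10 (?z - x)) k)\<^sup>2)"
        by (simp add: sum.distrib sum_distrib_left)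
      also have "\<dots> \<le> 2 * (\<epsilon> / 16) + 2 * (\<epsilon> / 16)"
        using tail_leD[OF tx F] order_trans[OF h10_bessel[OF F(1), of "?z - x"] less_imp_le[OF M[OF n]]]
        by (intro add_mono mult_left_mono) auto
      finally have "2 * ((\<Sum>k\<in>F. ev k * (coef (of_h10 ?z) k)\<^sup>2) + G\<^sup>2 / (p0\<^sup>2 * ev N)) \<le> 2 * ((2 * (\<epsilon> / 16) + 2 * (\<epsilon> / 16)) + \<epsilon> / 8)"
        by (intro mult_left_mono add_mono GN) auto
      also have "\<dots> \<le> \<epsilon>" using \<epsilon> by simp
      finally show "(\<Sum>k\<in>F. (1 + ev k) * (coef (of_h10 ?u) k)\<^sup>2) \<le> \<epsilon>"
        by (rule order_trans[OF 1])
    qed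
    then show "\<exists>N M. \<forall>n\<ge>M. \<forall>s\<in>{0..T}. tail_le N (coef (of_h10 (w (diagseq n) s))) \<epsilon>" by blast
  qed
  with subseq_diagseq that show ?thesis by blast
qed

lemma integral_from_0:
  fixes P :: "real \<Rightarrow> real"
  assumes P: "continuous_on {0..T} P" "\<forall>s\<in>{0..T}. 0 \<le> P s"
  shows "continuous_on {0..T} (\<lambda>s. integral {0..s} P)"
    and "\<And>s t. 0 \<le> s \<Longrightarrow> s \<le> t \<Longrightarrow> t \<le> T \<Longrightarrow> integral {0..s} P \<le> integral {0..t} P"
    and "\<And>s. 0 < s \<Longrightarrow> s < T \<Longrightarrow> ((\<lambda>s. integral {0..s} P) has_real_derivative P s) (at s)"
proof -
  show "continuous_on {0..T} (\<lambda>s. integral {0..s} P)"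
    by (intro indefinite_integral_continuous_1 integrable_continuous_interval P)
  show "integral {0..s} P \<le> integral {0..t} P" if "0 \<le> s" "s \<le> t" "t \<le> T" for s t
    using that by (intro integral_subset_le integrable_continuous_interval continuous_on_subset[OF P(1)]) (use P(2) in auto)
  show "((\<lambda>s. integral {0..s} P) has_real_derivative P s) (at s)" if "0 < s" "s < T" for s
    using integral_has_real_derivative[OF P(1), of s] that by (simp add: at_within_Icc_at)
qed

text \<open>Variation of constants for a time-dependent factor \<open>P\<close>: the semigroup runs along the clock \<open>\<integral>P\<close>.\<close>

lemma mild_formula:
  fixes y h :: "real \<Rightarrow> l2"
  assumes \<tau>: "0 \<le> \<tau>" and P: "continuous_on {0..\<tau>} P" "\<forall>s\<in>{0..\<tau>}. 0 \<le> P s"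
    and h: "continuous_on {0..\<tau>} h" and y: "continuous_on {0..\<tau>} y"
    and der: "\<And>k s. 0 < s \<Longrightarrow> s < \<tau> \<Longrightarrow> ((\<lambda>s. coef (y s) k) has_real_derivative - ev k * P s * coef (y s) k + coef (h s) k) (at s)"
  shows "((\<lambda>s. heat_semigroup (integral {0..\<tau>} P - integral {0..s} P) (h s)) has_integral
      (y \<tau> - heat_semigroup (integral {0..\<tau>} P) (y 0))) {0..\<tau>}"
proof -
  define B where "B s = integral {0..s} P" for s
  note B = integral_from_0[OF P, folded B_def]
  have B0: "B 0 = 0" by (simp add: B_def)
  have B\<tau>: "0 \<le> B \<tau>" using B(2)[of 0 \<tau>] B0 \<tau> by simp
  have nn: "0 \<le> B \<tau> - B s" if "s \<in> {0..\<tau>}" for s using B(2)[of s \<tau>] that by simp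
  have "continuous_on {0..\<tau>} (\<lambda>s. heat_semigroup (B \<tau> - B s) (h s))"
    by (intro continuous_on_heat_semigroup continuous_intros B(1) h nn)
  then have "(\<lambda>s. heat_semigroup (B \<tau> - B s) (h s)) integrable_on {0..\<tau>}"
    by (rule integrable_continuous_interval)
  then obtain I where I: "((\<lambda>s. heat_semigroup (B \<tau> - B s) (h s)) has_integral I) {0..\<tau>}" by blast
  have "I = y \<tau> - heat_semigroup (B \<tau>) (y 0)"
  proof (rule esine.coefficients_eqI)
    fix k
    have "((\<lambda>s. coef (heat_semigroup (B \<tau> - B s) (h s)) k) has_integral coef I k) {0..\<tau>}"
      using has_integral_linear[OF I bounded_linear_inner_left] by (simp add: o_def)
    then have 1: "((\<lambda>s. exp (- (ev k * (B \<tau> - B s))) * coef (h s) k) has_integral coef I k) {0..\<tau>}"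
      by (rule has_integral_eq[rotated]) (use nn in \<open>simp add: coef_heat_semigroup\<close>)
    have "((\<lambda>s. exp (- (ev k * (B \<tau> - B s))) * coef (h s) k) has_integral
        exp (- (ev k * (B \<tau> - B \<tau>))) * coef (y \<tau>) k - exp (- (ev k * (B \<tau> - B 0))) * coef (y 0) k) {0..\<tau>}"
    proof (rule fundamental_theorem_of_calculus_interior[OF \<tau>])
      show "continuous_on {0..\<tau>} (\<lambda>s. exp (- (ev k * (B \<tau> - B s))) * coef (y s) k)"
        by (intro continuous_intros B(1) y)
      fix s assume "s \<in> {0<..<\<tau>}"
      then have s: "0 < s" "s < \<tau>" by auto
      have "((\<lambda>s. exp (- (ev k * (B \<tau> - B s)))) has_real_derivative exp (- (ev k * (B \<tau> - B s))) * (ev k * P s)) (at s)"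
        using B(3)[OF s] by (auto intro!: derivative_eq_intros)
      from DERIV_mult[OF this der[OF s, of k]]
      show "((\<lambda>s. exp (- (ev k * (B \<tau> - B s))) * coef (y s) k) has_vector_derivative exp (- (ev k * (B \<tau> - B s))) * coef (h s) k) (at s)"
        by (simp add: has_real_derivative_iff_has_vector_derivative[symmetric] algebra_simps)
    qed
    from has_integral_unique[OF 1 this] B\<tau> B0
    show "coef I k = coef (y \<tau> - heat_semigroup (B \<tau>) (y 0)) k"
      by (simp add: inner_diff_left coef_heat_semigroup)
  qed
  with I show ?thesis by (simp add: B_def)
qed

text \<open>The solution of the linear equation with initial value \<open>x\<close>, selected through its Fourier coefficients,
  which have a closed form; \<open>weak_solution_duhamel\<close> shows that these coefficients belong to \<open>H\<^sup>1\<^sub>0\<close>.\<close>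

definition duhamel :: "h10 \<Rightarrow> (real \<Rightarrow> real) \<Rightarrow> (real \<Rightarrow> l2) \<Rightarrow> real \<Rightarrow> h10" where
  "duhamel x P h \<tau> = (SOME v. \<forall>k. coef (of_h10 v) k = exp (- (ev k * integral {0..\<tau>} P)) *
     (coef (of_h10 x) k + integral {0..\<tau>} (\<lambda>s. exp (ev k * integral {0..s} P) * coef (h s) k)))"

lemma duhamel_cong:
  assumes "\<And>s. 0 \<le> s \<Longrightarrow> s \<le> \<tau> \<Longrightarrow> P s = P' s" "\<And>s. 0 \<le> s \<Longrightarrow> s \<le> \<tau> \<Longrightarrow> h s = h' s"
  shows "duhamel x P h \<tau> = duhamel x P' h' \<tau>"
proof -
  have 1: "integral {0..s} P = integral {0..s} P'" if "s \<le> \<tau>" for s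
    using that by (intro integral_cong assms) auto
  have 2: "integral {0..\<tau>} (\<lambda>s. exp (ev k * integral {0..s} P) * coef (h s) k) = integral {0..\<tau>} (\<lambda>s. exp (ev k * integral {0..s} P') * coef (h' s) k)" for k
    by (intro integral_cong) (simp add: 1 assms)
  show ?thesis unfolding duhamel_def 2 by (simp only: 1[OF order_refl])
qed

lemma DERIV_variation_of_constants:
  fixes B H :: "real \<Rightarrow> real"
  assumes B: "(B has_real_derivative b) (at s)" and H: "(H has_real_derivative exp (\<mu> * B s) * g) (at s)"
  shows "((\<lambda>s. exp (- (\<mu> * B s)) * (c + H s)) has_real_derivative
    - \<mu> * b * (exp (- (\<mu> * B s)) * (c + H s)) + g) (at s)"
proof -
  have E: "((\<lambda>s. exp (- (\<mu> * B s))) has_real_derivative exp (- (\<mu> * B s)) * (- (\<mu> * b))) (at s)"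
    using B by (auto intro!: derivative_eq_intros)
  have ee: "exp (\<mu> * B s) * g * exp (- (\<mu> * B s)) = g" by (simp add: exp_minus field_simps)
  have eq: "exp (- (\<mu> * B s)) * (- (\<mu> * b)) * (c + H s) + (0 + exp (\<mu> * B s) * g) * exp (- (\<mu> * B s))
      = - \<mu> * b * (exp (- (\<mu> * B s)) * (c + H s)) + g"
    unfolding add_0_left ee by (simp add: algebra_simps)
  show ?thesis by (rule DERIV_cong[OF DERIV_mult[OF E DERIV_add[OF DERIV_const H]] eq])
qed

lemma weak_solution_duhamel:
  assumes T: "0 \<le> T" and P: "continuous_on {0..T} P" "\<And>s. 0 \<le> s \<Longrightarrow> s \<le> T \<Longrightarrow> p0 \<le> P s" "0 < p0"
    and h: "continuous_on {0..T} h"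
  shows "weak_solution T P h (duhamel x P h)" and "duhamel x P h 0 = x"
proof -
  define B where "B s = integral {0..s} P" for s
  have P0: "\<forall>s\<in>{0..T}. 0 \<le> P s" using P(2,3) by (auto intro: order_trans less_imp_le)
  note B = integral_from_0[OF P(1) P0, folded B_def]
  define H where "H k s = integral {0..s} (\<lambda>s. exp (ev k * B s) * coef (h s) k)" for k s
  have cH: "continuous_on {0..T} (\<lambda>s. exp (ev k * B s) * coef (h s) k)" for k
    by (intro continuous_intros B(1) h)
  have DH: "(H k has_real_derivative exp (ev k * B s) * coef (h s) k) (at s)" if "0 < s" "s < T" for k s
    unfolding H_def using integral_has_real_derivative[OF cH, of s k] that by (simp add: at_within_Icc_at)
  have HC: "continuous_on {0..T} (H k)" for k
    unfolding H_def by (intro indefinite_integral_continuous_1 integrable_continuous_interval cH)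
  define c where "c k s = exp (- (ev k * B s)) * (coef (of_h10 x) k + H k s)" for k s
  have cc: "continuous_on {0..T} (c k)" for k
    unfolding c_def by (intro continuous_intros B(1) HC)
  have Dc: "(c k has_real_derivative - ev k * P s * c k s + coef (h s) k) (at s)" if s: "0 < s" "s < T" for k s
    unfolding c_def by (rule DERIV_variation_of_constants[OF B(3)[OF s] DH[OF s]])
  have c0: "c k 0 = coef (of_h10 x) k" for k by (simp add: c_def B_def H_def)
  have "bounded (h ` {0..T})" by (intro compact_imp_bounded compact_continuous_image h) simp
  then obtain G where "\<forall>s\<in>{0..T}. norm (h s) \<le> G" unfolding bounded_iff by auto
  then have G: "norm (h s) \<le> G" if "0 \<le> s" "s \<le> T" for s using that by simp
  have "\<exists>N. \<forall>s\<in>{0..T}. tail_le N (\<lambda>k. c k s) \<epsilon>" if \<epsilon>: "0 < \<epsilon>" for \<epsilon>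
  proof -
    obtain N1 where N1: "tail_le N1 (coef (of_h10 x)) (\<epsilon> / 4)" using h10_tail[of "\<epsilon> / 4" x] \<epsilon> by auto
    obtain N2 where N2: "\<And>N'. N2 \<le> N' \<Longrightarrow> G\<^sup>2 / (p0\<^sup>2 * ev N') \<le> \<epsilon> / 4"
      using forcing_tail_small[of "\<epsilon> / 4" G p0] \<epsilon> by auto
    define N where "N = max N1 N2"
    have GN: "G\<^sup>2 / (p0\<^sup>2 * ev N) \<le> \<epsilon> / 4" by (rule N2) (simp add: N_def)
    have tx: "tail_le N (coef (of_h10 x)) (\<epsilon> / 4)" by (rule tail_le_mono[OF N1]) (simp add: N_def)
    have "tail_le N (\<lambda>k. c k s) \<epsilon>" if s: "s \<in> {0..T}" for s
    proof (rule tail_leI)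
      fix F :: "nat set" assume F: "finite F" "F \<subseteq> {N..}"
      have "(\<Sum>k\<in>F. (1 + ev k) * (c k s)\<^sup>2) \<le> (\<Sum>k\<in>F. 2 * (ev k * (c k s)\<^sup>2))"
      proof (rule sum_mono)
        fix k show "(1 + ev k) * (c k s)\<^sup>2 \<le> 2 * (ev k * (c k s)\<^sup>2)"
          using mult_right_mono[OF one_plus_ev_le[of k], of "(c k s)\<^sup>2"] by (simp add: mult.assoc)
      qed
      also have "\<dots> = 2 * (\<Sum>k\<in>F. ev k * (c k s)\<^sup>2)" by (simp add: sum_distrib_left)
      finally have 1: "(\<Sum>k\<in>F. (1 + ev k) * (c k s)\<^sup>2) \<le> 2 * (\<Sum>k\<in>F. ev k * (c k s)\<^sup>2)" .
      have 2: "(\<Sum>k\<in>F. ev k * (c k s)\<^sup>2) \<le> (\<Sum>k\<in>F. ev k * (c k 0)\<^sup>2) + G\<^sup>2 / (p0\<^sup>2 * ev N)"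
      proof (rule energy_tail[where P = P and T = T and h = "\<lambda>k s. coef (h s) k", OF F(1) _ P(3) cc Dc])
        show "(\<Sum>k\<in>F. (coef (h t) k)\<^sup>2) \<le> G\<^sup>2" if "0 < t" "t < T" for t
        proof -
          have "(norm (h t))\<^sup>2 \<le> G\<^sup>2" using G[of t] that by (intro power_mono) auto
          with esine.bessel[OF F(1), of "h t"] show ?thesis by linarith
        qed
      qed (use F P s in auto)
      have "(\<Sum>k\<in>F. ev k * (c k 0)\<^sup>2) \<le> (\<Sum>k\<in>F. (1 + ev k) * (coef (of_h10 x) k)\<^sup>2)"
        by (intro sum_mono) (auto simp: c0 intro: mult_right_mono)
      also have "\<dots> \<le> \<epsilon> / 4" by (rule tail_leD[OF tx F])
      finally show "(\<Sum>k\<in>F. (1 + ev k) * (c k s)\<^sup>2) \<le> \<epsilon>" using 1 2 GN by linarith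
    qed
    then show ?thesis by blast
  qed
  from h10_curve_with_coefs[of "{0..T}" c, OF cc this]
  obtain v where v: "continuous_on {0..T} v" "\<And>s k. s \<in> {0..T} \<Longrightarrow> coef (of_h10 (v s)) k = c k s" by blast
  have coef_d: "coef (of_h10 (duhamel x P h s)) k = c k s" if "s \<in> {0..T}" for s k
  proof -
    have "\<forall>k. coef (of_h10 (duhamel x P h s)) k = c k s"
      unfolding duhamel_def c_def H_def B_def
      by (rule someI[of _ "v s"]) (use v(2)[OF that] in \<open>simp add: c_def H_def B_def\<close>)
    then show ?thesis by blast
  qed
  have d_eq: "duhamel x P h s = v s" if "s \<in> {0..T}" for s
    by (rule h10_eqI) (simp only: coef_d[OF that] v(2)[OF that])
  show "duhamel x P h 0 = x" by (rule h10_eqI) (simp add: coef_d T c0)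
  show "weak_solution T P h (duhamel x P h)"
    unfolding weak_solution_def
  proof (intro conjI ballI allI)
    show "continuous_on {0..T} (duhamel x P h)" using v(1) by (subst continuous_on_cong[OF refl d_eq])
    fix \<tau> k assume \<tau>: "\<tau> \<in> {0..T}"
    have "((\<lambda>r. - ev k * P r * c k r + coef (h r) k) has_integral (c k \<tau> - c k 0)) {0..\<tau>}"
    proof (rule fundamental_theorem_of_calculus_interior)
      show "continuous_on {0..\<tau>} (c k)" using \<tau> by (intro continuous_on_subset[OF cc]) auto
      show "(c k has_vector_derivative - ev k * P s * c k s + coef (h s) k) (at s)" if "s \<in> {0<..<\<tau>}" for s
        using Dc[of s k] that \<tau> by (simp add: has_real_derivative_iff_has_vector_derivative)
    qed (use \<tau> in simp)
    then have "((\<lambda>r. - ev k * P r * coef (of_h10 (duhamel x P h r)) k + coef (h r) k) has_integral (c k \<tau> - c k 0)) {0..\<tau>}"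
      by (rule has_integral_eq[rotated]) (use \<tau> in \<open>simp add: coef_d\<close>)
    then show "coef (of_h10 (duhamel x P h \<tau>)) k - coef (of_h10 (duhamel x P h 0)) k
        = integral {0..\<tau>} (\<lambda>r. - ev k * P r * coef (of_h10 (duhamel x P h r)) k + coef (h r) k)"
      using \<tau> T by (simp add: integral_unique coef_d)
  qed
qed

section \<open>The a priori bound\<close>

lemma le_const_limit:
  assumes "\<And>n. le_const u (c + r * (x ^ n / fact n))"
  shows "le_const u c"
  unfolding le_const_def
proof (intro ballI impI)
  fix \<psi> assume \<psi>: "\<psi> \<in> test_functions" "\<forall>x. 0 \<le> \<psi> x"
  have "(\<lambda>n. x ^ n / fact n) \<longlonglongrightarrow> 0"
    using summable_LIMSEQ_zero[OF summable_exp[of x]] by (simp add: field_simps)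
  then have "(\<lambda>n. (c + r * (x ^ n / fact n)) * inner one (abs_l2 \<psi>)) \<longlonglongrightarrow> (c + r * 0) * inner one (abs_l2 \<psi>)"
    by (intro tendsto_intros)
  moreover have "inner u (abs_l2 \<psi>) \<le> (c + r * (x ^ n / fact n)) * inner one (abs_l2 \<psi>)" for n
    using assms[of n] \<psi> by (simp add: le_const_def)
  ultimately have "inner u (abs_l2 \<psi>) \<le> (c + r * 0) * inner one (abs_l2 \<psi>)"
    by (intro LIMSEQ_le_const) auto
  then show "inner u (abs_l2 \<psi>) \<le> c * inner one (abs_l2 \<psi>)" by simp
qed

lemma le_const_scaleR: "le_const u c \<Longrightarrow> 0 \<le> a \<Longrightarrow> le_const (a *\<^sub>R u) (a * c)"
  unfolding le_const_def by (auto simp: mult.assoc intro: mult_left_mono)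

text \<open>At a point where \<open>u\<close> has the value \<open>s\<close>, monotonicity of \<open>\<kappa> s + f(s)\<close> replaces \<open>s\<close> by the larger \<open>z = min v r\<close>, which
  is nonnegative and still in the range of monotonicity, so that the growth bound for \<open>f\<close> applies to it. The
  constant \<open>\<kappa>'\<close> absorbs \<open>\<kappa>\<close> for all values of the coefficient \<open>Q\<close>.\<close>

lemma le_const_nonlinearity:
  assumes f: "continuous_on UNIV f" and Kf: "\<And>u. 0 \<le> u \<Longrightarrow> f u \<le> K * u + K" and K: "0 \<le> K"
    and mono: "mono_on {-r..r} (\<lambda>s. \<kappa> * s + f s)" and \<kappa>: "0 < \<kappa>"
    and Q: "0 \<le> Q" "Q \<le> q1" and lam: "0 < lam" and \<gamma>: "0 < \<gamma>" and b: "0 \<le> b"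
    and u: "abs_le_const (of_h10 u) r" "le_const (of_h10 u) v" "0 \<le> v" and d: "le_const d b" and r: "0 \<le> r"
    and \<kappa>': "\<kappa>' = q1 * lam * \<kappa>"
  shows "le_const (Q *\<^sub>R (lam *\<^sub>R superpose f u + \<gamma> *\<^sub>R d) + \<kappa>' *\<^sub>R of_h10 u)
     ((q1 * lam * K + \<kappa>') * v + (q1 * lam * K + q1 * \<gamma> * b))"
  unfolding le_const_AE
  using AE_rep_lincomb[of Q "lam *\<^sub>R superpose f u + \<gamma> *\<^sub>R d" \<kappa>' "of_h10 u"]
    AE_rep_lincomb[of lam "superpose f u" \<gamma> d] AE_rep_superpose[OF f, of u]
    u(1)[unfolded abs_le_const_def] u(2)[unfolded le_const_AE] d[unfolded le_const_AE]
proof eventually_elim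
  case (elim x)
  define s where "s = rep_l2 (of_h10 u) x"
  define t where "t = rep_l2 d x"
  define z where "z = min v r"
  have s: "\<bar>s\<bar> \<le> r" "s \<le> v" and t: "t \<le> b" using elim by (auto simp: s_def t_def)
  have z: "0 \<le> z" "z \<le> v" "z \<le> r" "s \<le> z" using s u(3) r by (auto simp: z_def)
  have q1: "0 \<le> q1" using Q by simp
  have "\<kappa> * s + f s \<le> \<kappa> * z + f z" using mono_onD[OF mono, of s z] s z by auto
  then have 1: "(Q * lam) * (\<kappa> * s + f s) \<le> (Q * lam) * (\<kappa> * z + f z)"
    using Q lam by (intro mult_left_mono) auto
  have "Q * lam * \<kappa> \<le> \<kappa>'" unfolding \<kappa>' using Q lam \<kappa> by (intro mult_right_mono) auto
  then have 2: "(\<kappa>' - Q * lam * \<kappa>) * s \<le> (\<kappa>' - Q * lam * \<kappa>) * z"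
    using z by (intro mult_left_mono) auto
  have 3: "(Q * lam) * f z \<le> (q1 * lam) * (K * z + K)"
  proof -
    have "(Q * lam) * f z \<le> (Q * lam) * (K * z + K)" using Kf[OF z(1)] Q lam by (intro mult_left_mono) auto
    also have "\<dots> \<le> (q1 * lam) * (K * z + K)" using Q lam K z by (intro mult_right_mono add_nonneg_nonneg) auto
    finally show ?thesis .
  qed
  have 4: "Q * \<gamma> * t \<le> q1 * \<gamma> * b"
  proof -
    have "Q * \<gamma> * t \<le> Q * \<gamma> * b" using t Q \<gamma> by (intro mult_left_mono) auto
    also have "\<dots> \<le> q1 * \<gamma> * b" using Q \<gamma> b by (intro mult_right_mono) auto
    finally show ?thesis .
  qed
  have \<kappa>'0: "0 \<le> \<kappa>'" unfolding \<kappa>' using q1 lam \<kappa> by simp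
  have 5: "(q1 * lam * K + \<kappa>') * z \<le> (q1 * lam * K + \<kappa>') * v"
    using z q1 lam K \<kappa>'0 by (intro mult_left_mono) auto
  have "Q * (lam * f s + \<gamma> * t) + \<kappa>' * s = (Q * lam) * (\<kappa> * s + f s) + (\<kappa>' - Q * lam * \<kappa>) * s + Q * \<gamma> * t"
    by (simp add: algebra_simps)
  also have "\<dots> \<le> (Q * lam) * (\<kappa> * z + f z) + (\<kappa>' - Q * lam * \<kappa>) * z + q1 * \<gamma> * b"
    using 1 2 4 by linarith
  also have "\<dots> = (Q * lam) * f z + \<kappa>' * z + q1 * \<gamma> * b" by (simp add: algebra_simps)
  also have "\<dots> \<le> (q1 * lam) * (K * z + K) + \<kappa>' * z + q1 * \<gamma> * b" using 3 by linarith
  also have "\<dots> = (q1 * lam * K + \<kappa>') * z + (q1 * lam * K + q1 * \<gamma> * b)" by (simp add: algebra_simps)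
  also have "\<dots> \<le> (q1 * lam * K + \<kappa>') * v + (q1 * lam * K + q1 * \<gamma> * b)" using 5 by linarith
  finally show ?case using elim by (simp add: s_def t_def)
qed

text \<open>Comparison with the exponential barrier \<open>y\<close>. Adding \<open>\<kappa>' w\<close> to both sides makes the right-hand side monotone in \<open>w\<close>,
  so an upper bound of \<open>w\<close> can be fed into the mild formula; iterating improves the trivial bound \<open>y + r\<close> to
  \<open>y + r (C \<tau>)\<^sup>n / n!\<close>, and the limit \<open>y\<close> does not depend on \<open>\<kappa>\<close> or \<open>r\<close>.\<close>

lemma upper_barrier:
  fixes w :: "real \<Rightarrow> h10" and d :: "real \<Rightarrow> l2"
  assumes T: "0 \<le> T" and ws: "weak_solution T P (\<lambda>s. Q s *\<^sub>R (lam *\<^sub>R superpose f (w s) + \<gamma> *\<^sub>R d s)) w"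
    and P: "continuous_on {0..T} P" "\<And>s. 0 \<le> s \<Longrightarrow> s \<le> T \<Longrightarrow> 0 \<le> P s"
    and Q: "continuous_on {0..T} Q" "\<And>s. 0 \<le> s \<Longrightarrow> s \<le> T \<Longrightarrow> 0 \<le> Q s" "\<And>s. 0 \<le> s \<Longrightarrow> s \<le> T \<Longrightarrow> Q s \<le> q1"
    and d: "continuous_on {0..T} d" "\<And>s. 0 \<le> s \<Longrightarrow> s \<le> T \<Longrightarrow> le_const (d s) b"
    and w0: "le_const (of_h10 (w 0)) b" and b: "1 \<le> b"
    and lam: "0 < lam" and \<gamma>: "0 < \<gamma>"
    and f: "continuous_on UNIV f" and Kf: "\<And>u. 0 \<le> u \<Longrightarrow> f u \<le> K * u + K" and K: "0 \<le> K"
    and mono: "\<forall>r>0. \<exists>\<kappa>>0. mono_on {-r..r} (\<lambda>s. \<kappa> * s + f s)"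
    and A: "A = 2 * (q1 * lam * K) + q1 * \<gamma> * b"
    and \<tau>: "0 \<le> \<tau>" "\<tau> \<le> T"
  shows "le_const (of_h10 (w \<tau>)) (b * exp (A * \<tau>))"
proof -
  have cw: "continuous_on {0..T} w" using ws by (simp add: weak_solution_def)
  have "bounded (w ` {0..T})" by (intro compact_imp_bounded compact_continuous_image cw) simp
  then obtain r0 where r0: "\<forall>s\<in>{0..T}. norm (w s) \<le> r0" unfolding bounded_iff by auto
  define r where "r = max r0 1"
  have r: "r > 0" and wr: "norm (w s) \<le> r" if "0 \<le> s" "s \<le> T" for s
    using r0 that by (auto simp: r_def max_def intro: order_trans)
  have r: "r > 0" by (simp add: r_def)
  obtain \<kappa> where \<kappa>: "\<kappa> > 0" "mono_on {-r..r} (\<lambda>s. \<kappa> * s + f s)" using mono r by blast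
  have q1: "0 \<le> q1" using Q(2,3)[of 0] T by simp
  define \<kappa>' where "\<kappa>' = q1 * lam * \<kappa>"
  \<comment> \<open>\<open>le_const_nonlinearity\<close> bounds the forcing by \<open>(k + \<kappa>') v + k'\<close>; as \<open>y \<ge> 1\<close>, the barrier absorbs the constant: \<open>y' = A y \<ge> k y + k'\<close>\<close>
  define k where "k = q1 * lam * K"
  define k' where "k' = q1 * lam * K + q1 * \<gamma> * b"
  have k: "0 \<le> \<kappa>'" "0 \<le> k" "0 \<le> k'" using q1 lam \<kappa>(1) K \<gamma> b by (simp_all add: \<kappa>'_def k_def k'_def)
  have A_eq: "A = k + k'" by (simp add: A k_def k'_def)
  have A0: "0 \<le> A" using k A_eq by simp
  define C where "C = k + \<kappa>'"
  have C: "0 \<le> C" using k by (simp add: C_def)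
  define y where "y s = b * exp (A * s)" for s
  have y1: "1 \<le> y s" if "0 \<le> s" for s
    unfolding y_def using b A0 that mult_mono[of 1 b 1 "exp (A * s)"] by simp
  define h where "h s = Q s *\<^sub>R (lam *\<^sub>R superpose f (w s) + \<gamma> *\<^sub>R d s)" for s
  define ht where "ht s = exp (\<kappa>' * s) *\<^sub>R (h s + \<kappa>' *\<^sub>R of_h10 (w s))" for s
  define yt where "yt s = exp (\<kappa>' * s) *\<^sub>R of_h10 (w s)" for s
  have csf: "continuous_on {0..T} (\<lambda>s. superpose f (w s))"
    by (rule continuous_on_compose2[OF continuous_on_superpose[OF f] cw]) simp
  have ch: "continuous_on {0..T} h" unfolding h_def by (intro continuous_intros Q csf d)
  have cow: "continuous_on {0..T} (\<lambda>s. of_h10 (w s))" by (rule bounded_linear.continuous_on[OF bounded_linear_of_h10 cw])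
  have cht: "continuous_on {0..T} ht" unfolding ht_def by (intro continuous_intros ch cow)
  have cyt: "continuous_on {0..T} yt" unfolding yt_def by (intro continuous_intros cow)
  have ws': "weak_solution T P h w" using ws by (simp add: h_def[abs_def])
  have der: "((\<lambda>s. coef (yt s) j) has_real_derivative - ev j * P s * coef (yt s) j + coef (ht s) j) (at s)"
    if s: "0 < s" "s < T" for s j
  proof -
    have "((\<lambda>s. exp (\<kappa>' * s)) has_real_derivative exp (\<kappa>' * s) * \<kappa>') (at s)" by (auto intro!: derivative_eq_intros)
    from DERIV_mult[OF this weak_solution_DERIV_interior[OF ws' P(1) ch s, of j]]
    show ?thesis by (simp add: yt_def ht_def inner_add_left algebra_simps)
  qed
  have claim: "le_const (of_h10 (w \<tau>)) (y \<tau> + r * ((C * \<tau>) ^ n / fact n))" if "0 \<le> \<tau>" "\<tau> \<le> T" for n \<tau>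
    using that
  proof (induction n arbitrary: \<tau>)
    case 0
    have "AE x in unit_leb. rep_l2 (of_h10 (w \<tau>)) x \<le> y \<tau> + r"
      using H10_abs_le_const[of "w \<tau>", unfolded abs_le_const_def]
      by eventually_elim (use wr[OF 0] y1[of \<tau>] 0 in linarith)
    then show ?case by (simp add: le_const_AE)
  next
    case (Suc n)
    define v where "v s = y s + r * ((C * s) ^ n / fact n)" for s
    have v0: "0 \<le> v s" if "0 \<le> s" for s
      unfolding v_def using y1[OF that] r C that by (intro add_nonneg_nonneg mult_nonneg_nonneg) auto
    \<comment> \<open>the next bound, weighted like \<open>yt\<close>; its derivative \<open>\<Phi>'\<close> turns out to dominate the forcing \<open>ht\<close>\<close>
    define \<Phi> where "\<Phi> s = exp (\<kappa>' * s) * (y s + r * ((C * s) ^ Suc n / fact (Suc n)))" for s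
    define \<Phi>' where "\<Phi>' s = exp (\<kappa>' * s) * (\<kappa>' * (y s + r * ((C * s) ^ Suc n / fact (Suc n))) + (A * y s + r * (C * ((C * s) ^ n / fact n))))" for s
    have D\<Phi>: "(\<Phi> has_real_derivative \<Phi>' s) (at s)" for s
    proof -
      have D1: "((\<lambda>s. (C * s) ^ Suc n / fact (Suc n)) has_real_derivative C * ((C * s) ^ n / fact n)) (at s)"
      proof -
        have "((\<lambda>s. (C * s) ^ Suc n / fact (Suc n)) has_real_derivative (1 + real n) * (C * (C * s) ^ n) / fact (Suc n)) (at s)"
          by (rule DERIV_cong[OF DERIV_cdivide[OF DERIV_power_Suc[OF DERIV_cmult[OF DERIV_ident, of C]]]]) simp
        also have "(1 + real n) * (C * (C * s) ^ n) / fact (Suc n) = C * ((C * s) ^ n / fact n)"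
          by (simp add: fact_Suc) 
        finally show ?thesis .
      qed
      have D2: "(y has_real_derivative A * y s) (at s)"
        unfolding y_def by (auto intro!: derivative_eq_intros)
      have D3: "((\<lambda>s. exp (\<kappa>' * s)) has_real_derivative exp (\<kappa>' * s) * \<kappa>') (at s)" by (auto intro!: derivative_eq_intros)
      show ?thesis unfolding \<Phi>_def
        by (rule DERIV_cong[OF DERIV_mult[OF D3 DERIV_add[OF D2 DERIV_cmult[OF D1, of r]]]])
          (simp add: \<Phi>'_def algebra_simps del: fact_Suc)
    qed
    have int\<Phi>: "(\<Phi>' has_integral (\<Phi> \<tau> - \<Phi> 0)) {0..\<tau>}"
      using Suc.prems D\<Phi> by (intro fundamental_theorem_of_calculus)
        (auto simp: has_real_derivative_iff_has_vector_derivative[symmetric] intro: has_field_derivative_at_within)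
    have \<Phi>0: "\<Phi> 0 = b" by (simp add: \<Phi>_def y_def)
    have ht_le: "le_const (ht s) (\<Phi>' s)" if s: "0 \<le> s" "s \<le> T" for s
    proof -
      have "le_const (h s + \<kappa>' *\<^sub>R of_h10 (w s)) ((q1 * lam * K + \<kappa>') * v s + (q1 * lam * K + q1 * \<gamma> * b))"
        unfolding h_def
        by (rule le_const_nonlinearity[OF f Kf K \<kappa>(2,1) Q(2,3)[OF s] lam \<gamma> _ abs_le_const_mono[OF H10_abs_le_const wr[OF s]]
              _ v0[OF s(1)] d(2)[OF s] _ \<kappa>'_def])
          (use b r Suc.IH[OF s] in \<open>auto simp: v_def\<close>)
      then have 1: "le_const (ht s) (exp (\<kappa>' * s) * (C * v s + k'))"
        unfolding ht_def by (intro le_const_scaleR) (auto simp: C_def k_def k'_def)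
      have "C * v s + k' \<le> \<kappa>' * (y s + r * ((C * s) ^ Suc n / fact (Suc n))) + (A * y s + r * (C * ((C * s) ^ n / fact n)))"
      proof -
        have "k' \<le> k' * y s" using y1[OF s(1)] k mult_left_mono[of 1 "y s" k'] by simp
        moreover have "0 \<le> \<kappa>' * (r * ((C * s) ^ Suc n / fact (Suc n)))"
          using k r C s by (intro mult_nonneg_nonneg divide_nonneg_nonneg zero_le_power) auto
        moreover have "C * v s = k * y s + \<kappa>' * y s + r * (C * ((C * s) ^ n / fact n))"
          by (simp add: v_def C_def algebra_simps)
        moreover have "A * y s = k * y s + k' * y s" by (simp add: A_eq algebra_simps)
        ultimately show ?thesis by (simp only: distrib_left)
      qed
      then have 2: "exp (\<kappa>' * s) * (C * v s + k') \<le> \<Phi>' s" unfolding \<Phi>'_def by (intro mult_left_mono) auto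
      show ?thesis
        using 1 2 unfolding le_const_AE by (auto elim: AE_mp)
    qed
    define B where "B s = integral {0..s} P" for s
    have P': "continuous_on {0..\<tau>} P" "\<forall>s\<in>{0..\<tau>}. 0 \<le> P s"
      using Suc.prems P(2) by (auto intro: continuous_on_subset[OF P(1)])
    note BB = integral_from_0[OF P', folded B_def]
    have mf: "((\<lambda>s. heat_semigroup (B \<tau> - B s) (ht s)) has_integral (yt \<tau> - heat_semigroup (B \<tau>) (yt 0))) {0..\<tau>}"
      unfolding B_def
      by (rule mild_formula[OF Suc.prems(1) P' continuous_on_subset[OF cht] continuous_on_subset[OF cyt] der])
        (use Suc.prems in auto)
    have B\<tau>: "0 \<le> B \<tau>" using BB(2)[of 0 \<tau>] Suc.prems by (simp add: B_def)
    show ?case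
      unfolding le_const_def
    proof (intro ballI impI)
      fix \<psi> assume \<psi>: "\<psi> \<in> test_functions" "\<forall>x. 0 \<le> \<psi> x"
      define J where "J = inner one (abs_l2 \<psi>)"
      have J: "0 \<le> J" unfolding J_def using \<psi> by (intro inner_one_test_nonneg) auto
      have "inner (yt \<tau> - heat_semigroup (B \<tau>) (yt 0)) (abs_l2 \<psi>) \<le> (\<Phi> \<tau> - \<Phi> 0) * J"
      proof (rule has_integral_le)
        show "((\<lambda>s. inner (heat_semigroup (B \<tau> - B s) (ht s)) (abs_l2 \<psi>)) has_integral inner (yt \<tau> - heat_semigroup (B \<tau>) (yt 0)) (abs_l2 \<psi>)) {0..\<tau>}"
          using has_integral_linear[OF mf bounded_linear_inner_left] by (simp add: o_def)
        show "((\<lambda>s. \<Phi>' s * J) has_integral (\<Phi> \<tau> - \<Phi> 0) * J) {0..\<tau>}"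
          by (rule has_integral_mult_left[OF int\<Phi>])
        fix s assume s: "s \<in> {0..\<tau>}"
        have "0 \<le> \<Phi>' s"
          unfolding \<Phi>'_def using s k A0 y1[of s] C r
          by (intro mult_nonneg_nonneg add_nonneg_nonneg divide_nonneg_nonneg zero_le_power) auto
        then have "le_const (heat_semigroup (B \<tau> - B s) (ht s)) (\<Phi>' s)"
          using s Suc.prems BB(2)[of s \<tau>] by (intro heat_semigroup_le_const ht_le) auto
        then show "inner (heat_semigroup (B \<tau> - B s) (ht s)) (abs_l2 \<psi>) \<le> \<Phi>' s * J"
          using \<psi> by (simp add: le_const_def J_def)
      qed
      moreover have "inner (heat_semigroup (B \<tau>) (yt 0)) (abs_l2 \<psi>) \<le> \<Phi> 0 * J"
        using heat_semigroup_le_const[OF B\<tau> w0] b \<psi> unfolding \<Phi>0 by (simp add: yt_def le_const_def J_def)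
      ultimately have "inner (yt \<tau>) (abs_l2 \<psi>) \<le> \<Phi> \<tau> * J" by (simp add: inner_diff_left algebra_simps)
      then have "exp (\<kappa>' * \<tau>) * inner (of_h10 (w \<tau>)) (abs_l2 \<psi>) \<le> exp (\<kappa>' * \<tau>) * ((y \<tau> + r * ((C * \<tau>) ^ Suc n / fact (Suc n))) * J)"
        by (simp add: yt_def \<Phi>_def mult.assoc del: power_Suc fact_Suc)
      then have "inner (of_h10 (w \<tau>)) (abs_l2 \<psi>) \<le> (y \<tau> + r * ((C * \<tau>) ^ Suc n / fact (Suc n))) * J"
        by (rule mult_left_le_imp_le) simp
      then show "inner (of_h10 (w \<tau>)) (abs_l2 \<psi>) \<le> (y \<tau> + r * ((C * \<tau>) ^ Suc n / fact (Suc n))) * inner one (abs_l2 \<psi>)"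
        by (simp only: J_def)
    qed
  qed
  show ?thesis
    using le_const_limit[OF claim[OF \<tau>]] by (simp add: y_def)
qed

lemma superpose_reflect:
  assumes "continuous_on UNIV f"
  shows "superpose (\<lambda>s. - f (- s)) (- u) = - superpose f u"
proof -
  have f': "continuous_on UNIV (\<lambda>s. - f (- s))"
    by (intro continuous_intros continuous_on_compose2[OF assms]) auto
  have "AE x in unit_leb. rep_l2 (superpose (\<lambda>s. - f (- s)) (- u)) x = rep_l2 (- superpose f u) x"
    using AE_rep_superpose[OF f', of "- u"] AE_rep_superpose[OF assms, of u] AE_rep_minus[of "superpose f u"] AE_rep_minus[of "of_h10 u"]
    by eventually_elim (simp add: of_h10_minus)
  then show ?thesis
    using abs_l2_eqI[OF square_integrable_rep square_integrable_rep] abs_rep_l2 by metis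
qed

lemma weak_solution_minus:
  assumes "weak_solution T P h w"
  shows "weak_solution T P (\<lambda>s. - h s) (\<lambda>s. - w s)"
  unfolding weak_solution_def
proof (intro conjI ballI allI)
  show "continuous_on {0..T} (\<lambda>s. - w s)" using assms by (auto simp: weak_solution_def intro: continuous_intros)
  fix \<tau> k assume "\<tau> \<in> {0..T}"
  then have "coef (of_h10 (w \<tau>)) k - coef (of_h10 (w 0)) k = integral {0..\<tau>} (\<lambda>r. - ev k * P r * coef (of_h10 (w r)) k + coef (h r) k)"
    using assms unfolding weak_solution_def by blast
  moreover have "integral {0..\<tau>} (\<lambda>r. - ev k * P r * coef (of_h10 (- w r)) k + coef (- h r) k)
      = integral {0..\<tau>} (\<lambda>r. - (- ev k * P r * coef (of_h10 (w r)) k + coef (h r) k))"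
    by (simp add: of_h10_minus)
  moreover have "\<dots> = - integral {0..\<tau>} (\<lambda>r. - ev k * P r * coef (of_h10 (w r)) k + coef (h r) k)"
    by (rule integral_neg)
  ultimately show "coef (of_h10 (- w \<tau>)) k - coef (of_h10 (- w 0)) k = integral {0..\<tau>} (\<lambda>r. - ev k * P r * coef (of_h10 (- w r)) k + coef (- h r) k)"
    by (simp add: of_h10_minus)
qed

text \<open>The lower bound is the upper bound for \<open>- w\<close>, which solves the equation with nonlinearity \<open>s \<mapsto> - f (- s)\<close>.\<close>

lemma abs_barrier:
  fixes w :: "real \<Rightarrow> h10" and d :: "real \<Rightarrow> l2"
  assumes T: "0 \<le> T" and ws: "weak_solution T P (\<lambda>s. Q s *\<^sub>R (lam *\<^sub>R superpose f (w s) + \<gamma> *\<^sub>R d s)) w"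
    and P: "continuous_on {0..T} P" "\<And>s. 0 \<le> s \<Longrightarrow> s \<le> T \<Longrightarrow> 0 \<le> P s"
    and Q: "continuous_on {0..T} Q" "\<And>s. 0 \<le> s \<Longrightarrow> s \<le> T \<Longrightarrow> 0 \<le> Q s" "\<And>s. 0 \<le> s \<Longrightarrow> s \<le> T \<Longrightarrow> Q s \<le> q1"
    and d: "continuous_on {0..T} d" "\<And>s. 0 \<le> s \<Longrightarrow> s \<le> T \<Longrightarrow> abs_le_const (d s) b"
    and w0: "abs_le_const (of_h10 (w 0)) b" and b: "1 \<le> b"
    and lam: "0 < lam" and \<gamma>: "0 < \<gamma>"
    and f: "continuous_on UNIV f" and Kf: "\<And>u. 0 \<le> u \<Longrightarrow> f u \<le> K * u + K" "\<And>u. u \<le> 0 \<Longrightarrow> K * u - K \<le> f u" and K: "0 \<le> K"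
    and mono: "\<forall>r>0. \<exists>\<kappa>>0. mono_on {-r..r} (\<lambda>s. \<kappa> * s + f s)"
    and A: "A = 2 * (q1 * lam * K) + q1 * \<gamma> * b"
    and \<tau>: "0 \<le> \<tau>" "\<tau> \<le> T"
  shows "abs_le_const (of_h10 (w \<tau>)) (b * exp (A * \<tau>))"
proof (rule abs_le_constI)
  show "le_const (of_h10 (w \<tau>)) (b * exp (A * \<tau>))"
    by (rule upper_barrier[OF T ws P Q d(1) abs_le_constD(1)[OF d(2)] abs_le_constD(1)[OF w0] b lam \<gamma> f Kf(1) K mono A \<tau>])
next
  let ?f = "\<lambda>s. - f (- s)"
  have f': "continuous_on UNIV ?f"
    by (intro continuous_intros continuous_on_compose2[OF f]) auto
  have "weak_solution T P (\<lambda>s. Q s *\<^sub>R (lam *\<^sub>R superpose ?f (- w s) + \<gamma> *\<^sub>R (- d s))) (\<lambda>s. - w s)"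
    using weak_solution_minus[OF ws] by (simp add: superpose_reflect[OF f] algebra_simps)
  moreover have "\<forall>r>0. \<exists>\<kappa>>0. mono_on {-r..r} (\<lambda>s. \<kappa> * s + ?f s)"
  proof (intro allI impI)
    fix r :: real assume "r > 0"
    then obtain \<kappa> where \<kappa>: "\<kappa> > 0" "mono_on {-r..r} (\<lambda>s. \<kappa> * s + f s)" using mono by blast
    have "mono_on {-r..r} (\<lambda>s. \<kappa> * s + ?f s)"
    proof (rule mono_onI)
      fix s t assume "s \<in> {-r..r}" "t \<in> {-r..r}" "s \<le> t"
      then show "\<kappa> * s + ?f s \<le> \<kappa> * t + ?f t" using mono_onD[OF \<kappa>(2), of "- t" "- s"] by auto
    qed
    with \<kappa>(1) show "\<exists>\<kappa>>0. mono_on {-r..r} (\<lambda>s. \<kappa> * s + ?f s)" by blast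
  qed
  moreover have "le_const (of_h10 (- w 0)) b" using abs_le_constD(2)[OF w0] by (simp add: of_h10_minus)
  moreover have "continuous_on {0..T} (\<lambda>s. - d s)" by (intro continuous_intros d(1))
  moreover have "?f u \<le> K * u + K" if "0 \<le> u" for u using Kf(2)[of "- u"] that by simp
  ultimately have "le_const (of_h10 (- w \<tau>)) (b * exp (A * \<tau>))"
    using upper_barrier[OF T, of P Q lam ?f "\<lambda>s. - w s" \<gamma> "\<lambda>s. - d s" q1 b K A \<tau>]
      P Q abs_le_constD(2)[OF d(2)] b lam \<gamma> f' K A \<tau> by blast
  then show "le_const (- of_h10 (w \<tau>)) (b * exp (A * \<tau>))" by (simp add: of_h10_minus)
qed

section \<open>The delay equation on one delay interval\<close>

lemma uniform_limit_sequentiallyD: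
  assumes "uniform_limit S f g sequentially" "0 < e"
  obtains N where "\<forall>n\<ge>N. \<forall>s\<in>S. dist (f n s) (g s) < e"
  using uniform_limitD[OF assms] unfolding eventually_sequentially by blast

lemma weak_solution_limit:
  fixes w :: "nat \<Rightarrow> real \<Rightarrow> h10"
  assumes ws: "\<And>n. weak_solution T (P n) (h n) (w n)"
    and cont: "\<And>n. continuous_on {0..T} (P n)" "\<And>n. continuous_on {0..T} (h n)"
    and lim: "uniform_limit {0..T} w v sequentially"
      "\<And>s. 0 \<le> s \<Longrightarrow> s \<le> T \<Longrightarrow> (\<lambda>n. P n s) \<longlonglongrightarrow> P' s"
      "\<And>s. 0 \<le> s \<Longrightarrow> s \<le> T \<Longrightarrow> (\<lambda>n. h n s) \<longlonglongrightarrow> h' s"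
    and bound: "\<And>n s. 0 \<le> s \<Longrightarrow> s \<le> T \<Longrightarrow> \<bar>P n s\<bar> \<le> p1" "\<And>n s. 0 \<le> s \<Longrightarrow> s \<le> T \<Longrightarrow> norm (h n s) \<le> G"
  shows "weak_solution T P' h' v"
  unfolding weak_solution_def
proof (intro conjI ballI allI)
  have cw: "continuous_on {0..T} (w n)" for n using ws[of n] by (simp add: weak_solution_def)
  show cv: "continuous_on {0..T} v"
    by (rule uniform_limit_theorem[OF _ lim(1)]) (use cw in auto)
  fix \<tau> k assume \<tau>: "\<tau> \<in> {0..T}"
  have wlim: "(\<lambda>n. coef (of_h10 (w n s)) k) \<longlonglongrightarrow> coef (of_h10 (v s)) k" if "s \<in> {0..T}" for s
    by (intro tendsto_inner tendsto_const bounded_linear.tendsto[OF bounded_linear_of_h10] tendsto_uniform_limitI[OF lim(1) that])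
  let ?f = "\<lambda>n r. - ev k * P n r * coef (of_h10 (w n r)) k + coef (h n r) k"
  let ?g = "\<lambda>r. - ev k * P' r * coef (of_h10 (v r)) k + coef (h' r) k"
  have "bounded (v ` {0..T})" by (intro compact_imp_bounded compact_continuous_image cv) simp
  then obtain V where V: "\<forall>s\<in>{0..T}. norm (v s) \<le> V" unfolding bounded_iff by auto
  obtain M where "\<forall>n\<ge>M. \<forall>s\<in>{0..T}. dist (w n s) (v s) < 1"
    by (rule uniform_limit_sequentiallyD[OF lim(1) zero_less_one])
  then have M: "dist (w n s) (v s) < 1" if "n \<ge> M" "s \<in> {0..T}" for n s using that by blast
  have "(\<lambda>n. integral {0..\<tau>} (?f (n + M))) \<longlonglongrightarrow> integral {0..\<tau>} ?g"
  proof (rule dominated_convergence(2)[where h = "\<lambda>r. ev k * p1 * (V + 1) + G"])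
    show "?f (n + M) integrable_on {0..\<tau>}" for n
    proof -
      have "continuous_on {0..T} (?f (n + M))"
        by (intro continuous_intros cont continuous_on_coef_h10 cw)
      then have "continuous_on {0..\<tau>} (?f (n + M))" by (rule continuous_on_subset) (use \<tau> in auto)
      then show ?thesis by (rule integrable_continuous_interval)
    qed
    show "(\<lambda>r. ev k * p1 * (V + 1) + G) integrable_on {0..\<tau>}" by (rule integrable_const_ivl)
    show "norm (?f (n + M) r) \<le> ev k * p1 * (V + 1) + G" if r: "r \<in> {0..\<tau>}" for n r
    proof -
      have rT: "r \<in> {0..T}" using r \<tau> by auto
      have "norm (w (n + M) r) \<le> V + 1"
      proof -
        have "norm (w (n + M) r) \<le> norm (v r) + norm (w (n + M) r - v r)" by (rule norm_triangle_sub)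
        moreover have "norm (w (n + M) r - v r) < 1" using M[of "n + M" r] rT by (simp add: dist_norm)
        moreover have "norm (v r) \<le> V" using V rT by blast
        ultimately show ?thesis by linarith
      qed
      then have 1: "\<bar>coef (of_h10 (w (n + M) r)) k\<bar> \<le> V + 1"
        using abs_coef_le[of "of_h10 (w (n + M) r)" k] norm_of_h10_le[of "w (n + M) r"] by linarith
      have "\<bar>ev k * P (n + M) r * coef (of_h10 (w (n + M) r)) k\<bar> = ev k * \<bar>P (n + M) r\<bar> * \<bar>coef (of_h10 (w (n + M) r)) k\<bar>"
        using ev_pos[of k] by (simp add: abs_mult)
      also have "\<dots> \<le> ev k * p1 * (V + 1)"
        using ev_pos[of k] bound(1)[of r "n + M"] rT 1 by (intro mult_mono) auto
      finally have "\<bar>ev k * P (n + M) r * coef (of_h10 (w (n + M) r)) k\<bar> \<le> ev k * p1 * (V + 1)" .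
      moreover have "\<bar>coef (h (n + M) r) k\<bar> \<le> G" using abs_coef_le[of "h (n + M) r" k] bound(2)[of r "n + M"] rT by auto
      ultimately show ?thesis unfolding real_norm_def by linarith
    qed
    show "(\<lambda>n. ?f (n + M) r) \<longlonglongrightarrow> ?g r" if r: "r \<in> {0..\<tau>}" for r
    proof -
      have rT: "r \<in> {0..T}" using r \<tau> by auto
      have "(\<lambda>n. ?f n r) \<longlonglongrightarrow> ?g r"
        using rT by (intro tendsto_intros lim wlim) auto
      then show ?thesis by (rule LIMSEQ_ignore_initial_segment)
    qed
  qed
  moreover have "integral {0..\<tau>} (?f (n + M)) = coef (of_h10 (w (n + M) \<tau>)) k - coef (of_h10 (w (n + M) 0)) k" for n
    using ws[of "n + M"] \<tau> unfolding weak_solution_def by simp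
  moreover have "(\<lambda>n. coef (of_h10 (w (n + M) \<tau>)) k - coef (of_h10 (w (n + M) 0)) k) \<longlonglongrightarrow> coef (of_h10 (v \<tau>)) k - coef (of_h10 (v 0)) k"
    using \<tau> LIMSEQ_ignore_initial_segment[OF wlim[OF \<tau>], of M] LIMSEQ_ignore_initial_segment[OF wlim[of 0], of M]
    by (intro tendsto_diff) auto
  ultimately show "coef (of_h10 (v \<tau>)) k - coef (of_h10 (v 0)) k = integral {0..\<tau>} ?g"
    using LIMSEQ_unique by fastforce
qed

text \<open>After the change of time the equation reads \<open>w' = p(w) w\<^sub>x\<^sub>x + q(w) (\<lambda> f(w) + \<gamma> w(\<sqdot> - \<rho>))\<close>, with \<open>p = 1 / (a \<circ> l)\<close> and
  \<open>q = p\<^sup>2\<close>. Continuity and the bounds are all that the solution theory uses of these coefficients.\<close>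

locale delay_problem =
  fixes lam \<gamma> \<rho> p0 p1 q1 :: real and p q :: "h10 \<Rightarrow> real"
  assumes lam: "0 < lam" and \<gamma>: "0 < \<gamma>" and \<rho>: "0 < \<rho>" and p0: "0 < p0"
    and cont_p: "continuous_on UNIV p" and cont_q: "continuous_on UNIV q"
    and p_bounds: "p0 \<le> p u" "p u \<le> p1" and q_bounds: "0 \<le> q u" "q u \<le> q1"
begin

lemma p1: "0 \<le> p1" and q1: "0 \<le> q1"
  using p_bounds[of 0] q_bounds[of 0] p0 by auto

text \<open>Tonelli's approximation. For \<open>\<delta> = 0\<close> this is the delay equation on \<open>[0,\<rho>]\<close>, where the delayed values are those of
  the initial history \<open>\<phi>\<close>; for \<open>\<delta> > 0\<close> the right-hand side at time \<open>s\<close> only involves \<open>w\<close> up to time \<open>s - \<delta>\<close>, and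
  the equation can be solved explicitly, step by step.\<close>

definition forcing :: "(real \<Rightarrow> real) \<Rightarrow> real \<Rightarrow> (real \<Rightarrow> h10) \<Rightarrow> (real \<Rightarrow> h10) \<Rightarrow> real \<Rightarrow> l2" where
  "forcing f \<delta> \<phi> w s = q (w (s - \<delta>)) *\<^sub>R (lam *\<^sub>R superpose f (w (s - \<delta>)) + \<gamma> *\<^sub>R of_h10 (\<phi> (s - \<rho>)))"

definition step_solution :: "(real \<Rightarrow> real) \<Rightarrow> real \<Rightarrow> (real \<Rightarrow> h10) \<Rightarrow> (real \<Rightarrow> h10) \<Rightarrow> bool" where
  "step_solution f \<delta> \<phi> w \<longleftrightarrow> continuous_on {-\<rho>..\<rho>} w \<and> (\<forall>\<theta>\<in>{-\<rho>..0}. w \<theta> = \<phi> \<theta>) \<and>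
     weak_solution \<rho> (\<lambda>s. p (w (s - \<delta>))) (forcing f \<delta> \<phi> w) w"

lemma continuous_on_coefficients:
  assumes w: "continuous_on {-\<rho>..\<rho>} w" and \<delta>: "0 \<le> \<delta>" "\<delta> \<le> \<rho>" and f: "continuous_on UNIV f"
    and \<phi>: "continuous_on {-\<rho>..0} \<phi>"
  shows "continuous_on {0..\<rho>} (\<lambda>s. p (w (s - \<delta>)))" and "continuous_on {0..\<rho>} (\<lambda>s. q (w (s - \<delta>)))"
    and "continuous_on {0..\<rho>} (\<lambda>s. of_h10 (\<phi> (s - \<rho>)))" and "continuous_on {0..\<rho>} (forcing f \<delta> \<phi> w)"
proof -
  have cw: "continuous_on {0..\<rho>} (\<lambda>s. w (s - \<delta>))"
    by (rule continuous_on_compose2[OF w]) (use \<delta> in \<open>auto intro!: continuous_intros\<close>)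
  show 1: "continuous_on {0..\<rho>} (\<lambda>s. p (w (s - \<delta>)))"
    by (rule continuous_on_compose2[OF cont_p cw]) simp
  show 2: "continuous_on {0..\<rho>} (\<lambda>s. q (w (s - \<delta>)))"
    by (rule continuous_on_compose2[OF cont_q cw]) simp
  have "continuous_on {0..\<rho>} (\<lambda>s. \<phi> (s - \<rho>))"
    by (rule continuous_on_compose2[OF \<phi>]) (auto intro!: continuous_intros)
  then show 3: "continuous_on {0..\<rho>} (\<lambda>s. of_h10 (\<phi> (s - \<rho>)))"
    by (rule bounded_linear.continuous_on[OF bounded_linear_of_h10])
  have "continuous_on {0..\<rho>} (\<lambda>s. superpose f (w (s - \<delta>)))"
    by (rule continuous_on_compose2[OF continuous_on_superpose[OF f] cw]) simp
  then show "continuous_on {0..\<rho>} (forcing f \<delta> \<phi> w)"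
    unfolding forcing_def by (intro continuous_intros 2 3)
qed

lemma step_solution_compactness:
  fixes w :: "nat \<Rightarrow> real \<Rightarrow> h10"
  assumes sol: "\<And>n. step_solution f (\<delta> n) (\<phi> n) (w n)" and f: "continuous_on UNIV f"
    and \<delta>: "\<And>n. 0 \<le> \<delta> n" "\<And>n. \<delta> n \<le> \<rho>" "\<delta> \<longlonglongrightarrow> 0"
    and \<phi>n: "\<And>n. continuous_on {-\<rho>..0} (\<phi> n)" and \<phi>: "uniform_limit {-\<rho>..0} \<phi> \<psi> sequentially"
    and B: "\<And>n s. 0 \<le> s \<Longrightarrow> s \<le> \<rho> \<Longrightarrow> norm (superpose f (w n (s - \<delta> n))) \<le> B"
  obtains r v where "strict_mono (r :: nat \<Rightarrow> nat)" "uniform_limit {-\<rho>..\<rho>} (\<lambda>n. w (r n)) v sequentially" "step_solution f 0 \<psi> v"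
proof -
  have cw: "continuous_on {-\<rho>..\<rho>} (w n)" and w\<phi>: "\<And>\<theta>. \<theta> \<in> {-\<rho>..0} \<Longrightarrow> w n \<theta> = \<phi> n \<theta>"
    and ws: "weak_solution \<rho> (\<lambda>s. p (w n (s - \<delta> n))) (forcing f (\<delta> n) (\<phi> n) (w n)) (w n)" for n
    using sol[of n] by (auto simp: step_solution_def)
  note cc = continuous_on_coefficients[OF cw \<delta>(1,2) f \<phi>n]
  have c\<psi>: "continuous_on {-\<rho>..0} \<psi>" by (rule uniform_limit_theorem[OF _ \<phi>]) (use \<phi>n in auto)
  have "bounded (\<psi> ` {-\<rho>..0})" by (intro compact_imp_bounded compact_continuous_image c\<psi>) simp
  then obtain b0 where b0: "\<forall>\<theta>\<in>{-\<rho>..0}. norm (\<psi> \<theta>) \<le> b0" unfolding bounded_iff by auto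
  obtain M where "\<forall>n\<ge>M. \<forall>\<theta>\<in>{-\<rho>..0}. dist (\<phi> n \<theta>) (\<psi> \<theta>) < 1"
    by (rule uniform_limit_sequentiallyD[OF \<phi> zero_less_one])
  then have M: "dist (\<phi> n \<theta>) (\<psi> \<theta>) < 1" if "n \<ge> M" "\<theta> \<in> {-\<rho>..0}" for n \<theta> using that by blast
  have \<phi>b: "norm (\<phi> n \<theta>) \<le> b0 + 1" if n: "n \<ge> M" and t: "\<theta> \<in> {-\<rho>..0}" for n \<theta>
  proof -
    have "norm (\<psi> \<theta>) \<le> b0" using b0 t by blast
    then show ?thesis using M[OF n t] norm_triangle_sub[of "\<phi> n \<theta>" "\<psi> \<theta>"] by (simp add: dist_norm)
  qed
  define G where "G = q1 * (lam * B + \<gamma> * (b0 + 1))"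
  have hG: "norm (forcing f (\<delta> n) (\<phi> n) (w n) s) \<le> G" if n: "n \<ge> M" and s: "0 \<le> s" "s \<le> \<rho>" for n s
  proof -
    have "norm (lam *\<^sub>R superpose f (w n (s - \<delta> n)) + \<gamma> *\<^sub>R of_h10 (\<phi> n (s - \<rho>))) \<le> lam * B + \<gamma> * (b0 + 1)"
    proof (rule order_trans[OF norm_triangle_ineq add_mono])
      show "norm (lam *\<^sub>R superpose f (w n (s - \<delta> n))) \<le> lam * B" using B[OF s] lam by simp
      have "norm (of_h10 (\<phi> n (s - \<rho>))) \<le> b0 + 1" using norm_of_h10_le[of "\<phi> n (s - \<rho>)"] \<phi>b[OF n, of "s - \<rho>"] s by auto
      then show "norm (\<gamma> *\<^sub>R of_h10 (\<phi> n (s - \<rho>))) \<le> \<gamma> * (b0 + 1)" using \<gamma> by simp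
    qed
    then show ?thesis
      unfolding forcing_def G_def norm_scaleR using q_bounds[of "w n (s - \<delta> n)"] by (intro mult_mono) auto
  qed
  have x: "(\<lambda>n. w (n + M) 0) \<longlonglongrightarrow> \<psi> 0"
    using LIMSEQ_ignore_initial_segment[OF tendsto_uniform_limitI[OF \<phi>, of 0], of M] \<rho> by (simp add: w\<phi>)
  obtain r v where r: "strict_mono (r :: nat \<Rightarrow> nat)" and v: "uniform_limit {0..\<rho>} (\<lambda>n. w (r n + M)) v sequentially"
    by (rule weak_solution_compactness[of \<rho> "\<lambda>n s. p (w (n + M) (s - \<delta> (n + M)))"
          "\<lambda>n. forcing f (\<delta> (n + M)) (\<phi> (n + M)) (w (n + M))" "\<lambda>n. w (n + M)" p0 p1 G "\<psi> 0"])
      (use ws cc p_bounds p0 hG x \<rho> in auto)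
  define R where "R n = r n + M" for n
  have R: "strict_mono R" using r by (auto simp: R_def strict_mono_def)
  have v: "uniform_limit {0..\<rho>} (\<lambda>n. w (R n)) v sequentially" using v by (simp add: R_def)
  define V where "V s = (if s < 0 then \<psi> s else v s)" for s
  have \<phi>R: "uniform_limit {-\<rho>..0} (\<lambda>n. \<phi> (R n)) \<psi> sequentially"
    using filterlim_compose[OF \<phi> filterlim_subseq[OF R]] by simp
  have v0: "v 0 = \<psi> 0"
  proof (rule LIMSEQ_unique)
    show "(\<lambda>n. w (R n) 0) \<longlonglongrightarrow> v 0" using tendsto_uniform_limitI[OF v, of 0] \<rho> by simp
    show "(\<lambda>n. w (R n) 0) \<longlonglongrightarrow> \<psi> 0" using tendsto_uniform_limitI[OF \<phi>R, of 0] \<rho> by (simp add: w\<phi>)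
  qed
  have V\<psi>: "V \<theta> = \<psi> \<theta>" if "\<theta> \<in> {-\<rho>..0}" for \<theta> using that v0 by (auto simp: V_def)
  have Vv: "V s = v s" if "s \<in> {0..\<rho>}" for s using that by (simp add: V_def)
  have UV: "uniform_limit {-\<rho>..\<rho>} (\<lambda>n. w (R n)) V sequentially"
  proof (rule uniform_limitI)
    fix e :: real assume e: "e > 0"
    show "\<forall>\<^sub>F n in sequentially. \<forall>s\<in>{-\<rho>..\<rho>}. dist (w (R n) s) (V s) < e"
      using uniform_limitD[OF v e] uniform_limitD[OF \<phi>R e]
    proof eventually_elim
      case (elim n)
      show ?case
      proof
        fix s assume s: "s \<in> {-\<rho>..\<rho>}"
        show "dist (w (R n) s) (V s) < e"
        proof (cases "s < 0")
          case True
          then have "s \<in> {-\<rho>..0}" using s by simp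
          then show ?thesis using elim(2) by (simp add: V\<psi> w\<phi>)
        next
          case False
          then have "s \<in> {0..\<rho>}" using s by simp
          then show ?thesis using elim(1) by (simp add: Vv)
        qed
      qed
    qed
  qed
  have cV: "continuous_on {-\<rho>..\<rho>} V" by (rule uniform_limit_theorem[OF _ UV]) (use cw in auto)
  have \<delta>R: "(\<lambda>n. \<delta> (R n)) \<longlonglongrightarrow> 0" using LIMSEQ_subseq_LIMSEQ[OF \<delta>(3) R] by (simp add: o_def)
  have wshift: "(\<lambda>n. w (R n) (s - \<delta> (R n))) \<longlonglongrightarrow> V s" if s: "0 \<le> s" "s \<le> \<rho>" for s
  proof -
    have mem: "s - \<delta> (R n) \<in> {-\<rho>..\<rho>}" for n using \<delta>(1,2)[of "R n"] s by auto
    have "(\<lambda>n. s - \<delta> (R n)) \<longlonglongrightarrow> s - 0" by (intro tendsto_intros \<delta>R)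
    then have "(\<lambda>n. V (s - \<delta> (R n))) \<longlonglongrightarrow> V s"
      using s \<rho> mem by (intro continuous_on_tendsto_compose[OF cV]) auto
    moreover have "(\<lambda>n. w (R n) (s - \<delta> (R n)) - V (s - \<delta> (R n))) \<longlonglongrightarrow> 0"
    proof (rule LIMSEQ_I)
      fix e :: real assume "e > 0"
      from uniform_limit_sequentiallyD[OF UV this] obtain N where "\<forall>n\<ge>N. \<forall>s\<in>{-\<rho>..\<rho>}. dist (w (R n) s) (V s) < e" .
      then show "\<exists>N. \<forall>n\<ge>N. norm (w (R n) (s - \<delta> (R n)) - V (s - \<delta> (R n)) - 0) < e"
        using mem by (intro exI[of _ N]) (auto simp: dist_norm)
    qed
    ultimately have "(\<lambda>n. (w (R n) (s - \<delta> (R n)) - V (s - \<delta> (R n))) + V (s - \<delta> (R n))) \<longlonglongrightarrow> 0 + V s"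
      by (intro tendsto_add)
    then show ?thesis by simp
  qed
  have "weak_solution \<rho> (\<lambda>s. p (V (s - 0))) (forcing f 0 \<psi> V) V"
  proof (rule weak_solution_limit)
    show "weak_solution \<rho> (\<lambda>s. p (w (R n) (s - \<delta> (R n)))) (forcing f (\<delta> (R n)) (\<phi> (R n)) (w (R n))) (w (R n))" for n
      by (rule ws)
    show "uniform_limit {0..\<rho>} (\<lambda>n. w (R n)) V sequentially"
      by (rule uniform_limit_on_subset[OF UV]) (use \<rho> in auto)
    show "(\<lambda>n. p (w (R n) (s - \<delta> (R n)))) \<longlonglongrightarrow> p (V (s - 0))" if "0 \<le> s" "s \<le> \<rho>" for s
      using wshift[OF that] by (intro continuous_on_tendsto_compose[OF cont_p]) auto
    show "(\<lambda>n. forcing f (\<delta> (R n)) (\<phi> (R n)) (w (R n)) s) \<longlonglongrightarrow> forcing f 0 \<psi> V s" if s: "0 \<le> s" "s \<le> \<rho>" for s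
      unfolding forcing_def diff_0_right
    proof (intro tendsto_intros)
      show "(\<lambda>n. q (w (R n) (s - \<delta> (R n)))) \<longlonglongrightarrow> q (V s)"
        using wshift[OF s] by (intro continuous_on_tendsto_compose[OF cont_q]) auto
      show "(\<lambda>n. superpose f (w (R n) (s - \<delta> (R n)))) \<longlonglongrightarrow> superpose f (V s)"
        using wshift[OF s] by (intro continuous_on_tendsto_compose[OF continuous_on_superpose[OF f]]) auto
      show "(\<lambda>n. of_h10 (\<phi> (R n) (s - \<rho>))) \<longlonglongrightarrow> of_h10 (\<psi> (s - \<rho>))"
        using s by (intro bounded_linear.tendsto[OF bounded_linear_of_h10] tendsto_uniform_limitI[OF \<phi>R]) auto
    qed
    show "\<bar>p (w (R n) (s - \<delta> (R n)))\<bar> \<le> p1" for n s using p_bounds[of "w (R n) (s - \<delta> (R n))"] p0 by simp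
    show "norm (forcing f (\<delta> (R n)) (\<phi> (R n)) (w (R n)) s) \<le> G" if "0 \<le> s" "s \<le> \<rho>" for n s
      using that by (intro hG) (auto simp: R_def)
  qed (rule cc)+
  then have "step_solution f 0 \<psi> V" using cV V\<psi> by (simp add: step_solution_def)
  with R UV that show ?thesis by blast
qed

text \<open>The map \<open>w \<mapsto> \<Phi> w\<close> below uses \<open>w\<close> only up to time \<open>\<tau> - \<delta>\<close> to determine \<open>\<Phi> w\<close> at time \<open>\<tau>\<close>, so its iterates
  become stationary on \<open>[0,\<rho>]\<close> after finitely many steps.\<close>

lemma delayed_solution_exists:
  assumes \<delta>: "0 < \<delta>" "\<delta> \<le> \<rho>" and f: "continuous_on UNIV f" and \<phi>: "continuous_on {-\<rho>..0} \<phi>"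
  obtains w where "step_solution f \<delta> \<phi> w"
proof -
  define \<Phi> where "\<Phi> w \<tau> = (if \<tau> \<le> 0 then \<phi> \<tau> else duhamel (\<phi> 0) (\<lambda>s. p (w (s - \<delta>))) (forcing f \<delta> \<phi> w) \<tau>)" for w \<tau>
  define W where "W j = (\<Phi> ^^ j) (\<lambda>\<tau>. \<phi> (min \<tau> 0))" for j
  have W_Suc: "W (Suc j) = \<Phi> (W j)" for j unfolding W_def by simp
  have ws: "weak_solution \<rho> (\<lambda>s. p (w (s - \<delta>))) (forcing f \<delta> \<phi> w) (duhamel (\<phi> 0) (\<lambda>s. p (w (s - \<delta>))) (forcing f \<delta> \<phi> w))"
    and w0: "duhamel (\<phi> 0) (\<lambda>s. p (w (s - \<delta>))) (forcing f \<delta> \<phi> w) 0 = \<phi> 0"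
    if "continuous_on {-\<rho>..\<rho>} w" for w
    using continuous_on_coefficients[OF that _ \<delta>(2) f \<phi>] \<delta> \<rho> p0 p_bounds
    by (intro weak_solution_duhamel[of \<rho> _ p0]; simp)+
  have contW: "continuous_on {-\<rho>..\<rho>} (W j)" for j
  proof (induction j)
    case 0
    show ?case unfolding W_def
      by (simp, rule continuous_on_compose2[OF \<phi> continuous_on_min[OF continuous_on_id continuous_on_const]])
        (use \<rho> in auto)
  next
    case (Suc j)
    let ?d = "duhamel (\<phi> 0) (\<lambda>s. p (W j (s - \<delta>))) (forcing f \<delta> \<phi> (W j))"
    have "continuous_on {0..\<rho>} ?d" using ws[OF Suc] by (simp add: weak_solution_def)
    moreover have "W (Suc j) s = ?d s" if "s \<in> {0..\<rho>}" for s
      using that w0[OF Suc] by (auto simp: W_Suc \<Phi>_def)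
    ultimately have "continuous_on {0..\<rho>} (W (Suc j))" by (subst continuous_on_cong[OF refl]) auto
    moreover have "continuous_on {-\<rho>..0} (W (Suc j))"
      using \<phi> by (subst continuous_on_cong[OF refl, where g = \<phi>]) (auto simp: W_Suc \<Phi>_def)
    ultimately have "continuous_on ({-\<rho>..0} \<union> {0..\<rho>}) (W (Suc j))"
      by (intro continuous_on_closed_Un) auto
    moreover have "{-\<rho>..0} \<union> {0..\<rho>} = {-\<rho>..\<rho>}" using \<rho> by auto
    ultimately show ?case by simp
  qed
  have stat: "W (Suc j) \<tau> = W j \<tau>" if "\<tau> \<le> real j * \<delta>" for j \<tau>
    using that
  proof (induction j arbitrary: \<tau>)
    case 0
    then show ?case by (simp add: W_def \<Phi>_def)
  next
    case (Suc j)
    have eq: "W (Suc j) (s - \<delta>) = W j (s - \<delta>)" if "s \<le> \<tau>" for s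
      by (rule Suc.IH) (use that Suc.prems in \<open>simp add: algebra_simps\<close>)
    have "duhamel (\<phi> 0) (\<lambda>s. p (W (Suc j) (s - \<delta>))) (forcing f \<delta> \<phi> (W (Suc j))) \<tau>
        = duhamel (\<phi> 0) (\<lambda>s. p (W j (s - \<delta>))) (forcing f \<delta> \<phi> (W j)) \<tau>"
      by (rule duhamel_cong) (simp_all add: eq forcing_def)
    then have "\<Phi> (W (Suc j)) \<tau> = \<Phi> (W j) \<tau>" unfolding \<Phi>_def by simp
    then show ?case by (simp only: W_Suc)
  qed
  obtain J :: nat where J: "\<rho> / \<delta> \<le> real J" using real_arch_simple by blast
  have J\<delta>: "\<rho> \<le> real J * \<delta>" using J \<delta>(1) by (simp add: pos_divide_le_eq)
  define w where "w = W J"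
  have cw: "continuous_on {-\<rho>..\<rho>} w" using contW by (simp add: w_def)
  have fp: "w \<tau> = \<Phi> w \<tau>" if "\<tau> \<le> \<rho>" for \<tau>
    using stat[of \<tau> J] that J\<delta> by (simp add: w_def W_Suc)
  let ?d = "duhamel (\<phi> 0) (\<lambda>s. p (w (s - \<delta>))) (forcing f \<delta> \<phi> w)"
  have wd: "w s = ?d s" if "s \<in> {0..\<rho>}" for s
    using fp[of s] w0[OF cw] that unfolding \<Phi>_def by auto
  have "weak_solution \<rho> (\<lambda>s. p (w (s - \<delta>))) (forcing f \<delta> \<phi> w) w"
    unfolding weak_solution_def
  proof (intro conjI ballI allI)
    show "continuous_on {0..\<rho>} w" by (rule continuous_on_subset[OF cw]) (use \<rho> in auto)
    fix \<tau> k assume \<tau>: "\<tau> \<in> {0..\<rho>}"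
    have "coef (of_h10 (?d \<tau>)) k - coef (of_h10 (?d 0)) k = integral {0..\<tau>} (\<lambda>r. - ev k * p (w (r - \<delta>)) * coef (of_h10 (?d r)) k + coef (forcing f \<delta> \<phi> w r) k)"
      using ws[OF cw] \<tau> unfolding weak_solution_def by blast
    also have "\<dots> = integral {0..\<tau>} (\<lambda>r. - ev k * p (w (r - \<delta>)) * coef (of_h10 (w r)) k + coef (forcing f \<delta> \<phi> w r) k)"
      using \<tau> by (intro integral_cong) (simp add: wd)
    finally show "coef (of_h10 (w \<tau>)) k - coef (of_h10 (w 0)) k = integral {0..\<tau>} (\<lambda>r. - ev k * p (w (r - \<delta>)) * coef (of_h10 (w r)) k + coef (forcing f \<delta> \<phi> w r) k)"
      using \<tau> \<rho> by (simp add: wd)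
  qed
  moreover have "w \<theta> = \<phi> \<theta>" if "\<theta> \<in> {-\<rho>..0}" for \<theta> using fp[of \<theta>] that \<rho> by (simp add: \<Phi>_def)
  ultimately have "step_solution f \<delta> \<phi> w" using cw by (simp add: step_solution_def)
  then show ?thesis using that by blast
qed

lemma bounded_nonlinearity_solution_exists:
  assumes f: "continuous_on UNIV f" "\<And>s. \<bar>f s\<bar> \<le> B" and \<phi>: "continuous_on {-\<rho>..0} \<phi>"
  obtains w where "step_solution f 0 \<phi> w"
proof -
  define \<delta> where "\<delta> n = \<rho> / real (Suc n)" for n
  have \<delta>: "0 < \<delta> n" "\<delta> n \<le> \<rho>" for n using \<rho> by (auto simp: \<delta>_def pos_divide_le_eq)
  have "\<exists>w. step_solution f (\<delta> n) \<phi> w" for n using delayed_solution_exists[OF \<delta> f(1) \<phi>] by blast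
  then obtain w where w: "\<And>n. step_solution f (\<delta> n) \<phi> (w n)" by metis
  have B: "0 \<le> B" using f(2)[of 0] by simp
  have lim: "\<delta> \<longlonglongrightarrow> 0" unfolding \<delta>_def
    by (intro real_tendsto_divide_at_top[OF tendsto_const] filterlim_compose[OF filterlim_real_sequentially filterlim_Suc])
  have "norm (superpose f u) \<le> B" for u
    by (rule norm_superpose_le[OF f(1) H10_abs_le_const B f(2)])
  then show ?thesis
    using step_solution_compactness[of f \<delta> "\<lambda>_. \<phi>" w \<phi> B] w f(1) \<delta> lim \<phi> that less_imp_le
    by (metis uniform_limit_const)
qed

end

text \<open>The properties of the nonlinearity behind the a priori bound. Clamping the argument of \<open>f\<close> preserves them with
  the same \<open>K\<close>, so the bound is uniform in the level of the clamp.\<close>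

definition one_sided_growth :: "(real \<Rightarrow> real) \<Rightarrow> real \<Rightarrow> bool" where
  "one_sided_growth f K \<longleftrightarrow> 0 \<le> K \<and> (\<forall>u\<ge>0. f u \<le> K * u + K) \<and> (\<forall>u\<le>0. K * u - K \<le> f u) \<and>
     (\<forall>r>0. \<exists>\<kappa>>0. mono_on {-r..r} (\<lambda>s. \<kappa> * s + f s))"

definition clamp_fun :: "real \<Rightarrow> (real \<Rightarrow> real) \<Rightarrow> real \<Rightarrow> real" where
  "clamp_fun R f s = f (max (- R) (min R s))"

lemma one_sided_growth_clamp:
  assumes f: "one_sided_growth f K" and R: "0 < R"
  shows "one_sided_growth (clamp_fun R f) K"
  unfolding one_sided_growth_def
proof (intro conjI allI impI)
  show K: "0 \<le> K" using f by (simp add: one_sided_growth_def)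
  show "clamp_fun R f u \<le> K * u + K" if "0 \<le> u" for u
  proof -
    define c where "c = max (- R) (min R u)"
    have c: "0 \<le> c" "c \<le> u" using that R by (auto simp: c_def)
    have "f c \<le> K * c + K" using f c(1) by (simp add: one_sided_growth_def)
    also have "\<dots> \<le> K * u + K" using c K by (simp add: mult_left_mono)
    finally show ?thesis by (simp add: clamp_fun_def c_def)
  qed
  show "K * u - K \<le> clamp_fun R f u" if "u \<le> 0" for u
  proof -
    define c where "c = max (- R) (min R u)"
    have c: "c \<le> 0" "u \<le> c" using that R by (auto simp: c_def)
    have "K * u - K \<le> K * c - K" using c K by (simp add: mult_left_mono)
    also have "\<dots> \<le> f c" using f c(1) by (simp add: one_sided_growth_def)
    finally show ?thesis by (simp add: clamp_fun_def c_def)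
  qed
  fix r :: real assume "0 < r"
  obtain \<kappa> where \<kappa>: "\<kappa> > 0" "mono_on {-R..R} (\<lambda>s. \<kappa> * s + f s)" using f R by (auto simp: one_sided_growth_def)
  have "mono_on {-r..r} (\<lambda>s. \<kappa> * s + clamp_fun R f s)"
  proof (rule mono_onI)
    fix s t :: real assume "s \<le> t"
    define c where "c = max (- R) (min R s)"
    define d where "d = max (- R) (min R t)"
    have cd: "c \<in> {-R..R}" "d \<in> {-R..R}" "c \<le> d" "s - c \<le> t - d" using \<open>s \<le> t\<close> R by (auto simp: c_def d_def)
    have "\<kappa> * c + f c \<le> \<kappa> * d + f d" using mono_onD[OF \<kappa>(2) cd(1-3)] .
    moreover have "\<kappa> * (s - c) \<le> \<kappa> * (t - d)" using \<kappa>(1) cd(4) by (intro mult_left_mono) auto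
    ultimately have "\<kappa> * s + f c \<le> \<kappa> * t + f d" by (simp add: algebra_simps)
    then show "\<kappa> * s + clamp_fun R f s \<le> \<kappa> * t + clamp_fun R f t" by (simp add: clamp_fun_def c_def d_def)
  qed
  with \<kappa>(1) show "\<exists>\<kappa>>0. mono_on {-r..r} (\<lambda>s. \<kappa> * s + clamp_fun R f s)" by blast
qed

lemma continuous_on_clamp_fun: "continuous_on UNIV f \<Longrightarrow> continuous_on UNIV (clamp_fun R f)"
  unfolding clamp_fun_def by (rule continuous_on_compose2[of UNIV f]) (auto intro!: continuous_intros)

lemma superpose_clamp_fun:
  assumes f: "continuous_on UNIV f" and u: "abs_le_const (of_h10 u) R"
  shows "superpose (clamp_fun R f) u = superpose f u"
proof -
  have "AE x in unit_leb. rep_l2 (superpose (clamp_fun R f) u) x = rep_l2 (superpose f u) x"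
    using AE_rep_superpose[OF continuous_on_clamp_fun[OF f], of R u] AE_rep_superpose[OF f, of u] u[unfolded abs_le_const_def]
  proof eventually_elim
    case (elim x)
    then have "max (- R) (min R (rep_l2 (of_h10 u) x)) = rep_l2 (of_h10 u) x" by linarith
    with elim show ?case by (simp add: clamp_fun_def)
  qed
  then show ?thesis
    using abs_l2_eqI[OF square_integrable_rep square_integrable_rep] abs_rep_l2 by metis
qed

context delay_problem
begin

text \<open>The bound of \<open>abs_barrier\<close> at the end of one delay interval, for histories bounded by \<open>b\<close>.\<close>

definition barrier :: "real \<Rightarrow> real \<Rightarrow> real" where
  "barrier K b = b * exp ((2 * (q1 * lam * K) + q1 * \<gamma> * b) * \<rho>)"

lemma step_solution_barrier:
  assumes w: "step_solution f 0 \<phi> w" and f: "continuous_on UNIV f" "one_sided_growth f K"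
    and \<phi>: "continuous_on {-\<rho>..0} \<phi>" "\<And>\<theta>. \<theta> \<in> {-\<rho>..0} \<Longrightarrow> norm (\<phi> \<theta>) \<le> b" and b: "1 \<le> b"
    and s: "0 \<le> s" "s \<le> \<rho>"
  shows "abs_le_const (of_h10 (w s)) (barrier K b)"
proof -
  have cw: "continuous_on {-\<rho>..\<rho>} w" using w unfolding step_solution_def by blast
  have w\<phi>: "w \<theta> = \<phi> \<theta>" if "\<theta> \<in> {-\<rho>..0}" for \<theta> using w that unfolding step_solution_def by blast
  have "forcing f 0 \<phi> w = (\<lambda>s. q (w s) *\<^sub>R (lam *\<^sub>R superpose f (w s) + \<gamma> *\<^sub>R of_h10 (\<phi> (s - \<rho>))))"
    by (simp add: forcing_def fun_eq_iff)
  then have ws: "weak_solution \<rho> (\<lambda>s. p (w s)) (\<lambda>s. q (w s) *\<^sub>R (lam *\<^sub>R superpose f (w s) + \<gamma> *\<^sub>R of_h10 (\<phi> (s - \<rho>)))) w"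
    using w unfolding step_solution_def diff_0_right by (simp only:)
  note cc = continuous_on_coefficients[OF cw order_refl less_imp_le[OF \<rho>] f(1) \<phi>(1), unfolded diff_0_right]
  define A where "A = 2 * (q1 * lam * K) + q1 * \<gamma> * b"
  have K: "0 \<le> K" using f(2) by (simp add: one_sided_growth_def)
  have A: "0 \<le> A" unfolding A_def using q1 lam \<gamma> K b by simp
  have "abs_le_const (of_h10 (w s)) (b * exp (A * s))"
  proof (rule abs_barrier[OF less_imp_le[OF \<rho>] ws cc(1) _ cc(2) _ _ cc(3) _ _ b lam \<gamma> f(1) _ _ K _ A_def s])
    show "0 \<le> p (w s)" for s using p_bounds[of "w s"] p0 by simp
    show "0 \<le> q (w s)" "q (w s) \<le> q1" for s using q_bounds by auto
    show "abs_le_const (of_h10 (\<phi> (s - \<rho>))) b" if "0 \<le> s" "s \<le> \<rho>" for s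
      by (rule abs_le_const_mono[OF H10_abs_le_const \<phi>(2)]) (use that in auto)
    show "abs_le_const (of_h10 (w 0)) b"
      by (rule abs_le_const_mono[OF H10_abs_le_const]) (use \<rho> w\<phi>[of 0] \<phi>(2)[of 0] in auto)
    show "f u \<le> K * u + K" if "0 \<le> u" for u using f(2) that by (simp add: one_sided_growth_def)
    show "K * u - K \<le> f u" if "u \<le> 0" for u using f(2) that by (simp add: one_sided_growth_def)
    show "\<forall>r>0. \<exists>\<kappa>>0. mono_on {- r..r} (\<lambda>s. \<kappa> * s + f s)" using f(2) by (simp add: one_sided_growth_def)
  qed
  moreover have "b * exp (A * s) \<le> b * exp (A * \<rho>)" using A s b by (simp add: mult_left_mono)
  ultimately show ?thesis unfolding barrier_def A_def[symmetric] by (rule abs_le_const_mono)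
qed

lemma continuous_history_bounded:
  assumes "continuous_on {-\<rho>..0} (\<phi> :: real \<Rightarrow> h10)"
  obtains b where "1 \<le> b" "\<And>\<theta>. \<theta> \<in> {-\<rho>..0} \<Longrightarrow> norm (\<phi> \<theta>) \<le> b"
proof -
  have "bounded (\<phi> ` {-\<rho>..0})" by (intro compact_imp_bounded compact_continuous_image assms) simp
  then obtain b where "\<forall>\<theta>\<in>{-\<rho>..0}. norm (\<phi> \<theta>) \<le> b" unfolding bounded_iff by auto
  then have "norm (\<phi> \<theta>) \<le> max b 1" if "\<theta> \<in> {-\<rho>..0}" for \<theta> using that by (simp add: le_max_iff_disj)
  then show ?thesis using that[of "max b 1"] by simp
qed

text \<open>The nonlinearity is clamped at the height of the barrier; the solution of the clamped equation obeys the
  barrier and therefore never meets the clamp.\<close>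

lemma step_solution_exists:
  assumes f: "continuous_on UNIV f" "one_sided_growth f K" and \<phi>: "continuous_on {-\<rho>..0} \<phi>"
  obtains w where "step_solution f 0 \<phi> w"
proof -
  obtain b where b: "1 \<le> b" "\<And>\<theta>. \<theta> \<in> {-\<rho>..0} \<Longrightarrow> norm (\<phi> \<theta>) \<le> b"
    using continuous_history_bounded[OF \<phi>] by blast
  define R where "R = barrier K b"
  have R: "0 < R" using b by (simp add: R_def barrier_def)
  obtain B where B: "0 \<le> B" "\<And>s. \<bar>s\<bar> \<le> R \<Longrightarrow> \<bar>f s\<bar> \<le> B" using continuous_bounded_on_interval[OF f(1)] by blast
  have bnd: "\<bar>clamp_fun R f s\<bar> \<le> B" for s unfolding clamp_fun_def using R by (intro B) auto
  obtain w where w: "step_solution (clamp_fun R f) 0 \<phi> w"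
    using bounded_nonlinearity_solution_exists[OF continuous_on_clamp_fun[OF f(1)] bnd \<phi>] by blast
  have eq: "superpose (clamp_fun R f) (w s) = superpose f (w s)" if "0 \<le> s" "s \<le> \<rho>" for s
  proof (rule superpose_clamp_fun[OF f(1)])
    show "abs_le_const (of_h10 (w s)) R"
      unfolding R_def using step_solution_barrier[OF w continuous_on_clamp_fun[OF f(1)] one_sided_growth_clamp[OF f(2) R] \<phi> b(2) b(1) that] .
  qed
  have feq: "forcing (clamp_fun R f) 0 \<phi> w s = forcing f 0 \<phi> w s" if "0 \<le> s" "s \<le> \<rho>" for s
    using eq[OF that] by (simp add: forcing_def)
  have "step_solution f 0 \<phi> w"
    unfolding step_solution_def weak_solution_def
  proof (intro conjI ballI allI)
    fix \<tau> k assume \<tau>: "\<tau> \<in> {0..\<rho>}"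
    have "integral {0..\<tau>} (\<lambda>r. - ev k * p (w (r - 0)) * coef (of_h10 (w r)) k + coef (forcing f 0 \<phi> w r) k)
        = integral {0..\<tau>} (\<lambda>r. - ev k * p (w (r - 0)) * coef (of_h10 (w r)) k + coef (forcing (clamp_fun R f) 0 \<phi> w r) k)"
      using \<tau> by (intro integral_cong) (simp add: feq)
    moreover have "coef (of_h10 (w \<tau>)) k - coef (of_h10 (w 0)) k =
        integral {0..\<tau>} (\<lambda>r. - ev k * p (w (r - 0)) * coef (of_h10 (w r)) k + coef (forcing (clamp_fun R f) 0 \<phi> w r) k)"
      using w \<tau> unfolding step_solution_def weak_solution_def by blast
    ultimately show "coef (of_h10 (w \<tau>)) k - coef (of_h10 (w 0)) k =
        integral {0..\<tau>} (\<lambda>r. - ev k * p (w (r - 0)) * coef (of_h10 (w r)) k + coef (forcing f 0 \<phi> w r) k)"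
      by (simp only:)
  qed (use w in \<open>auto simp: step_solution_def weak_solution_def\<close>)
  then show ?thesis using that by blast
qed

lemma step_solution_sequence:
  assumes w: "\<And>n. step_solution f 0 (\<phi> n) (w n)" and f: "continuous_on UNIV f" "one_sided_growth f K"
    and \<phi>n: "\<And>n. continuous_on {-\<rho>..0} (\<phi> n)" and \<phi>: "uniform_limit {-\<rho>..0} \<phi> \<psi> sequentially"
  obtains r v where "strict_mono (r :: nat \<Rightarrow> nat)" "uniform_limit {-\<rho>..\<rho>} (\<lambda>n. w (r n)) v sequentially" "step_solution f 0 \<psi> v"
proof -
  have c\<psi>: "continuous_on {-\<rho>..0} \<psi>" by (rule uniform_limit_theorem[OF _ \<phi>]) (use \<phi>n in auto)
  obtain b where b: "1 \<le> b" "\<And>\<theta>. \<theta> \<in> {-\<rho>..0} \<Longrightarrow> norm (\<psi> \<theta>) \<le> b"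
    using continuous_history_bounded[OF c\<psi>] by blast
  obtain M where "\<forall>n\<ge>M. \<forall>\<theta>\<in>{-\<rho>..0}. dist (\<phi> n \<theta>) (\<psi> \<theta>) < 1"
    by (rule uniform_limit_sequentiallyD[OF \<phi> zero_less_one])
  then have M: "dist (\<phi> n \<theta>) (\<psi> \<theta>) < 1" if "n \<ge> M" "\<theta> \<in> {-\<rho>..0}" for n \<theta> using that by blast
  have \<phi>b: "norm (\<phi> n \<theta>) \<le> b + 1" if n: "n \<ge> M" and t: "\<theta> \<in> {-\<rho>..0}" for n \<theta>
    using M[OF n t] norm_triangle_sub[of "\<phi> n \<theta>" "\<psi> \<theta>"] b(2)[OF t] by (simp add: dist_norm)
  define R where "R = barrier K (b + 1)"
  obtain B where B: "0 \<le> B" "\<And>s. \<bar>s\<bar> \<le> R \<Longrightarrow> \<bar>f s\<bar> \<le> B" using continuous_bounded_on_interval[OF f(1)] by blast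
  have bar: "norm (superpose f (w (n + M) (s - 0))) \<le> B" if s: "0 \<le> s" "s \<le> \<rho>" for n s
  proof (rule norm_superpose_le[OF f(1) _ B])
    show "abs_le_const (of_h10 (w (n + M) (s - 0))) R" unfolding R_def
      using step_solution_barrier[OF w f \<phi>n \<phi>b _ s, of "n + M"] b(1) by simp
  qed
  have \<phi>M: "uniform_limit {-\<rho>..0} (\<lambda>n. \<phi> (n + M)) \<psi> sequentially"
    using filterlim_compose[OF \<phi> filterlim_add_const_nat_at_top] by simp
  obtain r v where r: "strict_mono (r :: nat \<Rightarrow> nat)" "uniform_limit {-\<rho>..\<rho>} (\<lambda>n. w (r n + M)) v sequentially" "step_solution f 0 \<psi> v"
    by (rule step_solution_compactness[of f "\<lambda>_. 0" "\<lambda>n. \<phi> (n + M)" "\<lambda>n. w (n + M)" \<psi> B])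
      (use w f(1) \<rho> \<phi>n \<phi>M bar in auto)
  have "strict_mono (\<lambda>n. r n + M)" using r(1) by (auto simp: strict_mono_def)
  with r(2,3) that show ?thesis by blast
qed

end

section \<open>Global solutions in weak form\<close>

lemma history_space_iff:
  "\<phi> \<in> mspace (history_space \<rho>) \<longleftrightarrow> \<phi> \<in> extensional {-\<rho>..0} \<and> continuous_on {-\<rho>..0} \<phi>"
proof -
  have "compactin (top_of_set {-\<rho>..0}) (topspace (top_of_set {-\<rho>..0}))"
    by (simp add: compactin_subtopology)
  from compactin_mspace_cfunspace[OF this, of "euclidean_metric :: h10 metric"]
  show ?thesis unfolding history_space_def by (simp only:) auto
qed

lemma history_space_mdist_le:
  assumes "0 \<le> e" "\<And>\<theta>. \<theta> \<in> {-\<rho>..0} \<Longrightarrow> dist (\<phi> \<theta>) (\<psi> \<theta>) \<le> e"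
  shows "mdist (history_space \<rho>) \<phi> \<psi> \<le> e"
  unfolding history_space_def by (rule mdist_cfunspace_le) (use assms in auto)

lemma history_space_limitinD:
  assumes lim: "limitin (mtopology_of (history_space \<rho>)) xs x sequentially" and xs: "\<And>n. xs n \<in> mspace (history_space \<rho>)"
  shows "x \<in> mspace (history_space \<rho>)" and "uniform_limit {-\<rho>..0} xs x sequentially"
proof -
  have *: "x \<in> mspace (history_space \<rho>) \<and> (\<forall>e>0. \<exists>N. \<forall>n\<ge>N. xs n \<in> mspace (history_space \<rho>) \<and> mdist (history_space \<rho>) (xs n) x < e)"
    using lim unfolding mtopology_of_def Metric_space.limit_metric_sequentially[OF Metric_space_mspace_mdist] .
  then show x: "x \<in> mspace (history_space \<rho>)" by blast
  show "uniform_limit {-\<rho>..0} xs x sequentially"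
  proof (rule uniform_limitI)
    fix e :: real assume "0 < e"
    then obtain N where N: "\<And>n. n \<ge> N \<Longrightarrow> mdist (history_space \<rho>) (xs n) x < e / 2" using * half_gt_zero by blast
    show "\<forall>\<^sub>F n in sequentially. \<forall>\<theta>\<in>{-\<rho>..0}. dist (xs n \<theta>) (x \<theta>) < e"
    proof (rule eventually_sequentiallyI[of N], rule ballI)
      fix n \<theta> assume n: "N \<le> n" and \<theta>: "\<theta> \<in> {-\<rho>..0}"
      have "mdist (cfunspace (top_of_set {-\<rho>..0}) euclidean_metric) (xs n) x \<le> e / 2"
        using less_imp_le[OF N[OF n]] by (simp only: history_space_def)
      then have "mdist euclidean_metric (xs n \<theta>) (x \<theta>) \<le> e / 2"
        using xs[of n] x \<theta> unfolding history_space_def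
        by (intro mdist_cfunspace_imp_mdist_le[of "xs n" "top_of_set {-\<rho>..0}" euclidean_metric x]) auto
      then show "dist (xs n \<theta>) (x \<theta>) < e" using \<open>0 < e\<close> by simp
    qed
  qed
qed

context delay_problem
begin

text \<open>The time derivative that the equation prescribes for the \<open>k\<close>-th Fourier coefficient.\<close>

definition rate :: "(real \<Rightarrow> real) \<Rightarrow> (real \<Rightarrow> h10) \<Rightarrow> nat \<Rightarrow> real \<Rightarrow> real" where
  "rate f w k r = - ev k * p (w r) * coef (of_h10 (w r)) k
     + coef (q (w r) *\<^sub>R (lam *\<^sub>R superpose f (w r) + \<gamma> *\<^sub>R of_h10 (w (r - \<rho>)))) k"

definition solves :: "real \<Rightarrow> (real \<Rightarrow> real) \<Rightarrow> (real \<Rightarrow> h10) \<Rightarrow> bool" where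
  "solves T f w \<longleftrightarrow> continuous_on {-\<rho>..T} w \<and>
     (\<forall>\<tau>\<in>{0..T}. \<forall>k. coef (of_h10 (w \<tau>)) k - coef (of_h10 (w 0)) k = integral {0..\<tau>} (rate f w k))"

lemma solvesD:
  assumes "solves T f w"
  shows "continuous_on {-\<rho>..T} w"
    and "\<And>\<tau> k. 0 \<le> \<tau> \<Longrightarrow> \<tau> \<le> T \<Longrightarrow> coef (of_h10 (w \<tau>)) k - coef (of_h10 (w 0)) k = integral {0..\<tau>} (rate f w k)"
  using assms unfolding solves_def by auto

lemma continuous_on_rate:
  assumes w: "continuous_on {-\<rho>..T} w" and f: "continuous_on UNIV f"
  shows "continuous_on {0..T} (rate f w k)"
proof -
  have cw: "continuous_on {0..T} w" by (rule continuous_on_subset[OF w]) (use \<rho> in auto)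
  have cd: "continuous_on {0..T} (\<lambda>r. w (r - \<rho>))"
    by (rule continuous_on_compose2[OF w]) (use \<rho> in \<open>auto intro!: continuous_intros\<close>)
  note comp = continuous_on_compose2[OF _ cw subset_UNIV]
  show ?thesis
    unfolding rate_def
    by (intro continuous_intros comp[OF cont_p] comp[OF cont_q] comp[OF continuous_on_superpose[OF f]]
        continuous_on_coef_h10 cw bounded_linear.continuous_on[OF bounded_linear_of_h10 cd])
qed

lemma rate_cong: "w r = w' r \<Longrightarrow> w (r - \<rho>) = w' (r - \<rho>) \<Longrightarrow> rate f w k r = rate f w' k r"
  by (simp add: rate_def)

lemma solves_cong:
  assumes w: "solves T f w" and T: "0 \<le> T" and eq: "\<And>s. -\<rho> \<le> s \<Longrightarrow> s \<le> T \<Longrightarrow> w' s = w s"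
  shows "solves T f w'"
  unfolding solves_def
proof (intro conjI ballI allI)
  show "continuous_on {-\<rho>..T} w'"
    using solvesD(1)[OF w] by (subst continuous_on_cong[OF refl, where g = w]) (auto intro: eq)
  fix \<tau> k assume \<tau>: "\<tau> \<in> {0..T}"
  have "integral {0..\<tau>} (rate f w' k) = integral {0..\<tau>} (rate f w k)"
    using \<tau> \<rho> by (intro integral_cong rate_cong eq) auto
  then show "coef (of_h10 (w' \<tau>)) k - coef (of_h10 (w' 0)) k = integral {0..\<tau>} (rate f w' k)"
    using solvesD(2)[OF w, of \<tau> k] \<tau> \<rho> T by (simp add: eq)
qed

lemma solves_mono: "solves T f w \<Longrightarrow> T' \<le> T \<Longrightarrow> solves T' f w"
  unfolding solves_def by (auto intro: continuous_on_subset)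

lemma integral_shift:
  fixes g :: "real \<Rightarrow> real"
  shows "integral {0..b} (\<lambda>s. g (c + s)) = integral {c..c + b} g"
  using integral_shift_Icc_real[of 0 b g c] by (simp add: o_def add.commute)

lemma integral_split:
  assumes w: "continuous_on {-\<rho>..T} w" and f: "continuous_on UNIV f" and s: "0 \<le> s" "s \<le> \<tau>" "\<tau> \<le> T"
  shows "integral {0..\<tau>} (rate f w k) = integral {0..s} (rate f w k) + integral {s..\<tau>} (rate f w k)"
proof -
  have "rate f w k integrable_on {0..\<tau>}"
    by (intro integrable_continuous_interval continuous_on_subset[OF continuous_on_rate[OF w f]]) (use s in auto)
  from Henstock_Kurzweil_Integration.integral_combine[OF s(1,2) this] show ?thesis by simp
qed

lemma rate_shift: "rate f (\<lambda>s. w (c + s)) k = (\<lambda>r. rate f w k (c + r))"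
  by (auto simp: rate_def fun_eq_iff add_diff_eq)

lemma solves_translate:
  assumes w: "solves (T1 + T2) f w" and f: "continuous_on UNIV f" and T: "0 \<le> T1" "0 \<le> T2"
  shows "solves T2 f (\<lambda>s. w (T1 + s))"
  unfolding solves_def
proof (intro conjI ballI allI)
  show "continuous_on {-\<rho>..T2} (\<lambda>s. w (T1 + s))"
    by (rule continuous_on_compose2[OF solvesD(1)[OF w]]) (use T in \<open>auto intro!: continuous_intros\<close>)
  fix \<tau> k assume \<tau>: "\<tau> \<in> {0..T2}"
  have "integral {0..\<tau>} (rate f (\<lambda>s. w (T1 + s)) k) = integral {T1..T1 + \<tau>} (rate f w k)"
    by (simp only: rate_shift integral_shift)
  also have "\<dots> = integral {0..T1 + \<tau>} (rate f w k) - integral {0..T1} (rate f w k)"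
    using integral_split[OF solvesD(1)[OF w] f, of T1 "T1 + \<tau>" k] \<tau> T by simp
  also have "\<dots> = coef (of_h10 (w (T1 + \<tau>))) k - coef (of_h10 (w T1)) k"
    using solvesD(2)[OF w, of "T1 + \<tau>" k] solvesD(2)[OF w, of T1 k] \<tau> T by simp
  finally show "coef (of_h10 (w (T1 + \<tau>))) k - coef (of_h10 (w (T1 + 0))) k = integral {0..\<tau>} (rate f (\<lambda>s. w (T1 + s)) k)"
    by simp
qed

lemma solves_concat:
  assumes w1: "solves T1 f w1" and w2: "solves T2 f w2" and f: "continuous_on UNIV f" and T: "0 \<le> T1" "0 \<le> T2"
    and eq: "\<And>\<theta>. \<theta> \<in> {-\<rho>..0} \<Longrightarrow> w2 \<theta> = w1 (T1 + \<theta>)"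
  shows "solves (T1 + T2) f (\<lambda>s. if s \<le> T1 then w1 s else w2 (s - T1))"
proof -
  define w where "w s = (if s \<le> T1 then w1 s else w2 (s - T1))" for s
  have ww1: "w s = w1 s" if "s \<le> T1" for s using that by (simp add: w_def)
  have ww2: "w s = w2 (s - T1)" if "T1 - \<rho> \<le> s" for s
    using that eq[of "s - T1"] by (auto simp: w_def)
  have "continuous_on {-\<rho>..T1} w"
    using solvesD(1)[OF w1] by (subst continuous_on_cong[OF refl, where g = w1]) (auto intro: ww1)
  moreover have "continuous_on {T1..T1 + T2} w"
  proof -
    have "continuous_on {T1..T1 + T2} (\<lambda>s. w2 (s - T1))"
      by (rule continuous_on_compose2[OF solvesD(1)[OF w2]]) (use \<rho> in \<open>auto intro!: continuous_intros\<close>)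
    then show ?thesis using \<rho> by (subst continuous_on_cong[OF refl, where g = "\<lambda>s. w2 (s - T1)"]) (auto intro: ww2)
  qed
  ultimately have "continuous_on ({-\<rho>..T1} \<union> {T1..T1 + T2}) w"
    by (intro continuous_on_closed_Un) auto
  moreover have "{-\<rho>..T1} \<union> {T1..T1 + T2} = {-\<rho>..T1 + T2}" using \<rho> T by auto
  ultimately have cw: "continuous_on {-\<rho>..T1 + T2} w" by simp
  have "solves T1 f w" by (rule solves_cong[OF w1 T(1)]) (simp add: ww1)
  note s1 = solvesD(2)[OF this]
  have "solves (T1 + T2) f w"
    unfolding solves_def
  proof (intro conjI ballI allI cw)
    fix \<tau> k assume \<tau>: "\<tau> \<in> {0..T1 + T2}"
    show "coef (of_h10 (w \<tau>)) k - coef (of_h10 (w 0)) k = integral {0..\<tau>} (rate f w k)"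
    proof (cases "\<tau> \<le> T1")
      case True
      then show ?thesis using s1 \<tau> by simp
    next
      case False
      define t where "t = \<tau> - T1"
      have t: "0 \<le> t" "t \<le> T2" "\<tau> = T1 + t" using \<tau> False by (auto simp: t_def)
      have "integral {T1..\<tau>} (rate f w k) = integral {0..t} (\<lambda>s. rate f w k (T1 + s))"
        unfolding t(3) by (rule integral_shift[symmetric])
      also have "\<dots> = integral {0..t} (rate f w2 k)"
        unfolding rate_shift[symmetric] using \<rho> by (intro integral_cong rate_cong) (auto simp: ww2)
      also have "\<dots> = coef (of_h10 (w2 t)) k - coef (of_h10 (w2 0)) k"
        using solvesD(2)[OF w2 t(1,2), of k] by simp
      also have "\<dots> = coef (of_h10 (w \<tau>)) k - coef (of_h10 (w T1)) k"
        using \<rho> t by (simp add: ww2)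
      finally show ?thesis
        using integral_split[OF cw f T(1), of \<tau> k] s1[of T1 k] T t by simp
    qed
  qed
  then show ?thesis by (simp add: w_def[abs_def])
qed

lemma step_solution_solves:
  assumes w: "step_solution f 0 \<phi> w"
  shows "solves \<rho> f w"
  unfolding solves_def
proof (intro conjI ballI allI)
  show "continuous_on {-\<rho>..\<rho>} w" using w unfolding step_solution_def by blast
  fix \<tau> k assume \<tau>: "\<tau> \<in> {0..\<rho>}"
  have "coef (of_h10 (w \<tau>)) k - coef (of_h10 (w 0)) k =
      integral {0..\<tau>} (\<lambda>r. - ev k * p (w (r - 0)) * coef (of_h10 (w r)) k + coef (forcing f 0 \<phi> w r) k)"
    using w \<tau> unfolding step_solution_def weak_solution_def by blast
  also have "\<dots> = integral {0..\<tau>} (rate f w k)"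
  proof (rule integral_cong)
    fix r assume "r \<in> {0..\<tau>}"
    then have "w (r - \<rho>) = \<phi> (r - \<rho>)" using w \<tau> unfolding step_solution_def by auto
    then show "- ev k * p (w (r - 0)) * coef (of_h10 (w r)) k + coef (forcing f 0 \<phi> w r) k = rate f w k r"
      by (simp add: rate_def forcing_def)
  qed
  finally show "coef (of_h10 (w \<tau>)) k - coef (of_h10 (w 0)) k = integral {0..\<tau>} (rate f w k)" .
qed

lemma solves_step_solution:
  assumes w: "solves \<rho> f w" and \<phi>: "\<And>\<theta>. \<theta> \<in> {-\<rho>..0} \<Longrightarrow> w \<theta> = \<phi> \<theta>"
  shows "step_solution f 0 \<phi> w"
  unfolding step_solution_def weak_solution_def
proof (intro conjI ballI allI \<phi>)
  show "continuous_on {-\<rho>..\<rho>} w" by (rule solvesD(1)[OF w])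
  then show "continuous_on {0..\<rho>} w" by (rule continuous_on_subset) (use \<rho> in auto)
  fix \<tau> k assume \<tau>: "\<tau> \<in> {0..\<rho>}"
  have "integral {0..\<tau>} (\<lambda>r. - ev k * p (w (r - 0)) * coef (of_h10 (w r)) k + coef (forcing f 0 \<phi> w r) k) = integral {0..\<tau>} (rate f w k)"
  proof (rule integral_cong)
    fix r assume "r \<in> {0..\<tau>}"
    then have "w (r - \<rho>) = \<phi> (r - \<rho>)" using \<tau> by (intro \<phi>) auto
    then show "- ev k * p (w (r - 0)) * coef (of_h10 (w r)) k + coef (forcing f 0 \<phi> w r) k = rate f w k r"
      by (simp add: rate_def forcing_def)
  qed
  then show "coef (of_h10 (w \<tau>)) k - coef (of_h10 (w 0)) k =
      integral {0..\<tau>} (\<lambda>r. - ev k * p (w (r - 0)) * coef (of_h10 (w r)) k + coef (forcing f 0 \<phi> w r) k)"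
    using solvesD(2)[OF w, of \<tau> k] \<tau> by (simp only:) simp
qed

definition global_solution :: "(real \<Rightarrow> real) \<Rightarrow> (real \<Rightarrow> h10) \<Rightarrow> (real \<Rightarrow> h10) \<Rightarrow> bool" where
  "global_solution f \<phi> w \<longleftrightarrow> (\<forall>T\<ge>0. solves T f w) \<and> (\<forall>\<theta>\<in>{-\<rho>..0}. w \<theta> = \<phi> \<theta>)"

lemma continuous_on_history:
  assumes "continuous_on {-\<rho>..T} w" "0 \<le> \<tau>" "\<tau> \<le> T"
  shows "continuous_on {-\<rho>..0} (history \<rho> w \<tau>)"
proof -
  have "continuous_on {-\<rho>..0} (\<lambda>\<theta>. w (\<tau> + \<theta>))"
    by (rule continuous_on_compose2[OF assms(1)]) (use assms in \<open>auto intro!: continuous_intros\<close>)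
  then show ?thesis unfolding history_def by (subst continuous_on_cong[OF refl]) auto
qed

lemma history_apply: "\<theta> \<in> {-\<rho>..0} \<Longrightarrow> history \<rho> w \<tau> \<theta> = w (\<tau> + \<theta>)"
  by (simp add: history_def)

text \<open>Solutions on \<open>[0, n \<rho>]\<close> are extended interval by interval by dependent choice, since they need not be
  unique; the extensions agree on their common domains and so define one function.\<close>

lemma global_solution_exists:
  assumes f: "continuous_on UNIV f" "one_sided_growth f K" and \<phi>: "continuous_on {-\<rho>..0} \<phi>"
  obtains w where "global_solution f \<phi> w"
proof -
  define P where "P n W \<longleftrightarrow> solves (real n * \<rho>) f W \<and> (\<forall>\<theta>\<in>{-\<rho>..0}. W \<theta> = \<phi> \<theta>)" for n W
  define Q where "Q n W W' \<longleftrightarrow> (\<forall>s\<le>real n * \<rho>. W' s = (W s :: h10))" for n :: nat and W W' :: "real \<Rightarrow> h10"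
  have "\<exists>W. \<forall>n. P n (W n) \<and> Q n (W n) (W (Suc n))"
  proof (rule dependent_nat_choice)
    show "\<exists>W. P 0 W" using \<phi> by (intro exI[of _ \<phi>]) (auto simp: P_def solves_def)
    fix W n assume W: "P n W"
    define T where "T = real n * \<rho>"
    have T: "0 \<le> T" using \<rho> by (simp add: T_def)
    have sW: "solves T f W" using W by (simp add: P_def T_def)
    obtain v where v: "step_solution f 0 (history \<rho> W T) v"
      using step_solution_exists[OF f continuous_on_history[OF solvesD(1)[OF sW] T order_refl]] by blast
    define W' where "W' s = (if s \<le> T then W s else v (s - T))" for s
    have "solves (T + \<rho>) f W'"
      unfolding W'_def
    proof (rule solves_concat[OF sW step_solution_solves[OF v] f(1) T less_imp_le[OF \<rho>]])
      fix \<theta> assume "\<theta> \<in> {-\<rho>..0}"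
      then show "v \<theta> = W (T + \<theta>)" using v by (simp add: step_solution_def history_apply)
    qed
    moreover have "T + \<rho> = real (Suc n) * \<rho>" by (simp add: T_def algebra_simps)
    ultimately have "P (Suc n) W'" using W T by (auto simp: P_def W'_def)
    moreover have "Q n W W'" by (simp add: Q_def W'_def T_def)
    ultimately show "\<exists>W'. P (Suc n) W' \<and> Q n W W'" by blast
  qed
  then obtain W where W: "\<And>n. P n (W n)" "\<And>n. Q n (W n) (W (Suc n))" by blast
  have ext: "W m s = W n s" if "n \<le> m" "s \<le> real n * \<rho>" for n m s
    using that(1)
  proof (induction m rule: dec_induct)
    case (step m)
    have "s \<le> real m * \<rho>" using that(2) step(1) \<rho> by (meson less_imp_le mult_right_mono of_nat_mono order_trans)
    then show ?case using W(2)[of m] step.IH by (simp add: Q_def)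
  qed simp
  define w where "w s = W (nat \<lceil>s / \<rho>\<rceil>) s" for s
  have wW: "w s = W n s" if "s \<le> real n * \<rho>" for s n
  proof -
    have "s / \<rho> \<le> real n" using that \<rho> by (simp add: pos_divide_le_eq)
    then have "nat \<lceil>s / \<rho>\<rceil> \<le> n" by (simp add: ceiling_le_iff)
    moreover have "s / \<rho> \<le> real (nat \<lceil>s / \<rho>\<rceil>)" by (rule real_nat_ceiling_ge)
    then have "s \<le> real (nat \<lceil>s / \<rho>\<rceil>) * \<rho>" using \<rho> by (simp add: pos_divide_le_eq)
    ultimately show ?thesis unfolding w_def by (rule ext[symmetric])
  qed
  have "solves T f w" if T: "0 \<le> T" for T
  proof -
    obtain n :: nat where "T / \<rho> \<le> real n" using real_arch_simple by blast
    then have n: "T \<le> real n * \<rho>" using \<rho> by (simp add: pos_divide_le_eq)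
    have "solves (real n * \<rho>) f (W n)" using W(1)[of n] by (simp add: P_def)
    then have "solves T f (W n)" using n by (rule solves_mono)
    then show ?thesis by (rule solves_cong[OF _ T]) (use n wW in auto)
  qed
  moreover have "w \<theta> = \<phi> \<theta>" if "\<theta> \<in> {-\<rho>..0}" for \<theta>
    using wW[of \<theta> 0] W(1)[of 0] that by (simp add: P_def)
  ultimately have "global_solution f \<phi> w" by (simp add: global_solution_def)
  with that show ?thesis by blast
qed

lemma global_solution_translate:
  assumes w: "global_solution f \<phi> w" and f: "continuous_on UNIV f" and t: "0 \<le> t"
  shows "global_solution f (history \<rho> w t) (\<lambda>s. w (t + s))"
  unfolding global_solution_def
proof (intro conjI allI impI ballI)
  show "solves T f (\<lambda>s. w (t + s))" if "0 \<le> T" for T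
    using w t that by (intro solves_translate[OF _ f t that]) (simp add: global_solution_def)
qed (simp add: history_apply)

lemma global_solution_concat:
  assumes w1: "solves t f w1" "\<And>\<theta>. \<theta> \<in> {-\<rho>..0} \<Longrightarrow> w1 \<theta> = \<phi> \<theta>" and w2: "global_solution f (history \<rho> w1 t) w2"
    and f: "continuous_on UNIV f" and t: "0 \<le> t"
  shows "global_solution f \<phi> (\<lambda>s. if s \<le> t then w1 s else w2 (s - t))"
  unfolding global_solution_def
proof (intro conjI allI impI ballI)
  have c: "solves (t + T) f (\<lambda>s. if s \<le> t then w1 s else w2 (s - t))" if "0 \<le> T" for T
    using w2 that by (intro solves_concat[OF w1(1) _ f t that]) (auto simp: global_solution_def history_apply)
  show "solves T f (\<lambda>s. if s \<le> t then w1 s else w2 (s - t))" if "0 \<le> T" for T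
    using solves_mono[OF c[OF that], of T] t by simp
qed (use w1(2) t in auto)

definition flow :: "(real \<Rightarrow> real) \<Rightarrow> real \<Rightarrow> (real \<Rightarrow> h10) \<Rightarrow> (real \<Rightarrow> h10) set" where
  "flow f \<tau> \<phi> = {history \<rho> w \<tau> | w. global_solution f \<phi> w}"

lemma global_solution_history:
  assumes "global_solution f \<phi> w" "0 \<le> \<tau>"
  shows "history \<rho> w \<tau> \<in> mspace (history_space \<rho>)"
  unfolding history_space_iff
proof
  show "history \<rho> w \<tau> \<in> extensional {-\<rho>..0}" by (simp add: history_def)
  show "continuous_on {-\<rho>..0} (history \<rho> w \<tau>)"
    using assms solvesD(1)[of \<tau> f w] by (intro continuous_on_history) (auto simp: global_solution_def)
qed

lemma flow_0:
  assumes f: "continuous_on UNIV f" "one_sided_growth f K" and \<phi>: "\<phi> \<in> mspace (history_space \<rho>)"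
  shows "flow f 0 \<phi> = {\<phi>}"
proof -
  have h: "history \<rho> w 0 = \<phi>" if "global_solution f \<phi> w" for w
  proof
    fix \<theta> show "history \<rho> w 0 \<theta> = \<phi> \<theta>"
      using that \<phi> by (cases "\<theta> \<in> {-\<rho>..0}")
        (auto simp: history_def global_solution_def history_space_iff extensional_def)
  qed
  obtain w where "global_solution f \<phi> w" using global_solution_exists[OF f] \<phi> by (auto simp: history_space_iff)
  with h show ?thesis unfolding flow_def by blast
qed

lemma flow_add:
  assumes f: "continuous_on UNIV f" and t: "0 \<le> t1" "0 \<le> t2"
  shows "flow f (t1 + t2) \<phi> = \<Union> (flow f t1 ` flow f t2 \<phi>)"
proof (intro equalityI subsetI)
  fix \<xi> assume "\<xi> \<in> flow f (t1 + t2) \<phi>"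
  then obtain w where w: "global_solution f \<phi> w" "\<xi> = history \<rho> w (t1 + t2)" by (auto simp: flow_def)
  have "\<xi> = history \<rho> (\<lambda>s. w (t2 + s)) t1" by (simp add: w(2) history_def add_ac)
  then have "\<xi> \<in> flow f t1 (history \<rho> w t2)"
    unfolding flow_def using global_solution_translate[OF w(1) f t(2)] by blast
  moreover have "history \<rho> w t2 \<in> flow f t2 \<phi>" unfolding flow_def using w(1) by blast
  ultimately show "\<xi> \<in> \<Union> (flow f t1 ` flow f t2 \<phi>)" by blast
next
  fix \<xi> assume "\<xi> \<in> \<Union> (flow f t1 ` flow f t2 \<phi>)"
  then obtain w1 w2 where w1: "global_solution f \<phi> w1" and w2: "global_solution f (history \<rho> w1 t2) w2" and \<xi>: "\<xi> = history \<rho> w2 t1"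
    by (auto simp: flow_def)
  define w where "w s = (if s \<le> t2 then w1 s else w2 (s - t2))" for s
  have "global_solution f \<phi> w"
    unfolding w_def using w1 t by (intro global_solution_concat[OF _ _ w2 f t(2)]) (auto simp: global_solution_def)
  moreover have "\<xi> = history \<rho> w (t1 + t2)"
  proof
    fix \<theta>
    show "\<xi> \<theta> = history \<rho> w (t1 + t2) \<theta>"
    proof (cases "\<theta> \<in> {-\<rho>..0} \<and> t1 + \<theta> \<le> 0")
      case True
      then have m: "t1 + \<theta> \<in> {-\<rho>..0}" using t by auto
      then have "w2 (t1 + \<theta>) = w1 (t2 + (t1 + \<theta>))" using w2 by (simp add: global_solution_def history_apply)
      then show ?thesis using True m by (simp add: \<xi> history_def w_def add_ac)
    qed (auto simp: \<xi> history_def w_def algebra_simps)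
  qed
  ultimately show "\<xi> \<in> flow f (t1 + t2) \<phi>" unfolding flow_def by blast
qed

lemma flow_in_space:
  assumes f: "continuous_on UNIV f" "one_sided_growth f K" and \<phi>: "\<phi> \<in> mspace (history_space \<rho>)" and t: "0 \<le> t"
  shows "flow f t \<phi> \<noteq> {}" and "flow f t \<phi> \<subseteq> mspace (history_space \<rho>)"
proof -
  obtain w where "global_solution f \<phi> w" using global_solution_exists[OF f] \<phi> by (auto simp: history_space_iff)
  then show "flow f t \<phi> \<noteq> {}" by (auto simp: flow_def)
  show "flow f t \<phi> \<subseteq> mspace (history_space \<rho>)" using global_solution_history t by (auto simp: flow_def)
qed

section \<open>Closedness of the flow and upper semicontinuity\<close>

text \<open>Closed graph and relative compactness of the values along convergent initial histories, in one property
  that composes under \<open>flow_add\<close>.\<close>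

definition sequentially_closed_flow :: "(real \<Rightarrow> real) \<Rightarrow> real \<Rightarrow> bool" where
  "sequentially_closed_flow f \<tau> \<longleftrightarrow> (\<forall>\<phi> \<psi> \<xi>. (\<forall>n. \<phi> n \<in> mspace (history_space \<rho>) \<and> \<xi> n \<in> flow f \<tau> (\<phi> n)) \<longrightarrow> \<psi> \<in> mspace (history_space \<rho>) \<longrightarrow>
     uniform_limit {-\<rho>..0} \<phi> \<psi> sequentially \<longrightarrow>
     (\<exists>r \<eta>. strict_mono (r :: nat \<Rightarrow> nat) \<and> \<eta> \<in> flow f \<tau> \<psi> \<and> uniform_limit {-\<rho>..0} (\<lambda>n. \<xi> (r n)) \<eta> sequentially))"

text \<open>Compactness provides a limit on one delay interval. It is continued to a global solution because \<open>flow\<close>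
  consists of histories of global solutions.\<close>

lemma sequentially_closed_flow_short:
  assumes f: "continuous_on UNIV f" "one_sided_growth f K" and \<tau>: "0 \<le> \<tau>" "\<tau> \<le> \<rho>"
  shows "sequentially_closed_flow f \<tau>"
  unfolding sequentially_closed_flow_def
proof (intro allI impI)
  fix \<phi> \<psi> \<xi>
  assume *: "\<forall>n. \<phi> n \<in> mspace (history_space \<rho>) \<and> \<xi> n \<in> flow f \<tau> (\<phi> n)"
    and \<psi>: "\<psi> \<in> mspace (history_space \<rho>)" and lim: "uniform_limit {-\<rho>..0} \<phi> \<psi> sequentially"
  have "\<forall>n. \<exists>w. global_solution f (\<phi> n) w \<and> \<xi> n = history \<rho> w \<tau>" using * by (auto simp: flow_def)
  then obtain w where w: "\<And>n. global_solution f (\<phi> n) (w n)" "\<And>n. \<xi> n = history \<rho> (w n) \<tau>" by metis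
  have ws: "step_solution f 0 (\<phi> n) (w n)" for n
    using w(1)[of n] \<rho> by (intro solves_step_solution) (auto simp: global_solution_def)
  have c\<phi>: "continuous_on {-\<rho>..0} (\<phi> n)" for n using * by (simp add: history_space_iff)
  obtain r v where r: "strict_mono (r :: nat \<Rightarrow> nat)" and v: "uniform_limit {-\<rho>..\<rho>} (\<lambda>n. w (r n)) v sequentially" "step_solution f 0 \<psi> v"
    using step_solution_sequence[OF ws f c\<phi> lim] by blast
  have sv: "solves \<rho> f v" by (rule step_solution_solves[OF v(2)])
  obtain u where u: "global_solution f (history \<rho> v \<rho>) u"
    using global_solution_exists[OF f continuous_on_history[OF solvesD(1)[OF sv] less_imp_le[OF \<rho>] order_refl]] by blast
  define V where "V s = (if s \<le> \<rho> then v s else u (s - \<rho>))" for s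
  have "v \<theta> = \<psi> \<theta>" if "\<theta> \<in> {-\<rho>..0}" for \<theta> using v(2) that by (simp add: step_solution_def)
  then have V: "global_solution f \<psi> V"
    unfolding V_def by (intro global_solution_concat[OF sv _ u f(1) less_imp_le[OF \<rho>]])
  have "uniform_limit {-\<rho>..0} (\<lambda>n. \<xi> (r n)) (history \<rho> V \<tau>) sequentially"
  proof (rule uniform_limitI)
    fix e :: real assume "0 < e"
    from uniform_limitD[OF v(1) this]
    show "\<forall>\<^sub>F n in sequentially. \<forall>\<theta>\<in>{-\<rho>..0}. dist (\<xi> (r n) \<theta>) (history \<rho> V \<tau> \<theta>) < e"
    proof eventually_elim
      case (elim n)
      show ?case
      proof
        fix \<theta> assume \<theta>: "\<theta> \<in> {-\<rho>..0}"
        then have "\<tau> + \<theta> \<in> {-\<rho>..\<rho>}" using \<tau> by auto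
        then show "dist (\<xi> (r n) \<theta>) (history \<rho> V \<tau> \<theta>) < e"
          using elim \<theta> by (auto simp: w(2) history_apply V_def)
      qed
    qed
  qed
  moreover have "history \<rho> V \<tau> \<in> flow f \<tau> \<psi>" using V by (auto simp: flow_def)
  ultimately show "\<exists>r \<eta>. strict_mono (r :: nat \<Rightarrow> nat) \<and> \<eta> \<in> flow f \<tau> \<psi> \<and> uniform_limit {-\<rho>..0} (\<lambda>n. \<xi> (r n)) \<eta> sequentially"
    using r by blast
qed

lemma sequentially_closed_flow_add:
  assumes f: "continuous_on UNIV f" "one_sided_growth f K" and t: "0 \<le> t1" "0 \<le> t2"
    and c1: "sequentially_closed_flow f t1" and c2: "sequentially_closed_flow f t2"
  shows "sequentially_closed_flow f (t1 + t2)"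
  unfolding sequentially_closed_flow_def
proof (intro allI impI)
  fix \<phi> \<psi> \<xi>
  assume *: "\<forall>n. \<phi> n \<in> mspace (history_space \<rho>) \<and> \<xi> n \<in> flow f (t1 + t2) (\<phi> n)"
    and \<psi>: "\<psi> \<in> mspace (history_space \<rho>)" and lim: "uniform_limit {-\<rho>..0} \<phi> \<psi> sequentially"
  have "\<forall>n. \<exists>\<zeta>. \<zeta> \<in> flow f t2 (\<phi> n) \<and> \<xi> n \<in> flow f t1 \<zeta>" using * flow_add[OF f(1) t] by blast
  then obtain \<zeta> where \<zeta>: "\<And>n. \<zeta> n \<in> flow f t2 (\<phi> n)" "\<And>n. \<xi> n \<in> flow f t1 (\<zeta> n)" by metis
  obtain r2 \<eta>2 where r2: "strict_mono (r2 :: nat \<Rightarrow> nat)" "\<eta>2 \<in> flow f t2 \<psi>" "uniform_limit {-\<rho>..0} (\<lambda>n. \<zeta> (r2 n)) \<eta>2 sequentially"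
    using c2[unfolded sequentially_closed_flow_def, rule_format, of \<phi> \<zeta> \<psi>] * \<zeta>(1) \<psi> lim by auto
  have \<zeta>X: "\<zeta> n \<in> mspace (history_space \<rho>)" for n using flow_in_space(2)[OF f _ t(2), of "\<phi> n"] * \<zeta>(1)[of n] by blast
  have \<eta>X: "\<eta>2 \<in> mspace (history_space \<rho>)" using flow_in_space(2)[OF f \<psi> t(2)] r2(2) by blast
  obtain r1 \<eta>1 where r1: "strict_mono (r1 :: nat \<Rightarrow> nat)" "\<eta>1 \<in> flow f t1 \<eta>2" "uniform_limit {-\<rho>..0} (\<lambda>n. \<xi> (r2 (r1 n))) \<eta>1 sequentially"
    using c1[unfolded sequentially_closed_flow_def, rule_format, of "\<lambda>n. \<zeta> (r2 n)" "\<lambda>n. \<xi> (r2 n)" \<eta>2] \<zeta>X \<eta>X \<zeta>(2) r2(3) by auto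
  have "strict_mono (\<lambda>n. r2 (r1 n))" using strict_mono_o[OF r2(1) r1(1)] by (simp add: o_def)
  moreover have "\<eta>1 \<in> flow f (t1 + t2) \<psi>" using flow_add[OF f(1) t] r1(2) r2(2) by blast
  ultimately show "\<exists>r \<eta>. strict_mono (r :: nat \<Rightarrow> nat) \<and> \<eta> \<in> flow f (t1 + t2) \<psi> \<and> uniform_limit {-\<rho>..0} (\<lambda>n. \<xi> (r n)) \<eta> sequentially"
    using r1(3) by blast
qed

lemma sequentially_closed_flow:
  assumes f: "continuous_on UNIV f" "one_sided_growth f K" and \<tau>: "0 \<le> \<tau>"
  shows "sequentially_closed_flow f \<tau>"
proof -
  have "\<forall>\<tau>. 0 \<le> \<tau> \<longrightarrow> \<tau> \<le> real (Suc n) * \<rho> \<longrightarrow> sequentially_closed_flow f \<tau>" for n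
  proof (induction n)
    case 0
    then show ?case using sequentially_closed_flow_short[OF f] by simp
  next
    case (Suc n)
    show ?case
    proof (intro allI impI)
      fix \<tau> assume \<tau>: "0 \<le> \<tau>" "\<tau> \<le> real (Suc (Suc n)) * \<rho>"
      show "sequentially_closed_flow f \<tau>"
      proof (cases "\<tau> \<le> \<rho>")
        case True
        then show ?thesis using sequentially_closed_flow_short[OF f \<tau>(1)] by simp
      next
        case False
        then have "0 \<le> \<tau> - \<rho>" "\<tau> - \<rho> \<le> real (Suc n) * \<rho>" using \<tau> by (auto simp: algebra_simps)
        then have "sequentially_closed_flow f (\<tau> - \<rho> + \<rho>)"
          using Suc \<rho> sequentially_closed_flow_short[OF f, of \<rho>]
          by (intro sequentially_closed_flow_add[OF f]) auto
        then show ?thesis by simp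
      qed
    qed
  qed
  moreover obtain n :: nat where "\<tau> / \<rho> \<le> real n" using real_arch_simple by blast
  then have "\<tau> \<le> real n * \<rho>" using \<rho> by (simp add: pos_divide_le_eq)
  then have "\<tau> \<le> real (Suc n) * \<rho>" using \<rho> by (simp add: algebra_simps)
  ultimately show ?thesis using \<tau> by blast
qed

text \<open>If the semidistance stayed above \<open>e\<close> along a subsequence, there would be values \<open>\<xi> n\<close> at distance more than \<open>e\<close>
  from \<open>flow f \<tau> x\<close>, although a further subsequence of them converges into this set.\<close>

lemma flow_upper_semicontinuous:
  assumes f: "continuous_on UNIV f" "one_sided_growth f K" and \<tau>: "0 \<le> \<tau>"
  shows "upper_semicontinuous (history_space \<rho>) (flow f \<tau>)"
  unfolding upper_semicontinuous_def
proof (intro allI impI)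
  fix xs x
  assume *: "range xs \<subseteq> mspace (history_space \<rho>) \<and> limitin (mtopology_of (history_space \<rho>)) xs x sequentially"
  have xsX: "xs n \<in> mspace (history_space \<rho>)" for n using * by blast
  have xX: "x \<in> mspace (history_space \<rho>)" and lim: "uniform_limit {-\<rho>..0} xs x sequentially"
    using history_space_limitinD[OF conjunct2[OF *] xsX] .
  let ?D = "\<lambda>n. hausdorff_semidist (history_space \<rho>) (flow f \<tau> (xs n)) (flow f \<tau> x)"
  have small: "\<forall>\<^sub>F n in sequentially. ?D n \<le> ennreal e" if e: "0 < e" for e
  proof (rule ccontr)
    assume "\<not> (\<forall>\<^sub>F n in sequentially. ?D n \<le> ennreal e)"
    then have "\<forall>N. \<exists>n>N. \<not> ?D n \<le> ennreal e" unfolding eventually_at_top_dense by blast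
    then have "infinite {n. \<not> ?D n \<le> ennreal e}" unfolding infinite_nat_iff_unbounded by blast
    then obtain s where s: "strict_mono (s :: nat \<Rightarrow> nat)" "\<And>n. \<not> ?D (s n) \<le> ennreal e"
      using infinite_enumerate by blast
    have "\<exists>\<xi>\<in>flow f \<tau> (xs (s n)). ennreal e < (INF \<eta>\<in>flow f \<tau> x. ennreal (mdist (history_space \<rho>) \<xi> \<eta>))" for n
      using s(2)[of n] unfolding hausdorff_semidist_def not_le less_SUP_iff .
    then obtain \<xi> where \<xi>: "\<And>n. \<xi> n \<in> flow f \<tau> (xs (s n))"
      "\<And>n. ennreal e < (INF \<eta>\<in>flow f \<tau> x. ennreal (mdist (history_space \<rho>) (\<xi> n) \<eta>))" by metis
    have lims: "uniform_limit {-\<rho>..0} (\<lambda>n. xs (s n)) x sequentially"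
      using filterlim_compose[OF lim filterlim_subseq[OF s(1)]] by simp
    obtain r \<eta> where \<eta>: "\<eta> \<in> flow f \<tau> x" and ul: "uniform_limit {-\<rho>..0} (\<lambda>n. \<xi> (r n)) \<eta> sequentially"
      using sequentially_closed_flow[OF f \<tau>, unfolded sequentially_closed_flow_def, rule_format, of "\<lambda>n. xs (s n)" \<xi> x] \<xi>(1) xsX xX lims by auto
    obtain N where N: "\<forall>n\<ge>N. \<forall>\<theta>\<in>{-\<rho>..0}. dist (\<xi> (r n) \<theta>) (\<eta> \<theta>) < e"
      by (rule uniform_limit_sequentiallyD[OF ul e])
    have "mdist (history_space \<rho>) (\<xi> (r N)) \<eta> \<le> e"
      by (rule history_space_mdist_le) (use N e in \<open>auto intro: less_imp_le\<close>)
    then have "(INF \<eta>\<in>flow f \<tau> x. ennreal (mdist (history_space \<rho>) (\<xi> (r N)) \<eta>)) \<le> ennreal e"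
      by (intro INF_lower2[OF \<eta>] ennreal_leI)
    with \<xi>(2)[of "r N"] show False by simp
  qed
  show "?D \<longlonglongrightarrow> 0"
  proof (rule order_tendstoI)
    fix a :: ennreal assume "0 < a"
    then obtain b where b: "0 < b" "b < a" using dense by blast
    then have "b \<noteq> top" by (metis not_top_less top_greatest order_less_le_trans)
    then obtain e where e: "b = ennreal e" "0 \<le> e" by (cases b) auto
    then have "0 < e" using b(1) by simp
    from small[OF this] show "\<forall>\<^sub>F n in sequentially. ?D n < a"
      by eventually_elim (use b e in auto)
  qed simp
qed

end

section \<open>The change of time\<close>

context delay_problem
begin

text \<open>Since \<open>p \<ge> p0 > 0\<close>, the clock \<open>\<beta>\<close> is an increasing bijection of \<open>[0,\<infinity>)\<close> with Lipschitz continuous inverse.\<close>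

lemma clock_properties:
  assumes w: "continuous_on {-\<rho>..} w"
  defines "\<beta> \<equiv> \<lambda>\<tau>. integral {0..\<tau>} (\<lambda>r. p (w r))"
  defines "\<alpha> \<equiv> inv_into {0..} \<beta>"
  shows "\<beta> 0 = 0" and "\<alpha> 0 = 0"
    and "\<And>T. continuous_on {0..T} \<beta>"
    and "\<And>\<tau>. 0 < \<tau> \<Longrightarrow> (\<beta> has_real_derivative p (w \<tau>)) (at \<tau>)"
    and "\<And>\<tau>. 0 \<le> \<tau> \<Longrightarrow> 0 \<le> \<beta> \<tau>"
    and "\<And>\<tau>. 0 \<le> \<tau> \<Longrightarrow> \<alpha> (\<beta> \<tau>) = \<tau>"
    and "\<And>t. 0 \<le> t \<Longrightarrow> \<beta> (\<alpha> t) = t"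
    and "\<And>t. 0 \<le> t \<Longrightarrow> 0 \<le> \<alpha> t"
    and "\<And>t. 0 < t \<Longrightarrow> 0 < \<alpha> t" and "\<And>\<tau>. 0 < \<tau> \<Longrightarrow> 0 < \<beta> \<tau>"
    and "continuous_on {0..} \<alpha>"
    and "\<And>t. 0 < t \<Longrightarrow> (\<alpha> has_real_derivative inverse (p (w (\<alpha> t)))) (at t)"
proof -
  have cp: "continuous_on {0..T} (\<lambda>r. p (w r))" for T
    by (rule continuous_on_compose2[OF cont_p continuous_on_subset[OF w]]) (use \<rho> in auto)
  have pn: "\<forall>s\<in>{0..T}. 0 \<le> p (w s)" for T using p_bounds p0 by (auto intro: order_trans less_imp_le)
  note b = integral_from_0[OF cp pn, folded \<beta>_def]
  show \<beta>0: "\<beta> 0 = 0" by (simp add: \<beta>_def)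
  show c\<beta>: "continuous_on {0..T} \<beta>" for T unfolding \<beta>_def by (rule integral_from_0(1)[OF cp pn])
  show D\<beta>: "(\<beta> has_real_derivative p (w \<tau>)) (at \<tau>)" if "0 < \<tau>" for \<tau>
    unfolding \<beta>_def by (rule integral_from_0(3)[OF cp pn, of _ "\<tau> + 1"]) (use that in auto)
  have grow: "p0 * (t - s) \<le> \<beta> t - \<beta> s" if "0 \<le> s" "s \<le> t" for s t
  proof -
    have "continuous_on {0..t} (\<lambda>r. p (w r) - p0)" by (intro continuous_intros cp)
    moreover have "\<forall>s\<in>{0..t}. 0 \<le> p (w s) - p0" using p_bounds by simp
    ultimately have "integral {0..s} (\<lambda>r. p (w r) - p0) \<le> integral {0..t} (\<lambda>r. p (w r) - p0)"
      using that by (rule integral_from_0(2)) simp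
    moreover have "integral {0..x} (\<lambda>r. p (w r) - p0) = \<beta> x - p0 * x" if "0 \<le> x" for x
      unfolding \<beta>_def using that
      by (subst integral_diff) (auto intro: integrable_continuous_interval cp)
    ultimately show ?thesis using that by (simp add: algebra_simps)
  qed
  show \<beta>_nn: "0 \<le> \<beta> \<tau>" if "0 \<le> \<tau>" for \<tau>
  proof -
    have "0 \<le> p0 * (\<tau> - 0)" using that p0 by simp
    with grow[OF order_refl that] \<beta>0 show ?thesis by linarith
  qed
  have less: "\<beta> s < \<beta> t" if "0 \<le> s" "s < t" for s t
  proof -
    have "0 < p0 * (t - s)" using that p0 by simp
    with grow[OF that(1) less_imp_le[OF that(2)]] show ?thesis by linarith
  qed
  then show \<beta>_pos: "0 < \<beta> \<tau>" if "0 < \<tau>" for \<tau> using less[of 0 \<tau>] that \<beta>0 by simp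
  have inj: "inj_on \<beta> {0..}"
  proof (rule inj_onI)
    fix s t assume "s \<in> {0..}" "t \<in> {0..}" "\<beta> s = \<beta> t"
    then show "s = t" using less[of s t] less[of t s] by (cases s t rule: linorder_cases) auto
  qed
  show \<alpha>\<beta>: "\<alpha> (\<beta> \<tau>) = \<tau>" if "0 \<le> \<tau>" for \<tau>
    unfolding \<alpha>_def using inv_into_f_f[OF inj] that by simp
  from \<alpha>\<beta>[of 0] show "\<alpha> 0 = 0" by (simp add: \<beta>0)
  have surj: "t \<in> \<beta> ` {0..}" if "0 \<le> t" for t
  proof -
    have "t \<le> \<beta> (t / p0)" using grow[of 0 "t / p0"] that p0 \<beta>0 by simp
    then have "\<exists>x. 0 \<le> x \<and> x \<le> t / p0 \<and> \<beta> x = t"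
      using that p0 \<beta>0 c\<beta> by (intro IVT') auto
    then show ?thesis by auto
  qed
  show \<beta>\<alpha>: "\<beta> (\<alpha> t) = t" if "0 \<le> t" for t unfolding \<alpha>_def by (rule f_inv_into_f[OF surj[OF that]])
  show \<alpha>_nn: "0 \<le> \<alpha> t" if "0 \<le> t" for t
    using inv_into_into[OF surj[OF that]] by (simp add: \<alpha>_def)
  show \<alpha>_pos: "0 < \<alpha> t" if "0 < t" for t
    using \<alpha>_nn[of t] \<beta>\<alpha>[of t] \<beta>0 that by (cases "\<alpha> t = 0") auto
  have lip: "\<bar>\<alpha> s - \<alpha> t\<bar> \<le> (1 / p0) * \<bar>s - t\<bar>" if "0 \<le> s" "0 \<le> t" for s t
  proof (cases "\<alpha> s \<le> \<alpha> t")
    case True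
    then have "p0 * (\<alpha> t - \<alpha> s) \<le> t - s" using grow[of "\<alpha> s" "\<alpha> t"] that by (simp add: \<alpha>_nn \<beta>\<alpha>)
    then show ?thesis using True p0 by (simp add: field_simps)
  next
    case False
    then have "p0 * (\<alpha> s - \<alpha> t) \<le> s - t" using grow[of "\<alpha> t" "\<alpha> s"] that by (simp add: \<alpha>_nn \<beta>\<alpha>)
    then show ?thesis using False p0 by (simp add: field_simps)
  qed
  show c\<alpha>: "continuous_on {0..} \<alpha>"
    unfolding continuous_on_iff
  proof (intro ballI allI impI)
    fix t e :: real assume t: "t \<in> {0..}" and e: "0 < e"
    show "\<exists>d>0. \<forall>s\<in>{0..}. dist s t < d \<longrightarrow> dist (\<alpha> s) (\<alpha> t) < e"
    proof (intro exI[of _ "p0 * e"] conjI ballI impI)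
      fix s assume s: "s \<in> {0..}" "dist s t < p0 * e"
      have "(1 / p0) * \<bar>s - t\<bar> < e" using s(2) p0 by (simp add: dist_real_def field_simps)
      then show "dist (\<alpha> s) (\<alpha> t) < e" using lip[of s t] s(1) t by (simp add: dist_real_def)
    qed (use p0 e in simp)
  qed
  show "(\<alpha> has_real_derivative inverse (p (w (\<alpha> t)))) (at t)" if t: "0 < t" for t
  proof (rule DERIV_inverse_function[where f = \<beta> and a = 0 and b = "t + 1"])
    show "(\<beta> has_real_derivative p (w (\<alpha> t))) (at (\<alpha> t))" by (rule D\<beta>[OF \<alpha>_pos[OF t]])
    show "p (w (\<alpha> t)) \<noteq> 0" using p_bounds(1)[of "w (\<alpha> t)"] p0 by auto
    show "isCont \<alpha> t" by (rule continuous_on_interior[OF c\<alpha>]) (use t in auto)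
  qed (use t \<beta>\<alpha> in auto)
qed

lemma continuous_on_history_line:
  assumes "\<And>T. 0 \<le> T \<Longrightarrow> continuous_on {-\<rho>..T} (w :: real \<Rightarrow> h10)"
  shows "continuous_on {-\<rho>..} w"
  unfolding continuous_on_eq_continuous_within
proof
  fix x assume x: "x \<in> {-\<rho>..}"
  define T where "T = max 0 x + 1"
  have "continuous (at x within {-\<rho>..T}) w"
    using assms[of T] x by (auto simp: continuous_on_eq_continuous_within T_def)
  moreover have "at x within {-\<rho>..} = at x within {-\<rho>..T}"
    by (rule at_within_nhd[of x "{..<T}"]) (auto simp: T_def)
  ultimately show "continuous (at x within {-\<rho>..}) w" by simp
qed

text \<open>Left to right, the mild equation gives each coefficient of \<open>w \<circ> \<alpha>\<close> in closed form, which is differentiated and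
  transported back along \<open>\<beta> = \<alpha>\<^sup>-\<^sup>1\<close>. Right to left, the coefficients of \<open>w \<circ> \<alpha>\<close> satisfy the linear equation with
  \<open>P = 1\<close>, and \<open>mild_formula\<close> recovers the mild equation.\<close>

lemma retarded_solution_iff_global_solution:
  assumes p: "\<And>u. p u = inverse (a (l u))" and q: "\<And>u. q u = (p u)\<^sup>2" and f: "continuous_on UNIV f"
  shows "retarded_solution a l f lam \<gamma> \<rho> \<phi> w \<longleftrightarrow> global_solution f \<phi> w"
proof -
  define \<beta> where "\<beta> = (\<lambda>\<tau>. integral {0..\<tau>} (\<lambda>r. p (w r)))"
  define \<alpha> where "\<alpha> = inv_into {0..} \<beta>"
  define G where "G r = lam *\<^sub>R superpose f (w r) + \<gamma> *\<^sub>R of_h10 (w (r - \<rho>))" for r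
  define gt where "gt s = p (w (\<alpha> s)) *\<^sub>R G (\<alpha> s)" for s
  have tc: "time_change a l w = \<beta>" by (simp add: time_change_def \<beta>_def p fun_eq_iff)
  have ret: "retarded_solution a l f lam \<gamma> \<rho> \<phi> w \<longleftrightarrow>
     continuous_on {-\<rho>..} w \<and> (\<forall>\<theta>\<in>{-\<rho>..0}. w \<theta> = \<phi> \<theta>) \<and>
     (\<forall>t\<ge>0. \<exists>I. ((\<lambda>s. heat_semigroup (t - s) (gt s)) has_integral I) {0..t} \<and>
        of_h10 (w (\<alpha> t)) = heat_semigroup t (of_h10 (\<phi> 0)) + I)"
    by (simp add: retarded_solution_def Let_def tc \<alpha>_def[symmetric] gt_def G_def p)
  have rate: "rate f w k r = - ev k * p (w r) * coef (of_h10 (w r)) k + (p (w r))\<^sup>2 * coef (G r) k" for k r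
    by (simp add: rate_def G_def q)
  have main: "(\<forall>t\<ge>0. \<exists>I. ((\<lambda>s. heat_semigroup (t - s) (gt s)) has_integral I) {0..t} \<and>
        of_h10 (w (\<alpha> t)) = heat_semigroup t (of_h10 (w 0)) + I) \<longleftrightarrow>
      (\<forall>\<tau>\<ge>0. \<forall>k. coef (of_h10 (w \<tau>)) k - coef (of_h10 (w 0)) k = integral {0..\<tau>} (rate f w k))"
    if cw: "continuous_on {-\<rho>..} w"
  proof -
    note clock = clock_properties[OF cw, folded \<beta>_def, folded \<alpha>_def]
    have cwT: "continuous_on {-\<rho>..T} w" for T by (rule continuous_on_subset[OF cw]) auto
    have c\<alpha>: "continuous_on {0..t} \<alpha>" for t by (rule continuous_on_subset[OF clock(11)]) auto
    have \<alpha>_range: "\<alpha> s \<in> {-\<rho>..}" "\<alpha> s - \<rho> \<in> {-\<rho>..}" if "s \<in> {0..t}" for s t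
      using clock(8)[of s] that \<rho> by auto
    have cw\<alpha>: "continuous_on {0..t} (\<lambda>s. w (\<alpha> s))" for t
      by (rule continuous_on_compose2[OF cw c\<alpha>]) (rule image_subsetI, rule \<alpha>_range(1))
    have cwd: "continuous_on {0..t} (\<lambda>s. w (\<alpha> s - \<rho>))" for t
    proof (rule continuous_on_compose2[OF cw])
      show "continuous_on {0..t} (\<lambda>s. \<alpha> s - \<rho>)" by (intro continuous_intros c\<alpha>)
      show "(\<lambda>s. \<alpha> s - \<rho>) ` {0..t} \<subseteq> {-\<rho>..}" by (rule image_subsetI) (rule \<alpha>_range(2))
    qed
    have cgt: "continuous_on {0..t} gt" for t
      unfolding gt_def G_def
      by (intro continuous_intros continuous_on_compose2[OF cont_p cw\<alpha> subset_UNIV] continuous_on_compose2[OF continuous_on_superpose[OF f] cw\<alpha> subset_UNIV]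
          bounded_linear.continuous_on[OF bounded_linear_of_h10 cwd])
    have pp: "p (w r) \<noteq> 0" for r using p_bounds(1)[of "w r"] p0 by auto
    show ?thesis
    proof (intro iffI allI impI)
      fix t :: real
      assume weak: "\<forall>\<tau>\<ge>0. \<forall>k. coef (of_h10 (w \<tau>)) k - coef (of_h10 (w 0)) k = integral {0..\<tau>} (rate f w k)" and t: "0 \<le> t"
      have Dw: "((\<lambda>r. coef (of_h10 (w r)) k) has_real_derivative rate f w k r) (at r)" if r: "0 < r" for k r
      proof -
        have "((\<lambda>r. integral {0..r} (rate f w k)) has_real_derivative rate f w k r) (at r within {0..r + 1})"
          using r by (intro integral_has_real_derivative continuous_on_rate cwT f) auto
        then have "((\<lambda>r. integral {0..r} (rate f w k)) has_real_derivative rate f w k r) (at r)"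
          using r by (simp add: at_within_Icc_at)
        then have "((\<lambda>r. coef (of_h10 (w 0)) k + integral {0..r} (rate f w k)) has_real_derivative rate f w k r) (at r)"
          using DERIV_add[OF DERIV_const] by fastforce
        then show ?thesis
        proof (rule has_field_derivative_transform_within_open[where S = "{0<..}"])
          fix x :: real assume "x \<in> {0<..}"
          then have "coef (of_h10 (w x)) k - coef (of_h10 (w 0)) k = integral {0..x} (rate f w k)" using weak by auto
          then show "coef (of_h10 (w 0)) k + integral {0..x} (rate f w k) = coef (of_h10 (w x)) k" by linarith
        qed (use r in auto)
      qed
      have mf: "((\<lambda>s. heat_semigroup (integral {0..t} (\<lambda>_. 1) - integral {0..s} (\<lambda>_. 1)) (gt s)) has_integral
          (of_h10 (w (\<alpha> t)) - heat_semigroup (integral {0..t} (\<lambda>_. 1)) (of_h10 (w (\<alpha> 0))))) {0..t}"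
      proof (rule mild_formula[OF t])
        show "continuous_on {0..t} (\<lambda>s. of_h10 (w (\<alpha> s)))" by (rule bounded_linear.continuous_on[OF bounded_linear_of_h10 cw\<alpha>])
        show "((\<lambda>s. coef (of_h10 (w (\<alpha> s))) k) has_real_derivative - ev k * 1 * coef (of_h10 (w (\<alpha> s))) k + coef (gt s) k) (at s)"
          if s: "0 < s" "s < t" for k s
        proof -
          have "((\<lambda>s. coef (of_h10 (w (\<alpha> s))) k) has_real_derivative rate f w k (\<alpha> s) * inverse (p (w (\<alpha> s)))) (at s)"
            by (rule DERIV_chain2[OF Dw[OF clock(9)[OF s(1)]] clock(12)[OF s(1)]])
          moreover have "rate f w k (\<alpha> s) * inverse (p (w (\<alpha> s))) = - ev k * 1 * coef (of_h10 (w (\<alpha> s))) k + coef (gt s) k"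
            using pp[of "\<alpha> s"] by (simp add: rate gt_def field_simps power2_eq_square)
          ultimately show ?thesis by simp
        qed
      qed (use cgt in auto)
      have int1: "integral {0..s} (\<lambda>_. 1::real) = s" if "0 \<le> s" for s using that by simp
      have "((\<lambda>s. heat_semigroup (t - s) (gt s)) has_integral (of_h10 (w (\<alpha> t)) - heat_semigroup t (of_h10 (w 0)))) {0..t}"
        by (rule has_integral_eq[OF _ mf[unfolded int1[OF t] clock(2)]]) (simp only: int1 atLeastAtMost_iff)
      then show "\<exists>I. ((\<lambda>s. heat_semigroup (t - s) (gt s)) has_integral I) {0..t} \<and> of_h10 (w (\<alpha> t)) = heat_semigroup t (of_h10 (w 0)) + I"
        by (intro exI[of _ "of_h10 (w (\<alpha> t)) - heat_semigroup t (of_h10 (w 0))"]) simp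
    next
      fix \<tau> :: real and k
      assume mild: "\<forall>t\<ge>0. \<exists>I. ((\<lambda>s. heat_semigroup (t - s) (gt s)) has_integral I) {0..t} \<and> of_h10 (w (\<alpha> t)) = heat_semigroup t (of_h10 (w 0)) + I"
        and \<tau>: "0 \<le> \<tau>"
      define H where "H t = integral {0..t} (\<lambda>s. exp (ev k * s) * coef (gt s) k)" for t
      have cH: "continuous_on {0..t} (\<lambda>s. exp (ev k * s) * coef (gt s) k)" for t
        by (intro continuous_intros cgt)
      have DH: "(H has_real_derivative exp (ev k * t) * coef (gt t) k) (at t)" if "0 < t" for t
        unfolding H_def using integral_has_real_derivative[OF cH, of t "t + 1"] that by (simp add: at_within_Icc_at)
      have c_mild: "coef (of_h10 (w (\<alpha> t))) k = exp (- (ev k * t)) * (coef (of_h10 (w 0)) k + H t)" if t: "0 \<le> t" for t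
      proof -
        obtain I where I: "((\<lambda>s. heat_semigroup (t - s) (gt s)) has_integral I) {0..t}"
          "of_h10 (w (\<alpha> t)) = heat_semigroup t (of_h10 (w 0)) + I" using mild t by blast
        have "((\<lambda>s. coef (heat_semigroup (t - s) (gt s)) k) has_integral coef I k) {0..t}"
          using has_integral_linear[OF I(1) bounded_linear_inner_left] by (simp add: o_def)
        then have "((\<lambda>s. exp (- (ev k * t)) * (exp (ev k * s) * coef (gt s) k)) has_integral coef I k) {0..t}"
        proof (rule has_integral_eq[rotated])
          fix s assume "s \<in> {0..t}"
          moreover have "exp (- (ev k * (t - s))) = exp (- (ev k * t)) * exp (ev k * s)"
            by (simp add: exp_add[symmetric] algebra_simps)
          ultimately show "coef (heat_semigroup (t - s) (gt s)) k = exp (- (ev k * t)) * (exp (ev k * s) * coef (gt s) k)"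
            by (simp add: coef_heat_semigroup)
        qed
        moreover have "((\<lambda>s. exp (- (ev k * t)) * (exp (ev k * s) * coef (gt s) k)) has_integral exp (- (ev k * t)) * H t) {0..t}"
          unfolding H_def by (intro has_integral_mult_right integrable_integral integrable_continuous_interval cH)
        ultimately have "coef I k = exp (- (ev k * t)) * H t" by (rule has_integral_unique)
        then show ?thesis unfolding I(2) using t by (simp add: inner_add_left coef_heat_semigroup distrib_left)
      qed
      have Dc: "((\<lambda>t. exp (- (ev k * t)) * (coef (of_h10 (w 0)) k + H t)) has_real_derivative
          - ev k * (exp (- (ev k * t)) * (coef (of_h10 (w 0)) k + H t)) + coef (gt t) k) (at t)" if t: "0 < t" for t
        using DERIV_variation_of_constants[where B = "\<lambda>t. t", OF DERIV_ident DH[OF t]] by simp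
      have "(rate f w k has_integral (coef (of_h10 (w \<tau>)) k - coef (of_h10 (w 0)) k)) {0..\<tau>}"
      proof (rule fundamental_theorem_of_calculus_interior[OF \<tau>])
        show "continuous_on {0..\<tau>} (\<lambda>r. coef (of_h10 (w r)) k)"
          by (rule continuous_on_coef_h10[OF continuous_on_subset[OF cw]]) (use \<rho> in auto)
        fix r assume "r \<in> {0<..<\<tau>}"
        then have r: "0 < r" by simp
        have \<beta>_app: "integral {0..t} (\<lambda>r. p (w r)) = \<beta> t" for t by (simp add: \<beta>_def)
        note clk = clock(4-6,10)[unfolded \<beta>_app]
        have \<beta>r: "0 < \<beta> r" "\<alpha> (\<beta> r) = r" using clk(4)[of r] clk(3)[of r] r by auto
        have Dr: "((\<lambda>r. exp (- (ev k * \<beta> r)) * (coef (of_h10 (w 0)) k + H (\<beta> r))) has_real_derivative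
            (- ev k * (exp (- (ev k * \<beta> r)) * (coef (of_h10 (w 0)) k + H (\<beta> r))) + coef (gt (\<beta> r)) k) * p (w r)) (at r)"
          by (rule DERIV_chain2[OF Dc[OF \<beta>r(1)] clk(1)[OF r]])
        have tr: "exp (- (ev k * \<beta> x)) * (coef (of_h10 (w 0)) k + H (\<beta> x)) = coef (of_h10 (w x)) k" if "x \<in> {0<..}" for x
          using c_mild[of "\<beta> x"] clk(2,3)[of x] that by simp
        have Dw: "((\<lambda>x. coef (of_h10 (w x)) k) has_real_derivative
            (- ev k * (exp (- (ev k * \<beta> r)) * (coef (of_h10 (w 0)) k + H (\<beta> r))) + coef (gt (\<beta> r)) k) * p (w r)) (at r)"
          by (rule has_field_derivative_transform_within_open[OF Dr open_greaterThan _ tr]) (use r in auto)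
        have er: "exp (- (ev k * \<beta> r)) * (coef (of_h10 (w 0)) k + H (\<beta> r)) = coef (of_h10 (w r)) k"
          using c_mild[of "\<beta> r"] \<beta>r by simp
        show "((\<lambda>r. coef (of_h10 (w r)) k) has_vector_derivative rate f w k r) (at r)"
          using Dw[unfolded er]
          by (simp add: has_real_derivative_iff_has_vector_derivative[symmetric] rate gt_def \<beta>r(2) algebra_simps power2_eq_square)
      qed
      then show "coef (of_h10 (w \<tau>)) k - coef (of_h10 (w 0)) k = integral {0..\<tau>} (rate f w k)"
        by (simp add: integral_unique)
    qed
  qed
  show ?thesis
  proof
    assume r: "retarded_solution a l f lam \<gamma> \<rho> \<phi> w"
    have cw: "continuous_on {-\<rho>..} w" and w\<phi>: "\<forall>\<theta>\<in>{-\<rho>..0}. w \<theta> = \<phi> \<theta>" using r ret by auto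
    have \<phi>0: "\<phi> 0 = w 0" using w\<phi> \<rho> by simp
    have "\<forall>\<tau>\<ge>0. \<forall>k. coef (of_h10 (w \<tau>)) k - coef (of_h10 (w 0)) k = integral {0..\<tau>} (rate f w k)"
      using r unfolding ret \<phi>0 main[OF cw, symmetric] by blast
    then show "global_solution f \<phi> w"
      using w\<phi> by (auto simp: global_solution_def solves_def intro: continuous_on_subset[OF cw])
  next
    assume g: "global_solution f \<phi> w"
    have cw: "continuous_on {-\<rho>..} w"
      by (rule continuous_on_history_line) (use g in \<open>auto simp: global_solution_def solves_def\<close>)
    have w\<phi>: "\<forall>\<theta>\<in>{-\<rho>..0}. w \<theta> = \<phi> \<theta>" using g by (simp add: global_solution_def)
    have \<phi>0: "\<phi> 0 = w 0" using w\<phi> \<rho> by simp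
    have "\<forall>\<tau>\<ge>0. \<forall>k. coef (of_h10 (w \<tau>)) k - coef (of_h10 (w 0)) k = integral {0..\<tau>} (rate f w k)"
    proof (intro allI impI)
      fix \<tau> :: real and k assume "0 \<le> \<tau>"
      then show "coef (of_h10 (w \<tau>)) k - coef (of_h10 (w 0)) k = integral {0..\<tau>} (rate f w k)"
        using g solvesD(2)[of \<tau> f w \<tau> k] by (simp add: global_solution_def)
    qed
    then show "retarded_solution a l f lam \<gamma> \<rho> \<phi> w"
      unfolding ret \<phi>0 main[OF cw] using cw w\<phi> by blast
  qed
qed

lemma solution_map_eq_flow:
  assumes p: "\<And>u. p u = inverse (a (l u))" and q: "\<And>u. q u = (p u)\<^sup>2" and f: "continuous_on UNIV f" and \<tau>: "0 \<le> \<tau>"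
  shows "solution_map a l f lam \<gamma> \<rho> \<tau> \<phi> = flow f \<tau> \<phi>"
proof -
  have "restrict (history \<rho> w) {0..} \<tau> = history \<rho> w \<tau>" for w :: "real \<Rightarrow> h10" using \<tau> by simp
  then show ?thesis
    unfolding solution_map_def solutions_from_def flow_def retarded_solution_iff_global_solution[of a l, OF p q f]
    by (smt (verit) Collect_cong mem_Collect_eq)
qed

end

section \<open>The multivalued semiflow of the retarded problem\<close>

text \<open>Dividing the condition by \<open>u\<close> gives the bounds for \<open>u \<noteq> 0\<close>; at \<open>u = 0\<close> they hold by continuity of \<open>f\<close>.\<close>

lemma dissipative_one_sided_growth:
  fixes f :: "real \<Rightarrow> real"
  assumes f: "continuous_on UNIV f" and mono: "\<forall>r>0. \<exists>\<kappa>>0. mono_on {-r..r} (\<lambda>s. \<kappa> * s + f s)"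
    and dis: "\<And>u. u * f u \<le> c * u\<^sup>2 + d * \<bar>u\<bar>"
  obtains K where "one_sided_growth f K"
proof -
  define K where "K = max \<bar>c\<bar> \<bar>d\<bar>"
  have uf: "u * f u \<le> K * u\<^sup>2 + K * \<bar>u\<bar>" for u
  proof -
    have "c \<le> K" "d \<le> K" unfolding K_def by linarith+
    then have "c * u\<^sup>2 \<le> K * u\<^sup>2" "d * \<bar>u\<bar> \<le> K * \<bar>u\<bar>" by (auto intro: mult_right_mono)
    with dis[of u] show ?thesis by linarith
  qed
  have pos: "f u \<le> K * u + K" if "0 < u" for u
  proof -
    have "u * f u \<le> u * (K * u + K)" using uf[of u] that by (simp add: power2_eq_square algebra_simps)
    then show ?thesis using that by simp
  qed
  have neg: "K * u - K \<le> f u" if "u < 0" for u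
  proof -
    have "(- u) * (K * u - K) \<le> (- u) * f u" using uf[of u] that by (simp add: power2_eq_square algebra_simps)
    then show ?thesis using that by simp
  qed
  have lim: "(f \<longlongrightarrow> f 0) (at 0)" using f by (simp add: continuous_on_def)
  have "f 0 \<le> K * 0 + K"
  proof (rule tendsto_le[OF trivial_limit_at_right_real])
    show "(f \<longlongrightarrow> f 0) (at_right 0)" using lim by (simp add: filterlim_at_split)
    show "((\<lambda>u. K * u + K) \<longlongrightarrow> K * 0 + K) (at_right 0)" by (intro tendsto_intros)
    show "\<forall>\<^sub>F u in at_right 0. f u \<le> K * u + K"
      using eventually_at_right_less[of "0::real"] by eventually_elim (rule pos)
  qed
  moreover have "K * 0 - K \<le> f 0"
  proof (rule tendsto_le[OF trivial_limit_at_left_real])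
    show "(f \<longlongrightarrow> f 0) (at_left 0)" using lim by (simp add: filterlim_at_split)
    show "((\<lambda>u. K * u - K) \<longlongrightarrow> K * 0 - K) (at_left 0)" by (intro tendsto_intros)
    show "\<forall>\<^sub>F u in at_left 0. K * u - K \<le> f u"
      unfolding eventually_at_filter using neg by (intro always_eventually) auto
  qed
  ultimately have "one_sided_growth f K"
    unfolding one_sided_growth_def using pos neg mono
    by (auto simp: K_def le_less)
  with that show ?thesis by blast
qed

theorem theorem4p6:
  fixes lam \<gamma> \<rho> m M :: real
    and l :: "h10 \<Rightarrow> real" and a f :: "real \<Rightarrow> real"
  assumes "lam > 0" "\<gamma> > 0" "\<rho> > 0"
    and "continuous_on UNIV l" "range l \<subseteq> {0..}"
    and "continuous_on UNIV a" "range a \<subseteq> {m..M}" "{m..M} \<subseteq> {0<..}"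
    and "continuous_on UNIV f"
    and "\<forall>r>0. \<exists>\<kappa>>0. mono_on {-r..r} (\<lambda>s. \<kappa> * s + f s)"
    and dissipative: "\<exists>C0 C1. \<forall>\<nu>\<in>{m / lam, M / lam}.
      (\<forall>u. u * f u \<le> - \<nu> * C0 * u\<^sup>2 + C1 * \<bar>u\<bar>) \<and>
      (\<exists>\<omega>. first_eigenvalue (shifted_neg_laplacian (\<nu> * C0)) \<omega> \<and>
           \<omega> > 0 \<and> exp (- (\<omega> * \<rho> / m)) + \<gamma> / (\<omega> * m) < 1)"
  shows "strict_multivalued_semiflow (mspace (history_space \<rho>)) (solution_map a l f lam \<gamma> \<rho>) \<and>
         (\<forall>\<tau>\<ge>0. upper_semicontinuous (history_space \<rho>) (solution_map a l f lam \<gamma> \<rho> \<tau>))"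
proof -
  have aM: "m \<le> a s" "a s \<le> M" for s using subsetD[OF assms(7) rangeI[of a s]] by auto
  have "m \<in> {m..M}" using aM[of 0] by simp
  then have m: "0 < m" using assms(8) by auto
  define p where "p u = inverse (a (l u))" for u
  define q where "q u = (p u)\<^sup>2" for u
  have apos: "0 < a s" for s using aM[of s] m by linarith
  have pb: "inverse M \<le> p u" "p u \<le> inverse m" for u
    unfolding p_def using aM[of "l u"] apos[of "l u"] m by (auto intro: le_imp_inverse_le)
  have p0: "0 \<le> p u" for u unfolding p_def using apos[of "l u"] by simp
  have cal: "continuous_on UNIV (\<lambda>u. a (l u))"
    by (rule continuous_on_compose2[OF assms(6) assms(4)]) simp
  have cp: "continuous_on UNIV p"
    unfolding p_def using apos by (intro continuous_on_inverse cal) (auto simp: less_imp_neq[symmetric])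
  interpret delay_problem lam \<gamma> \<rho> "inverse M" "inverse m" "(inverse m)\<^sup>2" p q
  proof
    show "0 < inverse M" using aM[of 0] m by simp
    show "continuous_on UNIV q" unfolding q_def by (intro continuous_intros cp)
    show "0 \<le> q u" "q u \<le> (inverse m)\<^sup>2" for u
      unfolding q_def using pb[of u] p0[of u] by (auto intro: power_mono)
  qed (use assms(1-3) cp pb in auto)
  obtain C0 C1 where C: "\<And>u. u * f u \<le> (- (m / lam) * C0) * u\<^sup>2 + C1 * \<bar>u\<bar>" using dissipative by auto
  obtain K where K: "one_sided_growth f K" by (rule dissipative_one_sided_growth[OF assms(9,10) C])
  note f = assms(9) K
  have eq: "solution_map a l f lam \<gamma> \<rho> \<tau> = flow f \<tau>" if "0 \<le> \<tau>" for \<tau>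
    by (rule ext) (rule solution_map_eq_flow[of a l, OF p_def q_def assms(9) that])
  have "strict_multivalued_semiflow (mspace (history_space \<rho>)) (solution_map a l f lam \<gamma> \<rho>)"
    unfolding strict_multivalued_semiflow_def multivalued_semiflow_def
    using flow_in_space[OF f] flow_0[OF f] flow_add[OF assms(9)] by (simp add: eq)
  moreover have "upper_semicontinuous (history_space \<rho>) (solution_map a l f lam \<gamma> \<rho> \<tau>)" if "0 \<le> \<tau>" for \<tau>
    using flow_upper_semicontinuous[OF f that] by (simp add: eq that)
  ultimately show ?thesis by blast
qed

end
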